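(* Let $X$ be a spectrally negative Lévy process (paths of bounded or unbounded variation). Fix $a>0$, $q\ge0$, $x\in\mathbb R$ and $p>0$. Then, as measures in $y\in\mathbb R$, $$\begin{aligned} \int_0^\infty e^{-pt}\,&\mathbb E_x\Big[e^{-q\int_0^t\mathbf 1_{(0,a)}(X_s)\,\mathrm ds};X_t\in\mathrm dy\Big]\mathrm dt\\ ={}&e^{-\Phi(p)a}\,\frac{\mathcal H^{(p,q)}(x)-q\int_a^xW^{(p)}(x-z)\mathcal H^{(p,q)}(z)\,\mathrm dz}{\psi'(\Phi(p))+q\int_0^ae^{-\Phi(p)z}\mathcal H^{(p,q)}(z)\,\mathrm dz}\\ &\times\Big\{\mathcal H^{(p,q)}(a-y)-q\int_0^{-y}\mathcal H^{(p,q)}(a-y-z)W^{(p)}(z)\,\mathrm dz\Big\}\mathrm dy\\ &-\Big\{\mathcal W^{(p,q)}_{x-a}(x-y)-q\int_0^{-y}\mathcal W^{(p,q)}_{x-a}(x-y-z)W^{(p)}(z)\,\mathrm dz\Big\}\mathrm dy . \end{aligned}$$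
   Context: $X=\{X_t,t\ge0\}$ is a spectrally negative Lévy process (no positive jumps) whose paths are not monotone; $\mathbb P_x,\mathbb E_x$ denote law and expectation when $X_0=x$, and $\mathbb E[Z;A]=\mathbb E[Z\mathbf 1_A]$. Laplace exponent: $\psi(\lambda)=\log\mathbb E_0[e^{\lambda X_1}]$, $\lambda\ge0$, with derivative $\psi'$; $\Phi(q)=\sup\{\lambda\ge0:\psi(\lambda)=q\}$ for $q\ge0$. For $q\ge0$, the $q$-scale function $W^{(q)}$ is $0$ on $(-\infty,0)$ and on $[0,\infty)$ is the continuous function with $\int_0^\infty e^{-\lambda y}W^{(q)}(y)\,\mathrm dy=1/(\psi(\lambda)-q)$ for $\lambda>\Phi(q)$. For $p\ge0$, $q\in\mathbb R$ with $p+q\ge0$ and $x\in\mathbb R$: $\mathcal H^{(p,q)}(x)=e^{\Phi(p)x}\big[1+q\int_0^xe^{-\Phi(p)z}W^{(p+q)}(z)\,\mathrm dz\big]$ (so $\mathcal H^{(p,q)}(x)=e^{\Phi(p)x}$ for $x<0$). For $p,p+q\ge0$ and $a,x\in\mathbb R$: $\mathcal W^{(p,q)}_a(x)=W^{(p+q)}(x)-q\int_0^aW^{(p+q)}(x-z)W^{(p)}(z)\,\mathrm dz$. Integrals $\int_u^v$ with $v<u$ are oriented: $\int_u^v=-\int_v^u$. *)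

theory Defs
  imports "HOL-Probability.Probability"
begin

text \<open>A L\'evy process started at 0, given as a family of real random variables
  X t on a probability space M, indexed by time t (only t \<ge> 0 matters).
  Paths are taken cadlag for every sample point (a cadlag version).\<close>

definition cadlag_path :: "(real \<Rightarrow> real) \<Rightarrow> bool" where
  "cadlag_path f \<longleftrightarrow>
     (\<forall>t\<ge>0. continuous (at_right t) f) \<and> (\<forall>t>0. \<exists>l. (f \<longlongrightarrow> l) (at_left t))"

definition levy_process :: "'a measure \<Rightarrow> (real \<Rightarrow> 'a \<Rightarrow> real) \<Rightarrow> bool" where
  "levy_process M X \<longleftrightarrow>
     prob_space M \<and>
     (\<forall>t. X t \<in> borel_measurable M) \<and>
     (\<forall>\<omega>\<in>space M. X 0 \<omega> = 0) \<and>
     (\<forall>\<omega>\<in>space M. cadlag_path (\<lambda>t. X t \<omega>)) \<and>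
     (\<forall>(n::nat) (ts::nat \<Rightarrow> real). 0 \<le> ts 0 \<and> (\<forall>i<n. ts i \<le> ts (Suc i)) \<longrightarrow>
        prob_space.indep_vars M (\<lambda>_. borel) (\<lambda>i \<omega>. X (ts (Suc i)) \<omega> - X (ts i) \<omega>) {..<n}) \<and>
     (\<forall>s t. 0 \<le> s \<and> s \<le> t \<longrightarrow>
        distr M borel (\<lambda>\<omega>. X t \<omega> - X s \<omega>) = distr M borel (X (t - s)))"

definition spectrally_negative_levy :: "'a measure \<Rightarrow> (real \<Rightarrow> 'a \<Rightarrow> real) \<Rightarrow> bool" where
  "spectrally_negative_levy M X \<longleftrightarrow>
     levy_process M X \<and>
     (\<forall>\<omega>\<in>space M. \<forall>t>0. \<forall>l. ((\<lambda>s. X s \<omega>) \<longlongrightarrow> l) (at_left t) \<longrightarrow> X t \<omega> \<le> l) \<and>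
     \<not> (AE \<omega> in M. mono_on {0..} (\<lambda>t. X t \<omega>)) \<and>
     \<not> (AE \<omega> in M. antimono_on {0..} (\<lambda>t. X t \<omega>))"

definition levy_psi :: "'a measure \<Rightarrow> (real \<Rightarrow> 'a \<Rightarrow> real) \<Rightarrow> real \<Rightarrow> real" where
  "levy_psi M X l = ln (\<integral>\<omega>. exp (l * X 1 \<omega>) \<partial>M)"

definition levy_Phi :: "'a measure \<Rightarrow> (real \<Rightarrow> 'a \<Rightarrow> real) \<Rightarrow> real \<Rightarrow> real" where
  "levy_Phi M X q = Sup {l. l \<ge> 0 \<and> levy_psi M X l = q}"

definition scale_W :: "'a measure \<Rightarrow> (real \<Rightarrow> 'a \<Rightarrow> real) \<Rightarrow> real \<Rightarrow> real \<Rightarrow> real" where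
  "scale_W M X q = (THE W. (\<forall>y<0. W y = 0) \<and> continuous_on {0..} W \<and>
      (\<forall>l>levy_Phi M X q.
         ((\<lambda>y. exp (- l * y) * W y) has_integral 1 / (levy_psi M X l - q)) {0..}))"

text \<open>H^(p,q)(x); integrals are oriented (interval_lebesgue_integral).\<close>
definition scale_H :: "'a measure \<Rightarrow> (real \<Rightarrow> 'a \<Rightarrow> real) \<Rightarrow> real \<Rightarrow> real \<Rightarrow> real \<Rightarrow> real" where
  "scale_H M X p q x = exp (levy_Phi M X p * x) *
     (1 + q * (LBINT z=0..x. exp (- levy_Phi M X p * z) * scale_W M X (p + q) z))"

definition scale_Wpq :: "'a measure \<Rightarrow> (real \<Rightarrow> 'a \<Rightarrow> real) \<Rightarrow> real \<Rightarrow> real \<Rightarrow> real \<Rightarrow> real \<Rightarrow> real" where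
  "scale_Wpq M X p q a x = scale_W M X (p + q) x -
     q * (LBINT z=0..a. scale_W M X (p + q) (x - z) * scale_W M X p z)"

end

theory Submission
  imports Defs
begin

text \<open>Let T be an independent exponential time with rate p. A path without positive jumps crosses
  every level y continuously, so the strong Markov property at the first passage time over y and the
  lack of memory of T show that S, the supremum of X up to T, is exponentially distributed and
  independent of D = S - X(T). Its parameter c is identified as \<open>\<Phi>(p)\<close>. Since D has no atoms off 0,
  \<open>(c / p) E[exp (c (x - D)); D \<le> x]\<close> is continuous on the half line; it is the scale function, and
  the p-resolvent of X has the density \<open>exp (c (x - y)) / \<psi>'(c) - W(x - y)\<close>.

  By the Feynman-Kac formula the killed resolvent K satisfies \<open>K = r - q r 1_(0,a) K\<close> with this
  kernel r, which is a rank-one kernel minus a Volterra kernel. The identity \<open>V = W + q W * V\<close>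
  between the scale functions of orders p and p + q reduces it to a scalar linear equation, which
  gives the stated density on bounded sets; positivity of K then extends it to all Borel sets.\<close>

section \<open>Uniqueness of Laplace transforms\<close>

text \<open>The scale function is a definite description, so a continuous function with the
  prescribed Laplace transform has to be exhibited; the law of D supplies it. Finiteness of
  E[exp (l X(1))] is not given: it follows because the rate of S is unbounded in p, so every l >= 0
  lies below some rate. For l < c the splitting X = S - D yields
  \<open>p / (p - \<psi> l) = c / (c - l) * G p l\<close> with \<open>G p l\<close> =
  E[exp (- l D)]. For l > c the mean of exp (l X) at T is infinite, so this argument is silent, yet
  the transform of the scale function is needed exactly there. Instead of analytic continuation, the
  supremum over the sum of two independent exponential times is computed twice; this gives
  \<open>G p\<close> at the rates of larger parameters, and every l > c is such a rate. The absence
  of atoms is what turns the law of D into a continuous scale function. At the end, the stated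
  density is a difference of two terms, so neither its sign nor its integrability over unbounded
  sets can be read off; both come from its probabilistic meaning on bounded sets.\<close>

lemma has_integral_atLeast_imp_tendsto:
  fixes h :: "real \<Rightarrow> real"
  assumes "(h has_integral i) {0..}"
  shows "((\<lambda>y. integral {0..y} h) \<longlongrightarrow> i) at_top"
proof (rule tendstoI)
  fix e :: real assume "e > 0"
  then obtain B where B: "B > 0" "\<And>a b. ball 0 B \<subseteq> cbox a b \<Longrightarrow>
      norm (integral (cbox a b) (\<lambda>x. if x \<in> {0..} then h x else 0) - i) < e"
    using assms unfolding has_integral_alt' by blast
  have "dist (integral {0..y} h) i < e" if "y \<ge> B" for y
  proof -
    have "ball 0 B \<subseteq> cbox (-y) y" using that by (auto simp: dist_real_def)
    moreover have "integral (cbox (-y) y) (\<lambda>x. if x \<in> {0..} then h x else 0) = integral {0..y} h"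
    proof -
      have "integral (cbox (-y) y) (\<lambda>x. if x \<in> {0..} then h x else 0) = integral ({0..} \<inter> cbox (-y) y) h"
        by (rule integral_restrict_Int)
      also have "{0..} \<inter> cbox (-y) y = {0..y}" using that B(1) by auto
      finally show ?thesis .
    qed
    ultimately show ?thesis using B(2)[of "-y" y] by (simp add: dist_norm)
  qed
  then show "\<forall>\<^sub>F y in at_top. dist (integral {0..y} h) i < e"
    using eventually_at_top_linorder by blast
qed

lemma continuous_tendsto_0_bounded:
  fixes F :: "real \<Rightarrow> real"
  assumes cont: "continuous_on {0..} F" and lim: "(F \<longlongrightarrow> 0) at_top"
  obtains B where "B > 0" "\<And>y. y \<ge> 0 \<Longrightarrow> \<bar>F y\<bar> \<le> B"
proof -
  have "\<forall>\<^sub>F y in at_top. \<bar>F y\<bar> < 1"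
    using tendstoD[OF lim, of 1] by (simp add: dist_real_def)
  then obtain Y where Y: "\<And>y. y \<ge> Y \<Longrightarrow> \<bar>F y\<bar> < 1" unfolding eventually_at_top_linorder by blast
  have "compact (F ` {0..max 0 Y})"
    by (rule compact_continuous_image) (auto intro: continuous_on_subset[OF cont])
  then have "bounded (F ` {0..max 0 Y})" by (rule compact_imp_bounded)
  then obtain C where C: "\<And>y. y \<in> {0..max 0 Y} \<Longrightarrow> \<bar>F y\<bar> \<le> C" unfolding bounded_iff by (metis image_eqI real_norm_def)
  have "\<bar>F y\<bar> \<le> max 1 C" if "y \<ge> 0" for y
  proof (cases "y \<le> max 0 Y")
    case True
    then have "\<bar>F y\<bar> \<le> C" using C[of y] that by auto
    then show ?thesis by simp
  next
    case False
    then have "\<bar>F y\<bar> < 1" using Y[of y] that by auto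
    then show ?thesis by simp
  qed
  then show ?thesis using that[of "max 1 C"] by auto
qed

text \<open>In the variable u = exp (- z) the exponential moments become polynomial moments of a
  function on [0, 1], continuous up to u = 0 because F vanishes at infinity. Weierstrass
  approximation then makes a weighted square integral of F arbitrarily small.\<close>

lemma continuous_exp_moments_zero:
  fixes F :: "real \<Rightarrow> real"
  assumes cont: "continuous_on {0..} F" and lim: "(F \<longlongrightarrow> 0) at_top"
    and mom: "\<And>n::nat. ((\<lambda>y. integral {0..y} (\<lambda>z. exp (- (real n + 1) * z) * F z)) \<longlongrightarrow> 0) at_top"
    and y: "y > 0"
  shows "F y = 0"
proof -
  obtain B where B: "B > 0" "\<And>y. y \<ge> 0 \<Longrightarrow> \<bar>F y\<bar> \<le> B"
    using continuous_tendsto_0_bounded[OF cont lim] by blast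
  have contF: "continuous_on {0..y} F" for y by (rule continuous_on_subset[OF cont]) auto
  define h where "h u = (if u \<le> 0 then 0 else F (- ln u))" for u :: real
  have conth: "continuous_on {0..1} h"
    unfolding continuous_on_eq_continuous_within
  proof
    fix u :: real assume u: "u \<in> {0..1}"
    show "continuous (at u within {0..1}) h"
    proof (cases "u = 0")
      case True
      have "((\<lambda>u. F (- ln u)) \<longlongrightarrow> 0) (at_right 0)"
        by (rule filterlim_compose[OF lim]) (simp add: filterlim_uminus_at_top ln_at_0)
      then have "(h \<longlongrightarrow> 0) (at_right 0)"
        by (rule Lim_transform_eventually) (auto simp: h_def eventually_at_right_field intro: exI[of _ 1])
      then have "(h \<longlongrightarrow> h 0) (at 0 within {0..1})"
        by (simp add: h_def at_within_Icc_at_right)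
      with True show ?thesis by (simp add: continuous_within)
    next
      case False
      with u have u0: "0 < u" by auto
      have "continuous_on {0<..1} (\<lambda>u. F (- ln u))"
        by (rule continuous_on_compose2[OF cont]) (auto intro!: continuous_intros)
      then have "continuous_on {0<..1} h"
        by (rule continuous_on_eq) (auto simp: h_def)
      then have "continuous (at u within {0<..1}) h"
        using u u0 by (auto simp: continuous_on_eq_continuous_within)
      moreover have "at u within {0..1} = at u within {0<..1}"
        by (rule at_within_nhd[of _ "{0<..}"]) (use u0 in auto)
      ultimately show ?thesis by simp
    qed
  qed
  \<comment> \<open>The square of F is split as F * (F - P) + F * P. The first part contributes at
    most e * B, as exp (- z) has mass at most 1; the second is a combination of moments and
    disappears when the upper limit Y tends to infinity.\<close>
  have small: "integral {0..y} (\<lambda>z. exp (- z) * (F z)\<^sup>2) \<le> e * B" if e: "e > 0" for e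
  proof -
    obtain P where P: "real_polynomial_function P" "\<And>u. u \<in> {0..1} \<Longrightarrow> \<bar>h u - P u\<bar> < e"
      using Stone_Weierstrass_real_polynomial_function[OF _ conth e] by auto
    obtain a N where aN: "P = (\<lambda>x. \<Sum>i\<le>(N::nat). a i * x ^ i)"
      using P(1) unfolding real_polynomial_function_iff_sum by auto
    have Pc: "continuous_on S (\<lambda>z. P (exp (- z)))" for S unfolding aN by (intro continuous_intros)
    have Pz: "\<bar>F z - P (exp (- z))\<bar> < e" if "z \<ge> 0" for z
      using P(2)[of "exp (- z)"] that by (simp add: h_def)
    have bound: "integral {0..y} (\<lambda>z. exp (- z) * (F z)\<^sup>2)
        \<le> e * B + (\<Sum>i\<le>N. a i * integral {0..Y} (\<lambda>z. exp (- (real i + 1) * z) * F z))"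
      if Y: "Y \<ge> y" for Y
    proof -
      have i1: "(\<lambda>z. exp (- z) * (F z)\<^sup>2) integrable_on {0..Y}" for Y
        by (intro integrable_continuous_interval continuous_intros contF)
      have i2: "(\<lambda>z. exp (- z) * F z * (F z - P (exp (- z)))) integrable_on {0..Y}"
        by (intro integrable_continuous_interval continuous_intros contF Pc)
      have i3: "(\<lambda>z. a i * (exp (- (real i + 1) * z) * F z)) integrable_on {0..Y}" for i
        by (intro integrable_continuous_interval continuous_intros contF)
      have "integral {0..y} (\<lambda>z. exp (- z) * (F z)\<^sup>2) \<le> integral {0..Y} (\<lambda>z. exp (- z) * (F z)\<^sup>2)"
        by (rule integral_subset_le) (use Y i1 in auto)
      also have "\<dots> = integral {0..Y} (\<lambda>z. exp (- z) * F z * (F z - P (exp (- z)))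
            + (\<Sum>i\<le>N. a i * (exp (- (real i + 1) * z) * F z)))"
      proof (rule integral_cong)
        fix z assume "z \<in> {0..Y}"
        have "exp (- z) * F z * P (exp (- z)) = (\<Sum>i\<le>N. a i * (exp (- (real i + 1) * z) * F z))"
          unfolding aN sum_distrib_left
        proof (intro sum.cong refl)
          fix i
          have "exp (- (real i + 1) * z) = exp (- z) * exp (- z) ^ i"
            unfolding exp_of_nat_mult[symmetric] exp_add[symmetric] by (simp add: algebra_simps)
          then show "exp (- z) * F z * (a i * exp (- z) ^ i) = a i * (exp (- (real i + 1) * z) * F z)" by simp
        qed
        then show "exp (- z) * (F z)\<^sup>2 = exp (- z) * F z * (F z - P (exp (- z)))
            + (\<Sum>i\<le>N. a i * (exp (- (real i + 1) * z) * F z))"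
          by (simp add: algebra_simps power2_eq_square)
      qed
      also have "\<dots> = integral {0..Y} (\<lambda>z. exp (- z) * F z * (F z - P (exp (- z))))
            + integral {0..Y} (\<lambda>z. \<Sum>i\<le>N. a i * (exp (- (real i + 1) * z) * F z))"
        by (rule integral_add[OF i2]) (intro integrable_sum i3, simp)
      also have "integral {0..Y} (\<lambda>z. \<Sum>i\<le>N. a i * (exp (- (real i + 1) * z) * F z))
          = (\<Sum>i\<le>N. integral {0..Y} (\<lambda>z. a i * (exp (- (real i + 1) * z) * F z)))"
        by (rule integral_sum[OF finite_atMost i3])
      also have "\<dots> = (\<Sum>i\<le>N. a i * integral {0..Y} (\<lambda>z. exp (- (real i + 1) * z) * F z))"
        by (simp only: integral_mult_right)
      also have "integral {0..Y} (\<lambda>z. exp (- z) * F z * (F z - P (exp (- z)))) \<le> e * B"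
      proof -
        have d: "((\<lambda>z. (e * B) * exp (- z)) has_integral (- (e * B) * exp (- Y) - (- (e * B) * exp (- 0)))) {0..Y}"
          by (rule fundamental_theorem_of_calculus)
             (use Y y in \<open>auto intro!: derivative_eq_intros simp: has_real_derivative_iff_has_vector_derivative[symmetric]\<close>)
        have "integral {0..Y} (\<lambda>z. exp (- z) * F z * (F z - P (exp (- z)))) \<le> integral {0..Y} (\<lambda>z. (e * B) * exp (- z))"
        proof (rule integral_le[OF i2])
          show "(\<lambda>z. (e * B) * exp (- z)) integrable_on {0..Y}" using d by blast
          fix z assume "z \<in> {0..Y}"
          then have "\<bar>F z\<bar> * \<bar>F z - P (exp (- z))\<bar> \<le> B * e"
            by (intro mult_mono B less_imp_le[OF Pz]) (use B in auto)
          then have "F z * (F z - P (exp (- z))) \<le> e * B"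
            by (metis abs_mult abs_le_D1 mult.commute)
          then have "exp (- z) * (F z * (F z - P (exp (- z)))) \<le> exp (- z) * (e * B)"
            by (intro mult_left_mono) auto
          then show "exp (- z) * F z * (F z - P (exp (- z))) \<le> e * B * exp (- z)"
            by (simp add: mult.assoc mult.commute mult.left_commute)
        qed
        also have "\<dots> = (- (e * B) * exp (- Y) - (- (e * B) * exp (- 0)))" using d by (rule integral_unique)
        also have "\<dots> \<le> e * B" using e B(1) by simp
        finally show ?thesis .
      qed
      finally show ?thesis by simp
    qed
    have "((\<lambda>Y. e * B + (\<Sum>i\<le>N. a i * integral {0..Y} (\<lambda>z. exp (- (real i + 1) * z) * F z))) \<longlongrightarrow> e * B + (\<Sum>i\<le>N. a i * 0)) at_top"
      by (intro tendsto_intros mom)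
    then show ?thesis
      using tendsto_lowerbound[OF _ _ trivial_limit_at_top_linorder, of _ _ "integral {0..y} (\<lambda>z. exp (- z) * (F z)\<^sup>2)"]
        bound eventually_at_top_linorder by (metis (no_types, lifting) add.right_neutral mult_zero_right sum.neutral)
  qed
  have contG: "continuous_on {0..y} (\<lambda>z. exp (- z) * (F z)\<^sup>2)" for y by (intro continuous_intros contF)
  have zero: "integral {0..y} (\<lambda>z. exp (- z) * (F z)\<^sup>2) = 0" if "y \<ge> 0" and sm: "\<And>e. e > 0 \<Longrightarrow> integral {0..y} (\<lambda>z. exp (- z) * (F z)\<^sup>2) \<le> e * B" for y
  proof -
    have "integral {0..y} (\<lambda>z. exp (- z) * (F z)\<^sup>2) \<le> 0 + e" if "e > 0" for e
      using sm[of "e / B"] that B(1) by simp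
    then have "integral {0..y} (\<lambda>z. exp (- z) * (F z)\<^sup>2) \<le> 0" by (rule field_le_epsilon)
    moreover have "integral {0..y} (\<lambda>z. exp (- z) * (F z)\<^sup>2) \<ge> 0"
      by (rule integral_nonneg) (auto intro: integrable_continuous_interval contG)
    ultimately show ?thesis by simp
  qed
  have "((\<lambda>z. exp (- z) * (F z)\<^sup>2) has_integral 0) (cbox 0 y)"
    using integrable_integral[OF integrable_continuous_interval[OF contG[of y]]] zero[OF less_imp_le[OF y] small] by simp
  then have "exp (- y) * (F y)\<^sup>2 = 0"
    using has_integral_0_cbox_imp_0[of 0 y "\<lambda>z. exp (- z) * (F z)\<^sup>2" y] contG[of y] y by auto
  then show ?thesis by simp
qed

text \<open>The transforms are improper integrals and f may grow, so the argument passes to the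
  primitive F of exp (- (L + 1) z) f z. The transform at L + 1 shows that F tends to 0, integration
  by parts turns the transforms at larger integers shifts into moments of F, and differentiating F =
  0 gives f = 0.\<close>

lemma laplace_transform_zero_imp_zero:
  fixes f :: "real \<Rightarrow> real"
  assumes cont: "continuous_on {0..} f"
    and int: "\<And>l. l > L \<Longrightarrow> ((\<lambda>y. exp (- l * y) * f y) has_integral 0) {0..}"
    and y: "y \<ge> 0"
  shows "f y = 0"
proof -
  define g where "g z = exp (- (L + 1) * z) * f z" for z
  define F where "F y = integral {0..y} g" for y
  have contg: "continuous_on {0..} g" unfolding g_def by (intro continuous_intros cont)
  have contg': "continuous_on {0..y} g" for y by (rule continuous_on_subset[OF contg]) auto
  have derF: "(F has_real_derivative g z) (at z within {0..y})" if "z \<in> {0..y}" for z y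
    unfolding F_def by (rule integral_has_real_derivative[OF contg' that])
  have contFy: "continuous_on {0..y} F" for y
    by (meson DERIV_continuous derF continuous_on_eq_continuous_within)
  have contF: "continuous_on {0..} F"
    unfolding continuous_on_eq_continuous_within
  proof
    fix z :: real assume z: "z \<in> {0..}"
    then have "continuous (at z within {0..z+1}) F"
      using contFy[of "z+1"] by (auto simp: continuous_on_eq_continuous_within)
    moreover have "at z within {0..} = at z within {0..z+1}"
      by (rule at_within_nhd[of _ "{..<z+1}"]) auto
    ultimately show "continuous (at z within {0..}) F" by simp
  qed
  have int': "((\<lambda>y. exp (- real n * y) * g y) has_integral 0) {0..}" for n :: nat
  proof -
    have "exp (- real n * y) * g y = exp (- (L + 1 + real n) * y) * f y" for y
      by (simp add: g_def exp_add[symmetric] algebra_simps)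
    then show ?thesis using int[of "L + 1 + real n"] by simp
  qed
  have limF: "(F \<longlongrightarrow> 0) at_top"
    using has_integral_atLeast_imp_tendsto[OF int'[of 0]] by (simp add: F_def[abs_def])
  have "F z = 0" if z: "z > 0" for z
  proof (rule continuous_exp_moments_zero[OF contF limF _ z])
    fix n :: nat
    let ?n = "real n + 1"
    have parts: "integral {0..y} (\<lambda>z. exp (- ?n * z) * F z) =
        (integral {0..y} (\<lambda>z. exp (- real (Suc n) * z) * g z) - exp (- ?n * y) * F y) / ?n" if "y \<ge> 0" for y
    proof -
      have "((\<lambda>z. exp (- ?n * z) * g z - ?n * (exp (- ?n * z) * F z)) has_integral
          (exp (- ?n * y) * F y - exp (- ?n * 0) * F 0)) {0..y}"
      proof (rule fundamental_theorem_of_calculus[OF that])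
        fix x assume x: "x \<in> {0..y}"
        have "((\<lambda>z. exp (- ?n * z) * F z) has_real_derivative
            exp (- ?n * x) * g x - ?n * (exp (- ?n * x) * F x)) (at x within {0..y})"
          by (rule derivative_eq_intros derF x refl | simp add: algebra_simps)+
        then show "((\<lambda>z. exp (- ?n * z) * F z) has_vector_derivative
            exp (- ?n * x) * g x - ?n * (exp (- ?n * x) * F x)) (at x within {0..y})"
          by (simp add: has_real_derivative_iff_has_vector_derivative)
      qed
      then have "integral {0..y} (\<lambda>z. exp (- ?n * z) * g z - ?n * (exp (- ?n * z) * F z)) = exp (- ?n * y) * F y"
        by (simp add: integral_unique F_def)
      moreover have "integral {0..y} (\<lambda>z. exp (- ?n * z) * g z - ?n * (exp (- ?n * z) * F z)) =
          integral {0..y} (\<lambda>z. exp (- ?n * z) * g z) - integral {0..y} (\<lambda>z. ?n * (exp (- ?n * z) * F z))"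
        by (rule integral_diff) (intro integrable_continuous_interval continuous_intros contg' contFy)+
      moreover have "integral {0..y} (\<lambda>z. ?n * (exp (- ?n * z) * F z)) = ?n * integral {0..y} (\<lambda>z. exp (- ?n * z) * F z)"
        by (simp only: integral_mult_right)
      ultimately show ?thesis by (simp add: field_simps)
    qed
    have lim1: "((\<lambda>y. (integral {0..y} (\<lambda>z. exp (- real (Suc n) * z) * g z) - exp (- ?n * y) * F y) / ?n) \<longlongrightarrow> (0 - 0 * 0) / ?n) at_top"
    proof (intro tendsto_intros has_integral_atLeast_imp_tendsto int' limF)
      show "((\<lambda>y. exp (- ?n * y)) \<longlongrightarrow> 0) at_top"
        by (rule filterlim_compose[OF exp_at_bot])
           (auto intro!: filterlim_tendsto_neg_mult_at_bot[OF tendsto_const] filterlim_ident)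
    qed auto
    have z0: "(0 - 0 * 0) / ?n = 0" by simp
    show "((\<lambda>y. integral {0..y} (\<lambda>z. exp (- ?n * z) * F z)) \<longlongrightarrow> 0) at_top"
      by (rule Lim_transform_eventually[OF lim1[unfolded z0]])
         (rule eventually_mono[OF eventually_ge_at_top[of 0]], rule parts[symmetric])
  qed
  then have F0: "F z = 0" if "z \<ge> 0" for z using that by (cases "z = 0") (auto simp: F_def)
  \<comment> \<open>The derivative is taken within \<open>{0..y+1}\<close>, which covers the
    one-sided case y = 0.\<close>
  have "((\<lambda>z. 0) has_real_derivative g y) (at y within {0..y+1})"
    using derF[of y "y+1"] y by (rule_tac has_field_derivative_transform_within[where f=F and d=1]) (auto simp: F0)
  moreover have "((\<lambda>z. 0::real) has_real_derivative 0) (at y within {0..y+1})" by simp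
  ultimately have "g y = 0"
    using has_field_derivative_unique[of "\<lambda>z. 0" "g y" y "{0..y+1}" 0] y
    by (simp add: trivial_limit_within islimpt_Icc)
  then show ?thesis by (simp add: g_def)
qed

section \<open>Convolution of locally bounded functions on the half line\<close>

lemma integrable_bounded_support:
  fixes h :: "'b \<Rightarrow> real"
  assumes "h \<in> borel_measurable N" "S \<in> sets N" "emeasure N S < \<infinity>"
    and "\<And>z. z \<in> space N \<Longrightarrow> \<bar>h z\<bar> \<le> B * indicator S z"
  shows "integrable N h"
proof (rule Bochner_Integration.integrable_bound)
  show "integrable N (\<lambda>z. B * indicator S z :: real)" using assms(2,3) by simp
  show "AE x in N. norm (h x) \<le> norm (B * indicator S x :: real)"
    using assms(4) by (intro AE_I2) (smt (verit) real_norm_def)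
qed fact

text \<open>Bounds are required on \<open>{0..T}\<close> only, since these are the values that a
  convolution on the half line reads.\<close>

definition loc_bounded :: "(real \<Rightarrow> real) \<Rightarrow> bool" where
  "loc_bounded f \<longleftrightarrow> f \<in> borel_measurable borel \<and> (\<forall>T. \<exists>B. \<forall>x\<in>{0..T}. \<bar>f x\<bar> \<le> B)"

definition conv :: "(real \<Rightarrow> real) \<Rightarrow> (real \<Rightarrow> real) \<Rightarrow> real \<Rightarrow> real" where
  "conv f g x = (\<integral>z. indicator {0..x} z * (f (x - z) * g z) \<partial>lborel)"

lemma loc_boundedD:
  assumes "loc_bounded f"
  obtains B where "B \<ge> 0" "\<And>x. 0 \<le> x \<Longrightarrow> x \<le> T \<Longrightarrow> \<bar>f x\<bar> \<le> B"
proof -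
  obtain B where "\<forall>x\<in>{0..T}. \<bar>f x\<bar> \<le> B" using assms unfolding loc_bounded_def by blast
  then show ?thesis using that[of "max 0 B"] by (simp add: le_max_iff_disj)
qed

lemma loc_bounded_measurable [measurable_dest]: "loc_bounded f \<Longrightarrow> f \<in> borel_measurable borel"
  by (simp add: loc_bounded_def)

lemma conv_integrable:
  assumes f: "loc_bounded f" and g: "loc_bounded g"
  shows "integrable lborel (\<lambda>z. indicator {0..x} z * (f (x - z) * g z))"
proof -
  note [measurable] = loc_bounded_measurable[OF f] loc_bounded_measurable[OF g]
  obtain Bf where Bf: "Bf \<ge> 0" "\<And>z. 0 \<le> z \<Longrightarrow> z \<le> x \<Longrightarrow> \<bar>f z\<bar> \<le> Bf" using loc_boundedD[OF f] by metis
  obtain Bg where Bg: "Bg \<ge> 0" "\<And>z. 0 \<le> z \<Longrightarrow> z \<le> x \<Longrightarrow> \<bar>g z\<bar> \<le> Bg" using loc_boundedD[OF g] by metis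
  show ?thesis
    by (rule integrable_bounded_support[where S="{0..x}" and B="Bf * Bg"])
       (auto simp: indicator_def abs_mult emeasure_lborel_Icc_eq Bf Bg intro!: mult_mono)
qed

lemma conv_eq_0: "x < 0 \<Longrightarrow> conv f g x = 0"
  by (simp add: conv_def)

lemma conv_cong:
  assumes "\<And>z. 0 \<le> z \<Longrightarrow> z \<le> x \<Longrightarrow> f z = f' z" "\<And>z. 0 \<le> z \<Longrightarrow> z \<le> x \<Longrightarrow> g z = g' z"
  shows "conv f g x = conv f' g' x"
  unfolding conv_def
  by (rule Bochner_Integration.integral_cong) (auto simp: indicator_def assms)

lemma conv_commute: "conv f g x = conv g f x"
proof -
  have "conv f g x = (\<integral>z. indicator {0..x} (x + (-1) * z) * (f (x - (x + (-1) * z)) * g (x + (-1) * z)) \<partial>lborel)"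
    unfolding conv_def by (subst lborel_integral_real_affine[where c="-1" and t=x]) auto
  also have "\<dots> = conv g f x" unfolding conv_def
    by (rule Bochner_Integration.integral_cong) (auto simp: indicator_def)
  finally show ?thesis .
qed

lemma conv_measurable:
  assumes [measurable]: "f \<in> borel_measurable borel" "g \<in> borel_measurable borel"
  shows "conv f g \<in> borel_measurable borel"
proof -
  \<comment> \<open>The interval in the indicator depends on x; written as a condition on the pair
    of x and z it is visibly jointly measurable.\<close>
  have "conv f g = (\<lambda>x. \<integral>z. (if 0 \<le> z \<and> z \<le> x then f (x - z) * g z else 0) \<partial>lborel)"
    by (auto simp: conv_def fun_eq_iff indicator_def intro!: Bochner_Integration.integral_cong)
  also have "\<dots> \<in> borel_measurable borel" by measurable
  finally show ?thesis .
qed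

lemma conv_loc_bounded:
  assumes f: "loc_bounded f" and g: "loc_bounded g"
  shows "loc_bounded (conv f g)"
  unfolding loc_bounded_def
proof (intro conjI allI)
  show "conv f g \<in> borel_measurable borel" using f g by (simp add: conv_measurable loc_bounded_measurable)
  fix T
  obtain Bf where Bf: "Bf \<ge> 0" "\<And>z. 0 \<le> z \<Longrightarrow> z \<le> T \<Longrightarrow> \<bar>f z\<bar> \<le> Bf" using loc_boundedD[OF f] by metis
  obtain Bg where Bg: "Bg \<ge> 0" "\<And>z. 0 \<le> z \<Longrightarrow> z \<le> T \<Longrightarrow> \<bar>g z\<bar> \<le> Bg" using loc_boundedD[OF g] by metis
  have "\<bar>conv f g x\<bar> \<le> Bf * Bg * T" if x: "x \<in> {0..T}" for x
  proof -
    have "\<bar>conv f g x\<bar> \<le> (\<integral>z. Bf * Bg * indicator {0..x} z \<partial>lborel)"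
      unfolding conv_def real_norm_def[symmetric]
    proof (rule Bochner_Integration.integral_norm_bound_integral[OF conv_integrable[OF f g]])
      show "integrable lborel (\<lambda>z. Bf * Bg * indicator {0..x} z)" by (simp add: emeasure_lborel_Icc_eq)
      fix z
      show "norm (indicator {0..x} z * (f (x - z) * g z)) \<le> Bf * Bg * indicator {0..x} z"
        using x by (auto simp: indicator_def abs_mult Bf Bg intro!: mult_mono)
    qed
    also have "\<dots> = Bf * Bg * x" using x by simp
    also have "\<dots> \<le> Bf * Bg * T" using x Bf(1) Bg(1) by (intro mult_left_mono) auto
    finally show ?thesis .
  qed
  then show "\<exists>B. \<forall>x\<in>{0..T}. \<bar>conv f g x\<bar> \<le> B" by blast
qed

text \<open>Fubini on the triangle 0 <= u <= z <= x, followed by the translation z = u + s of the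
  inner integral.\<close>

lemma conv_assoc:
  assumes f: "loc_bounded f" and g: "loc_bounded g" and h: "loc_bounded h"
  shows "conv f (conv g h) x = conv (conv f g) h x"
proof -
  note [measurable] = loc_bounded_measurable[OF f] loc_bounded_measurable[OF g] loc_bounded_measurable[OF h]
  obtain Bf where Bf: "Bf \<ge> 0" "\<And>z. 0 \<le> z \<Longrightarrow> z \<le> x \<Longrightarrow> \<bar>f z\<bar> \<le> Bf" using loc_boundedD[OF f] by metis
  obtain Bg where Bg: "Bg \<ge> 0" "\<And>z. 0 \<le> z \<Longrightarrow> z \<le> x \<Longrightarrow> \<bar>g z\<bar> \<le> Bg" using loc_boundedD[OF g] by metis
  obtain Bh where Bh: "Bh \<ge> 0" "\<And>z. 0 \<le> z \<Longrightarrow> z \<le> x \<Longrightarrow> \<bar>h z\<bar> \<le> Bh" using loc_boundedD[OF h] by metis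
  define F where "F z u = (if 0 \<le> u \<and> u \<le> z \<and> z \<le> x then f (x - z) * (g (z - u) * h u) else 0)" for z u
  have Fm [measurable]: "case_prod F \<in> borel_measurable (lborel \<Otimes>\<^sub>M lborel)"
    unfolding F_def[abs_def] by measurable
  have int: "integrable (lborel \<Otimes>\<^sub>M lborel) (case_prod F)"
  proof (rule integrable_bounded_support[where S="{0..x} \<times> {0..x}" and B="Bf * (Bg * Bh)"])
    show "emeasure (lborel \<Otimes>\<^sub>M lborel) ({0..x} \<times> {0..x}) < \<infinity>"
      by (simp add: lborel.emeasure_pair_measure_Times emeasure_lborel_Icc_eq ennreal_mult_less_top)
    fix z :: "real \<times> real"
    have "\<bar>f (x - a) * (g (a - b) * h b)\<bar> \<le> Bf * (Bg * Bh)" if "0 \<le> b" "b \<le> a" "a \<le> x" for a b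
      unfolding abs_mult using that by (intro mult_mono Bf Bg Bh mult_nonneg_nonneg abs_ge_zero) auto
    then show "\<bar>case_prod F z\<bar> \<le> Bf * (Bg * Bh) * indicator ({0..x} \<times> {0..x}) z"
      using Bf(1) Bg(1) Bh(1) by (auto simp: F_def indicator_def split: prod.split)
  qed auto
  have "conv f (conv g h) x = (\<integral>z. (\<integral>u. F z u \<partial>lborel) \<partial>lborel)"
    unfolding conv_def
  proof (rule Bochner_Integration.integral_cong[OF refl])
    fix z
    show "indicator {0..x} z * (f (x - z) * (\<integral>u. indicator {0..z} u * (g (z - u) * h u) \<partial>lborel)) = (\<integral>u. F z u \<partial>lborel)"
      unfolding integral_mult_right_zero[symmetric]
      by (rule Bochner_Integration.integral_cong) (auto simp: F_def indicator_def)
  qed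
  also have "\<dots> = (\<integral>u. (\<integral>z. F z u \<partial>lborel) \<partial>lborel)"
    by (rule lborel_pair.Fubini_integral[OF int, symmetric])
  also have "\<dots> = conv (conv f g) h x"
    unfolding conv_def[of "conv f g"]
  proof (rule Bochner_Integration.integral_cong[OF refl])
    fix u
    have "(\<integral>z. F z u \<partial>lborel) = (\<integral>s. F (u + 1 * s) u \<partial>lborel)"
      by (subst lborel_integral_real_affine[where c=1 and t=u]) auto
    also have "\<dots> = indicator {0..x} u * (conv f g (x - u) * h u)"
      unfolding conv_def integral_mult_left_zero[symmetric] integral_mult_right_zero[symmetric]
      by (rule Bochner_Integration.integral_cong) (auto simp: F_def indicator_def algebra_simps)
    finally show "(\<integral>z. F z u \<partial>lborel) = indicator {0..x} u * (conv f g (x - u) * h u)" .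
  qed
  finally show ?thesis .
qed

lemma conv_add_right:
  assumes "loc_bounded f" "loc_bounded g" "loc_bounded h"
  shows "conv f (\<lambda>z. g z + r * h z) x = conv f g x + r * conv f h x"
proof -
  have "conv f g x + r * conv f h x =
      (\<integral>z. indicator {0..x} z * (f (x - z) * g z) + r * (indicator {0..x} z * (f (x - z) * h z)) \<partial>lborel)"
    using conv_integrable[OF assms(1,2)] conv_integrable[OF assms(1,3)]
    by (simp add: conv_def)
  also have "\<dots> = conv f (\<lambda>z. g z + r * h z) x" unfolding conv_def
    by (rule Bochner_Integration.integral_cong) (auto simp: algebra_simps)
  finally show ?thesis by simp
qed

lemma conv_add_left:
  assumes "loc_bounded f" "loc_bounded g" "loc_bounded h"
  shows "conv (\<lambda>z. g z + r * h z) f x = conv g f x + r * conv h f x"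
  using conv_add_right[OF assms] by (simp add: conv_commute)

lemma loc_bounded_add:
  assumes f: "loc_bounded f" and g: "loc_bounded g"
  shows "loc_bounded (\<lambda>z. f z + r * g z)"
  unfolding loc_bounded_def
proof (intro conjI allI)
  show "(\<lambda>z. f z + r * g z) \<in> borel_measurable borel" using f g by (auto simp: loc_bounded_def)
  fix T
  obtain Bf where Bf: "Bf \<ge> 0" "\<And>z. 0 \<le> z \<Longrightarrow> z \<le> T \<Longrightarrow> \<bar>f z\<bar> \<le> Bf" using loc_boundedD[OF f] by metis
  obtain Bg where Bg: "Bg \<ge> 0" "\<And>z. 0 \<le> z \<Longrightarrow> z \<le> T \<Longrightarrow> \<bar>g z\<bar> \<le> Bg" using loc_boundedD[OF g] by metis
  have "\<bar>f x + r * g x\<bar> \<le> Bf + \<bar>r\<bar> * Bg" if "x \<in> {0..T}" for x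
  proof -
    have "\<bar>f x + r * g x\<bar> \<le> \<bar>f x\<bar> + \<bar>r\<bar> * \<bar>g x\<bar>" by (metis abs_mult abs_triangle_ineq)
    also have "\<dots> \<le> Bf + \<bar>r\<bar> * Bg" using that by (intro add_mono mult_left_mono Bf Bg) auto
    finally show ?thesis .
  qed
  then show "\<exists>B. \<forall>x\<in>{0..T}. \<bar>f x + r * g x\<bar> \<le> B" by blast
qed

lemma loc_bounded_scale: "loc_bounded f \<Longrightarrow> loc_bounded (\<lambda>z. r * f z)"
  using loc_bounded_add[of "\<lambda>_. 0" f r] by (auto simp: loc_bounded_def)

section \<open>Dyadic approximation from the right\<close>

text \<open>The summand 1 puts the grid point strictly to the right of s even if s lies on the grid,
  so that the approach is from the right.\<close>

definition dyadic_above :: "nat \<Rightarrow> real \<Rightarrow> real" where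
  "dyadic_above n s = (of_int \<lfloor>2 ^ n * s\<rfloor> + 1) / 2 ^ n"

lemma dyadic_above_gt: "s < dyadic_above n s"
  unfolding dyadic_above_def by (simp add: field_simps) linarith

lemma dyadic_above_le: "dyadic_above n s \<le> s + (1/2)^n"
  unfolding dyadic_above_def by (simp add: field_simps power_one_over)

lemma dyadic_above_tendsto: "(\<lambda>n. dyadic_above n s) \<longlonglongrightarrow> s"
proof (rule tendsto_sandwich)
  show "(\<lambda>n. s) \<longlonglongrightarrow> s" by simp
  have "(\<lambda>n. s + (1/2)^n) \<longlonglongrightarrow> s + 0" by (intro tendsto_intros LIMSEQ_power_zero) simp
  then show "(\<lambda>n. s + (1/2)^n) \<longlonglongrightarrow> s" by simp
qed (simp_all add: less_imp_le dyadic_above_gt dyadic_above_le)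

lemma dyadic_above_at_right: "filterlim (\<lambda>n. dyadic_above n s) (at_right s) sequentially"
  unfolding filterlim_at by (simp add: dyadic_above_tendsto dyadic_above_gt less_imp_neq[symmetric])

text \<open>Cauchy's equation for ln f gives linearity at dyadic times, and right-continuity carries
  it to all t by approximation from above.\<close>

lemma multiplicative_right_continuous_exp:
  fixes f :: "real \<Rightarrow> real"
  assumes pos: "\<And>t. t \<ge> 0 \<Longrightarrow> f t > 0"
    and mult: "\<And>s t. s \<ge> 0 \<Longrightarrow> t \<ge> 0 \<Longrightarrow> f (s + t) = f s * f t"
    and rc: "\<And>t. t \<ge> 0 \<Longrightarrow> (f \<longlongrightarrow> f t) (at_right t)"
    and t: "t \<ge> 0"
  shows "f t = exp (t * ln (f 1))"
proof -
  define g where "g t = ln (f t)" for t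
  have add: "g (s + t) = g s + g t" if "s \<ge> 0" "t \<ge> 0" for s t
    using that pos by (simp add: g_def mult ln_mult less_imp_neq[symmetric] less_imp_le)
  have g0: "g 0 = 0" using add[of 0 0] by simp
  have gn: "g (real n * t) = real n * g t" if "t \<ge> 0" for n t
    by (induction n) (use that in \<open>auto simp: g0 distrib_right add\<close>)
  have gd: "g (real k / 2 ^ n) = real k / 2 ^ n * g 1" for k n
  proof -
    have "2 ^ n * g (real k / 2 ^ n) = g (real (2 ^ n) * (real k / 2 ^ n))" by (subst gn) auto
    also have "\<dots> = g (real k * 1)" by simp
    also have "\<dots> = real k * g 1" by (rule gn) simp
    finally show ?thesis by (simp add: field_simps)
  qed
  have gda: "g (dyadic_above n t) = dyadic_above n t * g 1" for n
  proof -
    have "of_int \<lfloor>2 ^ n * t\<rfloor> + 1 = real (nat \<lfloor>2 ^ n * t\<rfloor> + 1)" using t by simp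
    then show ?thesis unfolding dyadic_above_def using gd[of "nat \<lfloor>2 ^ n * t\<rfloor> + 1" n] by (simp only:)
  qed
  have "(\<lambda>n. f (dyadic_above n t)) \<longlonglongrightarrow> f t"
    by (rule filterlim_compose[OF rc[OF t] dyadic_above_at_right])
  then have "(\<lambda>n. g (dyadic_above n t)) \<longlonglongrightarrow> g t"
    unfolding g_def by (rule tendsto_ln) (use pos[OF t] in auto)
  moreover have "(\<lambda>n. g (dyadic_above n t)) \<longlonglongrightarrow> t * g 1"
    unfolding gda by (intro tendsto_intros dyadic_above_tendsto)
  ultimately have "g t = t * g 1" using LIMSEQ_unique by blast
  then show ?thesis using pos[OF t] by (metis exp_ln g_def)
qed

section \<open>Paths without positive jumps\<close>

definition sn_path :: "(real \<Rightarrow> real) \<Rightarrow> bool" where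
  "sn_path f \<longleftrightarrow> cadlag_path f \<and> (\<forall>t>0. \<forall>l. (f \<longlongrightarrow> l) (at_left t) \<longrightarrow> f t \<le> l)"

definition run_sup :: "(real \<Rightarrow> real) \<Rightarrow> real \<Rightarrow> real \<Rightarrow> real" where
  "run_sup f s t = Sup (f ` {s..t})"

lemma dyadic_above_nat: "r \<ge> 0 \<Longrightarrow> dyadic_above n r = real (nat \<lfloor>2 ^ n * r\<rfloor> + 1) / 2 ^ n"
  by (simp add: dyadic_above_def)

lemma sn_path_right_cont: "sn_path f \<Longrightarrow> t \<ge> 0 \<Longrightarrow> (f \<longlongrightarrow> f t) (at_right t)"
  by (simp add: sn_path_def cadlag_path_def continuous_within)

lemma sn_path_left_limit:
  assumes "sn_path f" "t > 0"
  obtains l where "(f \<longlongrightarrow> l) (at_left t)" "f t \<le> l"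
  using assms unfolding sn_path_def cadlag_path_def by blast

lemma sn_path_right_gt:
  assumes "sn_path f" "u \<ge> 0" "f u > a"
  obtains e where "e > 0" "\<And>x. u \<le> x \<Longrightarrow> x < u + e \<Longrightarrow> f x > a"
proof -
  have "\<forall>\<^sub>F x in at_right u. f x > a" using order_tendstoD(1)[OF sn_path_right_cont[OF assms(1,2)] assms(3)] .
  then obtain b where b: "b > u" "\<And>x. x > u \<Longrightarrow> x < b \<Longrightarrow> f x > a"
    unfolding eventually_at_right_field by blast
  have "f x > a" if "u \<le> x" "x < u + (b - u)" for x
    using b(2)[of x] assms(3) that by (cases "x = u") auto
  then show ?thesis using that[of "b - u"] b(1) by simp
qed

lemma sn_path_right_less:
  assumes "sn_path f" "u \<ge> 0" "f u < a"
  obtains e where "e > 0" "\<And>x. u \<le> x \<Longrightarrow> x < u + e \<Longrightarrow> f x < a"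
proof -
  have "\<forall>\<^sub>F x in at_right u. f x < a" using order_tendstoD(2)[OF sn_path_right_cont[OF assms(1,2)] assms(3)] .
  then obtain b where b: "b > u" "\<And>x. x > u \<Longrightarrow> x < b \<Longrightarrow> f x < a"
    unfolding eventually_at_right_field by blast
  have "f x < a" if "u \<le> x" "x < u + (b - u)" for x
    using b(2)[of x] assms(3) that by (cases "x = u") auto
  then show ?thesis using that[of "b - u"] b(1) by simp
qed

lemma sn_path_left_gt:
  assumes "sn_path f" "u > 0" "f u > a"
  obtains e where "e > 0" "\<And>x. u - e < x \<Longrightarrow> x \<le> u \<Longrightarrow> f x > a"
proof -
  obtain l where l: "(f \<longlongrightarrow> l) (at_left u)" "f u \<le> l" using sn_path_left_limit[OF assms(1,2)] .
  have "\<forall>\<^sub>F x in at_left u. f x > a" using order_tendstoD(1)[OF l(1), of a] assms(3) l(2) by simp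
  then obtain b where b: "b < u" "\<And>x. x > b \<Longrightarrow> x < u \<Longrightarrow> f x > a"
    unfolding eventually_at_left_field by blast
  have "f x > a" if "u - (u - b) < x" "x \<le> u" for x
    using b(2)[of x] assms(3) that by (cases "x = u") auto
  then show ?thesis using that[of "u - b"] b(1) by simp
qed

lemma sn_path_left_bounded:
  assumes "sn_path f" "u > 0"
  obtains e B where "e > 0" "\<And>x. u - e < x \<Longrightarrow> x < u \<Longrightarrow> f x \<le> B"
proof -
  obtain l where l: "(f \<longlongrightarrow> l) (at_left u)" "f u \<le> l" using sn_path_left_limit[OF assms] .
  have "\<forall>\<^sub>F x in at_left u. f x < l + 1" using order_tendstoD(2)[OF l(1), of "l + 1"] by simp
  then obtain b where "b < u" "\<And>x. x > b \<Longrightarrow> x < u \<Longrightarrow> f x < l + 1"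
    unfolding eventually_at_left_field by blast
  then show ?thesis using that[of "u - b" "l + 1"] by (simp add: less_imp_le)
qed

text \<open>Compactness by bisection: near each point the path is bounded on the right by
  right-continuity and on the left by its left limit.\<close>

lemma sn_path_bdd_above:
  assumes f: "sn_path f" and s: "0 \<le> s" and st: "s \<le> t"
  shows "bdd_above (f ` {s..t})"
proof -
  \<comment> \<open>The sign condition is part of the bisected property, because nothing is known
    about the path at negative times.\<close>
  have "0 \<le> s \<longrightarrow> bdd_above (f ` {s..t})"
  proof (rule Bolzano[OF st])
    fix a b c :: real
    assume *: "0 \<le> a \<longrightarrow> bdd_above (f ` {a..b})" "0 \<le> b \<longrightarrow> bdd_above (f ` {b..c})" and "a \<le> b" "b \<le> c"
    then have "{a..c} = {a..b} \<union> {b..c}" by auto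
    then have "f ` {a..c} = f ` {a..b} \<union> f ` {b..c}" by (simp add: image_Un)
    then show "0 \<le> a \<longrightarrow> bdd_above (f ` {a..c})" using * \<open>a \<le> b\<close> by (simp add: bdd_above_Un)
  next
    fix x assume x: "s \<le> x" "x \<le> t"
    obtain e1 where e1: "e1 > 0" "\<And>z. x \<le> z \<Longrightarrow> z < x + e1 \<Longrightarrow> f z < f x + 1"
      using sn_path_right_less[OF f, of x "f x + 1"] x s by auto
    obtain e2 B where e2: "e2 > 0" "\<And>z. x - e2 < z \<Longrightarrow> 0 \<le> z \<Longrightarrow> z < x \<Longrightarrow> f z \<le> B"
    proof (cases "x = 0")
      case True
      show ?thesis by (rule that[of 1 0]) (use True in auto)
    next
      case False
      then have "x > 0" using x s by auto
      then show ?thesis using sn_path_left_bounded[OF f, of x] that by metis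
    qed
    have "bdd_above (f ` {a..b})" if "a \<le> x" "x \<le> b" "b - a < min e1 e2" "0 \<le> a" for a b
      unfolding bdd_above_def
    proof (intro exI ballI)
      fix v assume "v \<in> f ` {a..b}"
      then obtain z where z: "v = f z" "a \<le> z" "z \<le> b" by auto
      show "v \<le> max (f x + 1) B"
      proof (cases "z < x")
        case True then show ?thesis using e2(2)[of z] z that by auto
      next
        case False then show ?thesis using e1(2)[of z] z that by auto
      qed
    qed
    then show "\<exists>d>0. \<forall>a b. a \<le> x \<and> x \<le> b \<and> b - a < d \<longrightarrow> 0 \<le> a \<longrightarrow> bdd_above (f ` {a..b})"
      using e1(1) e2(1) by (intro exI[of _ "min e1 e2"]) auto
  qed
  then show ?thesis using s by simp
qed

lemma run_sup_upper: "sn_path f \<Longrightarrow> 0 \<le> s \<Longrightarrow> s \<le> u \<Longrightarrow> u \<le> t \<Longrightarrow> f u \<le> run_sup f s t"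
  unfolding run_sup_def by (rule cSup_upper) (auto intro: sn_path_bdd_above)

lemma run_sup_least: "s \<le> t \<Longrightarrow> (\<And>u. s \<le> u \<Longrightarrow> u \<le> t \<Longrightarrow> f u \<le> B) \<Longrightarrow> run_sup f s t \<le> B"
  unfolding run_sup_def by (rule cSup_least) auto

lemma run_sup_gtE:
  assumes "sn_path f" "0 \<le> s" "s \<le> t" "a < run_sup f s t"
  obtains u where "s \<le> u" "u \<le> t" "f u > a"
  using assms run_sup_least[of s t f a] by (meson linorder_not_less)

lemma run_sup_mono:
  assumes f: "sn_path f" and "0 \<le> s'" "s' \<le> s" "s \<le> t" "t \<le> t'"
  shows "run_sup f s t \<le> run_sup f s' t'"
  by (rule run_sup_least) (use assms in \<open>auto intro!: run_sup_upper[OF f]\<close>)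

text \<open>A value above a persists to the right by right-continuity and, at the right end point,
  to the left because the left limit is at least the value. Unlike a single time, an interval is met
  by every sufficiently fine grid.\<close>

lemma sn_path_gt_interval:
  assumes f: "sn_path f" and "0 \<le> s" "s < t" "s \<le> u" "u \<le> t" "f u > a"
  obtains v w where "s \<le> v" "v < w" "w \<le> t" "\<And>x. v < x \<Longrightarrow> x < w \<Longrightarrow> f x > a"
proof (cases "u < t")
  case True
  obtain e where "e > 0" "\<And>x. u \<le> x \<Longrightarrow> x < u + e \<Longrightarrow> f x > a"
    using sn_path_right_gt[OF f, of u a] assms by auto
  then show ?thesis using that[of u "min t (u + e)"] True assms by auto
next
  case False
  then have "u > 0" using assms by linarith
  then obtain e where "e > 0" "\<And>x. u - e < x \<Longrightarrow> x \<le> u \<Longrightarrow> f x > a"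
    using sn_path_left_gt[OF f _ assms(6)] by blast
  then show ?thesis using that[of "max s (u - e)" u] False assms by auto
qed

text \<open>Exhibits the running supremum as a limit of maxima of finitely many values, which is the
  source of its measurability.\<close>

lemma grid_max_tendsto:
  assumes f: "sn_path f" and s: "0 \<le> s" "s \<le> t"
  shows "(\<lambda>n. Max ((\<lambda>j. f (s + real j * (t - s) / 2 ^ n)) ` {..2 ^ n :: nat})) \<longlonglongrightarrow> run_sup f s t"
proof (rule order_tendstoI)
  have grid: "s \<le> s + real j * (t - s) / 2 ^ n \<and> s + real j * (t - s) / 2 ^ n \<le> t" if "j \<le> 2 ^ n" for j n
  proof -
    have "real j / 2 ^ n * (t - s) \<le> 1 * (t - s)"
      using that s by (intro mult_right_mono) (auto simp: divide_le_eq_1)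
    then show ?thesis using s by simp
  qed
  have le: "Max ((\<lambda>j. f (s + real j * (t - s) / 2 ^ n)) ` {..2 ^ n :: nat}) \<le> run_sup f s t" for n
    by (rule Max.boundedI) (use grid in \<open>auto intro!: run_sup_upper[OF f s(1)]\<close>)
  fix a assume "a > run_sup f s t"
  then show "\<forall>\<^sub>F n in sequentially. Max ((\<lambda>j. f (s + real j * (t - s) / 2 ^ n)) ` {..2 ^ n :: nat}) < a"
    using le by (intro always_eventually allI) (rule order.strict_trans1)
next
  fix a assume a: "a < run_sup f s t"
  obtain u where u: "s \<le> u" "u \<le> t" "f u > a" using run_sup_gtE[OF f s a] .
  show "\<forall>\<^sub>F n in sequentially. Max ((\<lambda>j. f (s + real j * (t - s) / 2 ^ n)) ` {..2 ^ n :: nat}) > a"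
  proof (cases "s = t")
    case True
    then have "Max ((\<lambda>j. f (s + real j * (t - s) / 2 ^ n)) ` {..2 ^ n :: nat}) = f u" for n
      using u by (simp add: image_constant_conv)
    then show ?thesis using u by simp
  next
    case False
    then obtain v w where vw: "s \<le> v" "v < w" "w \<le> t" "\<And>x. v < x \<Longrightarrow> x < w \<Longrightarrow> f x > a"
      using sn_path_gt_interval[OF f s(1) _ u] s by (metis order_le_less)
    \<comment> \<open>The position of v after rescaling [s, t] to [0, 1]; its dyadic successor
      eventually falls before w.\<close>
    define r where "r = (v - s) / (t - s)"
    have r0: "r \<ge> 0" using vw s False by (simp add: r_def)
    have "(\<lambda>n. s + dyadic_above n r * (t - s)) \<longlonglongrightarrow> s + r * (t - s)"
      by (intro tendsto_intros dyadic_above_tendsto)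
    also have "s + r * (t - s) = v" using False by (simp add: r_def)
    finally have "\<forall>\<^sub>F n in sequentially. s + dyadic_above n r * (t - s) < w"
      using vw(2) by (rule order_tendstoD)
    then show ?thesis
    proof (rule eventually_mono)
      fix n assume *: "s + dyadic_above n r * (t - s) < w"
      define j where "j = nat \<lfloor>2 ^ n * r\<rfloor> + 1"
      have j: "dyadic_above n r = real j / 2 ^ n" using dyadic_above_nat[OF r0] by (simp add: j_def)
      have ts: "t - s > 0" using s False by simp
      have "dyadic_above n r * (t - s) < 1 * (t - s)" using less_le_trans[OF * vw(3)] by (simp add: less_diff_eq add.commute)
      then have "dyadic_above n r < 1" using ts by (simp add: mult_less_cancel_right)
      then have "real j < 2 ^ n" by (simp add: j divide_less_eq)
      then have "j \<le> 2 ^ n" by simp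
      have "r * (t - s) < dyadic_above n r * (t - s)"
        using ts dyadic_above_gt by (intro mult_strict_right_mono)
      then have "v < s + dyadic_above n r * (t - s)" using ts by (simp add: r_def)
      then have "a < f (s + real j * (t - s) / 2 ^ n)" using vw(4) * by (simp add: j)
      also have "\<dots> \<le> Max ((\<lambda>j. f (s + real j * (t - s) / 2 ^ n)) ` {..2 ^ n :: nat})"
        by (rule Max_ge) (use \<open>j \<le> 2 ^ n\<close> in auto)
      finally show "a < Max ((\<lambda>j. f (s + real j * (t - s) / 2 ^ n)) ` {..2 ^ n :: nat})" .
    qed
  qed
qed

lemma run_sup_locally_constant:
  assumes f: "sn_path f" and t: "0 \<le> t" and less: "f t < run_sup f 0 t"
  obtains e where "e > 0" "\<And>s. t \<le> s \<Longrightarrow> s < t + e \<Longrightarrow> run_sup f 0 s = run_sup f 0 t"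
proof -
  obtain e where e: "e > 0" "\<And>x. t \<le> x \<Longrightarrow> x < t + e \<Longrightarrow> f x < run_sup f 0 t"
    using sn_path_right_less[OF f t less] by blast
  have "run_sup f 0 s = run_sup f 0 t" if s: "t \<le> s" "s < t + e" for s
  proof (rule antisym)
    show "run_sup f 0 s \<le> run_sup f 0 t"
    proof (rule run_sup_least)
      fix u assume u: "0 \<le> u" "u \<le> s"
      show "f u \<le> run_sup f 0 t"
      proof (cases "u \<le> t")
        case True then show ?thesis using run_sup_upper[OF f] u by auto
      next
        case False then show ?thesis using e(2)[of u] u s by auto
      qed
    qed (use t s in auto)
    show "run_sup f 0 t \<le> run_sup f 0 s" using run_sup_mono[OF f] t s by auto
  qed
  then show ?thesis using that e(1) by blast
qed

text \<open>After such a time t the supremum is constant on some interval, since the path lies below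
  it, whereas a later member needs a supremum exceeding all earlier rational values. So a rational
  number separates t from all later members of the set.\<close>

lemma countable_new_max_below:
  assumes f: "sn_path f" and d: "d > 0"
  shows "countable {t. 0 < t \<and> run_sup f 0 t - f t = d \<and> (\<forall>r\<in>\<rat>. 0 \<le> r \<longrightarrow> r < t \<longrightarrow> run_sup f 0 r < run_sup f 0 t)}"
    (is "countable ?B")
proof -
  have "\<exists>q\<in>\<rat>. t < q \<and> (\<forall>t'\<in>?B. t < t' \<longrightarrow> q < t')" if t: "t \<in> ?B" for t
  proof -
    have "f t < run_sup f 0 t" using t d by auto
    then obtain e where e: "e > 0" "\<And>s. t \<le> s \<Longrightarrow> s < t + e \<Longrightarrow> run_sup f 0 s = run_sup f 0 t"
      using run_sup_locally_constant[OF f, of t] t by auto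
    obtain q where q: "q \<in> \<rat>" "t < q" "q < t + e" using Rats_dense_in_real[of t "t + e"] e(1) by auto
    have "q < t'" if t': "t' \<in> ?B" "t < t'" for t'
    proof (rule ccontr)
      assume "\<not> q < t'"
      then have eq: "run_sup f 0 t' = run_sup f 0 t" using e(2)[of t'] q t' by auto
      obtain r where r: "r \<in> \<rat>" "t < r" "r < t'" using Rats_dense_in_real[OF t'(2)] by auto
      have "run_sup f 0 r < run_sup f 0 t'" using t' r t by auto
      moreover have "run_sup f 0 t \<le> run_sup f 0 r" using run_sup_mono[OF f] r t by auto
      ultimately show False using eq by simp
    qed
    then show ?thesis using q by blast
  qed
  then have "\<forall>t\<in>?B. \<exists>q. q \<in> \<rat> \<and> t < q \<and> (\<forall>t'\<in>?B. t < t' \<longrightarrow> q < t')"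
    unfolding Bex_def by (rule ballI)
  from bchoice[OF this] obtain q where "\<forall>t\<in>?B. q t \<in> \<rat> \<and> t < q t \<and> (\<forall>t'\<in>?B. t < t' \<longrightarrow> q t < t')" ..
  then have q: "\<And>t. t \<in> ?B \<Longrightarrow> q t \<in> \<rat> \<and> t < q t \<and> (\<forall>t'\<in>?B. t < t' \<longrightarrow> q t < t')" by (rule bspec)
  have "inj_on q ?B"
  proof (rule inj_onI)
    fix s t assume st: "s \<in> ?B" "t \<in> ?B" "q s = q t"
    show "s = t"
    proof (rule ccontr)
      assume "s \<noteq> t"
      then consider "s < t" | "t < s" by linarith
      then show False
      proof cases
        case 1
        then have "q s < t" "t < q t" using q[OF st(1)] q[OF st(2)] st(2) by blast+
        then show False using st(3) by simp
      next
        case 2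
        then have "q t < s" "s < q s" using q[OF st(1)] q[OF st(2)] st(1) by blast+
        then show False using st(3) by simp
      qed
    qed
  qed
  moreover have "countable (q ` ?B)" by (rule countable_subset[OF _ countable_rat]) (use q in blast)
  ultimately show ?thesis by (rule countable_image_inj_on[rotated])
qed

section \<open>First passage of a path over a level\<close>

definition first_passage :: "(real \<Rightarrow> real) \<Rightarrow> real \<Rightarrow> real" where
  "first_passage f y = Inf {t. 0 \<le> t \<and> f t > y}"

locale crossing_path =
  fixes f :: "real \<Rightarrow> real" and y :: real
  assumes path: "sn_path f" and start: "f 0 \<le> y" and crosses: "\<exists>t\<ge>0. f t > y"
begin

abbreviation "\<tau> \<equiv> first_passage f y"

lemma bdd: "bdd_below {t. 0 \<le> t \<and> f t > y}"
  by (rule bdd_belowI[of _ 0]) auto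

lemma tau_nonneg: "0 \<le> \<tau>"
  unfolding first_passage_def by (rule cInf_greatest) (use crosses in auto)

lemma below_tau: "0 \<le> s \<Longrightarrow> s < \<tau> \<Longrightarrow> f s \<le> y"
  using cInf_lower[OF _ bdd, of s] unfolding first_passage_def by force

text \<open>Without positive jumps, a value above y at the passage time would persist to the left of
  it and contradict the infimum.\<close>

lemma at_tau: "f \<tau> \<le> y"
proof (rule ccontr)
  assume "\<not> f \<tau> \<le> y"
  then have gt: "f \<tau> > y" by simp
  then have "\<tau> \<noteq> 0" using start by auto
  then have pos: "\<tau> > 0" using tau_nonneg by simp
  obtain e where e: "e > 0" "\<And>x. \<tau> - e < x \<Longrightarrow> x \<le> \<tau> \<Longrightarrow> f x > y" using sn_path_left_gt[OF path pos gt] by blast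
  define x where "x = max (\<tau> / 2) (\<tau> - e / 2)"
  have "0 \<le> x" "x < \<tau>" "\<tau> - e < x" using pos e(1) by (auto simp: x_def)
  then show False using e(2)[of x] below_tau[of x] by auto
qed

lemma le_tau: "0 \<le> s \<Longrightarrow> s \<le> \<tau> \<Longrightarrow> f s \<le> y"
  using below_tau at_tau by (cases "s = \<tau>") auto

lemma crosses_after_tau: 
  assumes "e > 0" 
  obtains u where "\<tau> < u" "u < \<tau> + e" "f u > y"
proof -
  have "\<exists>u\<in>{t. 0 \<le> t \<and> f t > y}. u < \<tau> + e"
    using cInf_lessD[of "{t. 0 \<le> t \<and> f t > y}" "\<tau> + e"] crosses assms unfolding first_passage_def by auto
  then obtain u where u: "0 \<le> u" "f u > y" "u < \<tau> + e" by blast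
  then have "\<tau> < u" using le_tau[of u] by force
  then show ?thesis using that u by blast
qed

text \<open>The level is crossed continuously: a value below y would persist to the right, although
  the path exceeds y at times arbitrarily close after \<tau>.\<close>

lemma tau_value: "f \<tau> = y"
proof (rule antisym[OF at_tau], rule ccontr)
  assume "\<not> y \<le> f \<tau>"
  then obtain e where e: "e > 0" "\<And>x. \<tau> \<le> x \<Longrightarrow> x < \<tau> + e \<Longrightarrow> f x < y"
    using sn_path_right_less[OF path tau_nonneg, of y] by auto
  obtain u where "\<tau> < u" "u < \<tau> + e" "f u > y" using crosses_after_tau[OF e(1)] .
  then show False using e(2)[of u] by auto
qed

lemma run_sup_gt_iff: "t \<ge> 0 \<Longrightarrow> run_sup f 0 t > y \<longleftrightarrow> \<tau> < t"
proof
  assume t: "t \<ge> 0" "\<tau> < t"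
  obtain u where "\<tau> < u" "u < \<tau> + (t - \<tau>)" "f u > y" using crosses_after_tau[of "t - \<tau>"] t by auto
  then show "run_sup f 0 t > y" using run_sup_upper[OF path, of 0 u t] tau_nonneg by auto
next
  assume t: "t \<ge> 0" "run_sup f 0 t > y"
  obtain u where "0 \<le> u" "u \<le> t" "f u > y" using run_sup_gtE[OF path _ t] by auto
  then show "\<tau> < t" using le_tau[of u] by (meson leD leI order.strict_trans1)
qed

text \<open>The first passage as seen on the dyadic grid. It is meaningful only if some grid point
  lies above the level, which by \<open>ex_grid\<close> holds for all large n.\<close>

definition grid_passage :: "nat \<Rightarrow> nat" where
  "grid_passage n = (LEAST k. f (real k / 2 ^ n) > y)"

lemma ex_grid: "e > 0 \<Longrightarrow> \<forall>\<^sub>F n in sequentially. \<exists>k. f (real k / 2 ^ n) > y \<and> \<tau> < real k / 2 ^ n \<and> real k / 2 ^ n < \<tau> + e"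
proof -
  assume e: "e > 0"
  obtain u where u: "\<tau> < u" "u < \<tau> + e" "f u > y" using crosses_after_tau[OF e] .
  obtain v w where vw: "\<tau> \<le> v" "v < w" "w \<le> \<tau> + e" "\<And>x. v < x \<Longrightarrow> x < w \<Longrightarrow> f x > y"
    using sn_path_gt_interval[OF path tau_nonneg, of "\<tau> + e" u y] u e by auto
  have "\<forall>\<^sub>F n in sequentially. dyadic_above n v < w"
    using dyadic_above_tendsto vw(2) by (rule order_tendstoD)
  then show ?thesis
  proof (rule eventually_mono)
    fix n assume *: "dyadic_above n v < w"
    have "f (dyadic_above n v) > y \<and> \<tau> < dyadic_above n v \<and> dyadic_above n v < \<tau> + e"
      using vw * dyadic_above_gt[of v n] by auto
    then show "\<exists>k. f (real k / 2 ^ n) > y \<and> \<tau> < real k / 2 ^ n \<and> real k / 2 ^ n < \<tau> + e"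
      using dyadic_above_nat[of v n] vw(1) tau_nonneg by (metis order.trans)
  qed
qed

lemma grid_passage_crosses: "\<forall>\<^sub>F n in sequentially. f (real (grid_passage n) / 2 ^ n) > y \<and> \<tau> < real (grid_passage n) / 2 ^ n"
  using ex_grid[of 1, simplified]
proof (rule eventually_mono)
  fix n assume "\<exists>k. f (real k / 2 ^ n) > y \<and> \<tau> < real k / 2 ^ n \<and> real k / 2 ^ n < \<tau> + 1"
  then have "f (real (grid_passage n) / 2 ^ n) > y" unfolding grid_passage_def by (metis (mono_tags, lifting) LeastI_ex)
  moreover from this have "\<tau> < real (grid_passage n) / 2 ^ n" using le_tau[of "real (grid_passage n) / 2 ^ n"] by force
  ultimately show "f (real (grid_passage n) / 2 ^ n) > y \<and> \<tau> < real (grid_passage n) / 2 ^ n" by simp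
qed

lemma grid_passage_tendsto: "(\<lambda>n. real (grid_passage n) / 2 ^ n) \<longlonglongrightarrow> \<tau>"
proof (rule tendstoI)
  fix e :: real assume e: "e > 0"
  show "\<forall>\<^sub>F n in sequentially. dist (real (grid_passage n) / 2 ^ n) \<tau> < e"
    using ex_grid[OF e] grid_passage_crosses
  proof eventually_elim
    case (elim n)
    then obtain k where k: "f (real k / 2 ^ n) > y" "real k / 2 ^ n < \<tau> + e" by auto
    have "grid_passage n \<le> k" unfolding grid_passage_def by (rule Least_le) (fact k(1))
    then have "real (grid_passage n) / 2 ^ n \<le> real k / 2 ^ n" by (simp add: divide_right_mono)
    then show ?case using k elim by (auto simp: dist_real_def)
  qed
qed

lemma grid_passage_at_right: "filterlim (\<lambda>n. real (grid_passage n) / 2 ^ n) (at_right \<tau>) sequentially"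
  unfolding filterlim_at using grid_passage_tendsto grid_passage_crosses by (auto elim: eventually_mono)

lemma f_grid_passage_tendsto: "(\<lambda>n. f (real (grid_passage n) / 2 ^ n)) \<longlonglongrightarrow> y"
  using filterlim_compose[OF sn_path_right_cont[OF path tau_nonneg] grid_passage_at_right] by (simp add: tau_value)

text \<open>Any value exceeding both a and y is taken strictly after \<tau>, hence after the grid
  passage once n is large; so dropping the path before the grid passage costs nothing in the
  limit.\<close>

lemma run_sup_after_passage:
  assumes t: "\<tau> < t"
  shows "(\<lambda>n. run_sup f (real (grid_passage n) / 2 ^ n) t) \<longlonglongrightarrow> run_sup f 0 t"
proof (rule order_tendstoI)
  have ev: "\<forall>\<^sub>F n in sequentially. real (grid_passage n) / 2 ^ n < u" if "\<tau> < u" for u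
    using grid_passage_tendsto that by (rule order_tendstoD)
  { fix a assume "run_sup f 0 t < a"
    then show "\<forall>\<^sub>F n in sequentially. run_sup f (real (grid_passage n) / 2 ^ n) t < a"
      using ev[OF t]
    proof (elim eventually_mono)
      fix n assume *: "run_sup f 0 t < a" "real (grid_passage n) / 2 ^ n < t"
      have "run_sup f (real (grid_passage n) / 2 ^ n) t \<le> run_sup f 0 t"
        by (rule run_sup_mono[OF path]) (use * in auto)
      then show "run_sup f (real (grid_passage n) / 2 ^ n) t < a" using * by simp
    qed }
  fix a assume a: "a < run_sup f 0 t"
  have "max a y < run_sup f 0 t" using a run_sup_gt_iff[of t] t tau_nonneg by auto
  then obtain u where u: "0 \<le> u" "u \<le> t" "f u > max a y" using run_sup_gtE[OF path order_refl, of t] t tau_nonneg by (metis less_imp_le order_trans)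
  then have "\<tau> < u" using le_tau[of u] by force
  from ev[OF this] show "\<forall>\<^sub>F n in sequentially. a < run_sup f (real (grid_passage n) / 2 ^ n) t"
  proof (rule eventually_mono)
    fix n assume "real (grid_passage n) / 2 ^ n < u"
    then have "f u \<le> run_sup f (real (grid_passage n) / 2 ^ n) t" using u by (intro run_sup_upper[OF path]) auto
    then show "a < run_sup f (real (grid_passage n) / 2 ^ n) t" using u by auto
  qed
qed

end

section \<open>The Markov property on path space\<close>

text \<open>The condition \<open>g 0 = 0\<close> makes the pasted path right-continuous at t; every
  other one-sided limit is taken inside one of the two pieces.\<close>

lemma sn_path_concat:
  assumes f: "sn_path f" and g: "sn_path g" and g0: "g 0 = 0" and t: "t \<ge> 0"
  shows "sn_path (\<lambda>s. if s \<le> t then f s else f t + g (s - t))" (is "sn_path ?h")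
proof -
  have after: "\<forall>\<^sub>F x in at_left s. f t + g (x - t) = ?h x" if "s > t" for s
    using that by (auto simp: eventually_at_left_field intro!: exI[of _ t])
  have before: "\<forall>\<^sub>F x in at_left s. f x = ?h x" if "s \<le> t" for s
    using that by (auto simp: eventually_at_left_field intro!: exI[of _ "s - 1"])
  have right: "(?h \<longlongrightarrow> ?h s) (at_right s)" if s: "s \<ge> 0" for s
  proof (cases "s < t")
    case True
    have "\<forall>\<^sub>F x in at_right s. f x = ?h x"
      using True by (auto simp: eventually_at_right_field intro!: exI[of _ t])
    from Lim_transform_eventually[OF sn_path_right_cont[OF f s] this]
    have "(?h \<longlongrightarrow> f s) (at_right s)" .
    then show ?thesis using True by simp
  next
    case False
    have "filterlim (\<lambda>x. x - t) (at_right (s - t)) (at_right s)"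
      by (simp add: filterlim_def filtermap_at_right_shift)
    then have "((\<lambda>x. f t + g (x - t)) \<longlongrightarrow> f t + g (s - t)) (at_right s)"
      by (intro tendsto_intros filterlim_compose[OF sn_path_right_cont[OF g]]) (use False in auto)
    moreover have "\<forall>\<^sub>F x in at_right s. f t + g (x - t) = ?h x"
      using False by (auto simp: eventually_at_right_field intro!: exI[of _ "s + 1"])
    ultimately have "(?h \<longlongrightarrow> f t + g (s - t)) (at_right s)" by (rule Lim_transform_eventually)
    then show ?thesis using False g0 by (cases "s = t") auto
  qed
  have left: "\<exists>l. (?h \<longlongrightarrow> l) (at_left s) \<and> ?h s \<le> l" if s: "s > 0" for s
  proof (cases "s \<le> t")
    case True
    obtain l where l: "(f \<longlongrightarrow> l) (at_left s)" "f s \<le> l" using sn_path_left_limit[OF f s] .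
    from Lim_transform_eventually[OF l(1) before[OF True]] show ?thesis using True l(2) by auto
  next
    case False
    then obtain l where l: "(g \<longlongrightarrow> l) (at_left (s - t))" "g (s - t) \<le> l" using sn_path_left_limit[OF g, of "s - t"] by auto
    have "filterlim (\<lambda>x. x - t) (at_left (s - t)) (at_left s)"
      by (simp add: filterlim_def filtermap_at_left_shift)
    then have "((\<lambda>x. f t + g (x - t)) \<longlongrightarrow> f t + l) (at_left s)"
      by (intro tendsto_intros filterlim_compose[OF l(1)])
    from Lim_transform_eventually[OF this after] have "(?h \<longlongrightarrow> f t + l) (at_left s)" using False by simp
    then show ?thesis using False l(2) by (intro exI[of _ "f t + l"]) auto
  qed
  show ?thesis unfolding sn_path_def cadlag_path_def
  proof (intro conjI allI impI)
    fix s :: real assume "0 \<le> s" then show "continuous (at_right s) ?h" using right by (simp add: continuous_within)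
  next
    fix s :: real assume "0 < s" then show "\<exists>l. (?h \<longlongrightarrow> l) (at_left s)" using left by blast
  next
    fix s l :: real assume "0 < s" and l: "(?h \<longlongrightarrow> l) (at_left s)"
    then obtain l' where l': "(?h \<longlongrightarrow> l') (at_left s)" "?h s \<le> l'" using left by blast
    then show "?h s \<le> l" using tendsto_unique[OF _ l l'(1)] by simp
  qed
qed

abbreviation path_space :: "(real \<Rightarrow> real) measure" where
  "path_space \<equiv> Pi\<^sub>M {0..} (\<lambda>_. borel)"

text \<open>Right-continuous paths are recovered from their values at countably many times, which makes
  evaluation jointly measurable on the product space.\<close>

definition path_eval :: "(real \<Rightarrow> real) \<Rightarrow> real \<Rightarrow> real" where
  "path_eval w s = lim (\<lambda>n. w (dyadic_above n (max 0 s)))"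

definition path_sup :: "(real \<Rightarrow> real) \<Rightarrow> real \<Rightarrow> real \<Rightarrow> real" where
  "path_sup w s t = lim (\<lambda>n. Max ((\<lambda>j. path_eval w (s + real j * (t - s) / 2 ^ n)) ` {..2 ^ n :: nat}))"

lemma path_eval_measurable [measurable (raw)]:
  assumes [measurable]: "f \<in> measurable N path_space" "g \<in> borel_measurable N"
  shows "(\<lambda>x. path_eval (f x) (g x)) \<in> borel_measurable N"
proof -
  have "(\<lambda>x. f x (dyadic_above n (max 0 (g x)))) \<in> borel_measurable N" for n
  proof -
    \<comment> \<open>The evaluation time has countably many possible values on the grid. The
      truncation \<open>max 0 i\<close> keeps the coordinate inside the index set for every integer
      i.\<close>
    have "(\<lambda>x. (\<lambda>i x. f x ((of_int (max 0 i) + 1) / 2 ^ n)) \<lfloor>2 ^ n * max 0 (g x)\<rfloor> x) \<in> borel_measurable N"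
    proof (rule measurable_compose_countable[where f="\<lambda>i x. f x ((of_int (max 0 i) + 1) / 2 ^ n)"
          and g="\<lambda>x. \<lfloor>2 ^ n * max 0 (g x)\<rfloor>"])
      fix i :: int
      have "(\<lambda>w. w ((of_int (max 0 i) + 1) / 2 ^ n)) \<in> borel_measurable path_space"
        by (rule measurable_component_singleton) auto
      then show "(\<lambda>x. f x ((of_int (max 0 i) + 1) / 2 ^ n)) \<in> borel_measurable N"
        by (rule measurable_compose[OF assms(1)])
    qed measurable
    moreover have "(of_int (max 0 \<lfloor>2 ^ n * max 0 (g x)\<rfloor>) + 1) / 2 ^ n = dyadic_above n (max 0 (g x))" for x
      by (simp add: dyadic_above_def)
    ultimately show ?thesis by simp
  qed
  then show ?thesis unfolding path_eval_def by (rule borel_measurable_lim_metric)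
qed

lemma path_sup_measurable [measurable (raw)]:
  assumes [measurable]: "f \<in> measurable N path_space" "g \<in> borel_measurable N" "h \<in> borel_measurable N"
  shows "(\<lambda>x. path_sup (f x) (g x) (h x)) \<in> borel_measurable N"
  unfolding path_sup_def by measurable

lemma path_eval_eq:
  assumes f: "sn_path f" and s: "s \<ge> 0"
  shows "path_eval (restrict f {0..}) s = f s"
proof -
  have "(\<lambda>n. f (dyadic_above n s)) \<longlonglongrightarrow> f s"
    by (rule filterlim_compose[OF sn_path_right_cont[OF f s] dyadic_above_at_right])
  moreover have "restrict f {0..} (dyadic_above n (max 0 s)) = f (dyadic_above n s)" for n
    using s dyadic_above_gt[of s n] by simp
  ultimately show ?thesis unfolding path_eval_def by (simp add: limI)
qed

lemma path_sup_eq: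
  assumes f: "sn_path f" and s: "0 \<le> s" "s \<le> t"
  shows "path_sup (restrict f {0..}) s t = run_sup f s t"
proof -
  have "path_eval (restrict f {0..}) (s + real j * (t - s) / 2 ^ n) = f (s + real j * (t - s) / 2 ^ n)" for j n
    using s by (intro path_eval_eq[OF f]) auto
  then show ?thesis unfolding path_sup_def using grid_max_tendsto[OF f s] by (simp add: limI)
qed

lemma vimage_box:
  "(\<lambda>x. \<lambda>i\<in>{..<n::nat}. f i x) -` Pi\<^sub>E {..<n} B \<inter> S = {x\<in>S. \<forall>i<n. f i x \<in> B i}"
proof (rule set_eqI)
  fix x
  have "(\<lambda>i\<in>{..<n}. f i x) \<in> Pi\<^sub>E {..<n} B \<longleftrightarrow> (\<forall>i<n. f i x \<in> B i)"
    unfolding PiE_iff by (metis lessThan_iff restrict_apply' restrict_extensional)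
  then show "x \<in> (\<lambda>x. \<lambda>i\<in>{..<n::nat}. f i x) -` Pi\<^sub>E {..<n} B \<inter> S \<longleftrightarrow> x \<in> {x\<in>S. \<forall>i<n. f i x \<in> B i}"
    unfolding Int_iff vimage_eq mem_Collect_eq by blast
qed

section \<open>The simple Markov property as an identity of laws\<close>

locale sn_levy = prob_space M for M :: "'a measure" +
  fixes X :: "real \<Rightarrow> 'a \<Rightarrow> real"
  assumes sn: "spectrally_negative_levy M X"
begin

lemma X_measurable [measurable]: "X t \<in> borel_measurable M"
  using sn by (auto simp: spectrally_negative_levy_def levy_process_def)

lemma X_0 [simp]: "\<omega> \<in> space M \<Longrightarrow> X 0 \<omega> = 0"
  using sn by (auto simp: spectrally_negative_levy_def levy_process_def)

lemma sn_path_X: "\<omega> \<in> space M \<Longrightarrow> sn_path (\<lambda>t. X t \<omega>)"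
  using sn by (auto simp: spectrally_negative_levy_def levy_process_def sn_path_def)

lemma increments_distr: "0 \<le> s \<Longrightarrow> s \<le> t \<Longrightarrow> distr M borel (\<lambda>\<omega>. X t \<omega> - X s \<omega>) = distr M borel (X (t - s))"
  using sn by (auto simp: spectrally_negative_levy_def levy_process_def)

lemma increments_prob:
  fixes ts :: "nat \<Rightarrow> real"
  assumes ts: "0 \<le> ts 0" "\<And>i. i < n \<Longrightarrow> ts i \<le> ts (Suc i)" and A [measurable]: "\<And>i. A i \<in> sets borel"
  shows "emeasure M {\<omega>\<in>space M. \<forall>i<n. X (ts (Suc i)) \<omega> - X (ts i) \<omega> \<in> A i}
    = (\<Prod>i<n. emeasure M {\<omega>\<in>space M. X (ts (Suc i) - ts i) \<omega> \<in> A i})"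
proof (cases "n = 0")
  case True
  then show ?thesis by (simp add: emeasure_space_1)
next
  case False
  have ts0: "0 \<le> ts i" if "i \<le> n" for i using that
    by (induction i) (use ts in \<open>auto intro: order_trans\<close>)
  have "indep_vars (\<lambda>_. borel) (\<lambda>i \<omega>. X (ts (Suc i)) \<omega> - X (ts i) \<omega>) {..<n}"
    using sn ts by (auto simp: spectrally_negative_levy_def levy_process_def)
  from indep_varsD_finite[OF this _ _ A]
  have "prob (\<Inter>i<n. (\<lambda>\<omega>. X (ts (Suc i)) \<omega> - X (ts i) \<omega>) -` A i \<inter> space M)
      = (\<Prod>i<n. prob ((\<lambda>\<omega>. X (ts (Suc i)) \<omega> - X (ts i) \<omega>) -` A i \<inter> space M))"
    using False by auto
  also have "(\<Inter>i<n. (\<lambda>\<omega>. X (ts (Suc i)) \<omega> - X (ts i) \<omega>) -` A i \<inter> space M)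
      = {\<omega>\<in>space M. \<forall>i<n. X (ts (Suc i)) \<omega> - X (ts i) \<omega> \<in> A i}"
    using False by auto
  also have "(\<Prod>i<n. prob ((\<lambda>\<omega>. X (ts (Suc i)) \<omega> - X (ts i) \<omega>) -` A i \<inter> space M))
      = (\<Prod>i<n. prob {\<omega>\<in>space M. X (ts (Suc i) - ts i) \<omega> \<in> A i})"
  proof (rule prod.cong[OF refl])
    fix i assume "i \<in> {..<n}"
    then have "measure (distr M borel (\<lambda>\<omega>. X (ts (Suc i)) \<omega> - X (ts i) \<omega>)) (A i)
        = measure (distr M borel (X (ts (Suc i) - ts i))) (A i)"
      using increments_distr[of "ts i" "ts (Suc i)"] ts ts0 by simp
    then show "prob ((\<lambda>\<omega>. X (ts (Suc i)) \<omega> - X (ts i) \<omega>) -` A i \<inter> space M) = prob {\<omega>\<in>space M. X (ts (Suc i) - ts i) \<omega> \<in> A i}"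
      by (simp add: measure_distr vimage_def Int_def conj_commute)
  qed
  finally show ?thesis by (simp add: emeasure_eq_measure prod_ennreal)
qed

text \<open>The path of one copy of X up to t, continued by the increments of an independent copy.
  The Markov property at t is stated as equality of its law with that of X.\<close>

definition restart :: "real \<Rightarrow> 'a \<times> 'a \<Rightarrow> real \<Rightarrow> real" where
  "restart t z s = (if s \<le> t then X s (fst z) else X t (fst z) + X (s - t) (snd z))"

lemma restart_measurable [measurable]: "(\<lambda>z. restart t z s) \<in> borel_measurable (M \<Otimes>\<^sub>M M)"
  unfolding restart_def by measurable

lemma sn_path_restart: "\<omega> \<in> space M \<Longrightarrow> \<omega>' \<in> space M \<Longrightarrow> t \<ge> 0 \<Longrightarrow> sn_path (restart t (\<omega>, \<omega>'))"
  unfolding restart_def[abs_def] fst_conv snd_conv by (rule sn_path_concat) (auto intro: sn_path_X)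

lemma restart_after: "\<omega> \<in> space M \<Longrightarrow> \<omega>' \<in> space M \<Longrightarrow> s \<ge> 0 \<Longrightarrow> restart t (\<omega>, \<omega>') (t + s) = X t \<omega> + X s \<omega>'"
  by (auto simp: restart_def)

lemma restart_before: "s \<le> t \<Longrightarrow> restart t (\<omega>, \<omega>') s = X s \<omega>"
  by (simp add: restart_def)

sublocale MM: pair_prob_space M M ..

text \<open>Since t is one of the division points, every increment belongs to just one of the two
  copies, and the event is a product set.\<close>

lemma restart_increments_prob:
  fixes ts :: "nat \<Rightarrow> real"
  assumes ts0: "ts 0 = 0" and mono: "\<And>i. i < n \<Longrightarrow> ts i \<le> ts (Suc i)" and m: "m \<le> n" "ts m = t"
    and A [measurable]: "\<And>i. A i \<in> sets borel"
  shows "emeasure (M \<Otimes>\<^sub>M M) {z\<in>space (M \<Otimes>\<^sub>M M). \<forall>i<n. restart t z (ts (Suc i)) - restart t z (ts i) \<in> A i}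
    = (\<Prod>i<n. emeasure M {\<omega>\<in>space M. X (ts (Suc i) - ts i) \<omega> \<in> A i})"
proof -
  have le: "ts i \<le> ts j" if "i \<le> j" "j \<le> n" for i j
    using that by (induction j) (use mono in \<open>auto simp: le_Suc_eq intro: order_trans\<close>)
  define us where "us i = ts (m + i) - t" for i
  have us0: "us 0 = 0" by (simp add: us_def m)
  have us: "us i \<le> us (Suc i)" if "i < n - m" for i using mono[of "m + i"] that by (simp add: us_def)
  have eq: "{z\<in>space (M \<Otimes>\<^sub>M M). \<forall>i<n. restart t z (ts (Suc i)) - restart t z (ts i) \<in> A i}
      = {\<omega>\<in>space M. \<forall>i<m. X (ts (Suc i)) \<omega> - X (ts i) \<omega> \<in> A i} \<times>
        {\<omega>\<in>space M. \<forall>i<n-m. X (us (Suc i)) \<omega> - X (us i) \<omega> \<in> A (m + i)}" (is "?L = ?C \<times> ?D")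
  proof -
    have 1: "restart t (\<omega>, \<omega>') (ts (Suc i)) - restart t (\<omega>, \<omega>') (ts i) = X (ts (Suc i)) \<omega> - X (ts i) \<omega>" if "i < m" for i \<omega> \<omega>'
      using le[of "Suc i" m] le[of i m] that m by (simp add: restart_before)
    have 2: "restart t (\<omega>, \<omega>') (ts (Suc (m + i))) - restart t (\<omega>, \<omega>') (ts (m + i)) = X (us (Suc i)) \<omega>' - X (us i) \<omega>'"
      if "i < n - m" "\<omega> \<in> space M" "\<omega>' \<in> space M" for i \<omega> \<omega>'
    proof -
      have r: "restart t (\<omega>, \<omega>') (ts (m + i)) = X t \<omega> + X (us i) \<omega>'" if "i \<le> n - m" for i
        using restart_after[OF \<open>\<omega> \<in> space M\<close> \<open>\<omega>' \<in> space M\<close>, of "us i" t] le[of m "m + i"] that m by (simp add: us_def)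
      show ?thesis using r[of i] r[of "Suc i"] that by simp
    qed
    have split: "(\<forall>i<n. P i) \<longleftrightarrow> (\<forall>i<m. P i) \<and> (\<forall>i<n-m. P (m + i))" for P
    proof (intro iffI conjI allI impI)
      fix i assume *: "(\<forall>i<m. P i) \<and> (\<forall>i<n-m. P (m + i))" "i < n"
      then show "P i" using conjunct2[OF *(1), rule_format, of "i - m"] by (cases "i < m") auto
    qed (use m(1) in auto)
    show ?thesis unfolding split[of "\<lambda>i. restart t _ (ts (Suc i)) - restart t _ (ts i) \<in> A i"]
      by (auto simp: space_pair_measure 1 2)
  qed
  have "emeasure (M \<Otimes>\<^sub>M M) (?C \<times> ?D) = emeasure M ?C * emeasure M ?D"
    by (rule emeasure_pair_measure_Times) auto
  also have "emeasure M ?C = (\<Prod>i<m. emeasure M {\<omega>\<in>space M. X (ts (Suc i) - ts i) \<omega> \<in> A i})"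
    by (rule increments_prob) (use ts0 mono m in auto)
  also have "emeasure M ?D = (\<Prod>i<n-m. emeasure M {\<omega>\<in>space M. X (us (Suc i) - us i) \<omega> \<in> A (m + i)})"
    by (rule increments_prob) (use us0 us in auto)
  also have "\<dots> = (\<Prod>i=m..<n. emeasure M {\<omega>\<in>space M. X (ts (Suc i) - ts i) \<omega> \<in> A i})"
    by (rule prod.reindex_bij_witness[where i="\<lambda>i. i - m" and j="\<lambda>i. m + i"]) (auto simp: us_def)
  also have "(\<Prod>i<m. emeasure M {\<omega>\<in>space M. X (ts (Suc i) - ts i) \<omega> \<in> A i}) * \<dots> = (\<Prod>i<n. emeasure M {\<omega>\<in>space M. X (ts (Suc i) - ts i) \<omega> \<in> A i})"
    using m(1) by (simp add: lessThan_atLeast0 prod.atLeastLessThan_concat)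
  finally show ?thesis unfolding eq .
qed

abbreviation path :: "'a \<Rightarrow> real \<Rightarrow> real" where
  "path \<omega> \<equiv> restrict (\<lambda>s. X s \<omega>) {0..}"

lemma path_measurable [measurable]: "path \<in> measurable M path_space"
  by measurable

lemma restart_path_measurable [measurable]: "(\<lambda>z. restrict (restart t z) {0..}) \<in> measurable (M \<Otimes>\<^sub>M M) path_space"
  by measurable

lemma increments_distr_eq:
  fixes ts :: "nat \<Rightarrow> real"
  assumes ts0: "ts 0 = 0" and mono: "\<And>i. i < n \<Longrightarrow> ts i \<le> ts (Suc i)" and m: "m \<le> n" "ts m = t"
  shows "distr M (Pi\<^sub>M {..<n} (\<lambda>_. borel)) (\<lambda>\<omega>. \<lambda>i\<in>{..<n}. X (ts (Suc i)) \<omega> - X (ts i) \<omega>)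
    = distr (M \<Otimes>\<^sub>M M) (Pi\<^sub>M {..<n} (\<lambda>_. borel)) (\<lambda>z. \<lambda>i\<in>{..<n}. restart t z (ts (Suc i)) - restart t z (ts i))"
    (is "?P = ?Q")
proof (rule measure_eqI_PiM_finite[where I="{..<n}" and M="\<lambda>_. borel :: real measure" and A="\<lambda>_. Pi\<^sub>E {..<n} (\<lambda>_. UNIV)"])
  fix A :: "nat \<Rightarrow> real set" assume A: "\<And>i. i \<in> {..<n} \<Longrightarrow> A i \<in> sets borel"
  define B where "B i = (if i < n then A i else {})" for i
  have B [measurable]: "B i \<in> sets borel" for i using A by (simp add: B_def)
  have box: "Pi\<^sub>E {..<n} B \<in> sets (Pi\<^sub>M {..<n} (\<lambda>_. borel))" by (rule sets_PiM_I_finite) auto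
  have m1: "(\<lambda>\<omega>. \<lambda>i\<in>{..<n}. X (ts (Suc i)) \<omega> - X (ts i) \<omega>) \<in> measurable M (Pi\<^sub>M {..<n} (\<lambda>_. borel))" by measurable
  have m2: "(\<lambda>z. \<lambda>i\<in>{..<n}. restart t z (ts (Suc i)) - restart t z (ts i)) \<in> measurable (M \<Otimes>\<^sub>M M) (Pi\<^sub>M {..<n} (\<lambda>_. borel))" by measurable
  have AB: "Pi\<^sub>E {..<n} A = Pi\<^sub>E {..<n} B" by (rule PiE_cong) (simp add: B_def)
  have "?P (Pi\<^sub>E {..<n} B) = emeasure M {\<omega>\<in>space M. \<forall>i<n. X (ts (Suc i)) \<omega> - X (ts i) \<omega> \<in> B i}"
    unfolding emeasure_distr[OF m1 box] vimage_box ..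
  also have "\<dots> = emeasure (M \<Otimes>\<^sub>M M) {z\<in>space (M \<Otimes>\<^sub>M M). \<forall>i<n. restart t z (ts (Suc i)) - restart t z (ts i) \<in> B i}"
    using increments_prob[of ts n B] restart_increments_prob[of ts n m t B] assms by simp
  also have "\<dots> = ?Q (Pi\<^sub>E {..<n} B)"
    unfolding emeasure_distr[OF m2 box] vimage_box ..
  finally show "?P (Pi\<^sub>E {..<n} A) = ?Q (Pi\<^sub>E {..<n} A)" unfolding AB .
next
  interpret P: prob_space ?P by (rule prob_space_distr) measurable
  show "?P (Pi\<^sub>E {..<n} (\<lambda>_. UNIV)) \<noteq> \<infinity>" by (simp add: P.emeasure_eq_measure)
qed (auto simp: space_PiM intro!: prod_algebraI_finite)

text \<open>Laws on the product space are determined by cylinders. The times of a cylinder are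
  enlarged by 0 and t and listed in order; its coordinates are then partial sums of increments,
  whose joint laws agree.\<close>

theorem restart_distr:
  assumes t: "t \<ge> 0"
  shows "distr M path_space path = distr (M \<Otimes>\<^sub>M M) path_space (\<lambda>z. restrict (restart t z) {0..})" (is "?P = ?Q")
proof (rule measure_eqI_PiM_infinite[where I="{0..}" and M="\<lambda>_. borel"])
  interpret P: prob_space ?P by (rule prob_space_distr) measurable
  show "finite_measure ?P" by (rule P.finite_measure_axioms)
next
  fix A :: "real \<Rightarrow> real set" and J :: "real set"
  assume J: "finite J" "J \<subseteq> {0..}" and A: "\<And>i. i \<in> J \<Longrightarrow> A i \<in> sets borel"
  define L where "L = sorted_list_of_set (insert 0 (insert t J))"
  define n where "n = length L - 1"
  define ts where "ts i = L ! i" for i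
  have setL: "set L = insert 0 (insert t J)" unfolding L_def by (rule set_sorted_list_of_set) (use J in simp)
  have len: "length L = Suc n" unfolding n_def using setL by (cases L) auto
  have sorted: "sorted L" by (simp add: L_def)
  have mono: "ts i \<le> ts (Suc i)" if "i < n" for i
    using sorted_nth_mono[OF sorted, of i "Suc i"] that len by (simp add: ts_def)
  have ts_in: "\<exists>i\<le>n. ts i = s" if "s \<in> set L" for s
    using that len unfolding ts_def in_set_conv_nth by (metis less_Suc_eq_le)
  have ts0: "ts 0 = 0"
  proof -
    obtain i where "i \<le> n" "ts i = 0" using ts_in[of 0] setL by auto
    then have "ts 0 \<le> 0" using sorted_nth_mono[OF sorted, of 0 i] len by (simp add: ts_def)
    moreover have "ts 0 \<in> set L" unfolding ts_def using len by simp
    ultimately show ?thesis using setL J t by auto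
  qed
  obtain m where m: "m \<le> n" "ts m = t" using ts_in[of t] setL by auto
  obtain idx where idx: "\<And>s. s \<in> J \<Longrightarrow> idx s \<le> n \<and> ts (idx s) = s" using ts_in setL by (metis insertCI)
  define E where "E = {v \<in> space (Pi\<^sub>M {..<n} (\<lambda>_. borel :: real measure)). \<forall>s\<in>J. (\<Sum>i<idx s. v i) \<in> A s}"
  have m1: "(\<lambda>\<omega>. \<lambda>i\<in>{..<n}. X (ts (Suc i)) \<omega> - X (ts i) \<omega>) \<in> measurable M (Pi\<^sub>M {..<n} (\<lambda>_. borel))" by measurable
  have m2: "(\<lambda>z. \<lambda>i\<in>{..<n}. restart t z (ts (Suc i)) - restart t z (ts i)) \<in> measurable (M \<Otimes>\<^sub>M M) (Pi\<^sub>M {..<n} (\<lambda>_. borel))" by measurable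
  have Em: "E \<in> sets (Pi\<^sub>M {..<n} (\<lambda>_. borel))"
    unfolding E_def
  proof (rule sets.sets_Collect_finite_All[OF _ J(1)])
    fix s assume s: "s \<in> J"
    have [measurable]: "A s \<in> sets borel" using A s by auto
    have "(\<lambda>v. \<Sum>i<idx s. v i) \<in> borel_measurable (Pi\<^sub>M {..<n} (\<lambda>_. borel :: real measure))"
      by (rule borel_measurable_sum) (use idx[OF s] in auto)
    then show "{v \<in> space (Pi\<^sub>M {..<n} (\<lambda>_. borel :: real measure)). (\<Sum>i<idx s. v i) \<in> A s} \<in> sets (Pi\<^sub>M {..<n} (\<lambda>_. borel))"
      by measurable
  qed
  have cyl [measurable]: "prod_emb {0..} (\<lambda>_. borel) J (Pi\<^sub>E J A) \<in> sets path_space"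
    by (rule sets_PiM_I) (use J A in auto)
  have sum1: "(\<Sum>i<idx s. (\<lambda>i\<in>{..<n}. f (ts (Suc i)) - f (ts i)) i) = f s" if "s \<in> J" "f 0 = 0" for s and f :: "real \<Rightarrow> real"
  proof -
    have "(\<Sum>i<idx s. (\<lambda>i\<in>{..<n}. f (ts (Suc i)) - f (ts i)) i) = (\<Sum>i<idx s. f (ts (Suc i)) - f (ts i))"
      by (rule sum.cong) (use idx[OF that(1)] in auto)
    also have "\<dots> = f (ts (idx s)) - f (ts 0)" by (rule sum_lessThan_telescope[of "\<lambda>i. f (ts i)"])
    finally show ?thesis using idx[OF that(1)] ts0 that(2) by simp
  qed
  have "?P (prod_emb {0..} (\<lambda>_. borel) J (Pi\<^sub>E J A)) =
      distr M (Pi\<^sub>M {..<n} (\<lambda>_. borel)) (\<lambda>\<omega>. \<lambda>i\<in>{..<n}. X (ts (Suc i)) \<omega> - X (ts i) \<omega>) E"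
    unfolding emeasure_distr[OF path_measurable cyl] emeasure_distr[OF m1 Em]
  proof (rule arg_cong[where f="emeasure M"])
    have "(\<lambda>i\<in>{..<n}. X (ts (Suc i)) \<omega> - X (ts i) \<omega>) \<in> E \<longleftrightarrow> (\<forall>s\<in>J. X s \<omega> \<in> A s)" if "\<omega> \<in> space M" for \<omega>
      using sum1[of _ "\<lambda>s. X s \<omega>"] that by (simp add: E_def space_PiM)
    moreover have "path \<omega> \<in> prod_emb {0..} (\<lambda>_. borel) J (Pi\<^sub>E J A) \<longleftrightarrow> (\<forall>s\<in>J. X s \<omega> \<in> A s)" for \<omega>
      using J by (auto simp: prod_emb_def PiE_iff space_PiM subset_eq)
    ultimately show "path -` prod_emb {0..} (\<lambda>_. borel) J (Pi\<^sub>E J A) \<inter> space M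
        = (\<lambda>\<omega>. \<lambda>i\<in>{..<n}. X (ts (Suc i)) \<omega> - X (ts i) \<omega>) -` E \<inter> space M" by blast
  qed
  also have "\<dots> = distr (M \<Otimes>\<^sub>M M) (Pi\<^sub>M {..<n} (\<lambda>_. borel)) (\<lambda>z. \<lambda>i\<in>{..<n}. restart t z (ts (Suc i)) - restart t z (ts i)) E"
    using increments_distr_eq[OF ts0 mono m] by simp
  also have "\<dots> = ?Q (prod_emb {0..} (\<lambda>_. borel) J (Pi\<^sub>E J A))"
  proof -
    have r0: "restart t z 0 = 0" if "z \<in> space (M \<Otimes>\<^sub>M M)" for z
      using that t by (auto simp: restart_def space_pair_measure)
    have "(\<lambda>i\<in>{..<n}. restart t z (ts (Suc i)) - restart t z (ts i)) \<in> E \<longleftrightarrow> (\<forall>s\<in>J. restart t z s \<in> A s)"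
      if "z \<in> space (M \<Otimes>\<^sub>M M)" for z
      using sum1[of _ "restart t z"] r0[OF that] by (simp add: E_def space_PiM)
    moreover have "restrict (restart t z) {0..} \<in> prod_emb {0..} (\<lambda>_. borel) J (Pi\<^sub>E J A) \<longleftrightarrow> (\<forall>s\<in>J. restart t z s \<in> A s)" for z
      using J by (auto simp: prod_emb_def PiE_iff space_PiM subset_eq)
    ultimately show ?thesis unfolding emeasure_distr[OF restart_path_measurable cyl] emeasure_distr[OF m2 Em]
      by (intro arg_cong[where f="emeasure (M \<Otimes>\<^sub>M M)"]) blast
  qed
  finally show "?P (prod_emb {0..} (\<lambda>_. borel) J (Pi\<^sub>E J A)) = ?Q (prod_emb {0..} (\<lambda>_. borel) J (Pi\<^sub>E J A))" .
qed auto

lemma markov_nn: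
  assumes [measurable]: "F \<in> borel_measurable path_space" and t: "t \<ge> 0"
  shows "(\<integral>\<^sup>+\<omega>. F (path \<omega>) \<partial>M) = (\<integral>\<^sup>+\<omega>. \<integral>\<^sup>+\<omega>'. F (restrict (restart t (\<omega>, \<omega>')) {0..}) \<partial>M \<partial>M)"
proof -
  have "(\<integral>\<^sup>+\<omega>. F (path \<omega>) \<partial>M) = (\<integral>\<^sup>+w. F w \<partial>distr M path_space path)"
    by (simp add: nn_integral_distr)
  also have "\<dots> = (\<integral>\<^sup>+z. F (restrict (restart t z) {0..}) \<partial>(M \<Otimes>\<^sub>M M))"
    unfolding restart_distr[OF t] by (simp add: nn_integral_distr)
  also have "\<dots> = (\<integral>\<^sup>+\<omega>. \<integral>\<^sup>+\<omega>'. F (restrict (restart t (\<omega>, \<omega>')) {0..}) \<partial>M \<partial>M)"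
    by (rule nn_integral_fst[symmetric]) measurable
  finally show ?thesis .
qed

lemma markov:
  fixes F :: "(real \<Rightarrow> real) \<Rightarrow> real"
  assumes [measurable]: "F \<in> borel_measurable path_space" and B: "\<And>w. w \<in> space path_space \<Longrightarrow> \<bar>F w\<bar> \<le> B" and t: "t \<ge> 0"
  shows "(\<integral>\<omega>. F (path \<omega>) \<partial>M) = (\<integral>\<omega>. \<integral>\<omega>'. F (restrict (restart t (\<omega>, \<omega>')) {0..}) \<partial>M \<partial>M)"
proof -
  have "(\<integral>\<omega>. F (path \<omega>) \<partial>M) = (\<integral>w. F w \<partial>distr M path_space path)"
    by (simp add: integral_distr)
  also have "\<dots> = (\<integral>z. F (restrict (restart t z) {0..}) \<partial>(M \<Otimes>\<^sub>M M))"
    unfolding restart_distr[OF t] by (simp add: integral_distr)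
  also have "\<dots> = (\<integral>\<omega>. \<integral>\<omega>'. F (restrict (restart t (\<omega>, \<omega>')) {0..}) \<partial>M \<partial>M)"
    by (rule MM.integral_fst'[symmetric], rule MM.P.integrable_const_bound[where B=B]) (use B measurable_space[OF restart_path_measurable] in auto)
  finally show ?thesis .
qed

end

section \<open>The supremum at an independent exponential time\<close>

lemma exponential_density_nonneg': "p > 0 \<Longrightarrow> 0 \<le> exponential_density p t"
  by (simp add: exponential_density_def)

lemma integrable_exponential_density: "p > 0 \<Longrightarrow> integrable lborel (exponential_density p)"
  and integral_exponential_density: "p > 0 \<Longrightarrow> (\<integral>t. exponential_density p t \<partial>lborel) = 1"
proof -
  assume p: "p > 0"
  interpret prob_space "density lborel (exponential_density p)" by (rule prob_space_exponential_density[OF p])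
  have "(\<integral>\<^sup>+t. ennreal (exponential_density p t) \<partial>lborel) = 1"
    using emeasure_space_1 by (simp add: emeasure_density)
  then have "has_bochner_integral lborel (exponential_density p) 1"
    by (intro has_bochner_integral_nn_integral) (auto simp: exponential_density_nonneg'[OF p])
  then show "integrable lborel (exponential_density p)" "(\<integral>t. exponential_density p t \<partial>lborel) = 1"
    by (auto simp: has_bochner_integral_iff)
qed

lemma integral_exp_after:
  fixes p T :: real
  assumes p: "p > 0"
  shows "(\<integral>t. (if T < t then p * exp (- p * t) else 0) \<partial>lborel) = exp (- p * T)"
proof -
  have "(\<integral>t. (if T < t then p * exp (- p * t) else 0) \<partial>lborel) = (\<integral>t. (if T \<le> t then p * exp (- p * t) else 0) \<partial>lborel)"
    by (rule integral_cong_AE) (use AE_lborel_singleton[of T] in auto)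
  also have "\<dots> = (\<integral>u. (if T \<le> T + 1 * u then p * exp (- p * (T + 1 * u)) else 0) \<partial>lborel)"
    by (subst lborel_integral_real_affine[where c=1 and t=T]) auto
  also have "\<dots> = (\<integral>u. exp (- p * T) * exponential_density p u \<partial>lborel)"
    by (rule Bochner_Integration.integral_cong) (auto simp: exponential_density_def exp_add[symmetric] algebra_simps)
  finally show ?thesis by (simp add: integral_exponential_density[OF p])
qed

context sn_levy
begin

text \<open>Time is truncated at 0 so that X, its supremum and the gap between them are functions of
  all real times; the exponential density ignores the negative ones.\<close>

definition XX :: "real \<Rightarrow> 'a \<Rightarrow> real" where "XX t \<omega> = X (max 0 t) \<omega>"
definition SS :: "real \<Rightarrow> 'a \<Rightarrow> real" where "SS t \<omega> = run_sup (\<lambda>s. X s \<omega>) 0 (max 0 t)"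
definition DD :: "real \<Rightarrow> 'a \<Rightarrow> real" where "DD t \<omega> = SS t \<omega> - XX t \<omega>"

lemma XX_measurable [measurable (raw)]:
  assumes [measurable]: "g \<in> borel_measurable N" "h \<in> measurable N M"
  shows "(\<lambda>x. XX (g x) (h x)) \<in> borel_measurable N"
proof -
  have [measurable]: "(\<lambda>x. path (h x)) \<in> measurable N path_space"
    by (rule measurable_compose[OF assms(2) path_measurable])
  have "XX (g x) (h x) = path_eval (path (h x)) (max 0 (g x))" if "x \<in> space N" for x
    using path_eval_eq[OF sn_path_X[OF measurable_space[OF assms(2) that]], of "max 0 (g x)"] by (simp add: XX_def)
  then show ?thesis by (subst measurable_cong[where g="\<lambda>x. path_eval (path (h x)) (max 0 (g x))"]) simp_all
qed

lemma SS_measurable [measurable (raw)]: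
  assumes [measurable]: "g \<in> borel_measurable N" "h \<in> measurable N M"
  shows "(\<lambda>x. SS (g x) (h x)) \<in> borel_measurable N"
proof -
  have [measurable]: "(\<lambda>x. path (h x)) \<in> measurable N path_space"
    by (rule measurable_compose[OF assms(2) path_measurable])
  have "SS (g x) (h x) = path_sup (path (h x)) 0 (max 0 (g x))" if "x \<in> space N" for x
    using path_sup_eq[OF sn_path_X[OF measurable_space[OF assms(2) that]], of 0 "max 0 (g x)"] by (simp add: SS_def)
  then show ?thesis by (subst measurable_cong[where g="\<lambda>x. path_sup (path (h x)) 0 (max 0 (g x))"]) simp_all
qed

lemma DD_measurable [measurable (raw)]:
  assumes [measurable]: "g \<in> borel_measurable N" "h \<in> measurable N M"
  shows "(\<lambda>x. DD (g x) (h x)) \<in> borel_measurable N"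
  unfolding DD_def by measurable

lemma SS_nonneg: "\<omega> \<in> space M \<Longrightarrow> 0 \<le> SS t \<omega>"
  using run_sup_upper[OF sn_path_X, of \<omega> 0 0 "max 0 t"] by (simp add: SS_def)

lemma DD_nonneg: "\<omega> \<in> space M \<Longrightarrow> 0 \<le> DD t \<omega>"
  using run_sup_upper[OF sn_path_X, of \<omega> 0 "max 0 t" "max 0 t"] by (simp add: DD_def SS_def XX_def)

lemma XX_eq: "XX t \<omega> = SS t \<omega> - DD t \<omega>"
  by (simp add: DD_def)

text \<open>A point of this product space is an exponential time of rate p together with an
  independent sample point.\<close>

definition exp_time :: "real \<Rightarrow> (real \<times> 'a) measure" where
  "exp_time p = density lborel (\<lambda>t. ennreal (exponential_density p t)) \<Otimes>\<^sub>M M"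

lemma sets_exp_time [measurable_cong]: "sets (exp_time p) = sets (borel \<Otimes>\<^sub>M M)"
  unfolding exp_time_def by (rule sets_pair_measure_cong) auto

lemma space_exp_time: "space (exp_time p) = UNIV \<times> space M"
  unfolding exp_time_def by (simp add: space_pair_measure)

lemma prob_space_exp_time: "p > 0 \<Longrightarrow> prob_space (exp_time p)"
  unfolding exp_time_def
  by (intro prob_space_pair prob_space_exponential_density) (auto intro: prob_space_axioms)

lemma exp_time_integral:
  fixes f :: "real \<times> 'a \<Rightarrow> real"
  assumes p: "p > 0" and [measurable]: "f \<in> borel_measurable (borel \<Otimes>\<^sub>M M)"
    and B: "\<And>z. z \<in> space (exp_time p) \<Longrightarrow> \<bar>f z\<bar> \<le> B"
  shows "integrable (exp_time p) f"
    and "(\<integral>z. f z \<partial>exp_time p) = (\<integral>\<omega>. (\<integral>t. exponential_density p t * f (t, \<omega>) \<partial>lborel) \<partial>M)"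
    and "(\<integral>z. f z \<partial>exp_time p) = (\<integral>t. exponential_density p t * (\<integral>\<omega>. f (t, \<omega>) \<partial>M) \<partial>lborel)"
proof -
  let ?E = "density lborel (\<lambda>t. ennreal (exponential_density p t))"
  interpret E: prob_space ?E by (rule prob_space_exponential_density[OF p])
  interpret EM: pair_prob_space ?E M ..
  interpret N: prob_space "exp_time p" by (rule prob_space_exp_time[OF p])
  show int: "integrable (exp_time p) f"
    by (rule N.integrable_const_bound[where B=B]) (use B in auto)
  then have int': "integrable (?E \<Otimes>\<^sub>M M) (case_prod (\<lambda>t \<omega>. f (t, \<omega>)))" by (simp add: exp_time_def)
  have "(\<integral>z. f z \<partial>exp_time p) = (\<integral>\<omega>. (\<integral>t. f (t, \<omega>) \<partial>?E) \<partial>M)"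
    using EM.integral_snd[OF int'] by (simp add: exp_time_def)
  also have "\<dots> = (\<integral>\<omega>. (\<integral>t. exponential_density p t * f (t, \<omega>) \<partial>lborel) \<partial>M)"
    by (rule Bochner_Integration.integral_cong[OF refl], subst integral_real_density)
       (auto simp: exponential_density_nonneg'[OF p])
  finally show "(\<integral>z. f z \<partial>exp_time p) = (\<integral>\<omega>. (\<integral>t. exponential_density p t * f (t, \<omega>) \<partial>lborel) \<partial>M)" .
  have "(\<integral>z. f z \<partial>exp_time p) = (\<integral>t. (\<integral>\<omega>. f (t, \<omega>) \<partial>M) \<partial>?E)"
    using EM.integral_fst'[OF int'] by (simp add: exp_time_def)
  also have "\<dots> = (\<integral>t. exponential_density p t * (\<integral>\<omega>. f (t, \<omega>) \<partial>M) \<partial>lborel)"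
    by (subst integral_real_density) (auto simp: exponential_density_nonneg'[OF p])
  finally show "(\<integral>z. f z \<partial>exp_time p) = (\<integral>t. exponential_density p t * (\<integral>\<omega>. f (t, \<omega>) \<partial>M) \<partial>lborel)" .
qed

lemma exp_time_nn_integral:
  assumes p: "p > 0" and [measurable]: "f \<in> borel_measurable (borel \<Otimes>\<^sub>M M)"
  shows "(\<integral>\<^sup>+z. f z \<partial>exp_time p) = (\<integral>\<^sup>+t. ennreal (exponential_density p t) * (\<integral>\<^sup>+\<omega>. f (t, \<omega>) \<partial>M) \<partial>lborel)"
proof -
  let ?E = "density lborel (\<lambda>t. ennreal (exponential_density p t))"
  have "(\<integral>\<^sup>+z. f z \<partial>exp_time p) = (\<integral>\<^sup>+t. (\<integral>\<^sup>+\<omega>. f (t, \<omega>) \<partial>M) \<partial>?E)"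
    unfolding exp_time_def by (rule nn_integral_fst[symmetric]) measurable
  also have "\<dots> = (\<integral>\<^sup>+t. ennreal (exponential_density p t) * (\<integral>\<^sup>+\<omega>. f (t, \<omega>) \<partial>M) \<partial>lborel)"
    by (rule nn_integral_density) auto
  finally show ?thesis .
qed

end

section \<open>The strong Markov property at the first passage\<close>

lemma sum_first_index:
  fixes g :: "nat \<Rightarrow> real"
  assumes "\<And>k. Q k \<longleftrightarrow> P k \<and> (\<forall>j<k. \<not> P j)" and "\<exists>k. P k"
  shows "(\<Sum>k\<le>K. (if Q k then g k else 0)) = (if (LEAST k. P k) \<le> K then g (LEAST k. P k) else 0)"
proof -
  have "Q k \<longleftrightarrow> k = (LEAST k. P k)" for k
    using assms by (metis LeastI_ex Least_le not_less_Least linorder_neqE_nat not_less)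
  then show ?thesis by simp
qed

text \<open>\<theta> is a test function of the pair (S, D). Continuity lets grid approximations pass
  to the limit inside it, and vanishing for s <= 0 removes the paths that never exceed y.\<close>

locale strong_markov = sn_levy M X for M :: "'a measure" and X +
  fixes p y B :: real and \<theta> :: "real \<Rightarrow> real \<Rightarrow> real"
  assumes p: "p > 0" and y: "y \<ge> 0" and cont: "continuous_on UNIV (\<lambda>(s, d). \<theta> s d)"
    and bound: "\<And>s d. \<bar>\<theta> s d\<bar> \<le> B" and zero: "\<And>s d. s \<le> 0 \<Longrightarrow> \<theta> s d = 0"
begin

lemma \<theta>_measurable [measurable (raw)]:
  assumes "g \<in> borel_measurable N" "h \<in> borel_measurable N"
  shows "(\<lambda>x. \<theta> (g x) (h x)) \<in> borel_measurable N"
proof -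
  have "(\<lambda>(s, d). \<theta> s d) \<in> borel_measurable borel" using cont by (rule borel_measurable_continuous_onI)
  from measurable_compose[OF _ this, of "\<lambda>x. (g x, h x)" N] show ?thesis using assms by simp
qed

lemma \<theta>_tendsto: "f \<longlonglongrightarrow> a \<Longrightarrow> g \<longlonglongrightarrow> b \<Longrightarrow> (\<lambda>n. \<theta> (f n) (g n)) \<longlonglongrightarrow> \<theta> a b"
  using continuous_on_tendsto_compose[OF cont, of "\<lambda>n. (f n, g n)" "(a, b)"] by (auto intro: tendsto_Pair)

text \<open>The expectation for a process restarted with excess r over the level; at the true
  passage time the excess is 0.\<close>

definition \<Theta> :: "real \<Rightarrow> real" where
  "\<Theta> r = (\<integral>z. \<theta> (r + SS (fst z) (snd z)) (DD (fst z) (snd z)) \<partial>exp_time p)"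

lemma B_nonneg: "0 \<le> B" using bound[of 0 0] by simp

lemma \<Theta>_tendsto: "f \<longlonglongrightarrow> r \<Longrightarrow> (\<lambda>n. \<Theta> (f n)) \<longlonglongrightarrow> \<Theta> r"
  unfolding \<Theta>_def
proof (rule integral_dominated_convergence[where w="\<lambda>_. B"])
  interpret N: prob_space "exp_time p" by (rule prob_space_exp_time[OF p])
  show "integrable (exp_time p) (\<lambda>_. B)" by simp
  assume "f \<longlonglongrightarrow> r"
  then show "AE z in exp_time p. (\<lambda>n. \<theta> (f n + SS (fst z) (snd z)) (DD (fst z) (snd z))) \<longlonglongrightarrow> \<theta> (r + SS (fst z) (snd z)) (DD (fst z) (snd z))"
    by (intro AE_I2 \<theta>_tendsto tendsto_intros)
qed (use bound in auto)

lemma \<Theta>_bound: "\<bar>\<Theta> r\<bar> \<le> B"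
proof -
  interpret N: prob_space "exp_time p" by (rule prob_space_exp_time[OF p])
  have int: "integrable (exp_time p) (\<lambda>z. \<theta> (r + SS (fst z) (snd z)) (DD (fst z) (snd z)))"
    by (rule exp_time_integral(1)[OF p, where B=B]) (use bound in auto)
  have "\<Theta> r \<le> B" unfolding \<Theta>_def
    by (rule N.integral_le_const[OF int]) (use bound in \<open>auto simp: abs_le_iff\<close>)
  moreover have "- B \<le> \<Theta> r" unfolding \<Theta>_def
    by (rule N.integral_ge_const[OF int]) (use bound in \<open>auto simp: abs_le_iff minus_le_iff\<close>)
  ultimately show ?thesis by simp
qed

lemma \<Theta>_measurable [measurable]: "\<Theta> \<in> borel_measurable borel"
  by (rule borel_measurable_continuous_onI) (simp add: continuous_on_sequentially \<Theta>_tendsto comp_def)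

definition first_at :: "(real \<Rightarrow> real) \<Rightarrow> nat \<Rightarrow> nat \<Rightarrow> bool" where
  "first_at f n k \<longleftrightarrow> f (real k / 2 ^ n) > y \<and> (\<forall>j<k. \<not> f (real j / 2 ^ n) > y)"

text \<open>Lack of memory: beyond T the residual exponential time u is again exponential, and the
  supremum is read over \<open>{T..T + u}\<close> only.\<close>

definition post :: "(real \<Rightarrow> real) \<Rightarrow> real \<Rightarrow> real" where
  "post w T = (\<integral>u. exponential_density p u * \<theta> (path_sup w T (T + u) - y) (path_sup w T (T + u) - path_eval w (T + u)) \<partial>lborel)"

text \<open>Contribution of the event that the grid passage happens at time k / 2^n; the factor exp
  (- p k / 2^n) is the probability that the exponential time is later than that.\<close>

definition F :: "nat \<Rightarrow> nat \<Rightarrow> (real \<Rightarrow> real) \<Rightarrow> real" where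
  "F n k w = (if first_at (path_eval w) n k then exp (- p * (real k / 2 ^ n)) * post w (real k / 2 ^ n) else 0)"

lemma exp_dens_bound: "\<bar>exponential_density p u * \<theta> a b\<bar> \<le> exponential_density p u * B"
  using bound[of a b] exponential_density_nonneg'[OF p, of u] by (simp add: abs_mult mult_left_mono)

lemma integral_dens_bound:
  assumes [measurable]: "a \<in> borel_measurable borel" "b \<in> borel_measurable borel"
  shows "\<bar>\<integral>u. exponential_density p u * \<theta> (a u) (b u) \<partial>lborel\<bar> \<le> B"
proof -
  have "\<bar>\<integral>u. exponential_density p u * \<theta> (a u) (b u) \<partial>lborel\<bar> \<le> (\<integral>u. exponential_density p u * B \<partial>lborel)"
    unfolding real_norm_def[symmetric]
  proof (rule Bochner_Integration.integral_norm_bound_integral)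
    show i: "integrable lborel (\<lambda>u. exponential_density p u * B)" by (simp add: integrable_exponential_density[OF p])
    show "integrable lborel (\<lambda>u. exponential_density p u * \<theta> (a u) (b u))"
      by (rule Bochner_Integration.integrable_bound[OF i]) (use exp_dens_bound in \<open>auto intro!: AE_I2 order_trans[OF exp_dens_bound]\<close>)
  qed (use exp_dens_bound in auto)
  then show ?thesis by (simp add: integral_exponential_density[OF p])
qed

lemma F_measurable [measurable]: "F n k \<in> borel_measurable path_space"
  unfolding F_def[abs_def] first_at_def post_def by measurable

lemma F_bound: 
  assumes "w \<in> space path_space"
  shows "\<bar>F n k w\<bar> \<le> B"
proof -
  have [measurable]: "(\<lambda>_. w) \<in> measurable borel path_space" using assms by simp
  have "\<bar>post w T\<bar> \<le> B" for T unfolding post_def by (rule integral_dens_bound) measurable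
  then have "exp (- p * (real k / 2 ^ n)) * \<bar>post w (real k / 2 ^ n)\<bar> \<le> 1 * B"
    using p by (intro mult_mono) auto
  then show ?thesis using B_nonneg by (simp add: F_def abs_mult)
qed

text \<open>Whether the grid passage happens at T is decided by the path up to T, while
  \<open>post\<close> at T depends on the later path only through X at T and the later increments,
  so the Markov property at the fixed time T suffices.\<close>

lemma restart_expectation:
  assumes k: "T = real k / 2 ^ n"
  shows "(\<integral>\<omega>. F n k (path \<omega>) \<partial>M) = (\<integral>\<omega>. (if first_at (\<lambda>s. X s \<omega>) n k then exp (- p * T) * \<Theta> (X T \<omega> - y) else 0) \<partial>M)"
proof -
  have T: "T \<ge> 0" by (simp add: k)
  have *: "(\<integral>\<omega>'. F n k (restrict (restart T (\<omega>, \<omega>')) {0..}) \<partial>M)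
      = (if first_at (\<lambda>s. X s \<omega>) n k then exp (- p * T) * \<Theta> (X T \<omega> - y) else 0)" if \<omega>: "\<omega> \<in> space M" for \<omega>
  proof -
    have F: "F n k (restrict (restart T (\<omega>, \<omega>')) {0..}) = (if first_at (\<lambda>s. X s \<omega>) n k then exp (- p * T) *
        (\<integral>u. exponential_density p u * \<theta> (X T \<omega> - y + SS u \<omega>') (DD u \<omega>') \<partial>lborel) else 0)" if \<omega>': "\<omega>' \<in> space M" for \<omega>'
    proof -
      let ?w = "restrict (restart T (\<omega>, \<omega>')) {0..}"
      have sn: "sn_path (restart T (\<omega>, \<omega>'))" by (rule sn_path_restart[OF \<omega> \<omega>' T])
      have "path_eval ?w (real j / 2 ^ n) = X (real j / 2 ^ n) \<omega>" if "j \<le> k" for j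
      proof -
        have "real j / 2 ^ n \<le> T" using that by (simp add: k divide_right_mono)
        then show ?thesis using path_eval_eq[OF sn, of "real j / 2 ^ n"] by (simp add: restart_before)
      qed
      then have "first_at (path_eval ?w) n k = first_at (\<lambda>s. X s \<omega>) n k" by (simp add: first_at_def)
      moreover have "post ?w T = (\<integral>u. exponential_density p u * \<theta> (X T \<omega> - y + SS u \<omega>') (DD u \<omega>') \<partial>lborel)"
        unfolding post_def
      proof (rule Bochner_Integration.integral_cong[OF refl])
        fix u
        show "exponential_density p u * \<theta> (path_sup ?w T (T + u) - y) (path_sup ?w T (T + u) - path_eval ?w (T + u)) =
          exponential_density p u * \<theta> (X T \<omega> - y + SS u \<omega>') (DD u \<omega>')"
        proof (cases "u \<ge> 0")
          case True
          have "path_eval ?w (T + u) = X T \<omega> + X u \<omega>'"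
            using path_eval_eq[OF sn, of "T + u"] restart_after[OF \<omega> \<omega>' True, of T] T True by simp
          moreover have "path_sup ?w T (T + u) = X T \<omega> + run_sup (\<lambda>s. X s \<omega>') 0 u"
          proof -
            have "path_sup ?w T (T + u) = run_sup (restart T (\<omega>, \<omega>')) T (T + u)"
              by (rule path_sup_eq[OF sn]) (use T True in auto)
            also have "\<dots> = X T \<omega> + run_sup (\<lambda>s. X s \<omega>') 0 u"
            proof (rule antisym)
              show "run_sup (restart T (\<omega>, \<omega>')) T (T + u) \<le> X T \<omega> + run_sup (\<lambda>s. X s \<omega>') 0 u"
              proof (rule run_sup_least)
                fix v assume "T \<le> v" "v \<le> T + u"
                then show "restart T (\<omega>, \<omega>') v \<le> X T \<omega> + run_sup (\<lambda>s. X s \<omega>') 0 u"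
                  using restart_after[OF \<omega> \<omega>', of "v - T" T] run_sup_upper[OF sn_path_X[OF \<omega>'], of 0 "v - T" u] by simp
              qed (use True in simp)
              have "run_sup (\<lambda>s. X s \<omega>') 0 u \<le> run_sup (restart T (\<omega>, \<omega>')) T (T + u) - X T \<omega>"
              proof (rule run_sup_least[OF True])
                fix v assume v: "0 \<le> v" "v \<le> u"
                have "restart T (\<omega>, \<omega>') (T + v) \<le> run_sup (restart T (\<omega>, \<omega>')) T (T + u)"
                  by (rule run_sup_upper[OF sn]) (use T v in auto)
                then show "X v \<omega>' \<le> run_sup (restart T (\<omega>, \<omega>')) T (T + u) - X T \<omega>"
                  using restart_after[OF \<omega> \<omega>' v(1), of T] by simp
              qed
              then show "X T \<omega> + run_sup (\<lambda>s. X s \<omega>') 0 u \<le> run_sup (restart T (\<omega>, \<omega>')) T (T + u)" by simp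
            qed
            finally show ?thesis .
          qed
          ultimately show ?thesis using True by (simp add: SS_def DD_def XX_def max_def algebra_simps)
        qed (simp add: exponential_density_def)
      qed
      ultimately show ?thesis by (simp add: F_def k)
    qed
    have "(\<integral>\<omega>'. F n k (restrict (restart T (\<omega>, \<omega>')) {0..}) \<partial>M) = (\<integral>\<omega>'. (if first_at (\<lambda>s. X s \<omega>) n k then exp (- p * T) *
        (\<integral>u. exponential_density p u * \<theta> (X T \<omega> - y + SS u \<omega>') (DD u \<omega>') \<partial>lborel) else 0) \<partial>M)"
      by (rule Bochner_Integration.integral_cong[OF refl F])
    also have "\<dots> = (if first_at (\<lambda>s. X s \<omega>) n k then exp (- p * T) *
        (\<integral>\<omega>'. (\<integral>u. exponential_density p u * \<theta> (X T \<omega> - y + SS u \<omega>') (DD u \<omega>') \<partial>lborel) \<partial>M) else 0)" by simp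
    also have "(\<integral>\<omega>'. (\<integral>u. exponential_density p u * \<theta> (X T \<omega> - y + SS u \<omega>') (DD u \<omega>') \<partial>lborel) \<partial>M) = \<Theta> (X T \<omega> - y)"
      unfolding \<Theta>_def by (subst exp_time_integral(2)[OF p, where B=B]) (use bound in auto)
    finally show ?thesis .
  qed
  have "(\<integral>\<omega>. F n k (path \<omega>) \<partial>M) = (\<integral>\<omega>. \<integral>\<omega>'. F n k (restrict (restart T (\<omega>, \<omega>')) {0..}) \<partial>M \<partial>M)"
    by (rule markov[where B=B]) (use F_bound T in auto)
  also have "\<dots> = (\<integral>\<omega>. (if first_at (\<lambda>s. X s \<omega>) n k then exp (- p * T) * \<Theta> (X T \<omega> - y) else 0) \<partial>M)"
    by (rule Bochner_Integration.integral_cong[OF refl *])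
  finally show ?thesis .
qed

lemma first_at_sum:
  assumes "\<exists>k. f (real k / 2 ^ n) > y"
  shows "(\<Sum>k\<le>K. (if first_at f n k then g k else 0 :: real)) =
    (if (LEAST k. f (real k / 2 ^ n) > y) \<le> K then g (LEAST k. f (real k / 2 ^ n) > y) else 0)"
  by (rule sum_first_index) (use assms in \<open>auto simp: first_at_def\<close>)

lemma first_at_sum_bound:
  assumes "\<And>k. \<bar>g k\<bar> \<le> C"
  shows "\<bar>\<Sum>k\<le>K. (if first_at f n k then g k else 0 :: real)\<bar> \<le> C"
proof (cases "\<exists>k. f (real k / 2 ^ n) > y")
  case True
  then show ?thesis using first_at_sum[OF True, of g K] assms order_trans[OF abs_ge_zero assms] by auto
next
  case False
  then show ?thesis using order_trans[OF abs_ge_zero assms] by (simp add: first_at_def)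
qed

lemma F_path: "\<omega> \<in> space M \<Longrightarrow> F n k (path \<omega>) = (if first_at (\<lambda>s. X s \<omega>) n k then exp (- p * (real k / 2 ^ n)) * post (path \<omega>) (real k / 2 ^ n) else 0)"
  using path_eval_eq[OF sn_path_X] by (simp add: F_def first_at_def)

lemma exp_post:
  assumes \<omega>: "\<omega> \<in> space M" and T: "T \<ge> 0"
  shows "exp (- p * T) * post (path \<omega>) T = (\<integral>t. (if T \<le> t then p * exp (- p * t) *
      \<theta> (run_sup (\<lambda>s. X s \<omega>) T t - y) (run_sup (\<lambda>s. X s \<omega>) T t - X t \<omega>) else 0) \<partial>lborel)" (is "_ = (\<integral>t. ?g t \<partial>lborel)")
proof -
  have "(\<integral>t. ?g t \<partial>lborel) = (\<integral>u. ?g (T + 1 * u) \<partial>lborel)"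
    by (subst lborel_integral_real_affine[where c=1 and t=T]) auto
  also have "\<dots> = (\<integral>u. exp (- p * T) * (exponential_density p u * \<theta> (path_sup (path \<omega>) T (T + u) - y) (path_sup (path \<omega>) T (T + u) - path_eval (path \<omega>) (T + u))) \<partial>lborel)"
  proof (rule Bochner_Integration.integral_cong[OF refl])
    fix u
    show "?g (T + 1 * u) = exp (- p * T) * (exponential_density p u * \<theta> (path_sup (path \<omega>) T (T + u) - y) (path_sup (path \<omega>) T (T + u) - path_eval (path \<omega>) (T + u)))"
    proof (cases "u \<ge> 0")
      case True
      have "path_sup (path \<omega>) T (T + u) = run_sup (\<lambda>s. X s \<omega>) T (T + u)"
        by (rule path_sup_eq[OF sn_path_X[OF \<omega>]]) (use T True in auto)
      moreover have "path_eval (path \<omega>) (T + u) = X (T + u) \<omega>"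
        by (rule path_eval_eq[OF sn_path_X[OF \<omega>]]) (use T True in auto)
      moreover have "exp (- (p * (T + u))) = exp (- (p * T)) * exp (- (u * p))"
        unfolding exp_add[symmetric] by (simp add: algebra_simps)
      ultimately show ?thesis using True by (simp add: exponential_density_def)
    qed (simp add: exponential_density_def)
  qed
  finally show ?thesis by (simp add: post_def)
qed

text \<open>At most one term of each sum is nonzero, the one at the grid passage. Its time tends to
  \<tau> from the right and the path there tends to y, so the excess inside \<open>\<Theta>\<close>
  disappears in the limit.\<close>

lemma path_limits:
  assumes \<omega>: "\<omega> \<in> space M"
  shows "(\<lambda>n. \<Sum>k\<le>n * 2 ^ n. F n k (path \<omega>)) \<longlonglongrightarrow> (\<integral>t. exponential_density p t * \<theta> (SS t \<omega> - y) (DD t \<omega>) \<partial>lborel)" (is ?L)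
    and "(\<lambda>n. \<Sum>k\<le>n * 2 ^ n. (if first_at (\<lambda>s. X s \<omega>) n k then exp (- p * (real k / 2 ^ n)) * \<Theta> (X (real k / 2 ^ n) \<omega> - y) else 0))
      \<longlonglongrightarrow> (\<integral>t. exponential_density p t * indicator {y<..} (SS t \<omega>) \<partial>lborel) * \<Theta> 0" (is ?R)
proof -
  let ?f = "\<lambda>s. X s \<omega>"
  have "?L \<and> ?R"
  proof (cases "\<exists>t\<ge>0. ?f t > y")
    case False
    then have no: "\<not> first_at ?f n k" for n k by (auto simp: first_at_def)
    have le: "SS t \<omega> \<le> y" for t
      unfolding SS_def by (rule run_sup_least) (use False in \<open>auto simp: not_less\<close>)
    show ?thesis using le by (simp add: F_path[OF \<omega>] no zero not_less[symmetric])
  next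
    case True
    interpret c: crossing_path ?f y
      by unfold_locales (use sn_path_X[OF \<omega>] \<omega> y True in auto)
    define T where "T n = real (c.grid_passage n) / 2 ^ n" for n
    \<comment> \<open>The sum stops at k = n * 2 ^ n, that is at time n, which eventually lies
      beyond the grid passage.\<close>
    have ev: "\<forall>\<^sub>F n in sequentially. (\<exists>k. ?f (real k / 2 ^ n) > y) \<and> c.grid_passage n \<le> n * 2 ^ n \<and> c.\<tau> < T n"
    proof -
      have "\<forall>\<^sub>F n in sequentially. T n < c.\<tau> + 1"
        using order_tendstoD(2)[OF c.grid_passage_tendsto, of "c.\<tau> + 1"] by (simp add: T_def)
      moreover have "\<forall>\<^sub>F n in sequentially. c.\<tau> + 1 \<le> real n"
        using eventually_ge_at_top[of "nat \<lceil>c.\<tau> + 1\<rceil>"] by eventually_elim linarith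
      moreover note c.grid_passage_crosses
      ultimately show ?thesis
      proof eventually_elim
        case (elim n)
        then have "real (c.grid_passage n) \<le> real n * 2 ^ n" by (simp add: T_def divide_less_eq) (smt (verit) mult_right_mono zero_le_power)
        then have "real (c.grid_passage n) \<le> real (n * 2 ^ n)" by simp
        then have "c.grid_passage n \<le> n * 2 ^ n" by (simp only: of_nat_le_iff)
        then show ?case using elim by (auto simp: T_def)
      qed
    qed
    have Tlim: "T \<longlonglongrightarrow> c.\<tau>" using c.grid_passage_tendsto by (simp add: T_def[abs_def])
    have T0: "T n \<ge> 0" for n by (simp add: T_def)
    have sumeq: "\<forall>\<^sub>F n in sequentially. g (T n) = (\<Sum>k\<le>n * 2 ^ n. (if first_at ?f n k then g (real k / 2 ^ n) else 0))" for g :: "real \<Rightarrow> real"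
      using ev by eventually_elim (simp add: first_at_sum c.grid_passage_def[symmetric] T_def)
    let ?h = "\<lambda>n t. if T n \<le> t then p * exp (- p * t) * \<theta> (run_sup ?f (T n) t - y) (run_sup ?f (T n) t - X t \<omega>) else 0"
    have SSt: "SS t \<omega> = run_sup ?f 0 t" if "t \<ge> 0" for t using that by (simp add: SS_def)
    \<comment> \<open>For t > \<tau> the supremum from the grid passage on tends to the full
      supremum; for t < \<tau> both sides vanish. Only the null set t = \<tau> is left out.\<close>
    have "(\<lambda>n. \<integral>t. ?h n t \<partial>lborel) \<longlonglongrightarrow> (\<integral>t. exponential_density p t * \<theta> (SS t \<omega> - y) (DD t \<omega>) \<partial>lborel)"
    proof (rule integral_dominated_convergence[where w="\<lambda>t. exponential_density p t * B"])
      show "integrable lborel (\<lambda>t. exponential_density p t * B)" by (simp add: integrable_exponential_density[OF p])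
      have [measurable]: "(\<lambda>_. path \<omega>) \<in> measurable borel path_space"
        using measurable_space[OF path_measurable \<omega>] by simp
      have "?h n = (\<lambda>t. if T n \<le> t then p * exp (- p * t) * \<theta> (path_sup (path \<omega>) (T n) t - y) (path_sup (path \<omega>) (T n) t - path_eval (path \<omega>) t) else 0)" for n
        using T0[of n] by (auto simp: fun_eq_iff path_sup_eq[OF sn_path_X[OF \<omega>]] path_eval_eq[OF sn_path_X[OF \<omega>]])
      then show "?h n \<in> borel_measurable lborel" for n by simp
      show "(\<lambda>t. exponential_density p t * \<theta> (SS t \<omega> - y) (DD t \<omega>)) \<in> borel_measurable lborel" using \<omega> by measurable
      show "AE t in lborel. norm (?h n t) \<le> exponential_density p t * B" for n
        using p bound T0[of n] B_nonneg
        by (intro AE_I2) (auto simp: exponential_density_def abs_mult mult.commute[of p] intro!: mult_mono)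
      have "(\<lambda>n. ?h n t) \<longlonglongrightarrow> exponential_density p t * \<theta> (SS t \<omega> - y) (DD t \<omega>)" if "t \<noteq> c.\<tau>" for t
      proof (cases "c.\<tau> < t")
        case True
        then have t0: "t \<ge> 0" using c.tau_nonneg by simp
        have "(\<lambda>n. p * exp (- p * t) * \<theta> (run_sup ?f (T n) t - y) (run_sup ?f (T n) t - X t \<omega>)) \<longlonglongrightarrow>
            p * exp (- p * t) * \<theta> (run_sup ?f 0 t - y) (run_sup ?f 0 t - X t \<omega>)"
          using c.run_sup_after_passage[OF True] by (intro tendsto_mult_left \<theta>_tendsto tendsto_diff) (auto simp: T_def)
        moreover have "\<forall>\<^sub>F n in sequentially. p * exp (- p * t) * \<theta> (run_sup ?f (T n) t - y) (run_sup ?f (T n) t - X t \<omega>) = ?h n t"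
          using order_tendstoD(2)[OF Tlim True] by eventually_elim simp
        ultimately have "(\<lambda>n. ?h n t) \<longlonglongrightarrow> p * exp (- p * t) * \<theta> (run_sup ?f 0 t - y) (run_sup ?f 0 t - X t \<omega>)"
          by (rule Lim_transform_eventually)
        then show ?thesis using t0 by (simp add: exponential_density_def SSt DD_def XX_def mult.commute)
      next
        case False
        then have less: "t < c.\<tau>" using that by simp
        have "\<forall>\<^sub>F n in sequentially. 0 = ?h n t" using ev by eventually_elim (use less in auto)
        then have "(\<lambda>n. ?h n t) \<longlonglongrightarrow> 0" by (rule Lim_transform_eventually[OF tendsto_const])
        moreover have "exponential_density p t * \<theta> (SS t \<omega> - y) (DD t \<omega>) = 0"
          using c.run_sup_gt_iff[of t] less by (cases "t \<ge> 0") (auto simp: SSt zero exponential_density_def)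
        ultimately show ?thesis by (simp only:)
      qed
      then show "AE t in lborel. (\<lambda>n. ?h n t) \<longlonglongrightarrow> exponential_density p t * \<theta> (SS t \<omega> - y) (DD t \<omega>)"
        using AE_lborel_singleton[of c.\<tau>] by (auto elim: eventually_mono)
    qed
    then have "(\<lambda>n. exp (- p * T n) * post (path \<omega>) (T n)) \<longlonglongrightarrow> (\<integral>t. exponential_density p t * \<theta> (SS t \<omega> - y) (DD t \<omega>) \<partial>lborel)"
      using exp_post[OF \<omega> T0] by simp
    from Lim_transform_eventually[OF this sumeq[of "\<lambda>t. exp (- p * t) * post (path \<omega>) t"]] have ?L by (simp add: F_path[OF \<omega>])
    have "(\<lambda>n. exp (- p * T n) * \<Theta> (X (T n) \<omega> - y)) \<longlonglongrightarrow> exp (- p * c.\<tau>) * \<Theta> (y - y)"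
      using c.f_grid_passage_tendsto by (intro tendsto_intros Tlim \<Theta>_tendsto) (simp add: T_def)
    moreover have "(\<integral>t. exponential_density p t * indicator {y<..} (SS t \<omega>) \<partial>lborel) = exp (- p * c.\<tau>)"
    proof -
      have "exponential_density p t * indicator {y<..} (SS t \<omega>) = (if c.\<tau> < t then p * exp (- p * t) else 0)" for t
        using c.run_sup_gt_iff[of t] c.tau_nonneg by (cases "t \<ge> 0") (auto simp: SSt exponential_density_def mult.commute)
      then show ?thesis using integral_exp_after[OF p] by simp
    qed
    ultimately have "(\<lambda>n. exp (- p * T n) * \<Theta> (X (T n) \<omega> - y)) \<longlonglongrightarrow> (\<integral>t. exponential_density p t * indicator {y<..} (SS t \<omega>) \<partial>lborel) * \<Theta> 0" by simp
    from Lim_transform_eventually[OF this sumeq[of "\<lambda>t. exp (- p * t) * \<Theta> (X t \<omega> - y)"]] have ?R .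
    then show ?thesis using \<open>?L\<close> by blast
  qed
  then show ?L ?R by auto
qed

text \<open>For each n the two sums have equal expectations term by term; dominated convergence
  passes to the limit, where exp (- p \<tau>) is the conditional probability, given the path, that S
  exceeds y.\<close>

theorem strong_markov:
  "(\<integral>z. \<theta> (SS (fst z) (snd z) - y) (DD (fst z) (snd z)) \<partial>exp_time p) =
    (\<integral>z. indicator {y<..} (SS (fst z) (snd z)) \<partial>exp_time p) * (\<integral>z. \<theta> (SS (fst z) (snd z)) (DD (fst z) (snd z)) \<partial>exp_time p)"
proof -
  let ?L = "\<lambda>n \<omega>. \<Sum>k\<le>n * 2 ^ n. F n k (path \<omega>)"
  let ?R = "\<lambda>n \<omega>. \<Sum>k\<le>n * 2 ^ n. (if first_at (\<lambda>s. X s \<omega>) n k then exp (- p * (real k / 2 ^ n)) * \<Theta> (X (real k / 2 ^ n) \<omega> - y) else 0)"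
  let ?l = "\<lambda>\<omega>. \<integral>t. exponential_density p t * \<theta> (SS t \<omega> - y) (DD t \<omega>) \<partial>lborel"
  let ?r = "\<lambda>\<omega>. (\<integral>t. exponential_density p t * indicator {y<..} (SS t \<omega>) \<partial>lborel) * \<Theta> 0"
  have Fm: "(\<lambda>\<omega>. F n k (path \<omega>)) \<in> borel_measurable M" for n k by measurable
  have Fb: "AE \<omega> in M. norm (F n k (path \<omega>)) \<le> B" for n k
    using measurable_space[OF path_measurable] F_bound by (intro AE_I2) auto
  have fm [measurable]: "Measurable.pred M (\<lambda>\<omega>. first_at (\<lambda>s. X s \<omega>) n k)" for n k unfolding first_at_def by measurable
  have Rb: "\<bar>exp (- p * (real k / 2 ^ n)) * \<Theta> (X (real k / 2 ^ n) \<omega> - y)\<bar> \<le> B" for n k \<omega>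
  proof -
    have "exp (- p * (real k / 2 ^ n)) * \<bar>\<Theta> (X (real k / 2 ^ n) \<omega> - y)\<bar> \<le> 1 * B"
      using p by (intro mult_mono \<Theta>_bound) auto
    then show ?thesis by (simp add: abs_mult)
  qed
  have "(\<integral>\<omega>. ?L n \<omega> \<partial>M) = (\<integral>\<omega>. ?R n \<omega> \<partial>M)" for n
  proof -
    have "(\<integral>\<omega>. ?L n \<omega> \<partial>M) = (\<Sum>k\<le>n * 2 ^ n. \<integral>\<omega>. F n k (path \<omega>) \<partial>M)"
      by (rule Bochner_Integration.integral_sum, rule integrable_const_bound[OF Fb Fm])
    also have "\<dots> = (\<Sum>k\<le>n * 2 ^ n. \<integral>\<omega>. (if first_at (\<lambda>s. X s \<omega>) n k then exp (- p * (real k / 2 ^ n)) * \<Theta> (X (real k / 2 ^ n) \<omega> - y) else 0) \<partial>M)"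
      by (intro sum.cong refl restart_expectation)
    also have "\<dots> = (\<integral>\<omega>. ?R n \<omega> \<partial>M)"
      by (rule Bochner_Integration.integral_sum[symmetric], rule integrable_const_bound[where B=B]) (use Rb B_nonneg in auto)
    finally show ?thesis .
  qed
  moreover have "(\<lambda>n. \<integral>\<omega>. ?L n \<omega> \<partial>M) \<longlonglongrightarrow> (\<integral>\<omega>. ?l \<omega> \<partial>M)"
  proof (rule integral_dominated_convergence[where w="\<lambda>_. B"])
    show "AE \<omega> in M. norm (?L n \<omega>) \<le> B" for n
    proof (rule AE_I2)
      fix \<omega> assume \<omega>: "\<omega> \<in> space M"
      have [measurable]: "(\<lambda>_. path \<omega>) \<in> measurable borel path_space"
        using measurable_space[OF path_measurable \<omega>] by simp
      have b: "\<bar>exp (- p * (real k / 2 ^ n)) * post (path \<omega>) (real k / 2 ^ n)\<bar> \<le> B" for k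
      proof -
        have "\<bar>post (path \<omega>) (real k / 2 ^ n)\<bar> \<le> B" unfolding post_def by (rule integral_dens_bound) measurable
        then have "exp (- p * (real k / 2 ^ n)) * \<bar>post (path \<omega>) (real k / 2 ^ n)\<bar> \<le> 1 * B"
          using p by (intro mult_mono) auto
        then show ?thesis by (simp add: abs_mult)
      qed
      show "norm (?L n \<omega>) \<le> B" unfolding F_path[OF \<omega>] real_norm_def by (rule first_at_sum_bound[OF b])
    qed
    show "AE \<omega> in M. (\<lambda>n. ?L n \<omega>) \<longlonglongrightarrow> ?l \<omega>" by (rule AE_I2) (rule path_limits(1))
  qed auto
  moreover have "(\<lambda>n. \<integral>\<omega>. ?R n \<omega> \<partial>M) \<longlonglongrightarrow> (\<integral>\<omega>. ?r \<omega> \<partial>M)"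
  proof (rule integral_dominated_convergence[where w="\<lambda>_. B"])
    show "AE \<omega> in M. norm (?R n \<omega>) \<le> B" for n
      unfolding real_norm_def by (rule AE_I2, rule first_at_sum_bound[OF Rb])
    show "AE \<omega> in M. (\<lambda>n. ?R n \<omega>) \<longlonglongrightarrow> ?r \<omega>" by (rule AE_I2) (rule path_limits(2))
  qed auto
  ultimately have "(\<integral>\<omega>. ?l \<omega> \<partial>M) = (\<integral>\<omega>. ?r \<omega> \<partial>M)" using LIMSEQ_unique by fastforce
  also have "(\<integral>\<omega>. ?r \<omega> \<partial>M) = (\<integral>\<omega>. (\<integral>t. exponential_density p t * indicator {y<..} (SS t \<omega>) \<partial>lborel) \<partial>M) * \<Theta> 0" by simp
  also have "(\<integral>\<omega>. (\<integral>t. exponential_density p t * indicator {y<..} (SS t \<omega>) \<partial>lborel) \<partial>M) = (\<integral>z. indicator {y<..} (SS (fst z) (snd z)) \<partial>exp_time p)"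
    by (subst exp_time_integral(2)[OF p, where B=1]) auto
  also have "(\<integral>\<omega>. ?l \<omega> \<partial>M) = (\<integral>z. \<theta> (SS (fst z) (snd z) - y) (DD (fst z) (snd z)) \<partial>exp_time p)"
    by (subst exp_time_integral(2)[OF p, where B=B]) (use bound in auto)
  finally show ?thesis by (simp add: \<Theta>_def)
qed

end

text \<open>A statement obtained by integrating out the exponential time holds at almost every time
  only; monotonicity in t removes the exceptional set.\<close>

lemma AE_nonneg_antimono_imp_all:
  fixes t :: real
  assumes ae: "AE t in lborel. t \<ge> 0 \<longrightarrow> Q t" and mono: "\<And>s t. 0 \<le> s \<Longrightarrow> s \<le> t \<Longrightarrow> Q t \<Longrightarrow> Q s" and t: "0 \<le> t"
  shows "Q t"
proof (rule ccontr)
  assume "\<not> Q t"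
  then have "\<not> Q s" if "s \<ge> t" for s using mono[of t s] t that by blast
  with ae have "AE s in lborel. s \<notin> {t..t+1}"
  proof (elim eventually_mono)
    fix s assume "0 \<le> s \<longrightarrow> Q s" and nQ: "\<And>s. t \<le> s \<Longrightarrow> \<not> Q s"
    then show "s \<notin> {t..t+1}" using t nQ[of s] by auto
  qed
  then have "emeasure lborel {t..t+1} = 0" by (subst (asm) AE_iff_measurable[where N="{t..t+1}"]) auto
  then show False by simp
qed

lemma exponential_density_eq: "exponential_density p t = (if t < 0 then 0 else p * exp (- p * t))"
  by (simp add: exponential_density_def mult.commute)

section \<open>The exponential law of the supremum\<close>

context sn_levy
begin

definition surv :: "real \<Rightarrow> real \<Rightarrow> real" where
  "surv p y = (\<integral>z. indicator {y<..} (SS (fst z) (snd z)) \<partial>exp_time p)"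

text \<open>The indicator of \<open>{z<..}\<close> is the limit of continuous ramps which vanish for
  s <= z, hence for s <= 0, and are therefore admissible test functions.\<close>

lemma strong_markov_product:
  assumes p: "p > 0" and y: "y \<ge> 0" and z: "z \<ge> 0" and \<phi>: "continuous_on UNIV \<phi>" and B: "\<And>d. \<bar>\<phi> d\<bar> \<le> B"
  shows "(\<integral>w. indicator {y + z<..} (SS (fst w) (snd w)) * \<phi> (DD (fst w) (snd w)) \<partial>exp_time p) =
    surv p y * (\<integral>w. indicator {z<..} (SS (fst w) (snd w)) * \<phi> (DD (fst w) (snd w)) \<partial>exp_time p)"
proof -
  interpret N: prob_space "exp_time p" by (rule prob_space_exp_time[OF p])
  have [measurable]: "\<phi> \<in> borel_measurable borel" using \<phi> by (rule borel_measurable_continuous_onI)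
  define \<rho> where "\<rho> j s = min 1 (real j * max 0 (s - z))" for j s
  have \<rho>: "0 \<le> \<rho> j s" "\<rho> j s \<le> 1" for j s by (auto simp: \<rho>_def)
  have [measurable]: "\<rho> j \<in> borel_measurable borel" for j unfolding \<rho>_def by measurable
  have B0: "0 \<le> B" using B[of 0] by simp
  have bnd: "\<bar>\<rho> j s * \<phi> d\<bar> \<le> B" for j s d
    using mult_mono[OF \<rho>(2)[of j s] B[of d]] \<rho>(1)[of j s] by (simp add: abs_mult)
  have lim: "(\<lambda>j. \<rho> j s) \<longlonglongrightarrow> indicator {z<..} s" for s
  proof (cases "z < s")
    case True
    have "\<forall>\<^sub>F j in sequentially. 1 = \<rho> j s"
    proof -
      have "filterlim (\<lambda>j. real j * (s - z)) at_top sequentially"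
        by (rule filterlim_at_top_mult_tendsto_pos[OF tendsto_const]) (use True filterlim_real_sequentially in auto)
      then have "\<forall>\<^sub>F j in sequentially. 1 \<le> real j * (s - z)" by (simp add: filterlim_at_top)
      then show ?thesis by eventually_elim (use True in \<open>simp add: \<rho>_def\<close>)
    qed
    then have "(\<lambda>j. \<rho> j s) \<longlonglongrightarrow> 1" by (rule Lim_transform_eventually[OF tendsto_const])
    then show ?thesis using True by simp
  qed (simp add: \<rho>_def)
  have sm: "(\<integral>w. \<rho> j (SS (fst w) (snd w) - y) * \<phi> (DD (fst w) (snd w)) \<partial>exp_time p) =
      surv p y * (\<integral>w. \<rho> j (SS (fst w) (snd w)) * \<phi> (DD (fst w) (snd w)) \<partial>exp_time p)" for j
  proof -
    interpret sm: strong_markov M X p y B "\<lambda>s d. \<rho> j s * \<phi> d"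
    proof unfold_locales
      show "continuous_on UNIV (\<lambda>(s, d). \<rho> j s * \<phi> d)"
        unfolding \<rho>_def case_prod_beta
        by (intro continuous_intros continuous_on_compose2[OF \<phi>]) auto
    qed (use p y z bnd in \<open>auto simp: \<rho>_def\<close>)
    show ?thesis using sm.strong_markov by (simp add: surv_def)
  qed
  have conv: "(\<lambda>j. \<integral>w. \<rho> j (SS (fst w) (snd w) - r) * \<phi> (DD (fst w) (snd w)) \<partial>exp_time p) \<longlonglongrightarrow>
      (\<integral>w. indicator {z<..} (SS (fst w) (snd w) - r) * \<phi> (DD (fst w) (snd w)) \<partial>exp_time p)" for r
    by (rule integral_dominated_convergence[where w="\<lambda>_. B"]) (use bnd in \<open>auto intro!: AE_I2 tendsto_intros lim\<close>)
  have "(\<lambda>j. surv p y * (\<integral>w. \<rho> j (SS (fst w) (snd w) - 0) * \<phi> (DD (fst w) (snd w)) \<partial>exp_time p)) \<longlonglongrightarrow>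
      surv p y * (\<integral>w. indicator {z<..} (SS (fst w) (snd w) - 0) * \<phi> (DD (fst w) (snd w)) \<partial>exp_time p)"
    by (intro tendsto_intros conv)
  with conv[of y] have "(\<integral>w. indicator {z<..} (SS (fst w) (snd w) - y) * \<phi> (DD (fst w) (snd w)) \<partial>exp_time p) =
    surv p y * (\<integral>w. indicator {z<..} (SS (fst w) (snd w)) * \<phi> (DD (fst w) (snd w)) \<partial>exp_time p)"
    using LIMSEQ_unique by (fastforce simp: sm)
  moreover have "indicator {z<..} (s - y) = (indicator {y + z<..} s :: real)" for s by (auto simp: indicator_def)
  ultimately show ?thesis by simp
qed

lemma surv_mult: "p > 0 \<Longrightarrow> y \<ge> 0 \<Longrightarrow> z \<ge> 0 \<Longrightarrow> surv p (y + z) = surv p y * surv p z"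
  using strong_markov_product[of p y z "\<lambda>_. 1" 1] by (simp add: surv_def)

lemma surv_cdf: 
  assumes p: "p > 0"
  shows "real_distribution (distr (exp_time p) borel (\<lambda>z. SS (fst z) (snd z)))"
    and "surv p y = 1 - cdf (distr (exp_time p) borel (\<lambda>z. SS (fst z) (snd z))) y"
proof -
  interpret N: prob_space "exp_time p" by (rule prob_space_exp_time[OF p])
  show R: "real_distribution (distr (exp_time p) borel (\<lambda>z. SS (fst z) (snd z)))"
    by (rule N.real_distribution_distr) measurable
  interpret R: real_distribution "distr (exp_time p) borel (\<lambda>z. SS (fst z) (snd z))" by (rule R)
  have "surv p y = (\<integral>x. indicator {y<..} x \<partial>distr (exp_time p) borel (\<lambda>z. SS (fst z) (snd z)))"
    unfolding surv_def by (subst integral_distr) auto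
  also have "\<dots> = R.prob {y<..}" by simp
  also have "{y<..} = space (distr (exp_time p) borel (\<lambda>z. SS (fst z) (snd z))) - {..y}" by auto
  also have "R.prob \<dots> = 1 - R.prob {..y}" by (rule R.prob_compl) simp
  finally show "surv p y = 1 - cdf (distr (exp_time p) borel (\<lambda>z. SS (fst z) (snd z))) y" by (simp add: cdf_def)
qed

lemma surv_nonneg: "p > 0 \<Longrightarrow> 0 \<le> surv p y"
  by (simp add: surv_def)

lemma SS_mono: "\<omega> \<in> space M \<Longrightarrow> s \<le> t \<Longrightarrow> SS s \<omega> \<le> SS t \<omega>"
  unfolding SS_def by (rule run_sup_mono[OF sn_path_X]) auto

lemma XX_le_SS: "\<omega> \<in> space M \<Longrightarrow> XX t \<omega> \<le> SS t \<omega>"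
  using DD_nonneg[of \<omega> t] by (simp add: DD_def)

text \<open>Multiplicativity leaves only the values 0 and 1. The value 0 would mean that X almost
  surely never exceeds 0, hence by stationarity of increments that its paths are nonincreasing,
  which the definition of the process excludes.\<close>

lemma surv_0: assumes p: "p > 0" shows "surv p 0 = 1"
proof (rule ccontr)
  assume "surv p 0 \<noteq> 1"
  then have s0: "surv p 0 = 0" using surv_mult[OF p, of 0 0] by simp
  define P where "P t = (\<integral>\<omega>. indicator {0<..} (SS t \<omega>) \<partial>M :: real)" for t
  have [measurable]: "P \<in> borel_measurable borel" unfolding P_def by measurable
  have int: "integrable M (\<lambda>\<omega>. indicator {0<..} (SS t \<omega>) :: real)" for t
    by (rule integrable_const_bound[where B=1]) auto
  have P: "0 \<le> P t" "P t \<le> 1" for t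
    unfolding P_def by (auto intro!: integral_le_const int)
  have "surv p 0 = (\<integral>t. exponential_density p t * P t \<partial>lborel)"
    unfolding surv_def P_def by (subst exp_time_integral(3)[OF p, where B=1]) auto
  then have "(\<integral>t. exponential_density p t * P t \<partial>lborel) = 0" using s0 by simp
  moreover have "integrable lborel (\<lambda>t. exponential_density p t * P t)"
    by (rule Bochner_Integration.integrable_bound[OF integrable_exponential_density[OF p]])
       (use P exponential_density_nonneg'[OF p] in \<open>auto intro!: AE_I2 mult_left_le simp: abs_mult\<close>)
  ultimately have "AE t in lborel. exponential_density p t * P t = 0"
    by (subst (asm) integral_nonneg_eq_0_iff_AE) (use P exponential_density_nonneg'[OF p] in auto)
  then have ae: "AE t in lborel. 0 \<le> t \<longrightarrow> P t = 0"
    by eventually_elim (use p in \<open>auto simp: exponential_density_def split: if_splits\<close>)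
  have P0: "P t = 0" if "0 \<le> t" for t
  proof (rule AE_nonneg_antimono_imp_all[OF ae _ that])
    fix s t :: real assume "0 \<le> s" "s \<le> t" "P t = 0"
    have "P s \<le> P t" unfolding P_def
      by (rule Bochner_Integration.integral_mono[OF int int])
         (use SS_mono \<open>s \<le> t\<close> in \<open>force simp: indicator_def\<close>)
    then show "P s = 0" using P(1)[of s] \<open>P t = 0\<close> by simp
  qed
  have X0: "AE \<omega> in M. X t \<omega> \<le> 0" if t: "0 \<le> t" for t
  proof -
    have "AE \<omega> in M. indicator {0<..} (SS t \<omega>) = (0::real)"
      using P0[OF t] unfolding P_def by (subst (asm) integral_nonneg_eq_0_iff_AE[OF int]) auto
    then have "AE \<omega> in M. SS t \<omega> \<le> 0" by eventually_elim (auto simp: indicator_def split: if_splits)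
    then show ?thesis using AE_space
      by eventually_elim (use XX_le_SS[of _ t] t in \<open>force simp: XX_def\<close>)
  qed
  have incr: "AE \<omega> in M. X t \<omega> \<le> X s \<omega>" if "0 \<le> s" "s \<le> t" for s t
  proof -
    have "AE x in distr M borel (X (t - s)). x \<le> 0"
      by (subst AE_distr_iff) (use X0[of "t - s"] that in auto)
    then have "AE x in distr M borel (\<lambda>\<omega>. X t \<omega> - X s \<omega>). x \<le> 0" unfolding increments_distr[OF that] .
    then have "AE \<omega> in M. X t \<omega> - X s \<omega> \<le> 0" by (subst (asm) AE_distr_iff) auto
    then show ?thesis by simp
  qed
  \<comment> \<open>Countably many pairs of rational times share one null set; right-continuity
    along dyadic times extends the inequality to all times.\<close>
  have "AE \<omega> in M. \<forall>s\<in>\<rat>. \<forall>t\<in>\<rat>. 0 \<le> s \<longrightarrow> s \<le> t \<longrightarrow> X t \<omega> \<le> X s \<omega>"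
    using incr by (intro AE_ball_countable'[OF _ countable_rat]) auto
  then have "AE \<omega> in M. antimono_on {0..} (\<lambda>t. X t \<omega>)" using AE_space
  proof eventually_elim
    case (elim \<omega>)
    show ?case
    proof (rule monotone_onI)
      fix s t :: real assume st: "s \<in> {0..}" "t \<in> {0..}" "s \<le> t"
      have lim: "(\<lambda>n. X (dyadic_above n r) \<omega>) \<longlonglongrightarrow> X r \<omega>" if "r \<ge> 0" for r
        by (rule filterlim_compose[OF sn_path_right_cont[OF sn_path_X[OF elim(2)] that] dyadic_above_at_right])
      have rat: "dyadic_above n r \<in> \<rat>" for n r unfolding dyadic_above_def by auto
      have le: "dyadic_above n s \<le> dyadic_above n t" for n
        unfolding dyadic_above_def using st by (intro divide_right_mono add_right_mono) (auto intro!: floor_mono)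
      show "X t \<omega> \<le> X s \<omega>"
      proof (rule LIMSEQ_le[OF lim lim])
        have "X (dyadic_above n t) \<omega> \<le> X (dyadic_above n s) \<omega>" for n
          using elim(1) rat le[of n] dyadic_above_gt[of s n] st by auto
        then show "\<exists>N. \<forall>n\<ge>N. X (dyadic_above n t) \<omega> \<le> X (dyadic_above n s) \<omega>" by blast
      qed (use st in auto)
    qed
  qed
  then show False using sn by (simp add: spectrally_negative_levy_def)
qed

lemma surv_right_cont: "p > 0 \<Longrightarrow> (surv p \<longlongrightarrow> surv p y) (at_right y)"
proof -
  assume p: "p > 0"
  interpret R: real_distribution "distr (exp_time p) borel (\<lambda>z. SS (fst z) (snd z))" by (rule surv_cdf(1)[OF p])
  show ?thesis using R.cdf_is_right_cont[of y] unfolding continuous_within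
    by (simp add: surv_cdf(2)[OF p, abs_def] tendsto_intros)
qed

text \<open>Right-continuity and the value 1 at 0 give positivity near 0, and multiplicativity
  propagates it to all multiples of a small step.\<close>

lemma surv_pos: assumes p: "p > 0" and y: "y \<ge> 0" shows "surv p y > 0"
proof -
  have "\<forall>\<^sub>F y in at_right 0. surv p y > 0"
    using order_tendstoD(1)[OF surv_right_cont[OF p, of 0], of 0] surv_0[OF p] by simp
  then obtain b where b: "b > 0" "\<And>y. 0 < y \<Longrightarrow> y < b \<Longrightarrow> surv p y > 0" unfolding eventually_at_right_field by auto
  have n: "surv p (real n * (b / 2)) > 0" for n
  proof (induction n)
    case (Suc n)
    have "surv p (real (Suc n) * (b / 2)) = surv p (real n * (b / 2) + b / 2)" by (simp add: algebra_simps add_divide_distrib)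
    also have "\<dots> = surv p (real n * (b / 2)) * surv p (b / 2)" by (rule surv_mult[OF p]) (use b in auto)
    finally show ?case using Suc b(2)[of "b / 2"] b(1) by simp
  qed (simp add: surv_0[OF p])
  obtain n where "y < real n * (b / 2)" using reals_Archimedean3[of "b / 2"] b(1) by auto
  then have "surv p (real n * (b / 2)) = surv p y * surv p (real n * (b / 2) - y)"
    using surv_mult[OF p y, of "real n * (b / 2) - y"] by simp
  then show ?thesis using n[of n] surv_nonneg[OF p, of y] by (metis less_irrefl mult_zero_left order_le_less)
qed

definition rate :: "real \<Rightarrow> real" where "rate p = - ln (surv p 1)"

lemma surv_eq: "p > 0 \<Longrightarrow> y \<ge> 0 \<Longrightarrow> surv p y = exp (- rate p * y)"
  using multiplicative_right_continuous_exp[of "surv p" y] surv_pos surv_mult surv_right_cont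
  by (simp add: rate_def mult.commute)

lemma rate_pos: assumes p: "p > 0" shows "rate p > 0"
proof (rule ccontr)
  assume "\<not> rate p > 0"
  then have ge: "surv p y \<ge> 1" if "y \<ge> 0" for y
    using surv_eq[OF p that] that by (simp add: mult_nonpos_nonneg)
  interpret R: real_distribution "distr (exp_time p) borel (\<lambda>z. SS (fst z) (snd z))" by (rule surv_cdf(1)[OF p])
  have "((\<lambda>y. 1 - cdf (distr (exp_time p) borel (\<lambda>z. SS (fst z) (snd z))) y) \<longlongrightarrow> 1 - 1) at_top"
    by (intro tendsto_intros R.cdf_lim_at_top_prob)
  then have "(surv p \<longlongrightarrow> 0) at_top" by (simp add: surv_cdf(2)[OF p, abs_def])
  then have "\<forall>\<^sub>F y in at_top. surv p y < 1" by (rule order_tendstoD) simp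
  then have "\<forall>\<^sub>F y in at_top. surv p y < 1 \<and> 0 \<le> y" using eventually_ge_at_top[of 0] by eventually_elim simp
  then obtain y where "surv p y < 1" "0 \<le> y" using eventually_happens[of _ "at_top :: real filter"] by auto
  then show False using ge by force
qed

text \<open>As p grows the exponential time shrinks to 0, where the path starts at 0 and is
  right-continuous, so the probability of exceeding level 1 vanishes. This is the source of
  exponential moments of every order.\<close>

lemma rate_unbounded: "\<exists>p>0. L < rate p"
proof -
  have "(\<lambda>n. surv (real n + 1) 1) \<longlonglongrightarrow> (\<integral>\<omega>. 0 \<partial>M)"
  proof -
    have eq: "surv (real n + 1) 1 = (\<integral>\<omega>. (\<integral>t. exponential_density (real n + 1) t * indicator {1<..} (SS t \<omega>) \<partial>lborel) \<partial>M)" for n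
      unfolding surv_def by (subst exp_time_integral(2)[where B=1]) auto
    have bd: "0 \<le> (\<integral>t. exponential_density (real n + 1) t * indicator {1<..} (SS t \<omega>) \<partial>lborel) \<and>
        (\<integral>t. exponential_density (real n + 1) t * indicator {1<..} (SS t \<omega>) \<partial>lborel) \<le> exp (- (real n + 1) * e)"
      if \<omega>: "\<omega> \<in> space M" and e: "e \<ge> 0" "\<And>t. 0 \<le> t \<Longrightarrow> t \<le> e \<Longrightarrow> SS t \<omega> \<le> 1" for \<omega> e n
    proof
      show "0 \<le> (\<integral>t. exponential_density (real n + 1) t * indicator {1<..} (SS t \<omega>) \<partial>lborel)"
        by (rule Bochner_Integration.integral_nonneg) (auto simp: exponential_density_nonneg')
      have "(\<integral>t. exponential_density (real n + 1) t * indicator {1<..} (SS t \<omega>) \<partial>lborel) \<le> (\<integral>t. (if e < t then (real n + 1) * exp (- (real n + 1) * t) else 0) \<partial>lborel)"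
      proof (rule integral_mono_AE')
        \<comment> \<open>A non-integrable function has Bochner integral 0, so the nonzero value of
          the integral proves integrability.\<close>
        show "integrable lborel (\<lambda>t. if e < t then (real n + 1) * exp (- (real n + 1) * t) else 0)"
          using integral_exp_after[of "real n + 1" e] not_integrable_integral_eq by fastforce
        show "AE t in lborel. exponential_density (real n + 1) t * indicator {1<..} (SS t \<omega>) \<le> (if e < t then (real n + 1) * exp (- (real n + 1) * t) else 0)"
        proof (rule AE_I2)
          fix t
          show "exponential_density (real n + 1) t * indicator {1<..} (SS t \<omega>) \<le> (if e < t then (real n + 1) * exp (- (real n + 1) * t) else 0)"
          proof (cases "0 \<le> t \<and> t \<le> e")
            case True
            then show ?thesis using e(2)[of t] by simp
          next
            case False
            then show ?thesis using e(1) by (auto simp: exponential_density_eq indicator_def)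
          qed
        qed
        show "AE t in lborel. 0 \<le> (if e < t then (real n + 1) * exp (- (real n + 1) * t) else 0)"
          by (intro AE_I2) auto
      qed
      then show "(\<integral>t. exponential_density (real n + 1) t * indicator {1<..} (SS t \<omega>) \<partial>lborel) \<le> exp (- (real n + 1) * e)"
        using integral_exp_after[of "real n + 1" e] by simp
    qed
    show ?thesis unfolding eq
    proof (rule integral_dominated_convergence[where w="\<lambda>_. 1"])
      show "AE \<omega> in M. norm (\<integral>t. exponential_density (real n + 1) t * indicator {1<..} (SS t \<omega>) \<partial>lborel) \<le> 1" for n
      proof (rule AE_I2)
        fix \<omega> assume \<omega>: "\<omega> \<in> space M"
        have "SS 0 \<omega> \<le> 1" unfolding SS_def by (rule run_sup_least) (use \<omega> in auto)
        then have "t = 0 \<Longrightarrow> SS t \<omega> \<le> 1" for t by simp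
        then show "norm (\<integral>t. exponential_density (real n + 1) t * indicator {1<..} (SS t \<omega>) \<partial>lborel) \<le> 1"
          using bd[OF \<omega>, of 0 n] by fastforce
      qed
      show "AE \<omega> in M. (\<lambda>n. \<integral>t. exponential_density (real n + 1) t * indicator {1<..} (SS t \<omega>) \<partial>lborel) \<longlonglongrightarrow> 0"
      proof (rule AE_I2)
        fix \<omega> assume \<omega>: "\<omega> \<in> space M"
        obtain e where e: "e > 0" "\<And>t. 0 \<le> t \<Longrightarrow> t < 0 + e \<Longrightarrow> X t \<omega> < 1"
          using sn_path_right_less[OF sn_path_X[OF \<omega>], of 0 1] \<omega> by auto
        have "SS t \<omega> \<le> 1" if "0 \<le> t" "t \<le> e / 2" for t
          unfolding SS_def by (rule run_sup_least) (use e that in \<open>auto intro!: less_imp_le\<close>)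
        then have b: "0 \<le> (\<integral>t. exponential_density (real n + 1) t * indicator {1<..} (SS t \<omega>) \<partial>lborel) \<and>
        (\<integral>t. exponential_density (real n + 1) t * indicator {1<..} (SS t \<omega>) \<partial>lborel) \<le> exp (- (real n + 1) * (e / 2))" for n
          using bd[OF \<omega>, of "e / 2" n] e(1) by auto
        show "(\<lambda>n. \<integral>t. exponential_density (real n + 1) t * indicator {1<..} (SS t \<omega>) \<partial>lborel) \<longlonglongrightarrow> 0"
        proof (rule tendsto_sandwich[of "\<lambda>_. 0" _ _ "\<lambda>n. exp (- (real n + 1) * (e / 2))"])
          have "filterlim (\<lambda>n. real n + 1) at_top sequentially"
            using filterlim_compose[OF filterlim_real_sequentially filterlim_Suc] by (simp add: add.commute)
          then have "filterlim (\<lambda>n. (real n + 1) * (e / 2)) at_top sequentially"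
            by (rule filterlim_at_top_mult_tendsto_pos[OF tendsto_const, rotated]) (use e in auto)
          then have "filterlim (\<lambda>n. - ((real n + 1) * (e / 2))) at_bot sequentially"
            by (simp add: filterlim_uminus_at_bot)
          then show "(\<lambda>n. exp (- (real n + 1) * (e / 2))) \<longlonglongrightarrow> 0"
            by (simp only: mult_minus_left) (rule filterlim_compose[OF exp_at_bot])
        qed (use b in auto)
      qed
    qed auto
  qed
  then have "(\<lambda>n. surv (real n + 1) 1) \<longlonglongrightarrow> 0" by simp
  then have "\<forall>\<^sub>F n in sequentially. surv (real n + 1) 1 < exp (- L)" by (rule order_tendstoD) simp
  then obtain n where n: "surv (real n + 1) 1 < exp (- L)" using eventually_happens[of _ sequentially] by auto
  have "exp (- rate (real n + 1)) < exp (- L)" using n surv_eq[of "real n + 1" 1] by simp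
  then show ?thesis by (intro exI[of _ "real n + 1"]) auto
qed

lemma SS_exponential:
  assumes p: "p > 0"
  shows "distributed (exp_time p) lborel (\<lambda>z. SS (fst z) (snd z)) (exponential_density (rate p))"
proof -
  interpret N: prob_space "exp_time p" by (rule prob_space_exp_time[OF p])
  show ?thesis
  proof (rule exponential_distributedI[OF _ rate_pos[OF p]])
    fix a :: real assume a: "0 \<le> a"
    have "N.prob {z\<in>space (exp_time p). SS (fst z) (snd z) \<le> a} = cdf (distr (exp_time p) borel (\<lambda>z. SS (fst z) (snd z))) a"
      by (simp add: cdf_def measure_distr vimage_def Int_def conj_commute)
    also have "\<dots> = 1 - exp (- a * rate p)" using surv_eq[OF p a] surv_cdf(2)[OF p, of a] by (simp add: mult.commute)
    finally show "emeasure (exp_time p) {z\<in>space (exp_time p). SS (fst z) (snd z) \<le> a} = 1 - ennreal (exp (- a * rate p))"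
      by (simp add: N.emeasure_eq_measure ennreal_minus flip: ennreal_1)
  qed measurable
qed

end

section \<open>Exponential moments and the Laplace exponent\<close>

context sn_levy
begin

text \<open>The strong Markov property says that conditioning on S > y leaves the law of D
  unchanged. Half lines \<open>{y<..}\<close> for S and \<open>{..b}\<close> for D form generators
  stable under intersection, so the product formula on them is enough.\<close>

lemma SS_DD_indep:
  assumes p: "p > 0"
  shows "prob_space.indep_var (exp_time p) borel (\<lambda>z. SS (fst z) (snd z)) borel (\<lambda>z. DD (fst z) (snd z))"
proof -
  interpret N: prob_space "exp_time p" by (rule prob_space_exp_time[OF p])
  let ?S = "\<lambda>z. SS (fst z) (snd z)" and ?D = "\<lambda>z. DD (fst z) (snd z)" and ?\<Omega> = "space (exp_time p)"
  \<comment> \<open>S is almost surely positive since \<open>surv p 0 = 1\<close>; this removes the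
    indicator from the right-hand side of \<open>strong_markov_product\<close> at z = 0.\<close>
  have Spos: "AE z in exp_time p. indicator {0<..} (?S z) = (1::real)"
  proof -
    have "(\<integral>z. 1 - indicator {0<..} (?S z) \<partial>exp_time p) = (0::real)"
      using surv_0[OF p] unfolding surv_def
      by (subst Bochner_Integration.integral_diff) (auto intro!: N.integrable_const_bound[where B=1] simp: N.prob_space)
    then have "AE z in exp_time p. 1 - indicator {0<..} (?S z) = (0::real)"
      by (subst (asm) integral_nonneg_eq_0_iff_AE) (auto intro!: N.integrable_const_bound[where B=1] simp: indicator_def)
    then show ?thesis by eventually_elim simp
  qed
  have prod_\<phi>: "(\<integral>w. indicator {y<..} (?S w) * \<phi> (?D w) \<partial>exp_time p) = surv p y * (\<integral>w. \<phi> (?D w) \<partial>exp_time p)"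
    if y: "y \<ge> 0" and \<phi>: "continuous_on UNIV \<phi>" and B: "\<And>d. \<bar>\<phi> d\<bar> \<le> B" for y \<phi> B
  proof -
    have [measurable]: "\<phi> \<in> borel_measurable borel" using \<phi> by (rule borel_measurable_continuous_onI)
    have "(\<integral>w. indicator {0<..} (?S w) * \<phi> (?D w) \<partial>exp_time p) = (\<integral>w. \<phi> (?D w) \<partial>exp_time p)"
      by (rule integral_cong_AE) (use Spos in auto)
    then show ?thesis using strong_markov_product[OF p y _ \<phi> B, of 0] by simp
  qed
  have prod_le: "(\<integral>w. indicator {y<..} (?S w) * indicator {..b} (?D w) \<partial>exp_time p) = surv p y * (\<integral>w. indicator {..b} (?D w) \<partial>exp_time p)"
    if y: "y \<ge> 0" for y b
  proof -
    define \<phi> where "\<phi> j d = max 0 (min 1 (1 - real j * (d - b)))" for j d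
    have \<phi>: "continuous_on UNIV (\<phi> j)" "\<bar>\<phi> j d\<bar> \<le> 1" for j d by (auto simp: \<phi>_def intro!: continuous_intros)
    have [measurable]: "\<phi> j \<in> borel_measurable borel" for j using \<phi>(1) by (rule borel_measurable_continuous_onI)
    have lim: "(\<lambda>j. \<phi> j d) \<longlonglongrightarrow> indicator {..b} d" for d
    proof (cases "d \<le> b")
      case True
      have "real j * (d - b) \<le> 0" for j using True by (simp add: mult_nonneg_nonpos)
      then have "\<phi> j d = 1" for j by (simp add: \<phi>_def min_def max_def)
      then show ?thesis using True by simp
    next
      case False
      have "filterlim (\<lambda>j. real j * (d - b)) at_top sequentially"
        by (rule filterlim_at_top_mult_tendsto_pos[OF tendsto_const]) (use False filterlim_real_sequentially in auto)
      then have "\<forall>\<^sub>F j in sequentially. 1 \<le> real j * (d - b)" by (simp add: filterlim_at_top)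
      then have "\<forall>\<^sub>F j in sequentially. 0 = \<phi> j d" by eventually_elim (simp add: \<phi>_def)
      then have "(\<lambda>j. \<phi> j d) \<longlonglongrightarrow> 0" by (rule Lim_transform_eventually[OF tendsto_const])
      then show ?thesis using False by simp
    qed
    have b: "\<bar>indicator {y<..} s * \<phi> j d\<bar> \<le> (1::real)" for s j d using \<phi>(2)[of j d] by (simp add: indicator_def)
    have "(\<lambda>j. \<integral>w. indicator {y<..} (?S w) * \<phi> j (?D w) \<partial>exp_time p) \<longlonglongrightarrow> (\<integral>w. indicator {y<..} (?S w) * indicator {..b} (?D w) \<partial>exp_time p)"
      by (rule integral_dominated_convergence[where w="\<lambda>_. 1"])
         (use b in \<open>auto intro!: AE_I2 tendsto_intros lim\<close>)
    moreover have "(\<lambda>j. surv p y * (\<integral>w. \<phi> j (?D w) \<partial>exp_time p)) \<longlonglongrightarrow> surv p y * (\<integral>w. indicator {..b} (?D w) \<partial>exp_time p)"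
      by (intro tendsto_intros, rule integral_dominated_convergence[where w="\<lambda>_. 1"])
         (use \<phi>(2) in \<open>auto intro!: AE_I2 lim simp: abs_mult\<close>)
    ultimately show ?thesis unfolding prod_\<phi>[OF y \<phi>] by (rule LIMSEQ_unique)
  qed
  have meas_ind: "(\<integral>w. indicator A (f w) \<partial>exp_time p) = N.prob (f -` A \<inter> ?\<Omega>)"
    if [measurable]: "f \<in> borel_measurable (exp_time p)" "A \<in> sets borel" for f and A :: "real set"
  proof -
    have "(\<integral>w. indicator A (f w) \<partial>exp_time p) = (\<integral>w. indicator (f -` A \<inter> ?\<Omega>) w \<partial>exp_time p :: real)"
      by (rule Bochner_Integration.integral_cong) (auto simp: indicator_def)
    then show ?thesis by simp
  qed
  have rect: "N.prob ((?S -` {y<..} \<inter> ?\<Omega>) \<inter> (?D -` {..b} \<inter> ?\<Omega>)) = N.prob (?S -` {y<..} \<inter> ?\<Omega>) * N.prob (?D -` {..b} \<inter> ?\<Omega>)" for y b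
  proof (cases "y \<ge> 0")
    case True
    have "N.prob ((?S -` {y<..} \<inter> ?\<Omega>) \<inter> (?D -` {..b} \<inter> ?\<Omega>)) = (\<integral>w. indicator ((?S -` {y<..} \<inter> ?\<Omega>) \<inter> (?D -` {..b} \<inter> ?\<Omega>)) w \<partial>exp_time p)"
      by simp
    also have "\<dots> = (\<integral>w. indicator {y<..} (?S w) * indicator {..b} (?D w) \<partial>exp_time p)"
      by (rule Bochner_Integration.integral_cong) (auto simp: indicator_def)
    finally show ?thesis using prod_le[OF True, of b] meas_ind[of ?S "{y<..}"] meas_ind[of ?D "{..b}"] by (simp add: surv_def)
  next
    case False
    have "y < SS t \<omega>" if "\<omega> \<in> space M" for t \<omega> using SS_nonneg[OF that, of t] False by linarith
    then have "?S -` {y<..} \<inter> ?\<Omega> = ?\<Omega>" by (auto simp: space_exp_time)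
    then show ?thesis by (simp add: N.prob_space)
  qed
  have sS: "sigma_sets ?\<Omega> {?S -` A \<inter> ?\<Omega> |A. A \<in> sets borel} = sigma_sets ?\<Omega> {?S -` A \<inter> ?\<Omega> |A. A \<in> range greaterThan}"
    unfolding borel_Ioi by (simp add: sigma_sets_vimage_commute) (rule sigma_sets_sigma_sets_eq, auto)
  have sD: "sigma_sets ?\<Omega> {?D -` A \<inter> ?\<Omega> |A. A \<in> sets borel} = sigma_sets ?\<Omega> {?D -` A \<inter> ?\<Omega> |A. A \<in> range atMost}"
    unfolding borel_eq_atMost by (simp add: sigma_sets_vimage_commute) (rule sigma_sets_sigma_sets_eq, auto)
  have "N.indep_set (sigma_sets ?\<Omega> {?S -` A \<inter> ?\<Omega> |A. A \<in> range greaterThan}) (sigma_sets ?\<Omega> {?D -` A \<inter> ?\<Omega> |A. A \<in> range atMost})"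
  proof (rule N.indep_set_sigma_sets)
    show "N.indep_set {?S -` A \<inter> ?\<Omega> |A. A \<in> range greaterThan} {?D -` A \<inter> ?\<Omega> |A. A \<in> range atMost}"
      by (rule N.indep_setI) (auto simp: rect)
    show "Int_stable {?S -` A \<inter> ?\<Omega> |A. A \<in> range greaterThan}"
      unfolding Int_stable_def
    proof safe
      fix a b
      show "\<exists>A. (?S -` {a<..} \<inter> ?\<Omega>) \<inter> (?S -` {b<..} \<inter> ?\<Omega>) = ?S -` A \<inter> ?\<Omega> \<and> A \<in> range greaterThan"
        by (intro exI[of _ "{max a b<..}"]) auto
    qed
    show "Int_stable {?D -` A \<inter> ?\<Omega> |A. A \<in> range atMost}"
      unfolding Int_stable_def
    proof safe
      fix a b
      show "\<exists>A. (?D -` {..a} \<inter> ?\<Omega>) \<inter> (?D -` {..b} \<inter> ?\<Omega>) = ?D -` A \<inter> ?\<Omega> \<and> A \<in> range atMost"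
        by (intro exI[of _ "{..min a b}"]) auto
    qed
  qed
  then show ?thesis unfolding N.indep_var_eq sS sD by simp
qed

lemma SS_DD_nn_integral:
  assumes p: "p > 0" and [measurable]: "f \<in> borel_measurable (borel \<Otimes>\<^sub>M borel)"
  shows "(\<integral>\<^sup>+z. f (SS (fst z) (snd z), DD (fst z) (snd z)) \<partial>exp_time p) =
    (\<integral>\<^sup>+z. (\<integral>\<^sup>+s. ennreal (exponential_density (rate p) s) * f (s, DD (fst z) (snd z)) \<partial>lborel) \<partial>exp_time p)"
proof -
  interpret N: prob_space "exp_time p" by (rule prob_space_exp_time[OF p])
  let ?S = "\<lambda>z. SS (fst z) (snd z)" and ?D = "\<lambda>z. DD (fst z) (snd z)"
  let ?LS = "distr (exp_time p) borel ?S" and ?LD = "distr (exp_time p) borel ?D"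
  interpret LS: prob_space ?LS by (rule N.prob_space_distr) measurable
  interpret LD: prob_space ?LD by (rule N.prob_space_distr) measurable
  interpret P: pair_sigma_finite ?LS ?LD ..
  have LS: "?LS = density lborel (\<lambda>t. ennreal (exponential_density (rate p) t))"
    using SS_exponential[OF p] unfolding distributed_def by (simp cong: distr_cong)
  have "(\<integral>\<^sup>+z. f (?S z, ?D z) \<partial>exp_time p) = (\<integral>\<^sup>+w. f w \<partial>distr (exp_time p) (borel \<Otimes>\<^sub>M borel) (\<lambda>z. (?S z, ?D z)))"
    by (subst nn_integral_distr) auto
  also have "distr (exp_time p) (borel \<Otimes>\<^sub>M borel) (\<lambda>z. (?S z, ?D z)) = ?LS \<Otimes>\<^sub>M ?LD"
    using SS_DD_indep[OF p] unfolding N.indep_var_distribution_eq by simp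
  also have "(\<integral>\<^sup>+w. f w \<partial>(?LS \<Otimes>\<^sub>M ?LD)) = (\<integral>\<^sup>+d. (\<integral>\<^sup>+s. f (s, d) \<partial>?LS) \<partial>?LD)"
    by (rule P.nn_integral_snd[symmetric]) measurable
  also have "\<dots> = (\<integral>\<^sup>+z. (\<integral>\<^sup>+s. f (s, ?D z) \<partial>?LS) \<partial>exp_time p)"
    by (subst nn_integral_distr) auto
  also have "\<dots> = (\<integral>\<^sup>+z. (\<integral>\<^sup>+s. ennreal (exponential_density (rate p) s) * f (s, ?D z) \<partial>lborel) \<partial>exp_time p)"
    unfolding LS by (intro nn_integral_cong nn_integral_density) auto
  finally show ?thesis .
qed

text \<open>The Laplace transform of D at the exponential time, the Wiener-Hopf factor belonging to
  the drawdown.\<close>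

definition G :: "real \<Rightarrow> real \<Rightarrow> real" where
  "G p l = (\<integral>z. exp (- l * DD (fst z) (snd z)) \<partial>exp_time p)"

lemma exp_DD_le: "l \<ge> 0 \<Longrightarrow> z \<in> space (exp_time p) \<Longrightarrow> exp (- l * DD (fst z) (snd z)) \<le> 1"
  using DD_nonneg by (auto simp: space_exp_time)

lemma G_integrable: 
  assumes p: "p > 0" and l: "l \<ge> 0"
  shows "integrable (exp_time p) (\<lambda>z. exp (- l * DD (fst z) (snd z)))"
  by (rule exp_time_integral(1)[OF p, where B=1]) (use exp_DD_le[OF l] in auto)

lemma G_pos: 
  assumes p: "p > 0" and l: "l \<ge> 0"
  shows "0 < G p l"
proof -
  interpret N: prob_space "exp_time p" by (rule prob_space_exp_time[OF p])
  have "0 \<le> G p l" unfolding G_def by simp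
  moreover have "G p l \<noteq> 0"
  proof
    assume "G p l = 0"
    then have "AE z in exp_time p. exp (- l * DD (fst z) (snd z)) = 0"
      unfolding G_def by (subst (asm) integral_nonneg_eq_0_iff_AE[OF G_integrable[OF p l]]) auto
    then have "AE z in exp_time p. False" by simp
    then show False by simp
  qed
  ultimately show ?thesis by simp
qed

lemma G_cont:
  assumes p: "p > 0"
  shows "continuous_on {0..} (G p)"
  unfolding continuous_on_sequentially comp_def
proof (intro ballI allI impI, elim conjE)
  interpret N: prob_space "exp_time p" by (rule prob_space_exp_time[OF p])
  fix l :: real and x assume x: "\<forall>n. x n \<in> {0..}" "x \<longlonglongrightarrow> l" 
  show "(\<lambda>n. G p (x n)) \<longlonglongrightarrow> G p l"
    unfolding G_def
  proof (rule integral_dominated_convergence[where w="\<lambda>_. 1"])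
    show "AE z in exp_time p. norm (exp (- x n * DD (fst z) (snd z))) \<le> 1" for n
      using exp_DD_le[of "x n"] x by (intro AE_I2) auto
    show "AE z in exp_time p. (\<lambda>n. exp (- x n * DD (fst z) (snd z))) \<longlonglongrightarrow> exp (- l * DD (fst z) (snd z))"
      by (intro AE_I2 tendsto_intros x)
  qed auto
qed

end

lemma nn_integral_exponential_density_exp:
  fixes c l :: real
  assumes "c > 0" "l < c"
  shows "(\<integral>\<^sup>+s. ennreal (exponential_density c s) * ennreal (exp (l * s)) \<partial>lborel) = ennreal (c / (c - l))"
proof -
  have "(\<integral>\<^sup>+s. ennreal (exponential_density c s) * ennreal (exp (l * s)) \<partial>lborel) =
      (\<integral>\<^sup>+s. ennreal (c / (c - l)) * ennreal (exponential_density (c - l) s) \<partial>lborel)"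
  proof (rule nn_integral_cong)
    fix s
    have "exponential_density c s * exp (l * s) = c / (c - l) * exponential_density (c - l) s"
    proof (cases "s < 0")
      case False
      have "exp (- c * s) * exp (l * s) = exp (- (c - l) * s)" unfolding exp_add[symmetric] by (simp add: algebra_simps)
      then show ?thesis using assms False by (simp add: exponential_density_eq)
    qed (simp add: exponential_density_eq)
    then show "ennreal (exponential_density c s) * ennreal (exp (l * s)) = ennreal (c / (c - l)) * ennreal (exponential_density (c - l) s)"
      using assms by (simp add: ennreal_mult'[symmetric] exponential_density_nonneg')
  qed
  also have "\<dots> = ennreal (c / (c - l)) * (\<integral>\<^sup>+s. ennreal (exponential_density (c - l) s) \<partial>lborel)"
    by (rule nn_integral_cmult) simp
  also have "(\<integral>\<^sup>+s. ennreal (exponential_density (c - l) s) \<partial>lborel) = 1"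
    using integrable_exponential_density[of "c - l"] integral_exponential_density[of "c - l"] assms
    by (subst nn_integral_eq_integral) (auto simp: exponential_density_nonneg')
  finally show ?thesis by simp
qed

lemma nn_integral_exponential_density_exp_infinite:
  fixes c l :: real
  assumes "c > 0" "l \<ge> c"
  shows "(\<integral>\<^sup>+s. ennreal (exponential_density c s) * ennreal (exp (l * s)) \<partial>lborel) = \<infinity>"
proof -
  have "(\<integral>\<^sup>+s. ennreal c * indicator {0..} (s::real) \<partial>lborel) \<le> (\<integral>\<^sup>+s. ennreal (exponential_density c s) * ennreal (exp (l * s)) \<partial>lborel)"
  proof (rule nn_integral_mono)
    fix s :: real
    show "ennreal c * indicator {0..} s \<le> ennreal (exponential_density c s) * ennreal (exp (l * s))"
    proof (cases "s \<ge> 0")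
      case True
      have "c * 1 \<le> c * (exp (- c * s) * exp (l * s))"
        using assms True by (intro mult_left_mono) (auto simp: exp_add[symmetric] algebra_simps mult_right_mono)
      then show ?thesis using True assms by (simp add: exponential_density_eq ennreal_mult'[symmetric] mult.assoc)
    qed simp
  qed
  moreover have "(\<integral>\<^sup>+s. ennreal c * indicator {0..} (s::real) \<partial>lborel) = \<infinity>"
  proof -
    have "emeasure lborel {0::real..} = \<infinity>"
    proof (rule ccontr)
      assume "emeasure lborel {0::real..} \<noteq> \<infinity>"
      then obtain r where r: "emeasure lborel {0::real..} = ennreal r" "r \<ge> 0" by (cases "emeasure lborel {0::real..}") auto
      have "emeasure lborel {0..r + 1} \<le> emeasure lborel {0::real..}" by (rule emeasure_mono) auto
      then show False using r by simp
    qed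
    then show ?thesis using assms by (subst nn_integral_cmult_indicator) (auto simp: ennreal_mult_eq_top_iff)
  qed
  ultimately show ?thesis by (simp add: top_unique)
qed

context sn_levy
begin

text \<open>For a p whose rate exceeds l, exp (l S) is integrable at the exponential time, hence at
  almost every fixed time, and by monotonicity of the supremum at every time.\<close>

lemma exp_SS_integrable:
  assumes l: "l \<ge> 0" and t: "t \<ge> 0"
  shows "integrable M (\<lambda>\<omega>. exp (l * SS t \<omega>))"
proof -
  obtain p where p: "p > 0" "l < rate p" using rate_unbounded by blast
  define P where "P t = (\<integral>\<^sup>+\<omega>. ennreal (exp (l * SS t \<omega>)) \<partial>M)" for t
  have "(\<integral>\<^sup>+z. ennreal (exp (l * SS (fst z) (snd z))) \<partial>exp_time p) = (\<integral>\<^sup>+z. (\<integral>\<^sup>+s. ennreal (exponential_density (rate p) s) * ennreal (exp (l * s)) \<partial>lborel) \<partial>exp_time p)"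
    using SS_DD_nn_integral[OF p(1), of "\<lambda>(s, d). ennreal (exp (l * s))"] by simp
  also have "\<dots> = ennreal (rate p / (rate p - l))"
    using prob_space.emeasure_space_1[OF prob_space_exp_time[OF p(1)]]
    by (simp add: nn_integral_exponential_density_exp[OF rate_pos[OF p(1)] p(2)])
  finally have fin: "(\<integral>\<^sup>+t. ennreal (exponential_density p t) * P t \<partial>lborel) \<noteq> \<infinity>"
    unfolding P_def by (subst (asm) exp_time_nn_integral[OF p(1)]) auto
  have [measurable]: "P \<in> borel_measurable borel" unfolding P_def by measurable
  have "AE t in lborel. ennreal (exponential_density p t) * P t \<noteq> \<infinity>"
    by (rule nn_integral_PInf_AE[OF _ fin]) measurable
  then have ae: "AE t in lborel. 0 \<le> t \<longrightarrow> P t \<noteq> \<infinity>"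
    by eventually_elim (use p in \<open>auto simp: exponential_density_eq ennreal_mult_eq_top_iff\<close>)
  have "P t \<noteq> \<infinity>"
  proof (rule AE_nonneg_antimono_imp_all[OF ae _ t])
    fix s t :: real assume "s \<le> t" "P t \<noteq> \<infinity>"
    moreover have "P s \<le> P t" unfolding P_def
      by (rule nn_integral_mono) (use SS_mono \<open>s \<le> t\<close> l in \<open>auto intro!: ennreal_leI mult_left_mono\<close>)
    ultimately show "P s \<noteq> \<infinity>" by (auto simp: top_unique)
  qed
  then show ?thesis unfolding P_def by (intro integrableI_nonneg) (auto simp: less_top)
qed

lemma exp_X_integrable:
  assumes "l \<ge> 0" "t \<ge> 0"
  shows "integrable M (\<lambda>\<omega>. exp (l * X t \<omega>))"
proof (rule Bochner_Integration.integrable_bound[OF exp_SS_integrable[OF assms]])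
  show "AE \<omega> in M. norm (exp (l * X t \<omega>)) \<le> norm (exp (l * SS t \<omega>))"
    using XX_le_SS[of _ t] assms by (intro AE_I2) (auto simp: XX_def intro!: mult_left_mono)
qed measurable

definition mgf :: "real \<Rightarrow> real \<Rightarrow> real" where "mgf l t = (\<integral>\<omega>. exp (l * X t \<omega>) \<partial>M)"

lemma nn_mgf: "l \<ge> 0 \<Longrightarrow> t \<ge> 0 \<Longrightarrow> (\<integral>\<^sup>+\<omega>. ennreal (exp (l * X t \<omega>)) \<partial>M) = ennreal (mgf l t)"
  unfolding mgf_def by (rule nn_integral_eq_integral[OF exp_X_integrable]) auto

lemma mgf_pos: assumes "l \<ge> 0" "t \<ge> 0" shows "mgf l t > 0"
proof -
  have "0 \<le> mgf l t" unfolding mgf_def by simp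
  moreover have "mgf l t \<noteq> 0"
  proof
    assume "mgf l t = 0"
    then have "AE \<omega> in M. exp (l * X t \<omega>) = 0"
      unfolding mgf_def by (subst (asm) integral_nonneg_eq_0_iff_AE[OF exp_X_integrable[OF assms]]) auto
    then have "AE \<omega> in M. False" by simp
    then show False by simp
  qed
  ultimately show ?thesis by simp
qed

lemma mgf_add: assumes l: "l \<ge> 0" and s: "s \<ge> 0" and t: "t \<ge> 0" shows "mgf l (s + t) = mgf l s * mgf l t"
proof -
  let ?F = "\<lambda>w. ennreal (exp (l * path_eval w (s + t)))"
  have "(\<integral>\<^sup>+\<omega>. ennreal (exp (l * X (s + t) \<omega>)) \<partial>M) = (\<integral>\<^sup>+\<omega>. ?F (path \<omega>) \<partial>M)"
    by (rule nn_integral_cong) (use s t in \<open>simp add: path_eval_eq[OF sn_path_X]\<close>)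
  also have "\<dots> = (\<integral>\<^sup>+\<omega>. \<integral>\<^sup>+\<omega>'. ?F (restrict (restart s (\<omega>, \<omega>')) {0..}) \<partial>M \<partial>M)"
    by (rule markov_nn[OF _ s]) measurable
  also have "\<dots> = (\<integral>\<^sup>+\<omega>. \<integral>\<^sup>+\<omega>'. ennreal (exp (l * X s \<omega>)) * ennreal (exp (l * X t \<omega>')) \<partial>M \<partial>M)"
    by (intro nn_integral_cong)
       (use s t in \<open>simp add: path_eval_eq[OF sn_path_restart] restart_after distrib_left exp_add ennreal_mult\<close>)
  also have "\<dots> = (\<integral>\<^sup>+\<omega>. ennreal (exp (l * X s \<omega>)) * ennreal (mgf l t) \<partial>M)"
    by (intro nn_integral_cong) (simp add: nn_integral_cmult nn_mgf[OF l t])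
  also have "\<dots> = ennreal (mgf l s) * ennreal (mgf l t)"
    by (simp add: nn_integral_multc nn_mgf[OF l s])
  finally have "ennreal (mgf l (s + t)) = ennreal (mgf l s * mgf l t)"
    using nn_mgf[OF l, of "s + t"] s t mgf_pos[OF l] by (simp add: ennreal_mult less_imp_le)
  then show ?thesis using mgf_pos[OF l] s t by (simp add: less_imp_le mult_nonneg_nonneg)
qed

lemma mgf_right_cont: assumes l: "l \<ge> 0" and t: "t \<ge> 0" shows "(mgf l \<longlongrightarrow> mgf l t) (at_right t)"
proof (rule tendsto_at_right_sequentially[of t "t + 1"])
  fix T :: "nat \<Rightarrow> real" assume T: "\<And>n. t < T n" "\<And>n. T n < t + 1" "T \<longlonglongrightarrow> t"
  have "T n \<noteq> t \<and> T n \<in> {t<..}" for n using T(1)[of n] by auto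
  then have T': "filterlim T (at_right t) sequentially" unfolding filterlim_at using T(3) by simp
  show "(\<lambda>n. mgf l (T n)) \<longlonglongrightarrow> mgf l t"
    unfolding mgf_def
  proof (rule integral_dominated_convergence[where w="\<lambda>\<omega>. exp (l * SS (t + 1) \<omega>)"])
    show "integrable M (\<lambda>\<omega>. exp (l * SS (t + 1) \<omega>))" using exp_SS_integrable[OF l] t by simp
    show "AE \<omega> in M. (\<lambda>n. exp (l * X (T n) \<omega>)) \<longlonglongrightarrow> exp (l * X t \<omega>)"
      by (intro AE_I2 tendsto_intros filterlim_compose[OF sn_path_right_cont[OF sn_path_X t] T'])
    show "AE \<omega> in M. norm (exp (l * X (T n) \<omega>)) \<le> exp (l * SS (t + 1) \<omega>)" for n
    proof (rule AE_I2)
      fix \<omega> assume \<omega>: "\<omega> \<in> space M"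
      have "X (T n) \<omega> \<le> SS (t + 1) \<omega>"
        using run_sup_upper[OF sn_path_X[OF \<omega>], of 0 "T n" "t + 1"] T(1,2)[of n] t by (simp add: SS_def)
      then show "norm (exp (l * X (T n) \<omega>)) \<le> exp (l * SS (t + 1) \<omega>)" using l by (simp add: mult_left_mono)
    qed
  qed auto
qed simp

abbreviation \<psi> :: "real \<Rightarrow> real" where "\<psi> \<equiv> levy_psi M X"

lemma mgf_eq: "l \<ge> 0 \<Longrightarrow> t \<ge> 0 \<Longrightarrow> mgf l t = exp (t * \<psi> l)"
  using multiplicative_right_continuous_exp[of "mgf l" t] mgf_pos mgf_add mgf_right_cont
  by (simp add: levy_psi_def mgf_def)

text \<open>The mean of exp (l X) at the exponential time is computed once from \<psi> and once from
  the independent pair S, D. With nonnegative integrals, finiteness of the second value excludes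
  \<open>\<psi> l \<ge> p\<close>.\<close>

lemma psi_below_rate:
  assumes p: "p > 0" and l: "l \<ge> 0" "l < rate p"
  shows "\<psi> l < p" "p / (p - \<psi> l) = rate p / (rate p - l) * G p l"
proof -
  let ?c = "rate p"
  have r: "?c / (?c - l) * G p l \<ge> 0" using rate_pos[OF p] l G_pos[OF p l(1)] by (simp add: less_imp_le)
  have "(\<integral>\<^sup>+z. ennreal (exp (l * XX (fst z) (snd z))) \<partial>exp_time p) =
      (\<integral>\<^sup>+t. ennreal (exponential_density p t) * ennreal (exp (\<psi> l * t)) \<partial>lborel)"
  proof (subst exp_time_nn_integral[OF p])
    show "(\<integral>\<^sup>+t. ennreal (exponential_density p t) * (\<integral>\<^sup>+\<omega>. ennreal (exp (l * XX (fst (t, \<omega>)) (snd (t, \<omega>)))) \<partial>M) \<partial>lborel) =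
        (\<integral>\<^sup>+t. ennreal (exponential_density p t) * ennreal (exp (\<psi> l * t)) \<partial>lborel)"
    proof (rule nn_integral_cong)
      fix t :: real
      show "ennreal (exponential_density p t) * (\<integral>\<^sup>+\<omega>. ennreal (exp (l * XX (fst (t, \<omega>)) (snd (t, \<omega>)))) \<partial>M) =
        ennreal (exponential_density p t) * ennreal (exp (\<psi> l * t))"
        by (cases "t \<ge> 0") (auto simp: XX_def nn_mgf[OF l(1)] mgf_eq[OF l(1)] mult.commute exponential_density_eq)
    qed
  qed measurable
  moreover have "(\<integral>\<^sup>+z. ennreal (exp (l * XX (fst z) (snd z))) \<partial>exp_time p) = ennreal (?c / (?c - l) * G p l)"
  proof -
    have "(\<integral>\<^sup>+z. ennreal (exp (l * XX (fst z) (snd z))) \<partial>exp_time p) =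
       (\<integral>\<^sup>+z. (\<integral>\<^sup>+s. ennreal (exponential_density ?c s) * ennreal (exp (l * (s - DD (fst z) (snd z)))) \<partial>lborel) \<partial>exp_time p)"
      using SS_DD_nn_integral[OF p, of "\<lambda>(s, d). ennreal (exp (l * (s - d)))"] by (simp add: XX_eq)
    also have "\<dots> = (\<integral>\<^sup>+z. (\<integral>\<^sup>+s. ennreal (exp (- l * DD (fst z) (snd z))) * (ennreal (exponential_density ?c s) * ennreal (exp (l * s))) \<partial>lborel) \<partial>exp_time p)"
      by (intro nn_integral_cong) (simp add: ennreal_mult'[symmetric] exponential_density_nonneg' exp_diff exp_minus field_simps algebra_simps rate_pos[OF p])
    also have "\<dots> = (\<integral>\<^sup>+z. ennreal (exp (- l * DD (fst z) (snd z))) * ennreal (?c / (?c - l)) \<partial>exp_time p)"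
      by (simp add: nn_integral_cmult nn_integral_exponential_density_exp[OF rate_pos[OF p] l(2)])
    also have "\<dots> = (\<integral>\<^sup>+z. ennreal (exp (- l * DD (fst z) (snd z))) \<partial>exp_time p) * ennreal (?c / (?c - l))"
      by (rule nn_integral_multc) measurable
    also have "(\<integral>\<^sup>+z. ennreal (exp (- l * DD (fst z) (snd z))) \<partial>exp_time p) = ennreal (G p l)"
      unfolding G_def by (rule nn_integral_eq_integral[OF G_integrable[OF p l(1)]]) auto
    finally show ?thesis using l rate_pos[OF p] G_pos[OF p l(1)]
      by (simp add: ennreal_mult[symmetric] less_imp_le mult.commute)
  qed
  ultimately have *: "(\<integral>\<^sup>+t. ennreal (exponential_density p t) * ennreal (exp (\<psi> l * t)) \<partial>lborel) = ennreal (?c / (?c - l) * G p l)" by simp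
  show "\<psi> l < p"
  proof (rule ccontr)
    assume "\<not> \<psi> l < p"
    then show False using nn_integral_exponential_density_exp_infinite[OF p, of "\<psi> l"] * by simp
  qed
  then have "ennreal (p / (p - \<psi> l)) = ennreal (?c / (?c - l) * G p l)"
    using * nn_integral_exponential_density_exp[OF p] by simp
  then show "p / (p - \<psi> l) = ?c / (?c - l) * G p l" using r p \<open>\<psi> l < p\<close> by (simp add: ennreal_inj)
qed

lemma psi_below_rate':
  assumes p: "p > 0" and l: "l \<ge> 0" "l < rate p"
  shows "\<psi> l = p - p * (rate p - l) / (rate p * G p l)"
proof -
  have "p - \<psi> l > 0" "rate p - l > 0" "rate p > 0" "G p l > 0"
    using psi_below_rate(1)[OF assms] l rate_pos[OF p] G_pos[OF p l(1)] by auto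
  then have "p - \<psi> l = p * (rate p - l) / (rate p * G p l)"
    using psi_below_rate(2)[OF assms] by (simp add: field_simps)
  then show ?thesis by simp
qed

text \<open>The formula belonging to p yields only the left limit p of \<psi> at
  \<open>rate p\<close>. The formula for some p' with a larger rate is valid at that point itself
  and supplies left-continuity.\<close>

lemma psi_rate: assumes p: "p > 0" shows "\<psi> (rate p) = p"
proof -
  let ?c = "rate p"
  obtain p' where p': "p' > 0" "?c < rate p'" using rate_unbounded by blast
  have c: "?c > 0" by (rule rate_pos[OF p])
  have lims: "(G r \<longlongrightarrow> G r ?c) (at_left ?c)" if "r > 0" for r
  proof -
    have "(G r \<longlongrightarrow> G r ?c) (at ?c within {0..})" using G_cont[OF that] c by (auto simp: continuous_on_def)
    moreover have "at ?c within {0..} = at ?c" by (rule at_within_interior) (use c in auto)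
    ultimately show ?thesis by (metis filterlim_at_split)
  qed
  have ev: "\<forall>\<^sub>F l in at_left ?c. 0 \<le> l \<and> l < ?c"
    using c by (auto simp: eventually_at_left_field intro!: exI[of _ 0])
  have "((\<lambda>l. p' - p' * (rate p' - l) / (rate p' * G p' l)) \<longlongrightarrow> p' - p' * (rate p' - ?c) / (rate p' * G p' ?c)) (at_left ?c)"
    using G_pos[OF p'(1), of ?c] c rate_pos[OF p'(1)] by (intro tendsto_intros lims p') auto
  moreover have "\<forall>\<^sub>F l in at_left ?c. p' - p' * (rate p' - l) / (rate p' * G p' l) = \<psi> l"
    using ev by eventually_elim (use psi_below_rate'[OF p'(1)] p'(2) in auto)
  ultimately have 1: "(\<psi> \<longlongrightarrow> p' - p' * (rate p' - ?c) / (rate p' * G p' ?c)) (at_left ?c)"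
    by (rule Lim_transform_eventually)
  have "((\<lambda>l. p - p * (?c - l) / (?c * G p l)) \<longlongrightarrow> p - p * (?c - ?c) / (?c * G p ?c)) (at_left ?c)"
    using G_pos[OF p, of ?c] c by (intro tendsto_intros lims p) auto
  moreover have "\<forall>\<^sub>F l in at_left ?c. p - p * (?c - l) / (?c * G p l) = \<psi> l"
    using ev by eventually_elim (use psi_below_rate'[OF p] in auto)
  ultimately have 2: "(\<psi> \<longlongrightarrow> p - p * (?c - ?c) / (?c * G p ?c)) (at_left ?c)"
    by (rule Lim_transform_eventually)
  have "p' - p' * (rate p' - ?c) / (rate p' * G p' ?c) = p - p * (?c - ?c) / (?c * G p ?c)"
    by (rule tendsto_unique[OF _ 1 2]) simp
  then show ?thesis using psi_below_rate'[OF p'(1) less_imp_le[OF c] p'(2)] by simp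
qed

text \<open>Convexity of \<psi> together with its value 0 at 0: \<open>rate p\<close> is the
  fraction r < 1 of l, whence \<open>p \<le> r * \<psi> l\<close>.\<close>

lemma psi_above_rate: assumes p: "p > 0" and l: "l > rate p" shows "\<psi> l > p"
proof -
  let ?c = "rate p"
  have c: "?c > 0" by (rule rate_pos[OF p])
  define r where "r = ?c / l"
  have r: "0 < r" "r < 1" "r * l = ?c" using c l by (auto simp: r_def)
  have E: "expectation (\<lambda>\<omega>. exp (?c * X 1 \<omega>)) = exp p" "expectation (\<lambda>\<omega>. exp (l * X 1 \<omega>)) = exp (\<psi> l)"
    using mgf_eq[of ?c 1] mgf_eq[of l 1] psi_rate[OF p] c l by (auto simp: mgf_def)
  have i: "integrable M (\<lambda>\<omega>. exp (?c * X 1 \<omega>))" "integrable M (\<lambda>\<omega>. exp (l * X 1 \<omega>))"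
    using exp_X_integrable c l by auto
  \<comment> \<open>Convexity of exp between \<open>l * X 1 \<omega> - \<psi> l\<close> and 0 with
    weights r and 1 - r; subtracting \<open>\<psi> l\<close> normalises the right-hand side to
    expectation 1.\<close>
  have "expectation (\<lambda>\<omega>. exp (- r * \<psi> l) * exp (?c * X 1 \<omega>)) \<le> expectation (\<lambda>\<omega>. r * (exp (- \<psi> l) * exp (l * X 1 \<omega>)) + (1 - r))"
  proof (rule Bochner_Integration.integral_mono)
    fix \<omega>
    have "exp ((1 - (1 - r)) *\<^sub>R (l * X 1 \<omega> - \<psi> l) + (1 - r) *\<^sub>R 0) \<le> (1 - (1 - r)) * exp (l * X 1 \<omega> - \<psi> l) + (1 - r) * exp 0"
      using convex_onD[OF exp_convex, of "1 - r" "l * X 1 \<omega> - \<psi> l" 0] r by auto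
    then have "exp (r * (l * X 1 \<omega> - \<psi> l)) \<le> r * exp (l * X 1 \<omega> - \<psi> l) + (1 - r)" by simp
    moreover have "exp (r * (l * X 1 \<omega> - \<psi> l)) = exp (- r * \<psi> l) * exp (?c * X 1 \<omega>)"
      unfolding exp_add[symmetric] r(3)[symmetric] by (simp add: algebra_simps)
    moreover have "exp (l * X 1 \<omega> - \<psi> l) = exp (- \<psi> l) * exp (l * X 1 \<omega>)"
      unfolding exp_add[symmetric] by (simp add: algebra_simps)
    ultimately show "exp (- r * \<psi> l) * exp (?c * X 1 \<omega>) \<le> r * (exp (- \<psi> l) * exp (l * X 1 \<omega>)) + (1 - r)" by simp
  qed (use i in auto)
  then have "exp (- r * \<psi> l) * exp p \<le> r * (exp (- \<psi> l) * exp (\<psi> l)) + (1 - r)" using i by (simp add: E prob_space)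
  then have "exp (p - r * \<psi> l) \<le> 1" by (simp add: exp_add[symmetric] algebra_simps)
  then have "p \<le> r * \<psi> l" by simp
  then have "0 < r * \<psi> l" using p by linarith
  then have "\<psi> l > 0" using r(1) by (simp add: zero_less_mult_iff)
  then have "r * \<psi> l < 1 * \<psi> l" using r by (intro mult_strict_right_mono) auto
  then show ?thesis using \<open>p \<le> r * \<psi> l\<close> by simp
qed

lemma Phi_eq_rate: assumes p: "p > 0" shows "levy_Phi M X p = rate p"
proof -
  have "{l. l \<ge> 0 \<and> \<psi> l = p} = {rate p}"
  proof (intro equalityI subsetI)
    fix l assume "l \<in> {l. l \<ge> 0 \<and> \<psi> l = p}"
    then have "l \<ge> 0" "\<psi> l = p" by auto
    then show "l \<in> {rate p}" using psi_below_rate(1)[OF p, of l] psi_above_rate[OF p, of l] by force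
  qed (use psi_rate[OF p] rate_pos[OF p] in auto)
  then show ?thesis unfolding levy_Phi_def by simp
qed

text \<open>Shows that each l above one rate is itself a rate, namely of the parameter
  \<open>\<psi> l\<close>; through this \<open>G_above_rate\<close> reaches all such l.\<close>

lemma rate_psi: assumes "p > 0" "l > rate p" shows "rate (\<psi> l) = l"
proof -
  have pos: "\<psi> l > 0" "l \<ge> 0" using psi_above_rate[OF assms] assms rate_pos[OF assms(1)] by auto
  show ?thesis using psi_below_rate(1)[OF pos(1), of l] psi_above_rate[OF pos(1), of l] pos by force
qed

end

section \<open>The Laplace exponent above the rate and its derivative\<close>

lemma nn_integral_exp_conv:
  fixes c d v :: real
  assumes c: "c > 0" and cd: "c \<noteq> d" and v: "v \<ge> 0"
  shows "(\<integral>\<^sup>+r. ennreal (exponential_density c r) * (indicator {..v} r * ennreal (exp (- d * (v - r)))) \<partial>lborel)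
    = ennreal (c * (exp (- c * v) - exp (- d * v)) / (d - c))"
proof -
  let ?F = "\<lambda>r. c * exp (- d * v) * exp ((d - c) * r) / (d - c)"
  have "(\<integral>\<^sup>+r. ennreal (exponential_density c r) * (indicator {..v} r * ennreal (exp (- d * (v - r)))) \<partial>lborel)
      = (\<integral>\<^sup>+r. ennreal (c * exp (- d * v) * exp ((d - c) * r)) * indicator {0..v} r \<partial>lborel)"
  proof (rule nn_integral_cong)
    fix r
    have "exp (- c * r) * exp (- d * (v - r)) = exp (- d * v) * exp ((d - c) * r)"
      unfolding exp_add[symmetric] by (simp add: algebra_simps)
    then show "ennreal (exponential_density c r) * (indicator {..v} r * ennreal (exp (- d * (v - r)))) =
        ennreal (c * exp (- d * v) * exp ((d - c) * r)) * indicator {0..v} r"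
      using c by (auto simp: exponential_density_eq indicator_def ennreal_mult[symmetric] mult.assoc)
  qed
  also have "\<dots> = ennreal (?F v - ?F 0)"
  proof (rule nn_integral_FTC_Icc[OF _ _ _ v])
    fix r
    have "((\<lambda>r. (c * exp (- d * v) / (d - c)) * exp ((d - c) * r)) has_real_derivative
        (c * exp (- d * v) / (d - c)) * (exp ((d - c) * r) * (d - c))) (at r)"
      by (auto intro!: derivative_eq_intros)
    then show "(?F has_real_derivative c * exp (- d * v) * exp ((d - c) * r)) (at r)"
      using cd by (simp add: mult.assoc)
  qed (use c in auto)
  also have "?F v - ?F 0 = c * (exp (- c * v) - exp (- d * v)) / (d - c)"
  proof -
    have "exp (- d * v) * exp ((d - c) * v) = exp (- c * v)"
      unfolding exp_add[symmetric] by (simp add: algebra_simps)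
    then show ?thesis by (simp add: diff_divide_distrib[symmetric] right_diff_distrib mult.assoc)
  qed
  finally show ?thesis .
qed

context sn_levy
begin

lemma nn_surv: 
  assumes p: "p > 0" and v: "v \<ge> 0"
  shows "(\<integral>\<^sup>+z. indicator {v<..} (SS (fst z) (snd z)) \<partial>exp_time p) = ennreal (exp (- rate p * v))"
proof -
  interpret N: prob_space "exp_time p" by (rule prob_space_exp_time[OF p])
  have "(\<integral>\<^sup>+z. ennreal (indicator {v<..} (SS (fst z) (snd z))) \<partial>exp_time p) = ennreal (surv p v)"
    unfolding surv_def by (rule nn_integral_eq_integral) (auto intro!: N.integrable_const_bound[where B=1])
  then show ?thesis using surv_eq[OF p v] by (simp add: ennreal_indicator)
qed

lemma run_sup_restart:
  assumes \<omega>: "\<omega> \<in> space M" "\<omega>' \<in> space M" and r: "r \<ge> 0" and t: "t \<ge> 0"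
  shows "run_sup (restart r (\<omega>, \<omega>')) 0 (r + t) = max (SS r \<omega>) (XX r \<omega> + SS t \<omega>')"
proof (rule antisym)
  have sn: "sn_path (restart r (\<omega>, \<omega>'))" by (rule sn_path_restart[OF \<omega> r])
  show "run_sup (restart r (\<omega>, \<omega>')) 0 (r + t) \<le> max (SS r \<omega>) (XX r \<omega> + SS t \<omega>')"
  proof (rule run_sup_least)
    fix u assume u: "0 \<le> u" "u \<le> r + t"
    show "restart r (\<omega>, \<omega>') u \<le> max (SS r \<omega>) (XX r \<omega> + SS t \<omega>')"
    proof (cases "u \<le> r")
      case True
      then have "X u \<omega> \<le> SS r \<omega>" using run_sup_upper[OF sn_path_X[OF \<omega>(1)], of 0 u r] u r by (simp add: SS_def)
      then show ?thesis using True by (simp add: restart_before)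
    next
      case False
      then have "X (u - r) \<omega>' \<le> SS t \<omega>'" using run_sup_upper[OF sn_path_X[OF \<omega>(2)], of 0 "u - r" t] u t by (simp add: SS_def)
      then show ?thesis using False r restart_after[OF \<omega>, of "u - r" r] by (simp add: XX_def)
    qed
  qed (use r t in simp)
  have "SS r \<omega> \<le> run_sup (restart r (\<omega>, \<omega>')) 0 (r + t)"
    unfolding SS_def
  proof (rule run_sup_least)
    fix u assume u: "0 \<le> u" "u \<le> max 0 r"
    then show "X u \<omega> \<le> run_sup (restart r (\<omega>, \<omega>')) 0 (r + t)"
      using run_sup_upper[OF sn, of 0 u "r + t"] r t by (simp add: restart_before)
  qed simp
  moreover have "SS t \<omega>' \<le> run_sup (restart r (\<omega>, \<omega>')) 0 (r + t) - XX r \<omega>"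
    unfolding SS_def
  proof (rule run_sup_least)
    fix u assume u: "0 \<le> u" "u \<le> max 0 t"
    then show "X u \<omega>' \<le> run_sup (restart r (\<omega>, \<omega>')) 0 (r + t) - XX r \<omega>"
      using run_sup_upper[OF sn, of 0 "r + u" "r + t"] r t restart_after[OF \<omega> u(1), of r] by (simp add: XX_def)
  qed simp
  ultimately show "max (SS r \<omega>) (XX r \<omega> + SS t \<omega>') \<le> run_sup (restart r (\<omega>, \<omega>')) 0 (r + t)" by simp
qed

text \<open>The supremum over the sum of two independent exponential times with rates p and q is computed
  in two ways: from the density of the sum, and by splitting the path at the first time.\<close>

lemma G_above_rate:
  assumes p: "p > 0" and pq: "p < q"
  shows "G p (rate q) = p * (rate q - rate p) / (rate p * (q - p))"
proof -
  let ?c = "rate p" and ?d = "rate q"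
  have q: "q > 0" using p pq by simp
  have c: "?c > 0" and d: "?d > 0" using rate_pos p q by auto
  have cd: "?c < ?d"
  proof (rule ccontr)
    assume "\<not> ?c < ?d"
    then have "?d < ?c \<or> ?d = ?c" by auto
    then show False using psi_below_rate(1)[OF p, of ?d] psi_rate[OF q] psi_rate[OF p] d pq by auto
  qed
  interpret Np: prob_space "exp_time p" by (rule prob_space_exp_time[OF p])
  interpret Nq: prob_space "exp_time q" by (rule prob_space_exp_time[OF q])
  define h where "h v = (\<integral>\<^sup>+\<omega>. indicator {1<..} (SS v \<omega>) \<partial>M)" for v
  have [measurable]: "h \<in> borel_measurable borel" unfolding h_def by measurable
  \<comment> \<open>The probability that the supremum over the sum of the two exponential times
    exceeds the level 1.\<close>
  define I where "I = (\<integral>\<^sup>+r. ennreal (exponential_density p r) * (\<integral>\<^sup>+t. ennreal (exponential_density q t) * h (r + t) \<partial>lborel) \<partial>lborel)"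
  have hs: "(\<integral>\<^sup>+v. ennreal (exponential_density r v) * h v \<partial>lborel) = ennreal (exp (- rate r))" if "r > 0" for r
    using exp_time_nn_integral[OF that, of "\<lambda>z. indicator {1<..} (SS (fst z) (snd z))"] nn_surv[OF that, of 1]
    by (simp add: h_def)
  \<comment> \<open>The density of the sum is a difference of multiples of the two exponential
    densities; the negative term is moved to the left so that the identity holds in the extended
    nonnegative reals.\<close>
  have "ennreal (q - p) * I + ennreal p * ennreal (exp (- ?d)) = ennreal q * ennreal (exp (- ?c))"
  proof -
    have "I = (\<integral>\<^sup>+r. (\<integral>\<^sup>+v. ennreal (exponential_density p r) * (ennreal (exponential_density q (v - r)) * h v) \<partial>lborel) \<partial>lborel)"
      unfolding I_def
    proof (rule nn_integral_cong)
      fix r :: real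
      have "(\<integral>\<^sup>+t. ennreal (exponential_density q t) * h (r + t) \<partial>lborel) = (\<integral>\<^sup>+v. ennreal (exponential_density q (v - r)) * h v \<partial>lborel)"
        by (subst nn_integral_real_affine[where c=1 and t="-r"]) auto
      then show "ennreal (exponential_density p r) * (\<integral>\<^sup>+t. ennreal (exponential_density q t) * h (r + t) \<partial>lborel) =
          (\<integral>\<^sup>+v. ennreal (exponential_density p r) * (ennreal (exponential_density q (v - r)) * h v) \<partial>lborel)"
        by (simp add: nn_integral_cmult)
    qed
    also have "\<dots> = (\<integral>\<^sup>+v. (\<integral>\<^sup>+r. ennreal (exponential_density p r) * (ennreal (exponential_density q (v - r)) * h v) \<partial>lborel) \<partial>lborel)"
      by (rule lborel_pair.Fubini') measurable
    also have "\<dots> = (\<integral>\<^sup>+v. ennreal (if v < 0 then 0 else p * q * (exp (- p * v) - exp (- q * v)) / (q - p)) * h v \<partial>lborel)"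
    proof (rule nn_integral_cong)
      fix v :: real
      have "(\<integral>\<^sup>+r. ennreal (exponential_density p r) * (ennreal (exponential_density q (v - r)) * h v) \<partial>lborel)
        = (\<integral>\<^sup>+r. (ennreal q * h v) * (ennreal (exponential_density p r) * (indicator {..v} r * ennreal (exp (- q * (v - r))))) \<partial>lborel)"
        using q by (intro nn_integral_cong) (auto simp: exponential_density_eq[of q] indicator_def ennreal_mult mult_ac)
      also have "\<dots> = (ennreal q * h v) * (\<integral>\<^sup>+r. ennreal (exponential_density p r) * (indicator {..v} r * ennreal (exp (- q * (v - r)))) \<partial>lborel)"
        by (rule nn_integral_cmult) measurable
      also have "\<dots> = ennreal (if v < 0 then 0 else p * q * (exp (- p * v) - exp (- q * v)) / (q - p)) * h v"
      proof (cases "v < 0")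
        case True
        have "(\<integral>\<^sup>+r. ennreal (exponential_density p r) * (indicator {..v} r * ennreal (exp (- q * (v - r)))) \<partial>lborel) = (\<integral>\<^sup>+r. 0 \<partial>(lborel :: real measure))"
          by (rule nn_integral_cong) (use True in \<open>auto simp: exponential_density_eq indicator_def\<close>)
        then show ?thesis using True by simp
      next
        case False
        have "0 \<le> exp (- p * v) - exp (- q * v)" using pq False by (auto intro: mult_right_mono)
        then have K: "0 \<le> p * (exp (- p * v) - exp (- q * v)) / (q - p)" using p pq by simp
        have J: "(\<integral>\<^sup>+r. ennreal (exponential_density p r) * (indicator {..v} r * ennreal (exp (- q * (v - r)))) \<partial>lborel)
            = ennreal (p * (exp (- p * v) - exp (- q * v)) / (q - p))"
          by (rule nn_integral_exp_conv) (use p pq False in auto)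
        have qK: "p * q * (exp (- p * v) - exp (- q * v)) / (q - p) = q * (p * (exp (- p * v) - exp (- q * v)) / (q - p))" by simp
        show ?thesis unfolding J if_not_P[OF False] qK ennreal_mult[OF less_imp_le[OF q] K] by (simp only: mult_ac)
      qed
      finally show "(\<integral>\<^sup>+r. ennreal (exponential_density p r) * (ennreal (exponential_density q (v - r)) * h v) \<partial>lborel)
        = ennreal (if v < 0 then 0 else p * q * (exp (- p * v) - exp (- q * v)) / (q - p)) * h v" .
    qed
    finally have I: "I = (\<integral>\<^sup>+v. ennreal (if v < 0 then 0 else p * q * (exp (- p * v) - exp (- q * v)) / (q - p)) * h v \<partial>lborel)" .
    have "ennreal (q - p) * I + ennreal p * ennreal (exp (- ?d)) =
        (\<integral>\<^sup>+v. ennreal (q - p) * (ennreal (if v < 0 then 0 else p * q * (exp (- p * v) - exp (- q * v)) / (q - p)) * h v)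
            + ennreal p * (ennreal (exponential_density q v) * h v) \<partial>lborel)"
      unfolding I hs[OF q, symmetric] by (simp add: nn_integral_add nn_integral_cmult)
    also have "\<dots> = (\<integral>\<^sup>+v. ennreal q * (ennreal (exponential_density p v) * h v) \<partial>lborel)"
    proof (rule nn_integral_cong)
      fix v :: real
      have "ennreal (q - p) * ennreal (if v < 0 then 0 else p * q * (exp (- p * v) - exp (- q * v)) / (q - p))
            + ennreal p * ennreal (exponential_density q v) = ennreal q * ennreal (exponential_density p v)"
      proof (cases "v < 0")
        case False
        have e: "0 \<le> exp (- p * v) - exp (- q * v)" using pq False by (auto intro: mult_right_mono)
        have "ennreal (q - p) * ennreal (p * q * (exp (- p * v) - exp (- q * v)) / (q - p)) + ennreal p * ennreal (q * exp (- q * v))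
          = ennreal (p * q * (exp (- p * v) - exp (- q * v)) + p * (q * exp (- q * v)))"
          using p q pq e by (simp add: ennreal_mult'[symmetric] ennreal_plus[symmetric] del: ennreal_plus)
        also have "p * q * (exp (- p * v) - exp (- q * v)) + p * (q * exp (- q * v)) = q * (p * exp (- p * v))"
          by (simp add: algebra_simps)
        finally show ?thesis using False p q by (simp add: exponential_density_eq ennreal_mult)
      qed (simp add: exponential_density_eq)
      then show "ennreal (q - p) * (ennreal (if v < 0 then 0 else p * q * (exp (- p * v) - exp (- q * v)) / (q - p)) * h v)
            + ennreal p * (ennreal (exponential_density q v) * h v) = ennreal q * (ennreal (exponential_density p v) * h v)"
        by (metis distrib_right mult.assoc)
    qed
    also have "\<dots> = ennreal q * ennreal (exp (- ?c))" using hs[OF p] by (simp add: nn_integral_cmult)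
    finally show ?thesis .
  qed
  moreover have "I = ennreal (exp (- ?c) + ?c * (exp (- ?c) - exp (- ?d)) / (?d - ?c) * G p ?d)"
  proof -
    \<comment> \<open>Given S = s and D = \<delta> at the first time, the level is either already
      exceeded or must be exceeded by a supremum of rate \<open>rate q\<close> from a distance of 1
      - s + \<delta>.\<close>
    let ?k = "\<lambda>(s, \<delta>). indicator {1<..} s + indicator {..1} s * ennreal (exp (- ?d * (1 - s + \<delta>)))"
    have hrt: "h (r + t) = (\<integral>\<^sup>+\<omega>. (\<integral>\<^sup>+\<omega>'. indicator {1<..} (max (SS r \<omega>) (XX r \<omega> + SS t \<omega>')) \<partial>M) \<partial>M)" if "r \<ge> 0" "t \<ge> 0" for r t
    proof -
      let ?F = "\<lambda>w. indicator {1<..} (path_sup w 0 (r + t)) :: ennreal"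
      have "h (r + t) = (\<integral>\<^sup>+\<omega>. ?F (path \<omega>) \<partial>M)" unfolding h_def SS_def
        by (rule nn_integral_cong) (use that in \<open>simp add: path_sup_eq[OF sn_path_X]\<close>)
      also have "\<dots> = (\<integral>\<^sup>+\<omega>. \<integral>\<^sup>+\<omega>'. ?F (restrict (restart r (\<omega>, \<omega>')) {0..}) \<partial>M \<partial>M)"
        by (rule markov_nn) (use that in auto)
      also have "\<dots> = (\<integral>\<^sup>+\<omega>. (\<integral>\<^sup>+\<omega>'. indicator {1<..} (max (SS r \<omega>) (XX r \<omega> + SS t \<omega>')) \<partial>M) \<partial>M)"
        by (intro nn_integral_cong) (use that in \<open>simp add: path_sup_eq[OF sn_path_restart] run_sup_restart\<close>)
      finally show ?thesis .
    qed
    have "I = (\<integral>\<^sup>+r. ennreal (exponential_density p r) * (\<integral>\<^sup>+t. ennreal (exponential_density q t) *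
        (\<integral>\<^sup>+\<omega>. (\<integral>\<^sup>+\<omega>'. indicator {1<..} (max (SS r \<omega>) (XX r \<omega> + SS t \<omega>')) \<partial>M) \<partial>M) \<partial>lborel) \<partial>lborel)"
      unfolding I_def
    proof (rule nn_integral_cong)
      fix r :: real
      show "ennreal (exponential_density p r) * (\<integral>\<^sup>+t. ennreal (exponential_density q t) * h (r + t) \<partial>lborel) =
         ennreal (exponential_density p r) * (\<integral>\<^sup>+t. ennreal (exponential_density q t) *
        (\<integral>\<^sup>+\<omega>. (\<integral>\<^sup>+\<omega>'. indicator {1<..} (max (SS r \<omega>) (XX r \<omega> + SS t \<omega>')) \<partial>M) \<partial>M) \<partial>lborel)"
      proof (cases "r < 0")
        case False
        have "(\<integral>\<^sup>+t. ennreal (exponential_density q t) * h (r + t) \<partial>lborel) = (\<integral>\<^sup>+t. ennreal (exponential_density q t) *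
          (\<integral>\<^sup>+\<omega>. (\<integral>\<^sup>+\<omega>'. indicator {1<..} (max (SS r \<omega>) (XX r \<omega> + SS t \<omega>')) \<partial>M) \<partial>M) \<partial>lborel)"
        proof (rule nn_integral_cong)
          fix t :: real
          show "ennreal (exponential_density q t) * h (r + t) = ennreal (exponential_density q t) *
          (\<integral>\<^sup>+\<omega>. (\<integral>\<^sup>+\<omega>'. indicator {1<..} (max (SS r \<omega>) (XX r \<omega> + SS t \<omega>')) \<partial>M) \<partial>M)"
            using False hrt[of r t] by (cases "t < 0") (auto simp: exponential_density_eq)
        qed
        then show ?thesis by simp
      qed (simp add: exponential_density_eq)
    qed
    also have "\<dots> = (\<integral>\<^sup>+r. ennreal (exponential_density p r) * (\<integral>\<^sup>+\<omega>. (\<integral>\<^sup>+t. ennreal (exponential_density q t) *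
        (\<integral>\<^sup>+\<omega>'. indicator {1<..} (max (SS r \<omega>) (XX r \<omega> + SS t \<omega>')) \<partial>M) \<partial>lborel) \<partial>M) \<partial>lborel)"
    proof (rule nn_integral_cong)
      fix r :: real
      interpret LM: pair_sigma_finite M lborel ..
      have "(\<integral>\<^sup>+t. ennreal (exponential_density q t) * (\<integral>\<^sup>+\<omega>. (\<integral>\<^sup>+\<omega>'. indicator {1<..} (max (SS r \<omega>) (XX r \<omega> + SS t \<omega>')) \<partial>M) \<partial>M) \<partial>lborel)
        = (\<integral>\<^sup>+t. (\<integral>\<^sup>+\<omega>. ennreal (exponential_density q t) * (\<integral>\<^sup>+\<omega>'. indicator {1<..} (max (SS r \<omega>) (XX r \<omega> + SS t \<omega>')) \<partial>M) \<partial>M) \<partial>lborel)"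
        by (simp add: nn_integral_cmult)
      also have "\<dots> = (\<integral>\<^sup>+\<omega>. (\<integral>\<^sup>+t. ennreal (exponential_density q t) * (\<integral>\<^sup>+\<omega>'. indicator {1<..} (max (SS r \<omega>) (XX r \<omega> + SS t \<omega>')) \<partial>M) \<partial>lborel) \<partial>M)"
        by (rule LM.Fubini') measurable
      finally show "ennreal (exponential_density p r) * (\<integral>\<^sup>+t. ennreal (exponential_density q t) *
        (\<integral>\<^sup>+\<omega>. (\<integral>\<^sup>+\<omega>'. indicator {1<..} (max (SS r \<omega>) (XX r \<omega> + SS t \<omega>')) \<partial>M) \<partial>M) \<partial>lborel) =
        ennreal (exponential_density p r) * (\<integral>\<^sup>+\<omega>. (\<integral>\<^sup>+t. ennreal (exponential_density q t) *
        (\<integral>\<^sup>+\<omega>'. indicator {1<..} (max (SS r \<omega>) (XX r \<omega> + SS t \<omega>')) \<partial>M) \<partial>lborel) \<partial>M)" by simp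
    qed
    also have "\<dots> = (\<integral>\<^sup>+r. ennreal (exponential_density p r) * (\<integral>\<^sup>+\<omega>. ?k (SS r \<omega>, DD r \<omega>) \<partial>M) \<partial>lborel)"
    proof (rule nn_integral_cong, rule arg_cong2[where f="(*)", OF refl], rule nn_integral_cong)
      fix r \<omega> assume \<omega>: "\<omega> \<in> space M"
      have "(\<integral>\<^sup>+t. ennreal (exponential_density q t) * (\<integral>\<^sup>+\<omega>'. indicator {1<..} (max (SS r \<omega>) (XX r \<omega> + SS t \<omega>')) \<partial>M) \<partial>lborel)
        = (\<integral>\<^sup>+z. indicator {1<..} (max (SS r \<omega>) (XX r \<omega> + SS (fst z) (snd z))) \<partial>exp_time q)"
        by (subst exp_time_nn_integral[OF q]) auto
      also have "\<dots> = ?k (SS r \<omega>, DD r \<omega>)"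
      proof (cases "SS r \<omega> > 1")
        case True
        then show ?thesis by (simp add: less_max_iff_disj Nq.emeasure_space_1)
      next
        case False
        have "0 \<le> 1 - SS r \<omega> + DD r \<omega>" using False DD_nonneg[OF \<omega>, of r] by simp
        from nn_surv[OF q this]
        have "(\<integral>\<^sup>+z. indicator {1 - SS r \<omega> + DD r \<omega><..} (SS (fst z) (snd z)) \<partial>exp_time q) = ennreal (exp (- ?d * (1 - SS r \<omega> + DD r \<omega>)))" .
        moreover have "indicator {1<..} (max (SS r \<omega>) (XX r \<omega> + s)) = (indicator {1 - SS r \<omega> + DD r \<omega><..} s :: ennreal)" for s
          using False by (auto simp: XX_eq indicator_def)
        ultimately show ?thesis using False by simp
      qed
      finally show "(\<integral>\<^sup>+t. ennreal (exponential_density q t) * (\<integral>\<^sup>+\<omega>'. indicator {1<..} (max (SS r \<omega>) (XX r \<omega> + SS t \<omega>')) \<partial>M) \<partial>lborel) = ?k (SS r \<omega>, DD r \<omega>)" .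
    qed
    also have "\<dots> = (\<integral>\<^sup>+z. ?k (SS (fst z) (snd z), DD (fst z) (snd z)) \<partial>exp_time p)"
      by (subst exp_time_nn_integral[OF p]) auto
    also have "\<dots> = (\<integral>\<^sup>+z. (\<integral>\<^sup>+s. ennreal (exponential_density ?c s) * ?k (s, DD (fst z) (snd z)) \<partial>lborel) \<partial>exp_time p)"
      by (rule SS_DD_nn_integral[OF p]) measurable
    also have "\<dots> = (\<integral>\<^sup>+z. ennreal (exp (- ?c)) + ennreal (exp (- ?d * DD (fst z) (snd z))) * ennreal (?c * (exp (- ?c) - exp (- ?d)) / (?d - ?c)) \<partial>exp_time p)"
    proof (rule nn_integral_cong)
      fix z
      let ?D = "DD (fst z) (snd z)"
      have "(\<integral>\<^sup>+s. ennreal (exponential_density ?c s) * ?k (s, ?D) \<partial>lborel) =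
        (\<integral>\<^sup>+s. ennreal (exponential_density ?c s) * indicator {1<..} s + ennreal (exp (- ?d * ?D)) * (ennreal (exponential_density ?c s) * (indicator {..1} s * ennreal (exp (- ?d * (1 - s))))) \<partial>lborel)"
      proof (rule nn_integral_cong)
        fix s :: real
        have "exp (- ?d * (1 - s + ?D)) = exp (- ?d * ?D) * exp (- ?d * (1 - s))"
          unfolding exp_add[symmetric] by (simp add: algebra_simps)
        then show "ennreal (exponential_density ?c s) * ?k (s, ?D) = ennreal (exponential_density ?c s) * indicator {1<..} s + ennreal (exp (- ?d * ?D)) * (ennreal (exponential_density ?c s) * (indicator {..1} s * ennreal (exp (- ?d * (1 - s)))))"
          by (simp add: ennreal_mult distrib_left mult_ac)
      qed
      also have "\<dots> = (\<integral>\<^sup>+s. ennreal (exponential_density ?c s) * indicator {1<..} s \<partial>lborel) + ennreal (exp (- ?d * ?D)) * (\<integral>\<^sup>+s. ennreal (exponential_density ?c s) * (indicator {..1} s * ennreal (exp (- ?d * (1 - s)))) \<partial>lborel)"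
        by (simp add: nn_integral_add nn_integral_cmult)
      also have "(\<integral>\<^sup>+s. ennreal (exponential_density ?c s) * (indicator {..1} s * ennreal (exp (- ?d * (1 - s)))) \<partial>lborel) = ennreal (?c * (exp (- ?c) - exp (- ?d)) / (?d - ?c))"
        using nn_integral_exp_conv[OF c, of ?d 1] cd by simp
      also have "(\<integral>\<^sup>+s. ennreal (exponential_density ?c s) * indicator {1<..} s \<partial>lborel) = ennreal (exp (- ?c))"
      proof -
        have "integrable lborel (\<lambda>t. if 1 < t then ?c * exp (- ?c * t) else 0)"
          using integral_exp_after[OF c, of 1] not_integrable_integral_eq by fastforce
        then have "(\<integral>\<^sup>+t. ennreal (if 1 < t then ?c * exp (- ?c * t) else 0) \<partial>lborel) = ennreal (exp (- ?c))"
          using integral_exp_after[OF c, of 1] c by (subst nn_integral_eq_integral) auto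
        moreover have "ennreal (exponential_density ?c s) * indicator {1<..} s = ennreal (if 1 < s then ?c * exp (- ?c * s) else 0)" for s
          by (auto simp: exponential_density_eq)
        ultimately show ?thesis by simp
      qed
      finally show "(\<integral>\<^sup>+s. ennreal (exponential_density ?c s) * ?k (s, ?D) \<partial>lborel) = ennreal (exp (- ?c)) + ennreal (exp (- ?d * ?D)) * ennreal (?c * (exp (- ?c) - exp (- ?d)) / (?d - ?c))" .
    qed
    also have "\<dots> = ennreal (exp (- ?c)) + (\<integral>\<^sup>+z. ennreal (exp (- ?d * DD (fst z) (snd z))) \<partial>exp_time p) * ennreal (?c * (exp (- ?c) - exp (- ?d)) / (?d - ?c))"
      by (simp add: nn_integral_add nn_integral_multc Np.emeasure_space_1)
    also have "(\<integral>\<^sup>+z. ennreal (exp (- ?d * DD (fst z) (snd z))) \<partial>exp_time p) = ennreal (G p ?d)"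
      unfolding G_def by (rule nn_integral_eq_integral[OF G_integrable[OF p less_imp_le[OF d]]]) auto
    finally show ?thesis
      using c cd G_pos[OF p less_imp_le[OF d]]
      by (simp add: ennreal_mult[symmetric] ennreal_plus[symmetric] less_imp_le mult.commute del: ennreal_plus)
  qed
  ultimately have eq: "(q - p) * (exp (- ?c) + ?c * (exp (- ?c) - exp (- ?d)) / (?d - ?c) * G p ?d) + p * exp (- ?d) = q * exp (- ?c)"
  proof -
    let ?I = "exp (- ?c) + ?c * (exp (- ?c) - exp (- ?d)) / (?d - ?c) * G p ?d"
    assume *: "ennreal (q - p) * I + ennreal p * ennreal (exp (- ?d)) = ennreal q * ennreal (exp (- ?c))" and I: "I = ennreal ?I"
    have "0 \<le> ?I" using c cd G_pos[OF p less_imp_le[OF d]] by (intro add_nonneg_nonneg mult_nonneg_nonneg divide_nonneg_nonneg) auto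
    then have "ennreal ((q - p) * ?I + p * exp (- ?d)) = ennreal (q * exp (- ?c))"
      using * pq p q unfolding I by (simp add: ennreal_mult[symmetric] ennreal_plus[symmetric] del: ennreal_plus)
    moreover have "0 \<le> (q - p) * ?I + p * exp (- ?d)" using p pq
      by (intro add_nonneg_nonneg mult_nonneg_nonneg[OF _ \<open>0 \<le> ?I\<close>]) auto
    ultimately show ?thesis using q by (subst (asm) ennreal_inj) auto
  qed
  define E where "E = exp (- ?c) - exp (- ?d)"
  have E: "E > 0" using cd by (simp add: E_def)
  have "(q - p) * (?c * E / (?d - ?c) * G p ?d) = p * E"
    using eq unfolding E_def[symmetric] by (simp add: E_def algebra_simps)
  then have "(q - p) * ?c * G p ?d * E = p * (?d - ?c) * E" using cd by (simp add: field_simps)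
  then have "(q - p) * ?c * G p ?d = p * (?d - ?c)" using E by simp
  then show ?thesis using pq c by (simp add: field_simps)
qed

text \<open>One formula on both sides of the rate: below it from \<open>psi_below_rate'\<close>,
  above it from \<open>G_above_rate\<close> with q replaced by \<open>\<psi> l\<close>.\<close>

lemma psi_eq:
  assumes p: "p > 0" and l: "l \<ge> 0" "l \<noteq> rate p"
  shows "(\<psi> l - p) / (l - rate p) = p / (rate p * G p l)"
proof (cases "l < rate p")
  case True
  have "\<psi> l - p = - (p * (rate p - l) / (rate p * G p l))" using psi_below_rate'[OF p l(1) True] by simp
  also have "\<dots> = p / (rate p * G p l) * (l - rate p)"
    by (simp add: right_diff_distrib diff_divide_distrib)
  finally show ?thesis using l by simp
next
  case False
  then have gt: "l > rate p" using l by simp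
  have \<psi>: "\<psi> l > p" by (rule psi_above_rate[OF p gt])
  have "G p l = p * (l - rate p) / (rate p * (\<psi> l - p))"
    using G_above_rate[OF p \<psi>] rate_psi[OF p gt] by simp
  then have "rate p * G p l = p * (l - rate p) / (\<psi> l - p)" using rate_pos[OF p] by simp
  then show ?thesis using p by simp
qed

text \<open>By \<open>psi_eq\<close> the difference quotient of \<psi> at the rate is an expression
  in \<open>G p\<close>, whose continuity gives the limit.\<close>

lemma deriv_psi: assumes p: "p > 0" shows "deriv \<psi> (rate p) = p / (rate p * G p (rate p))"
proof (rule DERIV_imp_deriv)
  let ?c = "rate p"
  have c: "?c > 0" by (rule rate_pos[OF p])
  have "(G p \<longlongrightarrow> G p ?c) (at ?c within {0..})" using G_cont[OF p] c by (auto simp: continuous_on_def)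
  moreover have "at ?c within {0..} = at ?c" by (rule at_within_interior) (use c in auto)
  ultimately have "((\<lambda>l. p / (?c * G p l)) \<longlongrightarrow> p / (?c * G p ?c)) (at ?c)"
    using c G_pos[OF p, of ?c] by (intro tendsto_intros) auto
  moreover have "\<forall>\<^sub>F l in at ?c. p / (?c * G p l) = (\<psi> l - \<psi> ?c) / (l - ?c)"
  proof -
    have "\<forall>\<^sub>F l in at ?c. l > 0" using order_tendstoD(1)[OF tendsto_ident_at c] .
    moreover have "\<forall>\<^sub>F l in at ?c. l \<noteq> ?c" by (rule eventually_neq_at_within)
    ultimately show ?thesis by eventually_elim (use psi_eq[OF p] psi_rate[OF p] in auto)
  qed
  ultimately show "(\<psi> has_field_derivative p / (?c * G p ?c)) (at ?c)"
    unfolding has_field_derivative_iff by (rule Lim_transform_eventually)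
qed

end

section \<open>The scale function and the resolvent density\<close>

context sn_levy
begin

text \<open>At the exponential time X = S - D with S exponential and independent of D; \<open>p * res_dens p\<close>
  is the resulting density of X.\<close>

definition res_dens :: "real \<Rightarrow> real \<Rightarrow> real" where
  "res_dens p y = rate p / p * exp (- rate p * y) *
     (\<integral>z. exp (- rate p * DD (fst z) (snd z)) * indicator {- y..} (DD (fst z) (snd z)) \<partial>exp_time p)"

definition scale :: "real \<Rightarrow> real \<Rightarrow> real" where
  "scale p x = rate p / p * exp (rate p * x) *
     (\<integral>z. exp (- rate p * DD (fst z) (snd z)) * indicator {..x} (DD (fst z) (snd z)) \<partial>exp_time p)"

lemma exp_DD_indicator_integrable:
  assumes p: "p > 0" and [measurable]: "A \<in> sets borel"
  shows "integrable (exp_time p) (\<lambda>z. exp (- rate p * DD (fst z) (snd z)) * indicator A (DD (fst z) (snd z)))"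
proof (rule exp_time_integral(1)[OF p, where B=1])
  fix z assume "z \<in> space (exp_time p)"
  then show "\<bar>exp (- rate p * DD (fst z) (snd z)) * indicator A (DD (fst z) (snd z))\<bar> \<le> 1"
    using exp_DD_le[OF less_imp_le[OF rate_pos[OF p]]] by (auto simp: indicator_def)
qed measurable

lemma res_dens_nonneg: "p > 0 \<Longrightarrow> 0 \<le> res_dens p y"
  unfolding res_dens_def using rate_pos[of p] by (intro mult_nonneg_nonneg Bochner_Integration.integral_nonneg) auto

lemma scale_nonneg: "p > 0 \<Longrightarrow> 0 \<le> scale p x"
  unfolding scale_def using rate_pos[of p] by (intro mult_nonneg_nonneg Bochner_Integration.integral_nonneg) auto

lemma scale_neg: assumes "p > 0" "x < 0" shows "scale p x = 0"
proof -
  have "(\<integral>z. exp (- rate p * DD (fst z) (snd z)) * indicator {..x} (DD (fst z) (snd z)) \<partial>exp_time p) = (\<integral>z. 0 \<partial>exp_time p)"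
  proof (rule Bochner_Integration.integral_cong[OF refl])
    fix z assume "z \<in> space (exp_time p)"
    then have "0 \<le> DD (fst z) (snd z)" using DD_nonneg by (auto simp: space_exp_time)
    then show "exp (- rate p * DD (fst z) (snd z)) * indicator {..x} (DD (fst z) (snd z)) = 0" using assms by simp
  qed
  then show ?thesis by (simp add: scale_def)
qed

lemma res_dens_measurable [measurable]: assumes "p > 0" shows "res_dens p \<in> borel_measurable borel"
proof -
  interpret N: prob_space "exp_time p" by (rule prob_space_exp_time[OF assms])
  have "(\<lambda>y. \<integral>z. exp (- rate p * DD (fst z) (snd z)) * (if - y \<le> DD (fst z) (snd z) then 1 else 0) \<partial>exp_time p) \<in> borel_measurable borel"
    by measurable
  then show ?thesis unfolding res_dens_def by (simp add: indicator_def)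
qed

lemma scale_measurable [measurable]: assumes "p > 0" shows "scale p \<in> borel_measurable borel"
proof -
  interpret N: prob_space "exp_time p" by (rule prob_space_exp_time[OF assms])
  have "(\<lambda>x. \<integral>z. exp (- rate p * DD (fst z) (snd z)) * (if DD (fst z) (snd z) \<le> x then 1 else 0) \<partial>exp_time p) \<in> borel_measurable borel"
    by measurable
  then show ?thesis unfolding scale_def by (simp add: indicator_def)
qed

text \<open>Substituting s = y + D for the value of S and exchanging integrals; the density of S is
  nonzero there only if D >= - y, which produces the indicator in \<open>res_dens\<close>.\<close>

lemma XX_nn_integral:
  assumes p: "p > 0" and [measurable]: "f \<in> borel_measurable borel"
  shows "(\<integral>\<^sup>+z. f (XX (fst z) (snd z)) \<partial>exp_time p) = (\<integral>\<^sup>+y. ennreal (p * res_dens p y) * f y \<partial>lborel)"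
proof -
  interpret N: prob_space "exp_time p" by (rule prob_space_exp_time[OF p])
  interpret NL: pair_sigma_finite "exp_time p" lborel ..
  let ?c = "rate p" and ?D = "\<lambda>z. DD (fst z) (snd z)"
  have c: "?c > 0" by (rule rate_pos[OF p])
  have "(\<integral>\<^sup>+z. f (XX (fst z) (snd z)) \<partial>exp_time p) = (\<integral>\<^sup>+z. (\<integral>\<^sup>+s. ennreal (exponential_density ?c s) * f (s - ?D z) \<partial>lborel) \<partial>exp_time p)"
    using SS_DD_nn_integral[OF p, of "\<lambda>(s, d). f (s - d)"] by (simp add: XX_eq)
  also have "\<dots> = (\<integral>\<^sup>+z. (\<integral>\<^sup>+y. ennreal (exponential_density ?c (y + ?D z)) * f y \<partial>lborel) \<partial>exp_time p)"
  proof (rule nn_integral_cong)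
    fix z
    show "(\<integral>\<^sup>+s. ennreal (exponential_density ?c s) * f (s - ?D z) \<partial>lborel) = (\<integral>\<^sup>+y. ennreal (exponential_density ?c (y + ?D z)) * f y \<partial>lborel)"
      by (subst nn_integral_real_affine[where c=1 and t="?D z"]) (auto simp: add.commute)
  qed
  also have "\<dots> = (\<integral>\<^sup>+y. (\<integral>\<^sup>+z. ennreal (exponential_density ?c (y + ?D z)) * f y \<partial>exp_time p) \<partial>lborel)"
    by (rule NL.Fubini'[symmetric]) measurable
  also have "\<dots> = (\<integral>\<^sup>+y. ennreal (p * res_dens p y) * f y \<partial>lborel)"
  proof (rule nn_integral_cong)
    fix y
    have "(\<integral>\<^sup>+z. ennreal (exponential_density ?c (y + ?D z)) * f y \<partial>exp_time p) = (\<integral>\<^sup>+z. ennreal (exponential_density ?c (y + ?D z)) \<partial>exp_time p) * f y"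
      by (rule nn_integral_multc) measurable
    also have "(\<integral>\<^sup>+z. ennreal (exponential_density ?c (y + ?D z)) \<partial>exp_time p) =
        (\<integral>\<^sup>+z. ennreal ((?c * exp (- ?c * y)) * (exp (- ?c * ?D z) * indicator {- y..} (?D z))) \<partial>exp_time p)"
      by (intro nn_integral_cong arg_cong[where f=ennreal])
         (auto simp: exponential_density_eq indicator_def exp_add[symmetric] algebra_simps)
    also have "\<dots> = ennreal (\<integral>z. (?c * exp (- ?c * y)) * (exp (- ?c * ?D z) * indicator {- y..} (?D z)) \<partial>exp_time p)"
      by (rule nn_integral_eq_integral) (use c exp_DD_indicator_integrable[OF p] in auto)
    also have "(\<integral>z. (?c * exp (- ?c * y)) * (exp (- ?c * ?D z) * indicator {- y..} (?D z)) \<partial>exp_time p) = p * res_dens p y"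
      using p by (simp add: res_dens_def)
    finally show "(\<integral>\<^sup>+z. ennreal (exponential_density ?c (y + ?D z)) * f y \<partial>exp_time p) = ennreal (p * res_dens p y) * f y" .
  qed
  finally show ?thesis .
qed

lemma XX_no_atom: assumes p: "p > 0" shows "(\<integral>\<^sup>+z. indicator {a} (XX (fst z) (snd z)) \<partial>exp_time p) = 0"
proof -
  have "(\<integral>\<^sup>+z. indicator {a} (XX (fst z) (snd z)) \<partial>exp_time p) = (\<integral>\<^sup>+y. ennreal (p * res_dens p y) * indicator {a} y \<partial>lborel)"
    by (rule XX_nn_integral[OF p]) simp
  also have "\<dots> = 0"
    using res_dens_measurable[OF p] by (subst nn_integral_0_iff_AE) (use AE_lborel_singleton[of a] in \<open>auto elim: eventually_mono\<close>)
  finally show ?thesis .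
qed

text \<open>Apart from countably many times t, \<open>S_t - X_t = d\<close> forces \<open>X_t = S_r - d\<close> for some rational
  r < t, and by the Markov property at r this only happens on a null set of times.\<close>

lemma DD_no_atom:
  assumes p: "p > 0" and d: "d > 0"
  shows "AE z in exp_time p. DD (fst z) (snd z) \<noteq> d"
proof -
  \<comment> \<open>The weight \<open>exponential_density p (t - r)\<close> is positive exactly for
    t >= r. After the restart at r it becomes the density of an exponential time, at which X has no
    atoms.\<close>
  have r0: "AE \<omega> in M. (\<integral>\<^sup>+t. ennreal (exponential_density p (t - r)) * indicator {SS r \<omega> - d} (XX t \<omega>) \<partial>lborel) = 0" if r: "r \<ge> 0" for r
  proof -
    let ?F = "\<lambda>w. \<integral>\<^sup>+t. ennreal (exponential_density p (t - r)) * indicator {0} (path_eval w t - (path_sup w 0 r - d)) \<partial>lborel"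
    have pe: "ennreal (exponential_density p (t - r)) * indicator {0} (path_eval (path \<omega>) t - (path_sup (path \<omega>) 0 r - d)) =
        ennreal (exponential_density p (t - r)) * indicator {SS r \<omega> - d} (XX t \<omega>)" if "\<omega> \<in> space M" for \<omega> t
      using r path_sup_eq[OF sn_path_X[OF that], of 0 r] path_eval_eq[OF sn_path_X[OF that], of t]
      by (cases "t < r") (auto simp: exponential_density_eq SS_def XX_def indicator_def)
    have "(\<integral>\<^sup>+\<omega>. ?F (path \<omega>) \<partial>M) = (\<integral>\<^sup>+\<omega>. \<integral>\<^sup>+\<omega>'. ?F (restrict (restart r (\<omega>, \<omega>')) {0..}) \<partial>M \<partial>M)"
      by (rule markov_nn[OF _ r]) measurable
    also have "\<dots> = (\<integral>\<^sup>+\<omega>. (\<integral>\<^sup>+\<omega>'. (\<integral>\<^sup>+u. ennreal (exponential_density p u) * indicator {SS r \<omega> - d - XX r \<omega>} (XX u \<omega>') \<partial>lborel) \<partial>M) \<partial>M)"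
    proof (rule nn_integral_cong, rule nn_integral_cong)
      fix \<omega> \<omega>' assume \<omega>: "\<omega> \<in> space M" "\<omega>' \<in> space M"
      let ?w = "restrict (restart r (\<omega>, \<omega>')) {0..}"
      have sn: "sn_path (restart r (\<omega>, \<omega>'))" by (rule sn_path_restart[OF \<omega> r])
      have sup: "path_sup ?w 0 r = SS r \<omega>"
      proof -
        have "path_sup ?w 0 r = run_sup (restart r (\<omega>, \<omega>')) 0 r" by (rule path_sup_eq[OF sn]) (use r in auto)
        also have "\<dots> = SS r \<omega>" using r unfolding SS_def run_sup_def
          by (intro arg_cong[where f=Sup] image_cong) (auto simp: restart_before)
        finally show ?thesis .
      qed
      have [measurable]: "(\<lambda>_. ?w) \<in> measurable borel path_space" by (simp add: space_PiM)
      have "?F ?w = (\<integral>\<^sup>+u. ennreal (exponential_density p u) * indicator {0} (path_eval ?w (r + u) - (path_sup ?w 0 r - d)) \<partial>lborel)"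
        by (subst nn_integral_real_affine[where c=1 and t=r]) auto
      also have "\<dots> = (\<integral>\<^sup>+u. ennreal (exponential_density p u) * indicator {SS r \<omega> - d - XX r \<omega>} (XX u \<omega>') \<partial>lborel)"
      proof (rule nn_integral_cong)
        fix u :: real
        show "ennreal (exponential_density p u) * indicator {0} (path_eval ?w (r + u) - (path_sup ?w 0 r - d)) =
          ennreal (exponential_density p u) * indicator {SS r \<omega> - d - XX r \<omega>} (XX u \<omega>')"
        proof (cases "u < 0")
          case False
          then have "path_eval ?w (r + u) = XX r \<omega> + XX u \<omega>'"
            using path_eval_eq[OF sn, of "r + u"] restart_after[OF \<omega>, of u r] r by (simp add: XX_def)
          then show ?thesis by (auto simp: sup indicator_def)
        qed (simp add: exponential_density_eq)
      qed
      finally show "?F ?w = (\<integral>\<^sup>+u. ennreal (exponential_density p u) * indicator {SS r \<omega> - d - XX r \<omega>} (XX u \<omega>') \<partial>lborel)" .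
    qed
    also have "\<dots> = (\<integral>\<^sup>+\<omega>. (\<integral>\<^sup>+z. indicator {SS r \<omega> - d - XX r \<omega>} (XX (fst z) (snd z)) \<partial>exp_time p) \<partial>M)"
    proof (rule nn_integral_cong)
      fix \<omega>
      interpret LM: pair_sigma_finite lborel M ..
      have "(\<integral>\<^sup>+\<omega>'. (\<integral>\<^sup>+u. ennreal (exponential_density p u) * indicator {SS r \<omega> - d - XX r \<omega>} (XX u \<omega>') \<partial>lborel) \<partial>M)
         = (\<integral>\<^sup>+u. (\<integral>\<^sup>+\<omega>'. ennreal (exponential_density p u) * indicator {SS r \<omega> - d - XX r \<omega>} (XX u \<omega>') \<partial>M) \<partial>lborel)"
        by (rule LM.Fubini') measurable
      also have "\<dots> = (\<integral>\<^sup>+z. indicator {SS r \<omega> - d - XX r \<omega>} (XX (fst z) (snd z)) \<partial>exp_time p)"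
        by (subst exp_time_nn_integral[OF p]) (auto simp: nn_integral_cmult)
      finally show "(\<integral>\<^sup>+\<omega>'. (\<integral>\<^sup>+u. ennreal (exponential_density p u) * indicator {SS r \<omega> - d - XX r \<omega>} (XX u \<omega>') \<partial>lborel) \<partial>M)
         = (\<integral>\<^sup>+z. indicator {SS r \<omega> - d - XX r \<omega>} (XX (fst z) (snd z)) \<partial>exp_time p)" .
    qed
    also have "\<dots> = 0" by (simp add: XX_no_atom[OF p])
    finally have "(\<integral>\<^sup>+\<omega>. ?F (path \<omega>) \<partial>M) = 0" .
    then have "AE \<omega> in M. ?F (path \<omega>) = 0" by (subst (asm) nn_integral_0_iff_AE) measurable
    then show ?thesis using AE_space by eventually_elim (simp add: pe)
  qed
  have "AE \<omega> in M. \<forall>r\<in>\<rat>. 0 \<le> r \<longrightarrow> (\<integral>\<^sup>+t. ennreal (exponential_density p (t - r)) * indicator {SS r \<omega> - d} (XX t \<omega>) \<partial>lborel) = 0"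
    using r0 by (intro AE_ball_countable'[OF _ countable_rat]) auto
  then have ae: "AE \<omega> in M. AE t in lborel. 0 < t \<longrightarrow> DD t \<omega> \<noteq> d" using AE_space
  proof eventually_elim
    case (elim \<omega>)
    let ?f = "\<lambda>t. X t \<omega>"
    have "AE t in lborel. r \<le> t \<longrightarrow> X t \<omega> \<noteq> SS r \<omega> - d" if r: "r \<in> \<rat>" "0 \<le> r" for r
    proof -
      have "AE t in lborel. ennreal (exponential_density p (t - r)) * indicator {SS r \<omega> - d} (XX t \<omega>) = 0"
        using elim(1) r elim(2) by (subst nn_integral_0_iff_AE[symmetric]) auto
      then show ?thesis
        by eventually_elim (use p r in \<open>auto simp: exponential_density_eq XX_def indicator_def max_def split: if_splits\<close>)
    qed
    then have "AE t in lborel. \<forall>r\<in>\<rat>. 0 \<le> r \<longrightarrow> r \<le> t \<longrightarrow> X t \<omega> \<noteq> SS r \<omega> - d"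
      by (intro AE_ball_countable'[OF _ countable_rat]) auto
    \<comment> \<open>The remaining times are those at which the supremum exceeds all its earlier
      rational values; with the path d below it they are countable in number.\<close>
    moreover have "AE t in lborel. t \<notin> {t. 0 < t \<and> run_sup ?f 0 t - ?f t = d \<and> (\<forall>r\<in>\<rat>. 0 \<le> r \<longrightarrow> r < t \<longrightarrow> run_sup ?f 0 r < run_sup ?f 0 t)}"
      by (rule AE_not_in, rule countable_imp_null_set_lborel, rule countable_new_max_below[OF sn_path_X[OF elim(2)] d])
    ultimately show ?case
    proof eventually_elim
      case t: (elim t)
      show ?case
      proof (intro impI notI)
        assume t0: "0 < t" and eq: "DD t \<omega> = d"
        then have eq': "run_sup ?f 0 t - ?f t = d" by (simp add: DD_def SS_def XX_def)
        then obtain r where r: "r \<in> \<rat>" "0 \<le> r" "r < t" "run_sup ?f 0 r \<ge> run_sup ?f 0 t" using t(2) t0 by force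
        have "run_sup ?f 0 r = run_sup ?f 0 t"
          using r run_sup_mono[OF sn_path_X[OF elim(2)], of 0 0 r t] by auto
        then have "X t \<omega> = SS r \<omega> - d" using r eq' by (simp add: SS_def)
        then show False using t(1) r by auto
      qed
    qed
  qed
  have "(\<integral>\<^sup>+z. indicator {d} (DD (fst z) (snd z)) \<partial>exp_time p) = 0"
  proof -
    interpret LM: pair_sigma_finite lborel M ..
    have "(\<integral>\<^sup>+z. indicator {d} (DD (fst z) (snd z)) \<partial>exp_time p) = (\<integral>\<^sup>+t. (\<integral>\<^sup>+\<omega>. ennreal (exponential_density p t) * indicator {d} (DD t \<omega>) \<partial>M) \<partial>lborel)"
      by (subst exp_time_nn_integral[OF p]) (auto simp: nn_integral_cmult)
    also have "\<dots> = (\<integral>\<^sup>+\<omega>. (\<integral>\<^sup>+t. ennreal (exponential_density p t) * indicator {d} (DD t \<omega>) \<partial>lborel) \<partial>M)"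
      by (rule LM.Fubini'[symmetric]) measurable
    also have "\<dots> = 0"
    proof (subst nn_integral_0_iff_AE)
      show "AE \<omega> in M. (\<integral>\<^sup>+t. ennreal (exponential_density p t) * indicator {d} (DD t \<omega>) \<partial>lborel) = 0"
        using ae AE_space
      proof eventually_elim
        case (elim \<omega>)
        have "AE t in lborel. ennreal (exponential_density p t) * indicator {d} (DD t \<omega>) = 0"
          using elim(1) AE_lborel_singleton[of 0] by eventually_elim (auto simp: exponential_density_eq indicator_def)
        then show ?case using elim(2) by (subst nn_integral_0_iff_AE) auto
      qed
    qed measurable
    finally show ?thesis .
  qed
  then have "AE z in exp_time p. indicator {d} (DD (fst z) (snd z)) = (0::ennreal)"
    by (subst (asm) nn_integral_0_iff_AE) measurable
  then show ?thesis by eventually_elim (auto simp: indicator_def split: if_splits)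
qed

text \<open>By \<open>deriv_psi_A0\<close> this is the reciprocal of the derivative of \<psi> at the
  rate.\<close>

definition A0 :: "real \<Rightarrow> real" where "A0 p = rate p * G p (rate p) / p"

lemma A0_pos: "p > 0 \<Longrightarrow> A0 p > 0"
  unfolding A0_def using rate_pos G_pos[of p "rate p"] by (simp add: less_imp_le)

lemma deriv_psi_A0: "p > 0 \<Longrightarrow> deriv \<psi> (rate p) = 1 / A0 p"
  by (simp add: deriv_psi A0_def)

text \<open>The events D >= - y and D <= - y overlap only in the value - y, which carries no mass
  unless y = 0; there D may have an atom.\<close>

lemma res_dens_eq:
  assumes p: "p > 0" and y: "y \<noteq> 0"
  shows "res_dens p y = A0 p * exp (- rate p * y) - scale p (- y)"
proof -
  let ?c = "rate p" and ?D = "\<lambda>z. DD (fst z) (snd z)"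
  have [measurable]: "{- y..} \<in> sets borel" "{..- y} \<in> sets borel" by auto
  have "(\<integral>z. exp (- ?c * ?D z) * indicator {- y..} (?D z) \<partial>exp_time p) = (\<integral>z. exp (- ?c * ?D z) - exp (- ?c * ?D z) * indicator {..- y} (?D z) \<partial>exp_time p)"
  proof (rule integral_cong_AE)
    have "AE z in exp_time p. ?D z \<noteq> - y"
    proof (cases "- y > 0")
      case True then show ?thesis by (rule DD_no_atom[OF p])
    next
      case False
      then have "- y < 0" using y by simp
      moreover have "0 \<le> ?D z" if "z \<in> space (exp_time p)" for z using that DD_nonneg by (auto simp: space_exp_time)
      ultimately show ?thesis by (intro AE_I2) force
    qed
    then show "AE z in exp_time p. exp (- ?c * ?D z) * indicator {- y..} (?D z) = exp (- ?c * ?D z) - exp (- ?c * ?D z) * indicator {..- y} (?D z)"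
      by eventually_elim (auto simp: indicator_def)
  qed measurable
  also have "\<dots> = G p ?c - (\<integral>z. exp (- ?c * ?D z) * indicator {..- y} (?D z) \<partial>exp_time p)"
    unfolding G_def by (rule Bochner_Integration.integral_diff[OF G_integrable[OF p less_imp_le[OF rate_pos[OF p]]] exp_DD_indicator_integrable[OF p]]) simp
  finally have eq: "(\<integral>z. exp (- ?c * ?D z) * indicator {- y..} (?D z) \<partial>exp_time p)
      = G p ?c - (\<integral>z. exp (- ?c * ?D z) * indicator {..- y} (?D z) \<partial>exp_time p)" .
  show ?thesis unfolding res_dens_def eq scale_def A0_def by (simp add: right_diff_distrib)
qed

text \<open>The only possible atom of D is at 0, and there sequences within the half line stay to
  the right, so the indicator of D <= x does not flicker.\<close>

lemma scale_cont: assumes p: "p > 0" shows "continuous_on {0..} (scale p)"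
proof -
  interpret N: prob_space "exp_time p" by (rule prob_space_exp_time[OF p])
  let ?c = "rate p" and ?D = "\<lambda>z. DD (fst z) (snd z)"
  have "continuous_on {0..} (\<lambda>x. \<integral>z. exp (- ?c * ?D z) * indicator {..x} (?D z) \<partial>exp_time p)"
    unfolding continuous_on_sequentially comp_def
  proof (intro ballI allI impI, elim conjE)
    fix x :: real and f assume x: "x \<in> {0..}" and f: "\<forall>n. f n \<in> {0..}" "f \<longlonglongrightarrow> x"
    show "(\<lambda>n. \<integral>z. exp (- ?c * ?D z) * indicator {..f n} (?D z) \<partial>exp_time p) \<longlonglongrightarrow> (\<integral>z. exp (- ?c * ?D z) * indicator {..x} (?D z) \<partial>exp_time p)"
    proof (rule integral_dominated_convergence[where w="\<lambda>_. 1"])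
      show "AE z in exp_time p. norm (exp (- ?c * ?D z) * indicator {..f n} (?D z)) \<le> 1" for n
        using exp_DD_le[OF less_imp_le[OF rate_pos[OF p]]] by (intro AE_I2) (auto simp: indicator_def)
      have "AE z in exp_time p. 0 \<le> ?D z \<and> (?D z = x \<longrightarrow> x = 0)"
      proof (cases "x = 0")
        case True then show ?thesis using DD_nonneg by (intro AE_I2) (auto simp: space_exp_time)
      next
        case False
        have "AE z in exp_time p. ?D z \<noteq> x" using False x by (intro DD_no_atom[OF p]) auto
        moreover have "AE z in exp_time p. 0 \<le> ?D z" using DD_nonneg by (intro AE_I2) (auto simp: space_exp_time)
        ultimately show ?thesis by eventually_elim auto
      qed
      then show "AE z in exp_time p. (\<lambda>n. exp (- ?c * ?D z) * indicator {..f n} (?D z)) \<longlonglongrightarrow> exp (- ?c * ?D z) * indicator {..x} (?D z)"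
      proof eventually_elim
        case (elim z)
        have "(\<lambda>n. indicator {..f n} (?D z) :: real) \<longlonglongrightarrow> indicator {..x} (?D z)"
        proof -
          consider "?D z < x" | "?D z > x" | "?D z = 0" "x = 0" using elim by force
          then have "\<forall>\<^sub>F n in sequentially. indicator {..x} (?D z) = (indicator {..f n} (?D z) :: real)"
          proof cases
            case 1
            show ?thesis using order_tendstoD(1)[OF f(2) 1] by eventually_elim (use 1 in \<open>auto simp: indicator_def\<close>)
          next
            case 2
            show ?thesis using order_tendstoD(2)[OF f(2) 2] by eventually_elim (use 2 in \<open>auto simp: indicator_def\<close>)
          next
            case 3
            then show ?thesis using f(1) by simp
          qed
          then show ?thesis by (rule Lim_transform_eventually[OF tendsto_const])
        qed
        then show ?case by (intro tendsto_intros)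
      qed
    qed auto
  qed
  then show ?thesis unfolding scale_def[abs_def] by (intro continuous_intros)
qed

text \<open>Integrating first over y >= D gives \<open>rate p / p / (l - rate p) * G p l\<close>,
  which \<open>psi_eq\<close> identifies.\<close>

lemma scale_laplace_nn:
  assumes p: "p > 0" and l: "l > rate p"
  shows "(\<integral>\<^sup>+y. ennreal (exp (- l * y) * scale p y) \<partial>lborel) = ennreal (1 / (\<psi> l - p))"
proof -
  interpret N: prob_space "exp_time p" by (rule prob_space_exp_time[OF p])
  interpret NL: pair_sigma_finite "exp_time p" lborel ..
  let ?c = "rate p" and ?D = "\<lambda>z. DD (fst z) (snd z)"
  have c: "?c > 0" by (rule rate_pos[OF p])
  have "(\<integral>\<^sup>+y. ennreal (exp (- l * y) * scale p y) \<partial>lborel) =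
      (\<integral>\<^sup>+y. (\<integral>\<^sup>+z. ennreal (?c / p * (exp (- (l - ?c) * y) * exp (- ?c * ?D z) * indicator {?D z..} y)) \<partial>exp_time p) \<partial>lborel)"
  proof (rule nn_integral_cong)
    fix y
    have e1: "exp (- l * y) * scale p y = (\<integral>z. ?c / p * exp (- (l - ?c) * y) * (exp (- ?c * ?D z) * indicator {..y} (?D z)) \<partial>exp_time p)"
    proof -
      have "exp (- l * y) * exp (?c * y) = exp (- (l - ?c) * y)" unfolding exp_add[symmetric] by (simp add: algebra_simps)
      then show ?thesis by (simp add: scale_def)
    qed
    have "ennreal (exp (- l * y) * scale p y) = (\<integral>\<^sup>+z. ennreal (?c / p * exp (- (l - ?c) * y) * (exp (- ?c * ?D z) * indicator {..y} (?D z))) \<partial>exp_time p)"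
      unfolding e1 by (rule nn_integral_eq_integral[symmetric]) (use c p exp_DD_indicator_integrable[OF p] in auto)
    also have "\<dots> = (\<integral>\<^sup>+z. ennreal (?c / p * (exp (- (l - ?c) * y) * exp (- ?c * ?D z) * indicator {?D z..} y)) \<partial>exp_time p)"
    proof (rule nn_integral_cong)
      fix z
      have "indicator {..y} (?D z) = (indicator {?D z..} y :: real)" by (simp add: indicator_def)
      then show "ennreal (?c / p * exp (- (l - ?c) * y) * (exp (- ?c * ?D z) * indicator {..y} (?D z))) =
          ennreal (?c / p * (exp (- (l - ?c) * y) * exp (- ?c * ?D z) * indicator {?D z..} y))"
        by (simp only: mult.assoc)
    qed
    finally show "ennreal (exp (- l * y) * scale p y) = (\<integral>\<^sup>+z. ennreal (?c / p * (exp (- (l - ?c) * y) * exp (- ?c * ?D z) * indicator {?D z..} y)) \<partial>exp_time p)" .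
  qed
  also have "\<dots> = (\<integral>\<^sup>+z. (\<integral>\<^sup>+y. ennreal (?c / p * (exp (- (l - ?c) * y) * exp (- ?c * ?D z) * indicator {?D z..} y)) \<partial>lborel) \<partial>exp_time p)"
  proof -
    have "(\<lambda>(z, y). ennreal (?c / p * (exp (- (l - ?c) * y) * exp (- ?c * ?D z) * (if ?D z \<le> y then 1 else 0)))) \<in> borel_measurable (exp_time p \<Otimes>\<^sub>M lborel)"
      by measurable
    then show ?thesis by (intro NL.Fubini') (simp add: indicator_def)
  qed
  also have "\<dots> = (\<integral>\<^sup>+z. ennreal (?c / p / (l - ?c) * exp (- l * ?D z)) \<partial>exp_time p)"
  proof (rule nn_integral_cong)
    fix z
    have "(\<integral>\<^sup>+y. ennreal (?c / p * (exp (- (l - ?c) * y) * exp (- ?c * ?D z) * indicator {?D z..} y)) \<partial>lborel) =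
        (\<integral>\<^sup>+u. ennreal (?c / p / (l - ?c) * exp (- l * ?D z)) * ennreal (exponential_density (l - ?c) u) \<partial>lborel)"
      apply (subst nn_integral_real_affine[where c=1 and t="?D z"])
        apply simp
       apply simp
      apply (simp only: abs_one ennreal_1 mult_1)
    proof (rule nn_integral_cong)
      fix u
      have "exp (- (l - ?c) * (?D z + u)) * exp (- ?c * ?D z) = exp (- l * ?D z) * exp (- (l - ?c) * u)"
        unfolding exp_add[symmetric] by (simp add: algebra_simps)
      then have "?c / p * (exp (- (l - ?c) * (?D z + u)) * exp (- ?c * ?D z) * indicator {?D z..} (?D z + u)) = ?c / p / (l - ?c) * exp (- l * ?D z) * exponential_density (l - ?c) u"
        using l by (auto simp: exponential_density_eq)
      then show "ennreal (?c / p * (exp (- (l - ?c) * (?D z + u)) * exp (- ?c * ?D z) * indicator {?D z..} (?D z + u))) =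
          ennreal (?c / p / (l - ?c) * exp (- l * ?D z)) * ennreal (exponential_density (l - ?c) u)"
        using c p l by (simp add: ennreal_mult'[symmetric] exponential_density_nonneg')
    qed
    also have "\<dots> = ennreal (?c / p / (l - ?c) * exp (- l * ?D z))"
      using nn_integral_exponential_density_exp[of "l - ?c" 0] l by (simp add: nn_integral_cmult)
    finally show "(\<integral>\<^sup>+y. ennreal (?c / p * (exp (- (l - ?c) * y) * exp (- ?c * ?D z) * indicator {?D z..} y)) \<partial>lborel) = ennreal (?c / p / (l - ?c) * exp (- l * ?D z))" .
  qed
  also have "\<dots> = ennreal (\<integral>z. ?c / p / (l - ?c) * exp (- l * ?D z) \<partial>exp_time p)"
    by (rule nn_integral_eq_integral) (use c p l G_integrable[OF p, of l] in auto)
  also have "(\<integral>z. ?c / p / (l - ?c) * exp (- l * ?D z) \<partial>exp_time p) = ?c / p / (l - ?c) * G p l"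
    by (simp add: G_def)
  also have "\<dots> = 1 / (\<psi> l - p)"
  proof -
    have "(\<psi> l - p) / (l - ?c) = p / (?c * G p l)" using psi_eq[OF p, of l] c l by simp
    then have "\<psi> l - p = p / (?c * G p l) * (l - ?c)" using l by (simp add: divide_eq_eq)
    then show ?thesis by simp
  qed
  finally show ?thesis .
qed

text \<open>Resolves the definite description: uniqueness comes from
  \<open>laplace_transform_zero_imp_zero\<close> applied to the difference of two
  candidates.\<close>

lemma scale_W_eq:
  assumes p: "p > 0"
  shows "scale_W M X p = scale p"
  unfolding scale_W_def
proof (rule the_equality)
  have \<Phi>: "levy_Phi M X p = rate p" by (rule Phi_eq_rate[OF p])
  have int: "((\<lambda>y. exp (- l * y) * scale p y) has_integral 1 / (\<psi> l - p)) {0..}" if l: "l > levy_Phi M X p" for l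
  proof -
    have l': "l > rate p" using l \<Phi> by simp
    have "has_bochner_integral lborel (\<lambda>y. exp (- l * y) * scale p y) (1 / (\<psi> l - p))"
      using scale_laplace_nn[OF p l'] scale_nonneg[OF p] psi_above_rate[OF p l'] scale_measurable[OF p]
      by (intro has_bochner_integral_nn_integral) auto
    then have "((\<lambda>y. exp (- l * y) * scale p y) has_integral 1 / (\<psi> l - p)) UNIV"
      using has_integral_integral_lborel[of "\<lambda>y. exp (- l * y) * scale p y"] by (simp only: has_bochner_integral_iff)
    then have "((\<lambda>y. if y \<in> {0..} then exp (- l * y) * scale p y else 0) has_integral 1 / (\<psi> l - p)) UNIV"
      by (rule has_integral_cong[THEN iffD1, rotated]) (auto simp: scale_neg[OF p])
    then show ?thesis by (simp only: has_integral_restrict_UNIV)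
  qed
  then show *: "(\<forall>y<0. scale p y = 0) \<and> continuous_on {0..} (scale p) \<and>
      (\<forall>l>levy_Phi M X p. ((\<lambda>y. exp (- l * y) * scale p y) has_integral 1 / (\<psi> l - p)) {0..})"
    using scale_neg[OF p] scale_cont[OF p] by auto
  fix W assume W: "(\<forall>y<0. W y = 0) \<and> continuous_on {0..} W \<and>
      (\<forall>l>levy_Phi M X p. ((\<lambda>y. exp (- l * y) * W y) has_integral 1 / (\<psi> l - p)) {0..})"
  show "W = scale p"
  proof
    fix y
    show "W y = scale p y"
    proof (cases "y < 0")
      case False
      have "W y - scale p y = 0"
      proof (rule laplace_transform_zero_imp_zero[where f="\<lambda>y. W y - scale p y" and L="levy_Phi M X p"])
        show "continuous_on {0..} (\<lambda>y. W y - scale p y)" using W * by (intro continuous_intros) auto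
        fix l assume l: "l > levy_Phi M X p"
        have "((\<lambda>y. exp (- l * y) * W y - exp (- l * y) * scale p y) has_integral 1 / (\<psi> l - p) - 1 / (\<psi> l - p)) {0..}"
          using W l int by (intro has_integral_diff) auto
        then show "((\<lambda>y. exp (- l * y) * (W y - scale p y)) has_integral 0) {0..}" by (simp add: right_diff_distrib)
      qed (use False in simp)
      then show ?thesis by simp
    qed (use W scale_neg[OF p] in simp)
  qed
qed

end

section \<open>The Volterra equation between scale functions\<close>

lemma loc_bounded_continuous:
  assumes "f \<in> borel_measurable borel" "continuous_on {0..} f"
  shows "loc_bounded f"
  unfolding loc_bounded_def
proof (intro conjI allI assms)
  fix T
  have "compact (f ` {0..T})"
    by (rule compact_continuous_image) (auto intro: continuous_on_subset[OF assms(2)])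
  then have "bounded (f ` {0..T})" by (rule compact_imp_bounded)
  then show "\<exists>B. \<forall>x\<in>{0..T}. \<bar>f x\<bar> \<le> B" unfolding bounded_iff by (metis image_eqI real_norm_def)
qed

lemma conv_continuous:
  assumes f: "loc_bounded f" "continuous_on {0..} f" and g: "loc_bounded g"
  shows "continuous_on {0..} (conv f g)"
  unfolding continuous_on_sequentially comp_def
proof (intro ballI allI impI, elim conjE)
  note [measurable] = loc_bounded_measurable[OF f(1)] loc_bounded_measurable[OF g]
  fix x :: real and s assume x: "x \<in> {0..}" and s: "\<forall>n. s n \<in> {0..}" "s \<longlonglongrightarrow> x"
  obtain T where T: "\<And>n. s n \<le> T"
    using convergent_imp_Bseq[OF convergentI[OF s(2)]] unfolding Bseq_def by (metis abs_le_D1 real_norm_def)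
  obtain Bf where Bf: "Bf \<ge> 0" "\<And>z. 0 \<le> z \<Longrightarrow> z \<le> T \<Longrightarrow> \<bar>f z\<bar> \<le> Bf" using loc_boundedD[OF f(1)] by metis
  obtain Bg where Bg: "Bg \<ge> 0" "\<And>z. 0 \<le> z \<Longrightarrow> z \<le> T \<Longrightarrow> \<bar>g z\<bar> \<le> Bg" using loc_boundedD[OF g] by metis
  show "(\<lambda>n. conv f g (s n)) \<longlonglongrightarrow> conv f g x"
    unfolding conv_def
  proof (rule integral_dominated_convergence[where w="\<lambda>z. Bf * Bg * indicator {0..T} z"])
    show "integrable lborel (\<lambda>z. Bf * Bg * indicator {0..T} z)" by (simp add: emeasure_lborel_Icc_eq)
    show "AE z in lborel. norm (indicator {0..s n} z * (f (s n - z) * g z)) \<le> Bf * Bg * indicator {0..T} z" for n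
      using T[of n] s(1) Bf(1) Bg(1) by (intro AE_I2) (auto simp: indicator_def abs_mult Bf Bg intro!: mult_mono)
    have "(\<lambda>n. indicator {0..s n} z * (f (s n - z) * g z)) \<longlonglongrightarrow> indicator {0..x} z * (f (x - z) * g z)" if "z \<noteq> x" for z
    proof (cases "z < x")
      case True
      have ev: "\<forall>\<^sub>F n in sequentially. z < s n" using order_tendstoD(1)[OF s(2) True] .
      \<comment> \<open>The maximum with 0 keeps the arguments in the half line, where f is
        continuous.\<close>
      have "(\<lambda>n. f (max 0 (s n - z))) \<longlonglongrightarrow> f (max 0 (x - z))"
        by (rule continuous_on_tendsto_compose[OF f(2)]) (auto intro!: tendsto_max tendsto_diff s(2))
      then have "(\<lambda>n. f (s n - z)) \<longlonglongrightarrow> f (x - z)"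
        using True by (rule_tac Lim_transform_eventually[where f="\<lambda>n. f (max 0 (s n - z))"]) (use ev in \<open>auto elim: eventually_mono\<close>)
      then have "(\<lambda>n. indicator {0..x} z * (f (s n - z) * g z)) \<longlonglongrightarrow> indicator {0..x} z * (f (x - z) * g z)"
        by (intro tendsto_intros)
      moreover have "\<forall>\<^sub>F n in sequentially. indicator {0..x} z * (f (s n - z) * g z) = indicator {0..s n} z * (f (s n - z) * g z)"
        using ev by eventually_elim (use True in \<open>auto simp: indicator_def\<close>)
      ultimately show ?thesis by (rule Lim_transform_eventually)
    next
      case False
      then have "x < z" using that by simp
      then have "\<forall>\<^sub>F n in sequentially. s n < z" by (rule order_tendstoD(2)[OF s(2)])
      then have "\<forall>\<^sub>F n in sequentially. 0 = indicator {0..s n} z * (f (s n - z) * g z)"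
        by eventually_elim (auto simp: indicator_def)
      then show ?thesis using \<open>x < z\<close> by (auto intro: Lim_transform_eventually[OF tendsto_const])
    qed
    then show "AE z in lborel. (\<lambda>n. indicator {0..s n} z * (f (s n - z) * g z)) \<longlonglongrightarrow> indicator {0..x} z * (f (x - z) * g z)"
      using AE_lborel_singleton[of x] by (auto elim: eventually_mono)
  qed measurable
qed

lemma has_integral_atLeast_from_nn:
  fixes f :: "real \<Rightarrow> real"
  assumes [measurable]: "f \<in> borel_measurable borel" and "\<And>y. 0 \<le> f y" "\<And>y. y < 0 \<Longrightarrow> f y = 0"
    and "(\<integral>\<^sup>+y. ennreal (f y) \<partial>lborel) = ennreal r" "r \<ge> 0"
  shows "(f has_integral r) {0..}"
proof -
  have "has_bochner_integral lborel f r"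
    using assms by (intro has_bochner_integral_nn_integral) auto
  then have "(f has_integral r) UNIV"
    using has_integral_integral_lborel[of f] by (simp only: has_bochner_integral_iff)
  then have "((\<lambda>y. if y \<in> {0..} then f y else 0) has_integral r) UNIV"
    by (rule has_integral_cong[THEN iffD1, rotated]) (auto simp: assms(3))
  then show ?thesis by (simp only: has_integral_restrict_UNIV)
qed

lemma conv_laplace_nn:
  fixes f g :: "real \<Rightarrow> real"
  assumes f: "loc_bounded f" "\<And>z. 0 \<le> f z" "\<And>z. z < 0 \<Longrightarrow> f z = 0"
    and g: "loc_bounded g" "\<And>z. 0 \<le> g z" "\<And>z. z < 0 \<Longrightarrow> g z = 0"
  shows "(\<integral>\<^sup>+y. ennreal (exp (- l * y) * conv f g y) \<partial>lborel) =
    (\<integral>\<^sup>+y. ennreal (exp (- l * y) * f y) \<partial>lborel) * (\<integral>\<^sup>+y. ennreal (exp (- l * y) * g y) \<partial>lborel)"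
proof -
  note [measurable] = loc_bounded_measurable[OF f(1)] loc_bounded_measurable[OF g(1)]
  have "(\<integral>\<^sup>+y. ennreal (exp (- l * y) * conv f g y) \<partial>lborel) =
      (\<integral>\<^sup>+y. (\<integral>\<^sup>+z. ennreal (exp (- l * (y - z)) * f (y - z)) * ennreal (exp (- l * z) * g z) \<partial>lborel) \<partial>lborel)"
  proof (rule nn_integral_cong)
    fix y
    have "ennreal (exp (- l * y) * conv f g y) = (\<integral>\<^sup>+z. ennreal (exp (- l * y) * (indicator {0..y} z * (f (y - z) * g z))) \<partial>lborel)"
      unfolding conv_def integral_mult_right_zero[symmetric]
      by (rule nn_integral_eq_integral[symmetric]) (use conv_integrable[OF f(1) g(1)] f(2) g(2) in auto)
    also have "\<dots> = (\<integral>\<^sup>+z. ennreal (exp (- l * (y - z)) * f (y - z)) * ennreal (exp (- l * z) * g z) \<partial>lborel)"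
    proof (rule nn_integral_cong)
      fix z
      have "exp (- l * y) = exp (- l * (y - z)) * exp (- l * z)" unfolding exp_add[symmetric] by (simp add: algebra_simps)
      moreover have "indicator {0..y} z * (f (y - z) * g z) = f (y - z) * g z"
        using f(3)[of "y - z"] g(3)[of z] by (cases "z < 0"; cases "y < z") (auto simp: indicator_def)
      ultimately have "exp (- l * y) * (indicator {0..y} z * (f (y - z) * g z)) = (exp (- l * (y - z)) * f (y - z)) * (exp (- l * z) * g z)"
        by (simp only: mult_ac)
      then show "ennreal (exp (- l * y) * (indicator {0..y} z * (f (y - z) * g z))) = ennreal (exp (- l * (y - z)) * f (y - z)) * ennreal (exp (- l * z) * g z)"
        using f(2) g(2) by (simp only: ennreal_mult[symmetric] mult_nonneg_nonneg exp_ge_zero)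
    qed
    finally show "ennreal (exp (- l * y) * conv f g y) = (\<integral>\<^sup>+z. ennreal (exp (- l * (y - z)) * f (y - z)) * ennreal (exp (- l * z) * g z) \<partial>lborel)" .
  qed
  also have "\<dots> = (\<integral>\<^sup>+z. (\<integral>\<^sup>+y. ennreal (exp (- l * (y - z)) * f (y - z)) * ennreal (exp (- l * z) * g z) \<partial>lborel) \<partial>lborel)"
    by (rule lborel_pair.Fubini'[symmetric]) measurable
  also have "\<dots> = (\<integral>\<^sup>+z. (\<integral>\<^sup>+y. ennreal (exp (- l * y) * f y) \<partial>lborel) * ennreal (exp (- l * z) * g z) \<partial>lborel)"
  proof (rule nn_integral_cong)
    fix z
    have "(\<integral>\<^sup>+y. ennreal (exp (- l * (y - z)) * f (y - z)) \<partial>lborel) = (\<integral>\<^sup>+y. ennreal (exp (- l * y) * f y) \<partial>lborel)"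
      by (subst nn_integral_real_affine[where c=1 and t=z]) auto
    then show "(\<integral>\<^sup>+y. ennreal (exp (- l * (y - z)) * f (y - z)) * ennreal (exp (- l * z) * g z) \<partial>lborel) =
        (\<integral>\<^sup>+y. ennreal (exp (- l * y) * f y) \<partial>lborel) * ennreal (exp (- l * z) * g z)"
      by (simp add: nn_integral_multc)
  qed
  also have "\<dots> = (\<integral>\<^sup>+y. ennreal (exp (- l * y) * f y) \<partial>lborel) * (\<integral>\<^sup>+y. ennreal (exp (- l * y) * g y) \<partial>lborel)"
    by (rule nn_integral_cmult) measurable
  finally show ?thesis .
qed

context sn_levy
begin

lemma scale_loc_bounded: "p > 0 \<Longrightarrow> loc_bounded (scale p)"
  by (rule loc_bounded_continuous[OF scale_measurable scale_cont])

text \<open>Both sides are continuous on the half line, and their Laplace transforms agree by the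
  partial fraction 1 / (\<psi> - p - q) - 1 / (\<psi> - p) = q / ((\<psi> - p) (\<psi> - p -
  q)).\<close>

theorem scale_volterra:
  assumes p: "p > 0" and q: "q \<ge> 0"
  shows "scale (p + q) y = scale p y + q * conv (scale p) (scale (p + q)) y"
proof (cases "y < 0")
  case True
  then show ?thesis using p q by (simp add: scale_neg conv_eq_0)
next
  case False
  have pq: "p + q > 0" using p q by simp
  let ?W = "scale p" and ?V = "scale (p + q)"
  note W = scale_loc_bounded[OF p] scale_nonneg[OF p] scale_neg[OF p]
  note V = scale_loc_bounded[OF pq] scale_nonneg[OF pq] scale_neg[OF pq]
  have C: "loc_bounded (conv ?W ?V)" by (rule conv_loc_bounded[OF W(1) V(1)])
  have Cnn: "0 \<le> conv ?W ?V y" for y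
    unfolding conv_def by (rule Bochner_Integration.integral_nonneg) (simp add: W(2) V(2))
  have "?V y - ?W y - q * conv ?W ?V y = 0"
  proof (rule laplace_transform_zero_imp_zero[where f="\<lambda>y. ?V y - ?W y - q * conv ?W ?V y" and L="max (rate p) (rate (p + q))"])
    show "continuous_on {0..} (\<lambda>y. ?V y - ?W y - q * conv ?W ?V y)"
      by (intro continuous_intros scale_cont p pq conv_continuous W V)
    fix l assume l: "l > max (rate p) (rate (p + q))"
    then have lp: "l > rate p" and lq: "l > rate (p + q)" by auto
    have \<psi>: "\<psi> l > p + q" by (rule psi_above_rate[OF pq lq])
    have iW: "((\<lambda>y. exp (- l * y) * ?W y) has_integral 1 / (\<psi> l - p)) {0..}"
      by (rule has_integral_atLeast_from_nn) (use scale_laplace_nn[OF p lp] W \<psi> q scale_measurable[OF p] in auto)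
    have iV: "((\<lambda>y. exp (- l * y) * ?V y) has_integral 1 / (\<psi> l - (p + q))) {0..}"
      by (rule has_integral_atLeast_from_nn) (use scale_laplace_nn[OF pq lq] V \<psi> q scale_measurable[OF pq] in auto)
    have iC: "((\<lambda>y. exp (- l * y) * conv ?W ?V y) has_integral (1 / (\<psi> l - p)) * (1 / (\<psi> l - (p + q)))) {0..}"
    proof (rule has_integral_atLeast_from_nn)
      show "(\<lambda>y. exp (- l * y) * conv ?W ?V y) \<in> borel_measurable borel" using loc_bounded_measurable[OF C] by measurable
      have "(\<integral>\<^sup>+y. ennreal (exp (- l * y) * conv ?W ?V y) \<partial>lborel) =
          (\<integral>\<^sup>+y. ennreal (exp (- l * y) * ?W y) \<partial>lborel) * (\<integral>\<^sup>+y. ennreal (exp (- l * y) * ?V y) \<partial>lborel)"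
        by (rule conv_laplace_nn) (use W V in auto)
      also have "\<dots> = ennreal (1 / (\<psi> l - p)) * ennreal (1 / (\<psi> l - (p + q)))"
        by (simp only: scale_laplace_nn[OF p lp] scale_laplace_nn[OF pq lq])
      also have "\<dots> = ennreal ((1 / (\<psi> l - p)) * (1 / (\<psi> l - (p + q))))"
        by (rule ennreal_mult[symmetric]) (use \<psi> q in auto)
      finally show "(\<integral>\<^sup>+y. ennreal (exp (- l * y) * conv ?W ?V y) \<partial>lborel) = ennreal ((1 / (\<psi> l - p)) * (1 / (\<psi> l - (p + q))))" .
    qed (use \<psi> q Cnn in \<open>auto simp: conv_eq_0\<close>)
    have "((\<lambda>y. exp (- l * y) * ?V y - exp (- l * y) * ?W y - q * (exp (- l * y) * conv ?W ?V y)) has_integral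
        1 / (\<psi> l - (p + q)) - 1 / (\<psi> l - p) - q * ((1 / (\<psi> l - p)) * (1 / (\<psi> l - (p + q))))) {0..}"
      by (intro has_integral_diff has_integral_mult_right iW iV iC)
    moreover have "1 / (\<psi> l - (p + q)) - 1 / (\<psi> l - p) - q * ((1 / (\<psi> l - p)) * (1 / (\<psi> l - (p + q)))) = 0"
    proof -
      have "\<psi> l - (p + q) \<noteq> 0" "\<psi> l - p \<noteq> 0" using \<psi> q by auto
      then have "1 / (\<psi> l - (p + q)) - 1 / (\<psi> l - p) = ((\<psi> l - p) - (\<psi> l - (p + q))) / ((\<psi> l - (p + q)) * (\<psi> l - p))"
        by (simp add: diff_frac_eq)
      then show ?thesis by (simp add: mult.commute)
    qed
    ultimately show "((\<lambda>y. exp (- l * y) * (?V y - ?W y - q * conv ?W ?V y)) has_integral 0) {0..}"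
      by (simp only: right_diff_distrib mult.left_commute)
  qed (use False in simp)
  then show ?thesis by simp
qed

end

section \<open>The Feynman--Kac equation\<close>

lemma quadratic_increments_const:
  fixes D :: "real \<Rightarrow> real"
  assumes T: "T \<ge> 0" and D: "\<And>s t. 0 \<le> s \<Longrightarrow> s \<le> t \<Longrightarrow> t \<le> T \<Longrightarrow> \<bar>D t - D s\<bar> \<le> C * (t - s)\<^sup>2"
  shows "D T = D 0"
proof -
  have sym: "\<bar>D t - D s\<bar> \<le> \<bar>C\<bar> * (t - s)\<^sup>2" if "s \<in> {0..T}" "t \<in> {0..T}" for s t
  proof -
    have "\<bar>D t - D s\<bar> \<le> C * (t - s)\<^sup>2"
    proof (cases "s \<le> t")
      case True then show ?thesis using D[of s t] that by auto
    next
      case False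
      then have "\<bar>D s - D t\<bar> \<le> C * (s - t)\<^sup>2" using D[of t s] that by auto
      then show ?thesis by (simp add: abs_minus_commute power2_commute)
    qed
    also have "\<dots> \<le> \<bar>C\<bar> * (t - s)\<^sup>2" by (intro mult_right_mono) auto
    finally show ?thesis .
  qed
  have "(D has_field_derivative 0) (at s within {0..T})" if s: "s \<in> {0..T}" for s
    unfolding has_field_derivative_iff
  proof (rule Lim_null_comparison[where g="\<lambda>t. \<bar>C\<bar> * \<bar>t - s\<bar>"])
    have "\<forall>\<^sub>F t in at s within {0..T}. t \<in> {0..T}" by (simp add: eventually_at_filter)
    then show "\<forall>\<^sub>F t in at s within {0..T}. norm ((D t - D s) / (t - s)) \<le> \<bar>C\<bar> * \<bar>t - s\<bar>"
    proof eventually_elim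
      case (elim t)
      show ?case
      proof (cases "t = s")
        case False
        have "\<bar>D t - D s\<bar> / \<bar>t - s\<bar> \<le> (\<bar>C\<bar> * (t - s)\<^sup>2) / \<bar>t - s\<bar>" by (intro divide_right_mono sym s elim) auto
        also have "\<dots> = \<bar>C\<bar> * (\<bar>t - s\<bar> * \<bar>t - s\<bar>) / \<bar>t - s\<bar>" by (simp add: power2_eq_square)
        also have "\<dots> = \<bar>C\<bar> * \<bar>t - s\<bar>" using False by (simp del: abs_mult_self_eq)
        finally show ?thesis by (simp add: abs_divide)
      qed simp
    qed
    have "((\<lambda>t. \<bar>C\<bar> * \<bar>t - s\<bar>) \<longlongrightarrow> \<bar>C\<bar> * \<bar>s - s\<bar>) (at s within {0..T})" by (intro tendsto_intros)
    then show "((\<lambda>t. \<bar>C\<bar> * \<bar>t - s\<bar>) \<longlongrightarrow> 0) (at s within {0..T})" by simp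
  qed
  then obtain c where "\<And>s. s \<in> {0..T} \<Longrightarrow> D s = c"
    using has_field_derivative_zero_constant[of "{0..T}" D] by auto
  then show ?thesis using T by auto
qed

text \<open>As g is merely measurable, the fundamental theorem of calculus is replaced by the observation
  that the difference of the two sides has quadratically small increments.\<close>

lemma exp_primitive_identity:
  fixes g :: "real \<Rightarrow> real"
  assumes [measurable]: "g \<in> borel_measurable borel" and g: "\<And>s. 0 \<le> g s" "\<And>s. g s \<le> B" and T: "T \<ge> 0"
  defines "P \<equiv> \<lambda>t. \<integral>v. indicator {0..t} v * g v \<partial>lborel"
  shows "(\<integral>s. indicator {0..T} s * (g s * exp (P s)) \<partial>lborel) = exp (P T) - 1"
proof -
  have B: "0 \<le> B" using g[of 0] by linarith
  have int: "integrable lborel (\<lambda>v. indicator {s..t} v * g v)" for s t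
    by (rule integrable_bounded_support[where S="{s..t}" and B=B])
       (use g B in \<open>auto simp: emeasure_lborel_Icc_eq indicator_def\<close>)
  have Pdiff: "P t - P s = (\<integral>v. indicator {s..t} v * g v \<partial>lborel)" if "0 \<le> s" "s \<le> t" for s t
  proof -
    have "(\<integral>v. indicator {0..s} v * g v + indicator {s..t} v * g v \<partial>lborel) = P s + (\<integral>v. indicator {s..t} v * g v \<partial>lborel)"
      unfolding P_def by (rule Bochner_Integration.integral_add[OF int int])
    moreover have "(\<integral>v. indicator {0..s} v * g v + indicator {s..t} v * g v \<partial>lborel) = P t"
      unfolding P_def by (rule integral_cong_AE) (use AE_lborel_singleton[of s] that in \<open>auto elim!: eventually_mono simp: indicator_def\<close>)
    ultimately show ?thesis by simp
  qed
  have Pbound: "0 \<le> P t - P s" "P t - P s \<le> B * (t - s)" if "0 \<le> s" "s \<le> t" for s t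
  proof -
    show "0 \<le> P t - P s" unfolding Pdiff[OF that] by (rule Bochner_Integration.integral_nonneg) (simp add: g)
    have "(\<integral>v. indicator {s..t} v * g v \<partial>lborel) \<le> (\<integral>v. indicator {s..t} v * B \<partial>lborel)"
      by (rule Bochner_Integration.integral_mono[OF int]) (auto simp: g emeasure_lborel_Icc_eq intro!: mult_left_mono)
    then show "P t - P s \<le> B * (t - s)" unfolding Pdiff[OF that] using that by (simp add: mult.commute)
  qed
  have P0: "P 0 = 0"
  proof -
    have "P 0 = (\<integral>v. 0 \<partial>(lborel :: real measure))" unfolding P_def
    proof (rule integral_cong_AE)
      show "AE v in lborel. indicator {0..0} v * g v = 0"
        using AE_lborel_singleton[of "0::real"] by eventually_elim (simp add: indicator_def)
    qed measurable
    then show ?thesis by simp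
  qed
  have [measurable]: "P \<in> borel_measurable borel"
  proof -
    have "P = (\<lambda>t. \<integral>v. (if 0 \<le> v \<and> v \<le> t then g v else 0) \<partial>lborel)"
      unfolding P_def by (auto simp: fun_eq_iff indicator_def intro!: Bochner_Integration.integral_cong)
    also have "\<dots> \<in> borel_measurable borel" by measurable
    finally show ?thesis .
  qed
  define E where "E = exp (P T)"
  have Ple: "exp (P s) \<le> E" if "0 \<le> s" "s \<le> T" for s using Pbound(1)[OF that] by (simp add: E_def)
  have intE: "integrable lborel (\<lambda>v. indicator {s..t} v * (g v * exp (P v)))" if "0 \<le> s" "t \<le> T" for s t
  proof (rule integrable_bounded_support[where S="{s..t}" and B="B * E"])
    fix v
    show "\<bar>indicator {s..t} v * (g v * exp (P v))\<bar> \<le> B * E * indicator {s..t} v"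
      using that g[of v] Ple[of v] B by (auto simp: indicator_def intro!: mult_mono)
  qed (auto simp: emeasure_lborel_Icc_eq)
  define Q where "Q t = (\<integral>s. indicator {0..t} s * (g s * exp (P s)) \<partial>lborel)" for t
  have Qdiff: "Q t - Q s = (\<integral>v. indicator {s..t} v * (g v * exp (P v)) \<partial>lborel)" if "0 \<le> s" "s \<le> t" "t \<le> T" for s t
  proof -
    have "(\<integral>v. indicator {0..s} v * (g v * exp (P v)) + indicator {s..t} v * (g v * exp (P v)) \<partial>lborel) = Q s + (\<integral>v. indicator {s..t} v * (g v * exp (P v)) \<partial>lborel)"
      unfolding Q_def by (rule Bochner_Integration.integral_add) (use intE that in auto)
    moreover have "(\<integral>v. indicator {0..s} v * (g v * exp (P v)) + indicator {s..t} v * (g v * exp (P v)) \<partial>lborel) = Q t"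
      unfolding Q_def by (rule integral_cong_AE) (use AE_lborel_singleton[of s] that in \<open>auto elim!: eventually_mono simp: indicator_def\<close>)
    ultimately show ?thesis by simp
  qed
  have Q0: "Q 0 = 0"
  proof -
    have "Q 0 = (\<integral>v. 0 \<partial>(lborel :: real measure))" unfolding Q_def
    proof (rule integral_cong_AE)
      show "AE v in lborel. indicator {0..0} v * (g v * exp (P v)) = 0"
        using AE_lborel_singleton[of "0::real"] by eventually_elim (simp add: indicator_def)
    qed measurable
    then show ?thesis by simp
  qed
  \<comment> \<open>Over [s, t] both exp P and Q grow by \<open>exp (P s) * \<delta>\<close> up to
    terms of second order in \<delta>, and \<delta> is at most B (t - s); this is the origin of the
    constant C.\<close>
  have "(exp (P T) - Q T) = (exp (P 0) - Q 0)"
  proof (rule quadratic_increments_const[OF T, where C="E * B\<^sup>2"])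
    fix s t :: real assume st: "0 \<le> s" "s \<le> t" "t \<le> T"
    define \<delta> where "\<delta> = P t - P s"
    have \<delta>: "0 \<le> \<delta>" "\<delta> \<le> B * (t - s)" using Pbound[OF st(1,2)] by (auto simp: \<delta>_def)
    have Pt: "exp (P t) = exp (P s) * exp \<delta>" by (simp add: \<delta>_def exp_add[symmetric])
    have mid: "exp (P s) \<le> exp (P v)" "exp (P v) \<le> exp (P t)" if "s \<le> v" "v \<le> t" for v
      using Pbound(1)[of s v] Pbound(1)[of v t] that st by auto
    have lo: "exp (P s) * \<delta> \<le> Q t - Q s"
    proof -
      have "(\<integral>v. exp (P s) * (indicator {s..t} v * g v) \<partial>lborel) \<le> (\<integral>v. indicator {s..t} v * (g v * exp (P v)) \<partial>lborel)"
        by (rule Bochner_Integration.integral_mono)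
           (use intE st int mid g in \<open>auto simp: indicator_def mult.commute intro!: mult_left_mono\<close>)
      then show ?thesis using Qdiff[OF st] Pdiff[OF st(1,2)] by (simp add: \<delta>_def)
    qed
    have hi: "Q t - Q s \<le> exp (P t) * \<delta>"
    proof -
      have "(\<integral>v. indicator {s..t} v * (g v * exp (P v)) \<partial>lborel) \<le> (\<integral>v. exp (P t) * (indicator {s..t} v * g v) \<partial>lborel)"
        by (rule Bochner_Integration.integral_mono)
           (use intE st int mid g in \<open>auto simp: indicator_def mult.commute intro!: mult_left_mono\<close>)
      then show ?thesis using Qdiff[OF st] Pdiff[OF st(1,2)] by (simp add: \<delta>_def)
    qed
    have "1 + \<delta> \<le> exp \<delta>" by (rule exp_ge_add_one_self)
    moreover have "1 - \<delta> \<le> exp (- \<delta>)" using exp_ge_add_one_self[of "- \<delta>"] by simp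
    then have "exp \<delta> * (1 - \<delta>) \<le> 1" using mult_left_mono[of "1 - \<delta>" "exp (- \<delta>)" "exp \<delta>"] by (simp add: exp_add[symmetric])
    ultimately have e: "0 \<le> exp \<delta> - 1 - \<delta>" "exp \<delta> - 1 \<le> \<delta> * exp \<delta>" by (auto simp: algebra_simps)
    have "exp (P s) * (exp \<delta> - 1) - (Q t - Q s) \<le> exp (P s) * (exp \<delta> - 1 - \<delta>)" using lo by (simp add: algebra_simps)
    also have "\<dots> \<le> exp (P s) * (\<delta> * exp \<delta> - \<delta>)" using e by (intro mult_left_mono) auto
    also have "\<dots> = exp (P s) * \<delta> * (exp \<delta> - 1)" by (simp add: algebra_simps)
    finally have u: "exp (P s) * (exp \<delta> - 1) - (Q t - Q s) \<le> exp (P s) * \<delta> * (exp \<delta> - 1)" .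
    have "exp (P s) * (exp \<delta> - 1) - (Q t - Q s) \<ge> exp (P s) * (exp \<delta> - 1 - \<delta> * exp \<delta>)" using hi Pt by (simp add: algebra_simps)
    moreover have "exp (P s) * (exp \<delta> - 1 - \<delta> * exp \<delta>) \<ge> exp (P s) * (\<delta> - \<delta> * exp \<delta>)" using e by (intro mult_left_mono) auto
    moreover have "exp (P s) * (\<delta> - \<delta> * exp \<delta>) = - (exp (P s) * \<delta> * (exp \<delta> - 1))" by (simp add: algebra_simps)
    ultimately have l: "- (exp (P s) * \<delta> * (exp \<delta> - 1)) \<le> exp (P s) * (exp \<delta> - 1) - (Q t - Q s)" by linarith
    have "(exp (P t) - Q t) - (exp (P s) - Q s) = exp (P s) * (exp \<delta> - 1) - (Q t - Q s)" by (simp add: Pt algebra_simps)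
    then have "\<bar>(exp (P t) - Q t) - (exp (P s) - Q s)\<bar> \<le> exp (P s) * \<delta> * (exp \<delta> - 1)" using u l by linarith
    also have "\<dots> \<le> exp (P s) * \<delta> * (\<delta> * exp \<delta>)" using e \<delta> by (intro mult_left_mono) auto
    also have "\<dots> = exp (P t) * (\<delta> * \<delta>)" by (simp add: Pt)
    also have "\<dots> \<le> E * ((B * (t - s)) * (B * (t - s)))"
      by (intro mult_mono Ple \<delta>) (use st \<delta> B E_def in auto)
    also have "\<dots> = E * B\<^sup>2 * (t - s)\<^sup>2" by (simp add: power2_eq_square)
    finally show "\<bar>(exp (P t) - Q t) - (exp (P s) - Q s)\<bar> \<le> E * B\<^sup>2 * (t - s)\<^sup>2" .
  qed
  then show ?thesis unfolding P0 Q0 by (simp add: Q_def)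
qed

lemma primitive_shift:
  fixes j :: "real \<Rightarrow> real"
  assumes [measurable]: "j \<in> borel_measurable borel" and j: "\<And>s. 0 \<le> j s" "\<And>s. j s \<le> 1" and s: "0 \<le> s" and u: "0 \<le> u"
  shows "(\<integral>v. indicator {0..s + u} v * j v \<partial>lborel) = (\<integral>v. indicator {0..s} v * j v \<partial>lborel) + (\<integral>v. indicator {0..u} v * j (s + v) \<partial>lborel)"
proof -
  have int: "integrable lborel (\<lambda>v. indicator {a..b} v * j v)" for a b
    by (rule integrable_bounded_support[where S="{a..b}" and B=1])
       (use j in \<open>auto simp: emeasure_lborel_Icc_eq indicator_def\<close>)
  have "(\<integral>v. indicator {0..s + u} v * j v \<partial>lborel) = (\<integral>v. indicator {0..s} v * j v + indicator {s..s + u} v * j v \<partial>lborel)"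
    by (rule integral_cong_AE) (use AE_lborel_singleton[of s] s u in \<open>auto elim!: eventually_mono simp: indicator_def\<close>)
  also have "\<dots> = (\<integral>v. indicator {0..s} v * j v \<partial>lborel) + (\<integral>v. indicator {s..s + u} v * j v \<partial>lborel)"
    by (rule Bochner_Integration.integral_add[OF int int])
  also have "(\<integral>v. indicator {s..s + u} v * j v \<partial>lborel) = (\<integral>v. indicator {s..s + u} (s + 1 * v) * j (s + 1 * v) \<partial>lborel)"
    by (subst lborel_integral_real_affine[where c=1 and t=s]) auto
  also have "\<dots> = (\<integral>v. indicator {0..u} v * j (s + v) \<partial>lborel)"
    by (rule Bochner_Integration.integral_cong) (auto simp: indicator_def)
  finally show ?thesis .
qed

text \<open>With P the primitive of j, the identity exp (- q P(t)) = 1 - q int_0^t j(s) exp (- q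
  (P(t) - P(s))) ds is inserted and the order of s and t exchanged. The translation t = s + u then
  leaves a functional of the path after s.\<close>

lemma feynman_kac_path:
  fixes j \<alpha> :: "real \<Rightarrow> real" and p q :: real
  assumes [measurable]: "j \<in> borel_measurable borel" "\<alpha> \<in> borel_measurable borel"
    and j: "\<And>s. 0 \<le> j s" "\<And>s. j s \<le> 1" and \<alpha>: "\<And>t. \<bar>\<alpha> t\<bar> \<le> 1" and p: "p > 0" and q: "q \<ge> 0"
  shows "(\<integral>t. exponential_density p t * (exp (- q * (\<integral>v. indicator {0..t} v * j v \<partial>lborel)) * \<alpha> t) \<partial>lborel) =
    (\<integral>t. exponential_density p t * \<alpha> t \<partial>lborel) -
    q * (\<integral>s. indicator {0..} s * exp (- p * s) * (j s *
      (\<integral>u. exponential_density p u * (exp (- q * (\<integral>v. indicator {0..u} v * j (s + v) \<partial>lborel)) * \<alpha> (s + u)) \<partial>lborel)) \<partial>lborel)"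
proof -
  define P where "P t = (\<integral>v. indicator {0..t} v * j v \<partial>lborel)" for t
  have Pm [measurable]: "P \<in> borel_measurable borel"
  proof -
    have "P = (\<lambda>t. \<integral>v. (if 0 \<le> v \<and> v \<le> t then j v else 0) \<partial>lborel)"
      unfolding P_def by (auto simp: fun_eq_iff indicator_def intro!: Bochner_Integration.integral_cong)
    also have "\<dots> \<in> borel_measurable borel" by measurable
    finally show ?thesis .
  qed
  have shift: "P (s + u) = P s + (\<integral>v. indicator {0..u} v * j (s + v) \<partial>lborel)" if "0 \<le> s" "0 \<le> u" for s u
    unfolding P_def by (rule primitive_shift) (use j that in auto)
  have Pmono: "P s \<le> P t" if "0 \<le> s" "s \<le> t" for s t
  proof -
    have "0 \<le> (\<integral>v. indicator {0..t - s} v * j (s + v) \<partial>lborel)" by (rule Bochner_Integration.integral_nonneg) (simp add: j)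
    then show ?thesis using shift[of s "t - s"] that by simp
  qed
  have expP: "exp (- q * P t) = 1 - q * (\<integral>s. indicator {0..t} s * (j s * exp (- q * (P t - P s))) \<partial>lborel)" if t: "0 \<le> t" for t
  proof -
    have PP: "(\<integral>v. indicator {0..t} v * (q * j v) \<partial>lborel) = q * P t" for t
      unfolding P_def by (subst integral_mult_right_zero[symmetric]) (simp add: mult.left_commute)
    have "(\<integral>s. indicator {0..t} s * ((q * j s) * exp (q * P s)) \<partial>lborel) = exp (q * P t) - 1"
      using exp_primitive_identity[of "\<lambda>s. q * j s" q t] j q t by (simp add: PP mult_left_le)
    then have "exp (- q * P t) * (\<integral>s. indicator {0..t} s * ((q * j s) * exp (q * P s)) \<partial>lborel) = 1 - exp (- q * P t)"
      by (simp add: right_diff_distrib exp_add[symmetric])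
    moreover have "exp (- q * P t) * (\<integral>s. indicator {0..t} s * ((q * j s) * exp (q * P s)) \<partial>lborel)
        = q * (\<integral>s. indicator {0..t} s * (j s * exp (- q * (P t - P s))) \<partial>lborel)"
      unfolding integral_mult_right_zero[symmetric]
    proof (rule Bochner_Integration.integral_cong[OF refl])
      fix s
      have "exp (- q * P t) * exp (q * P s) = exp (- q * (P t - P s))" unfolding exp_add[symmetric] by (simp add: algebra_simps)
      then show "exp (- q * P t) * (indicator {0..t} s * ((q * j s) * exp (q * P s))) = q * (indicator {0..t} s * (j s * exp (- q * (P t - P s))))"
        by (metis mult.assoc mult.left_commute)
    qed
    ultimately show ?thesis by simp
  qed
  define h where "h s t = (if 0 \<le> s \<and> s \<le> t then p * exp (- p * t) * \<alpha> t * (j s * exp (- q * (P t - P s))) else 0)" for s t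
  have hm [measurable]: "case_prod h \<in> borel_measurable (lborel \<Otimes>\<^sub>M lborel)" unfolding h_def[abs_def] by measurable
  \<comment> \<open>A majorant of |h| with explicit integral
    \<open>exponential_density p s / p\<close> in t, which justifies the exchange of
    integrals.\<close>
  define b where "b s t = (if 0 \<le> s \<and> s \<le> t then p * exp (- p * t) else 0)" for s t
  have hb: "\<bar>h s t\<bar> \<le> b s t" for s t
  proof (cases "0 \<le> s \<and> s \<le> t")
    case True
    have 1: "exp (- q * (P t - P s)) \<le> 1" using Pmono[of s t] True q by simp
    have "\<bar>\<alpha> t\<bar> * (j s * exp (- q * (P t - P s))) \<le> 1 * (1 * 1)" by (intro mult_mono \<alpha> j 1) (use j in auto)
    then have "(p * exp (- p * t)) * (\<bar>\<alpha> t\<bar> * (j s * exp (- q * (P t - P s)))) \<le> (p * exp (- p * t)) * 1"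
      using p by (intro mult_left_mono) auto
    then show ?thesis using True p j[of s] by (simp add: h_def b_def abs_mult mult.assoc)
  qed (auto simp: h_def b_def)
  have b_int: "integrable lborel (b s)" "(\<integral>t. b s t \<partial>lborel) = exponential_density p s / p" for s
  proof -
    have e: "(\<integral>t. (if s \<le> t then p * exp (- p * t) else 0) \<partial>lborel) = exp (- p * s)"
    proof -
      have "(\<integral>t. (if s \<le> t then p * exp (- p * t) else 0) \<partial>lborel) = (\<integral>t. (if s < t then p * exp (- p * t) else 0) \<partial>lborel)"
      proof (rule integral_cong_AE)
        show "AE t in lborel. (if s \<le> t then p * exp (- p * t) else 0) = (if s < t then p * exp (- p * t) else 0)"
          using AE_lborel_singleton[of s] by eventually_elim auto
      qed measurable
      then show ?thesis using integral_exp_after[OF p, of s] by simp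
    qed
    then have i: "integrable lborel (\<lambda>t. if s \<le> t then p * exp (- p * t) else 0)"
      using not_integrable_integral_eq by fastforce
    show "integrable lborel (b s)" using i by (cases "0 \<le> s") (auto simp: b_def[abs_def])
    show "(\<integral>t. b s t \<partial>lborel) = exponential_density p s / p"
      using e p by (cases "0 \<le> s") (auto simp: b_def exponential_density_eq)
  qed
  have bm [measurable]: "case_prod b \<in> borel_measurable (lborel \<Otimes>\<^sub>M lborel)" unfolding b_def[abs_def] by measurable
  have bint: "integrable (lborel \<Otimes>\<^sub>M lborel) (case_prod b)"
  proof (rule lborel_pair.Fubini_integrable)
    have "norm (b s t) = b s t" for s t using p by (simp add: b_def)
    then show "integrable lborel (\<lambda>s. \<integral>t. norm (case_prod b (s, t)) \<partial>lborel)"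
      using integrable_exponential_density[OF p] by (simp add: b_int)
  qed (auto simp: b_int)
  have hint: "integrable (lborel \<Otimes>\<^sub>M lborel) (case_prod h)"
    by (rule Bochner_Integration.integrable_bound[OF bint])
       (use hb in \<open>auto intro!: AE_I2 order_trans[OF hb] abs_ge_self\<close>)
  have ea: "integrable lborel (\<lambda>t. exponential_density p t * \<alpha> t)"
    by (rule Bochner_Integration.integrable_bound[OF integrable_exponential_density[OF p]])
       (use \<alpha> exponential_density_nonneg'[OF p] in \<open>auto intro!: AE_I2 mult_left_le simp: abs_mult\<close>)
  have "(\<integral>t. exponential_density p t * (exp (- q * P t) * \<alpha> t) \<partial>lborel) =
      (\<integral>t. exponential_density p t * \<alpha> t - q * (\<integral>s. h s t \<partial>lborel) \<partial>lborel)"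
  proof (rule Bochner_Integration.integral_cong[OF refl])
    fix t
    show "exponential_density p t * (exp (- q * P t) * \<alpha> t) = exponential_density p t * \<alpha> t - q * (\<integral>s. h s t \<partial>lborel)"
    proof (cases "0 \<le> t")
      case True
      have "(\<integral>s. h s t \<partial>lborel) = (\<integral>s. (p * exp (- p * t) * \<alpha> t) * (indicator {0..t} s * (j s * exp (- q * (P t - P s)))) \<partial>lborel)"
        by (rule Bochner_Integration.integral_cong) (auto simp: h_def indicator_def)
      also have "\<dots> = (p * exp (- p * t) * \<alpha> t) * (\<integral>s. indicator {0..t} s * (j s * exp (- q * (P t - P s))) \<partial>lborel)" by simp
      finally have H: "(\<integral>s. h s t \<partial>lborel) = (p * exp (- p * t) * \<alpha> t) * (\<integral>s. indicator {0..t} s * (j s * exp (- q * (P t - P s))) \<partial>lborel)" .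
      have alg: "k * ((1 - q * I) * b) = k * b - q * (k * b * I)" for I k b :: real by (simp add: algebra_simps)
      have ed: "exponential_density p t = p * exp (- p * t)" using True by (simp add: exponential_density_eq)
      show ?thesis unfolding H ed expP[OF True] by (rule alg)
    next
      case False
      then have "h s t = 0" for s by (simp add: h_def)
      then show ?thesis using False by (simp add: exponential_density_eq)
    qed
  qed
  also have "\<dots> = (\<integral>t. exponential_density p t * \<alpha> t \<partial>lborel) - q * (\<integral>t. (\<integral>s. h s t \<partial>lborel) \<partial>lborel)"
    using ea lborel_pair.integrable_snd[OF hint] by simp
  also have "(\<integral>t. (\<integral>s. h s t \<partial>lborel) \<partial>lborel) = (\<integral>s. (\<integral>t. h s t \<partial>lborel) \<partial>lborel)"
    by (rule lborel_pair.Fubini_integral[OF hint])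
  also have "(\<integral>s. (\<integral>t. h s t \<partial>lborel) \<partial>lborel) = (\<integral>s. indicator {0..} s * exp (- p * s) * (j s *
      (\<integral>u. exponential_density p u * (exp (- q * (\<integral>v. indicator {0..u} v * j (s + v) \<partial>lborel)) * \<alpha> (s + u)) \<partial>lborel)) \<partial>lborel)"
  proof (rule Bochner_Integration.integral_cong[OF refl])
    fix s
    show "(\<integral>t. h s t \<partial>lborel) = indicator {0..} s * exp (- p * s) * (j s *
      (\<integral>u. exponential_density p u * (exp (- q * (\<integral>v. indicator {0..u} v * j (s + v) \<partial>lborel)) * \<alpha> (s + u)) \<partial>lborel))"
    proof (cases "0 \<le> s")
      case True
      have "(\<integral>t. h s t \<partial>lborel) = (\<integral>u. h s (s + 1 * u) \<partial>lborel)"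
        by (subst lborel_integral_real_affine[where c=1 and t=s]) auto
      also have "\<dots> = (\<integral>u. (exp (- p * s) * j s) * (exponential_density p u * (exp (- q * (\<integral>v. indicator {0..u} v * j (s + v) \<partial>lborel)) * \<alpha> (s + u))) \<partial>lborel)"
      proof (rule Bochner_Integration.integral_cong[OF refl])
        fix u
        have "exp (- p * (s + u)) = exp (- p * s) * exp (- p * u)" unfolding exp_add[symmetric] by (simp add: algebra_simps)
        then show "h s (s + 1 * u) = (exp (- p * s) * j s) * (exponential_density p u * (exp (- q * (\<integral>v. indicator {0..u} v * j (s + v) \<partial>lborel)) * \<alpha> (s + u)))"
          using True shift[OF True, of u] by (cases "0 \<le> u") (simp_all add: h_def exponential_density_eq)
      qed
      finally show ?thesis using True by simp
    qed (simp add: h_def)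
  qed
  finally show ?thesis by (simp add: P_def)
qed

context sn_levy
begin

lemma XX_distr:
  assumes p: "p > 0"
  shows "distr (exp_time p) borel (\<lambda>z. XX (fst z) (snd z)) = density lborel (\<lambda>y. ennreal (p * res_dens p y))"
proof (rule measure_eqI)
  fix A assume "A \<in> sets (distr (exp_time p) borel (\<lambda>z. XX (fst z) (snd z)))"
  then have [measurable]: "A \<in> sets borel" by simp
  have [measurable]: "res_dens p \<in> borel_measurable borel" by (rule res_dens_measurable[OF p])
  have "emeasure (distr (exp_time p) borel (\<lambda>z. XX (fst z) (snd z))) A = (\<integral>\<^sup>+y. indicator A y \<partial>distr (exp_time p) borel (\<lambda>z. XX (fst z) (snd z)))" by simp
  also have "\<dots> = (\<integral>\<^sup>+z. indicator A (XX (fst z) (snd z)) \<partial>exp_time p)" by (rule nn_integral_distr) measurable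
  also have "\<dots> = (\<integral>\<^sup>+y. ennreal (p * res_dens p y) * indicator A y \<partial>lborel)" by (rule XX_nn_integral[OF p]) measurable
  finally show "emeasure (distr (exp_time p) borel (\<lambda>z. XX (fst z) (snd z))) A = emeasure (density lborel (\<lambda>y. ennreal (p * res_dens p y))) A"
    by (simp add: emeasure_density)
qed simp

lemma XX_integral:
  assumes p: "p > 0" and [measurable]: "f \<in> borel_measurable borel"
  shows "(\<integral>z. f (x + XX (fst z) (snd z)) \<partial>exp_time p) = p * (\<integral>z. res_dens p (z - x) * f z \<partial>lborel)"
proof -
  have [measurable]: "res_dens p \<in> borel_measurable borel" by (rule res_dens_measurable[OF p])
  have "(\<integral>z. f (x + XX (fst z) (snd z)) \<partial>exp_time p) = (\<integral>y. f (x + y) \<partial>distr (exp_time p) borel (\<lambda>z. XX (fst z) (snd z)))"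
    by (subst integral_distr) auto
  also have "\<dots> = (\<integral>y. p * res_dens p y * f (x + y) \<partial>lborel)"
    unfolding XX_distr[OF p] using res_dens_nonneg[OF p] p by (subst integral_real_density) auto
  also have "\<dots> = (\<integral>z. p * res_dens p (z - x) * f z \<partial>lborel)"
    by (subst lborel_integral_real_affine[where c=1 and t="-x"]) auto
  finally show ?thesis by (simp add: mult.assoc)
qed

end

section \<open>The resolvent equation of the killed process\<close>

locale omega_killed = sn_levy M X for M :: "'a measure" and X +
  fixes p q a :: real and A :: "real set"
  assumes p: "p > 0" and q: "q \<ge> 0" and A [measurable]: "A \<in> sets borel"
begin

definition occ :: "real \<Rightarrow> real \<Rightarrow> 'a \<Rightarrow> real" where
  "occ t y \<omega> = (\<integral>v. indicator {0..t} v * indicator {0<..<a} (y + XX v \<omega>) \<partial>lborel)"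

text \<open>Division by p turns the expectation at the exponential time into the integral against
  exp (- p t) dt, the left-hand side of the theorem.\<close>

definition res :: "real \<Rightarrow> real" where
  "res y = (\<integral>z. exp (- q * occ (fst z) y (snd z)) * indicator A (y + XX (fst z) (snd z)) \<partial>exp_time p) / p"

lemma occ_measurable [measurable (raw)]:
  assumes [measurable]: "f \<in> borel_measurable N" "g \<in> borel_measurable N" "h \<in> measurable N M"
  shows "(\<lambda>x. occ (f x) (g x) (h x)) \<in> borel_measurable N"
proof -
  have "occ t y \<omega> = (\<integral>v. (if 0 \<le> v \<and> v \<le> t \<and> 0 < y + XX v \<omega> \<and> y + XX v \<omega> < a then 1 else 0) \<partial>lborel)" for t y \<omega>
    unfolding occ_def by (rule Bochner_Integration.integral_cong) (auto simp: indicator_def)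
  then show ?thesis by (simp add: measurable_If)
qed

lemma occ_nonneg: "0 \<le> occ t y \<omega>"
  unfolding occ_def by (rule Bochner_Integration.integral_nonneg) auto

lemma weight_bound: "\<bar>exp (- q * occ t y \<omega>) * indicator A w\<bar> \<le> 1"
  using q occ_nonneg[of t y \<omega>] by (auto simp: indicator_def)

lemma res_measurable [measurable]: "res \<in> borel_measurable borel"
proof -
  interpret N: prob_space "exp_time p" by (rule prob_space_exp_time[OF p])
  show ?thesis unfolding res_def by measurable
qed

lemma res_bound: "0 \<le> res y" "res y \<le> 1 / p"
proof -
  interpret N: prob_space "exp_time p" by (rule prob_space_exp_time[OF p])
  show "0 \<le> res y" unfolding res_def using p by (intro divide_nonneg_nonneg Bochner_Integration.integral_nonneg) auto
  have "integrable (exp_time p) (\<lambda>z. exp (- q * occ (fst z) y (snd z)) * indicator A (y + XX (fst z) (snd z)))"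
    by (rule exp_time_integral(1)[OF p, where B=1]) (use weight_bound in auto)
  then have "(\<integral>z. exp (- q * occ (fst z) y (snd z)) * indicator A (y + XX (fst z) (snd z)) \<partial>exp_time p) \<le> 1"
    by (rule N.integral_le_const) (use weight_bound in \<open>auto simp: abs_le_iff\<close>)
  then show "res y \<le> 1 / p" unfolding res_def using p by (simp add: divide_right_mono)
qed

text \<open>The integrand at time s of \<open>feynman_kac_path\<close>, written on path space: it
  depends only on the path from s on, so that the Markov property at s applies.\<close>

definition Fs :: "real \<Rightarrow> real \<Rightarrow> (real \<Rightarrow> real) \<Rightarrow> real" where
  "Fs y s w = indicator {0<..<a} (y + path_eval w s) * (\<integral>u. exponential_density p u *
     (exp (- q * (\<integral>v. indicator {0..u} v * indicator {0<..<a} (y + path_eval w (s + v)) \<partial>lborel)) * indicator A (y + path_eval w (s + u))) \<partial>lborel)"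

lemma Fs_measurable [measurable (raw)]:
  assumes [measurable]: "f \<in> borel_measurable N" "h \<in> measurable N path_space"
  shows "(\<lambda>x. Fs y (f x) (h x)) \<in> borel_measurable N"
proof -
  have "Fs y s w = indicator {0<..<a} (y + path_eval w s) * (\<integral>u. exponential_density p u *
     (exp (- q * (\<integral>v. (if 0 \<le> v \<and> v \<le> u \<and> 0 < y + path_eval w (s + v) \<and> y + path_eval w (s + v) < a then 1 else 0) \<partial>lborel)) * indicator A (y + path_eval w (s + u))) \<partial>lborel)" for s w
    unfolding Fs_def by (intro arg_cong2[where f="(*)"] refl Bochner_Integration.integral_cong arg_cong[where f=exp]) (auto simp: indicator_def)
  then show ?thesis by simp
qed

lemma Fs_bound:
  assumes "w \<in> space path_space"
  shows "\<bar>Fs y s w\<bar> \<le> 1"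
proof -
  have [measurable]: "(\<lambda>_. w) \<in> measurable N path_space" for N using assms by simp
  define E where "E u = exp (- q * (\<integral>v. indicator {0..u} v * indicator {0<..<a} (y + path_eval w (s + v)) \<partial>lborel)) * indicator A (y + path_eval w (s + u))" for u
  have E: "0 \<le> E u \<and> E u \<le> 1" for u
  proof -
    have "0 \<le> (\<integral>v. indicator {0..u} v * indicator {0<..<a} (y + path_eval w (s + v)) \<partial>lborel :: real)"
      by (rule Bochner_Integration.integral_nonneg) auto
    then show ?thesis using q by (auto simp: E_def indicator_def)
  qed
  have "(\<integral>u. exponential_density p u * E u \<partial>lborel) \<le> (\<integral>u. exponential_density p u \<partial>lborel)"
    by (rule integral_mono_AE'[OF integrable_exponential_density[OF p]])
       (use E exponential_density_nonneg'[OF p] in \<open>auto intro!: AE_I2 mult_left_le\<close>)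
  moreover have "0 \<le> (\<integral>u. exponential_density p u * E u \<partial>lborel)"
    by (rule Bochner_Integration.integral_nonneg) (use E exponential_density_nonneg'[OF p] in auto)
  ultimately have "\<bar>\<integral>u. exponential_density p u * E u \<partial>lborel\<bar> \<le> 1" by (simp add: integral_exponential_density[OF p])
  then show ?thesis unfolding Fs_def E_def[symmetric] by (auto simp: indicator_def)
qed

lemma Fs_markov:
  assumes s: "s \<ge> 0"
  shows "(\<integral>\<omega>. Fs y s (path \<omega>) \<partial>M) = (\<integral>\<omega>. indicator {0<..<a} (y + XX s \<omega>) * (p * res (y + XX s \<omega>)) \<partial>M)"
proof -
  have "(\<integral>\<omega>. Fs y s (path \<omega>) \<partial>M) = (\<integral>\<omega>. \<integral>\<omega>'. Fs y s (restrict (restart s (\<omega>, \<omega>')) {0..}) \<partial>M \<partial>M)"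
    by (rule markov[where B=1]) (use Fs_bound s in auto)
  also have "\<dots> = (\<integral>\<omega>. indicator {0<..<a} (y + XX s \<omega>) * (p * res (y + XX s \<omega>)) \<partial>M)"
  proof (rule Bochner_Integration.integral_cong[OF refl])
    fix \<omega> assume \<omega>: "\<omega> \<in> space M"
    have "(\<integral>\<omega>'. Fs y s (restrict (restart s (\<omega>, \<omega>')) {0..}) \<partial>M) = (\<integral>\<omega>'. indicator {0<..<a} (y + XX s \<omega>) *
       (\<integral>u. exponential_density p u * (exp (- q * occ u (y + XX s \<omega>) \<omega>') * indicator A (y + XX s \<omega> + XX u \<omega>')) \<partial>lborel) \<partial>M)"
    proof (rule Bochner_Integration.integral_cong[OF refl])
      fix \<omega>' assume \<omega>': "\<omega>' \<in> space M"
      let ?w = "restrict (restart s (\<omega>, \<omega>')) {0..}"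
      have sn: "sn_path (restart s (\<omega>, \<omega>'))" by (rule sn_path_restart[OF \<omega> \<omega>' s])
      have ev: "path_eval ?w (s + u) = XX s \<omega> + XX u \<omega>'" if "0 \<le> u" for u
        using path_eval_eq[OF sn, of "s + u"] restart_after[OF \<omega> \<omega>' that, of s] s that by (simp add: XX_def)
      have ev0: "path_eval ?w s = XX s \<omega>" using path_eval_eq[OF sn s] s by (simp add: restart_before XX_def)
      have "(\<integral>v. indicator {0..u} v * indicator {0<..<a} (y + path_eval ?w (s + v)) \<partial>lborel) = occ u (y + XX s \<omega>) \<omega>'" for u
        unfolding occ_def by (rule Bochner_Integration.integral_cong) (auto simp: indicator_def ev add.assoc)
      then have "(\<integral>u. exponential_density p u * (exp (- q * (\<integral>v. indicator {0..u} v * indicator {0<..<a} (y + path_eval ?w (s + v)) \<partial>lborel)) * indicator A (y + path_eval ?w (s + u))) \<partial>lborel)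
        = (\<integral>u. exponential_density p u * (exp (- q * occ u (y + XX s \<omega>) \<omega>') * indicator A (y + XX s \<omega> + XX u \<omega>')) \<partial>lborel)"
        by (intro Bochner_Integration.integral_cong refl) (auto simp: exponential_density_eq ev add.assoc)
      then show "Fs y s ?w = indicator {0<..<a} (y + XX s \<omega>) *
       (\<integral>u. exponential_density p u * (exp (- q * occ u (y + XX s \<omega>) \<omega>') * indicator A (y + XX s \<omega> + XX u \<omega>')) \<partial>lborel)"
        by (simp add: Fs_def ev0)
    qed
    also have "\<dots> = indicator {0<..<a} (y + XX s \<omega>) *
       (\<integral>\<omega>'. (\<integral>u. exponential_density p u * (exp (- q * occ u (y + XX s \<omega>) \<omega>') * indicator A (y + XX s \<omega> + XX u \<omega>')) \<partial>lborel) \<partial>M)" by simp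
    also have "(\<integral>\<omega>'. (\<integral>u. exponential_density p u * (exp (- q * occ u (y + XX s \<omega>) \<omega>') * indicator A (y + XX s \<omega> + XX u \<omega>')) \<partial>lborel) \<partial>M) = p * res (y + XX s \<omega>)"
      unfolding res_def using p
      by (subst exp_time_integral(2)[OF p, where B=1]) (use weight_bound in auto)
    finally show "(\<integral>\<omega>'. Fs y s (restrict (restart s (\<omega>, \<omega>')) {0..}) \<partial>M) = indicator {0<..<a} (y + XX s \<omega>) * (p * res (y + XX s \<omega>))" .
  qed
  finally show ?thesis .
qed

text \<open>The pathwise identity is averaged. The weight exp (- p s) is 1 / p times the exponential
  density, so the outer integral is again an expectation at the exponential time, and the Markov
  property at s replaces the future by p times \<open>res\<close>.\<close>

theorem feynman_kac:
  "res y = (\<integral>z. indicator A (y + XX (fst z) (snd z)) \<partial>exp_time p) / p -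
     q / p * (\<integral>z. indicator {0<..<a} (y + XX (fst z) (snd z)) * res (y + XX (fst z) (snd z)) \<partial>exp_time p)"
proof -
  have fb: "\<bar>Fs y s (path \<omega>)\<bar> \<le> 1" if "\<omega> \<in> space M" for s \<omega>
    by (rule Fs_bound[OF measurable_space[OF path_measurable that]])
  let ?a = "\<lambda>\<omega>. \<integral>t. exponential_density p t * indicator A (y + XX t \<omega>) \<partial>lborel"
  let ?b = "\<lambda>\<omega>. \<integral>s. exponential_density p s * Fs y s (path \<omega>) \<partial>lborel"
  have "p * res y = (\<integral>\<omega>. (\<integral>t. exponential_density p t * (exp (- q * occ t y \<omega>) * indicator A (y + XX t \<omega>)) \<partial>lborel) \<partial>M)"
    unfolding res_def using p by (subst exp_time_integral(2)[OF p, where B=1]) (use weight_bound in auto)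
  also have "\<dots> = (\<integral>\<omega>. ?a \<omega> - q / p * ?b \<omega> \<partial>M)"
  proof (rule Bochner_Integration.integral_cong[OF refl])
    fix \<omega> assume \<omega>: "\<omega> \<in> space M"
    have [measurable]: "(\<lambda>_. \<omega>) \<in> measurable borel M" using \<omega> by simp
    have "(\<integral>t. exponential_density p t * (exp (- q * occ t y \<omega>) * indicator A (y + XX t \<omega>)) \<partial>lborel) =
      ?a \<omega> - q * (\<integral>s. indicator {0..} s * exp (- p * s) * (indicator {0<..<a} (y + XX s \<omega>) *
      (\<integral>u. exponential_density p u * (exp (- q * (\<integral>v. indicator {0..u} v * indicator {0<..<a} (y + XX (s + v) \<omega>) \<partial>lborel)) * indicator A (y + XX (s + u) \<omega>)) \<partial>lborel)) \<partial>lborel)"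
      unfolding occ_def
      by (rule feynman_kac_path[where j="\<lambda>s. indicator {0<..<a} (y + XX s \<omega>)" and \<alpha>="\<lambda>t. indicator A (y + XX t \<omega>)"]) (use p q in auto)
    also have "(\<integral>s. indicator {0..} s * exp (- p * s) * (indicator {0<..<a} (y + XX s \<omega>) *
      (\<integral>u. exponential_density p u * (exp (- q * (\<integral>v. indicator {0..u} v * indicator {0<..<a} (y + XX (s + v) \<omega>) \<partial>lborel)) * indicator A (y + XX (s + u) \<omega>)) \<partial>lborel)) \<partial>lborel) = (\<integral>s. 1 / p * (exponential_density p s * Fs y s (path \<omega>)) \<partial>lborel)"
    proof (rule Bochner_Integration.integral_cong[OF refl])
      fix s
      have ev: "path_eval (path \<omega>) s = XX s \<omega>" if "0 \<le> s" for s using path_eval_eq[OF sn_path_X[OF \<omega>] that] that by (simp add: XX_def)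
      show "indicator {0..} s * exp (- p * s) * (indicator {0<..<a} (y + XX s \<omega>) *
      (\<integral>u. exponential_density p u * (exp (- q * (\<integral>v. indicator {0..u} v * indicator {0<..<a} (y + XX (s + v) \<omega>) \<partial>lborel)) * indicator A (y + XX (s + u) \<omega>)) \<partial>lborel)) = 1 / p * (exponential_density p s * Fs y s (path \<omega>))"
      proof (cases "0 \<le> s")
        case True
        have "(\<integral>v. indicator {0..u} v * indicator {0<..<a} (y + XX (s + v) \<omega>) \<partial>lborel) = (\<integral>v. indicator {0..u} v * indicator {0<..<a} (y + path_eval (path \<omega>) (s + v)) \<partial>lborel :: real)" for u
          by (rule Bochner_Integration.integral_cong) (use True in \<open>auto simp: indicator_def ev\<close>)
        then have "(\<integral>u. exponential_density p u * (exp (- q * (\<integral>v. indicator {0..u} v * indicator {0<..<a} (y + XX (s + v) \<omega>) \<partial>lborel)) * indicator A (y + XX (s + u) \<omega>)) \<partial>lborel)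
          = (\<integral>u. exponential_density p u * (exp (- q * (\<integral>v. indicator {0..u} v * indicator {0<..<a} (y + path_eval (path \<omega>) (s + v)) \<partial>lborel)) * indicator A (y + path_eval (path \<omega>) (s + u))) \<partial>lborel)"
          by (intro Bochner_Integration.integral_cong refl) (use True in \<open>auto simp: exponential_density_eq ev\<close>)
        then have F: "indicator {0<..<a} (y + XX s \<omega>) * (\<integral>u. exponential_density p u * (exp (- q * (\<integral>v. indicator {0..u} v * indicator {0<..<a} (y + XX (s + v) \<omega>) \<partial>lborel)) * indicator A (y + XX (s + u) \<omega>)) \<partial>lborel) = Fs y s (path \<omega>)"
          using ev[OF True] by (simp only: Fs_def)
        have "1 / p * (exponential_density p s * c) = exp (- p * s) * c" for c using True p by (simp add: exponential_density_eq)
        then show ?thesis unfolding F using True by simp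
      qed (simp add: exponential_density_eq)
    qed
    also have "\<dots> = 1 / p * ?b \<omega>" by (rule integral_mult_right_zero)
    finally show "(\<integral>t. exponential_density p t * (exp (- q * occ t y \<omega>) * indicator A (y + XX t \<omega>)) \<partial>lborel) = ?a \<omega> - q / p * ?b \<omega>" by simp
  qed
  also have "\<dots> = (\<integral>\<omega>. ?a \<omega> \<partial>M) - q / p * (\<integral>\<omega>. ?b \<omega> \<partial>M)"
  proof -
    have mean_bound: "norm (\<integral>t. exponential_density p t * f t \<partial>lborel) \<le> 1"
      if [measurable]: "f \<in> borel_measurable borel" and f: "\<And>t. \<bar>f t\<bar> \<le> 1" for f
    proof -
      have b: "norm (exponential_density p t * f t) \<le> exponential_density p t" for t
        using f[of t] exponential_density_nonneg'[OF p, of t] by (simp add: abs_mult mult_left_le)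
      have "norm (\<integral>t. exponential_density p t * f t \<partial>lborel) \<le> (\<integral>t. exponential_density p t \<partial>lborel)"
      proof (rule Bochner_Integration.integral_norm_bound_integral[OF _ integrable_exponential_density[OF p] b])
        show "integrable lborel (\<lambda>t. exponential_density p t * f t)"
          by (rule Bochner_Integration.integrable_bound[OF integrable_exponential_density[OF p]])
             (use b exponential_density_nonneg'[OF p] in auto)
      qed
      then show ?thesis by (simp only: integral_exponential_density[OF p])
    qed
    have "integrable M ?a"
    proof (rule integrable_const_bound[where B=1])
      show "AE \<omega> in M. norm (?a \<omega>) \<le> 1"
      proof (rule AE_I2)
        fix \<omega> assume "\<omega> \<in> space M"
        then have [measurable]: "(\<lambda>_. \<omega>) \<in> measurable borel M" by simp
        show "norm (?a \<omega>) \<le> 1" by (rule mean_bound) auto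
      qed
    qed measurable
    moreover have "integrable M ?b"
    proof (rule integrable_const_bound[where B=1])
      show "AE \<omega> in M. norm (?b \<omega>) \<le> 1"
      proof (rule AE_I2)
        fix \<omega> assume \<omega>: "\<omega> \<in> space M"
        have [measurable]: "(\<lambda>_. path \<omega>) \<in> measurable borel path_space"
          using measurable_space[OF path_measurable \<omega>] by simp
        show "norm (?b \<omega>) \<le> 1" by (rule mean_bound) (use fb[OF \<omega>] in auto)
      qed
    qed measurable
    ultimately show ?thesis by simp
  qed
  also have "(\<integral>\<omega>. ?a \<omega> \<partial>M) = (\<integral>z. indicator A (y + XX (fst z) (snd z)) \<partial>exp_time p)"
    by (subst exp_time_integral(2)[OF p, where B=1]) auto
  also have "(\<integral>\<omega>. ?b \<omega> \<partial>M) = (\<integral>s. exponential_density p s * (\<integral>\<omega>. Fs y s (path \<omega>) \<partial>M) \<partial>lborel)"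
  proof -
    have m: "(\<lambda>z. Fs y (fst z) (path (snd z))) \<in> borel_measurable (borel \<Otimes>\<^sub>M M)" by measurable
    have b: "\<bar>Fs y (fst z) (path (snd z))\<bar> \<le> 1" if "z \<in> space (exp_time p)" for z
      using that fb[of "snd z" "fst z"] by (auto simp: space_exp_time)
    show ?thesis using exp_time_integral(2)[OF p m b] exp_time_integral(3)[OF p m b] by simp
  qed
  also have "\<dots> = (\<integral>s. p * (exponential_density p s * (\<integral>\<omega>. indicator {0<..<a} (y + XX s \<omega>) * res (y + XX s \<omega>) \<partial>M)) \<partial>lborel)"
  proof (rule Bochner_Integration.integral_cong[OF refl])
    fix s
    show "exponential_density p s * (\<integral>\<omega>. Fs y s (path \<omega>) \<partial>M) = p * (exponential_density p s * (\<integral>\<omega>. indicator {0<..<a} (y + XX s \<omega>) * res (y + XX s \<omega>) \<partial>M))"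
    proof (cases "0 \<le> s")
      case True
      have "(\<integral>\<omega>. indicator {0<..<a} (y + XX s \<omega>) * (p * res (y + XX s \<omega>)) \<partial>M) = p * (\<integral>\<omega>. indicator {0<..<a} (y + XX s \<omega>) * res (y + XX s \<omega>) \<partial>M)"
        by (subst integral_mult_right_zero[symmetric]) (simp add: mult.left_commute)
      then show ?thesis using Fs_markov[OF True, of y] by simp
    qed (simp add: exponential_density_eq)
  qed
  also have "\<dots> = p * (\<integral>s. exponential_density p s * (\<integral>\<omega>. indicator {0<..<a} (y + XX s \<omega>) * res (y + XX s \<omega>) \<partial>M) \<partial>lborel)"
    by (rule integral_mult_right_zero)
  also have "(\<integral>s. exponential_density p s * (\<integral>\<omega>. indicator {0<..<a} (y + XX s \<omega>) * res (y + XX s \<omega>) \<partial>M) \<partial>lborel) =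
      (\<integral>z. indicator {0<..<a} (y + XX (fst z) (snd z)) * res (y + XX (fst z) (snd z)) \<partial>exp_time p)"
    by (subst exp_time_integral(3)[OF p, where B="1 / p"]) (use res_bound p in \<open>auto simp: indicator_def\<close>)
  finally show ?thesis using p by (simp add: field_simps)
qed

end

section \<open>Solving the resolvent equation\<close>

abbreviation icc :: "real \<Rightarrow> real \<Rightarrow> (real \<Rightarrow> real) \<Rightarrow> real" where
  "icc u v f \<equiv> (\<integral>z. indicator {u..v} z * f z \<partial>lborel)"

lemma icc_cong: "(\<And>z. u \<le> z \<Longrightarrow> z \<le> v \<Longrightarrow> f z = g z) \<Longrightarrow> icc u v f = icc u v g"
  by (rule Bochner_Integration.integral_cong) (auto simp: indicator_def)

lemma icc_degenerate: assumes "v \<le> u" shows "icc u v f = 0"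
proof -
  have "icc u v f = (\<integral>z. 0 \<partial>(lborel :: real measure))"
  proof (cases "v = u")
    case True
    have "icc u u f = (\<integral>z. indicator {u} z * f u \<partial>lborel)"
      by (rule Bochner_Integration.integral_cong) (auto simp: indicator_def)
    then show ?thesis using True by simp
  next
    case False
    then show ?thesis using assms by simp
  qed
  then show ?thesis by simp
qed

lemma icc_shift: "icc (u + r) (v + r) f = icc u v (\<lambda>z. f (z + r))"
proof -
  have "icc (u + r) (v + r) f = (\<integral>z. indicator {u + r..v + r} (r + 1 * z) * f (r + 1 * z) \<partial>lborel)"
    by (subst lborel_integral_real_affine[where c=1 and t=r]) auto
  also have "\<dots> = icc u v (\<lambda>z. f (z + r))"
    by (rule Bochner_Integration.integral_cong) (auto simp: indicator_def add.commute)
  finally show ?thesis .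
qed

lemma icc_reflect: "icc u v f = icc (r - v) (r - u) (\<lambda>z. f (r - z))"
proof -
  have "icc u v f = (\<integral>z. indicator {u..v} (r + (-1) * z) * f (r + (-1) * z) \<partial>lborel)"
    by (subst lborel_integral_real_affine[where c="-1" and t=r]) auto
  also have "\<dots> = icc (r - v) (r - u) (\<lambda>z. f (r - z))"
    by (rule Bochner_Integration.integral_cong) (auto simp: indicator_def)
  finally show ?thesis .
qed

lemma icc_integrable:
  fixes B u v :: real and f :: "real \<Rightarrow> real"
  assumes [measurable]: "f \<in> borel_measurable borel" and B: "\<And>z. u \<le> z \<Longrightarrow> z \<le> v \<Longrightarrow> \<bar>f z\<bar> \<le> B"
  shows "integrable lborel (\<lambda>z. indicator {u..v} z * f z)"
  by (rule integrable_bounded_support[where S="{u..v}" and B=B])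
     (use B in \<open>auto simp: indicator_def emeasure_lborel_Icc_eq\<close>)

lemma icc_bound:
  fixes B u v :: real and f :: "real \<Rightarrow> real"
  assumes [measurable]: "f \<in> borel_measurable borel" and B: "\<And>z. u \<le> z \<Longrightarrow> z \<le> v \<Longrightarrow> \<bar>f z\<bar> \<le> B" and "B \<ge> 0"
  shows "\<bar>icc u v f\<bar> \<le> B * max 0 (v - u)"
proof -
  have "norm (icc u v f) \<le> (\<integral>z. B * indicator {u..v} z \<partial>lborel)"
  proof (rule Bochner_Integration.integral_norm_bound_integral[OF icc_integrable[OF assms(1) B]])
    show "norm (indicator {u..v} z * f z) \<le> B * indicator {u..v} z" for z
      using B[of z] by (auto simp: indicator_def)
  qed (auto simp: emeasure_lborel_Icc_eq)
  also have "\<dots> = B * max 0 (v - u)" by (cases "u \<le> v") auto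
  finally show ?thesis by simp
qed

text \<open>With reversed end points the oriented integral is zero as soon as the integrand vanishes
  in between. In the stated formula this happens because scale functions are 0 on the negative half
  line.\<close>

lemma icc_LBINT:
  assumes "\<And>z. v < z \<Longrightarrow> z < u \<Longrightarrow> f z = 0"
  shows "(LBINT z=ereal u..ereal v. f z) = icc u v f"
proof (cases "u \<le> v")
  case True
  then show ?thesis by (simp add: interval_integral_Icc set_lebesgue_integral_def)
next
  case False
  have "(LBINT z=ereal u..ereal v. f z) = - (LBINT z=ereal v..ereal u. f z)" by (rule interval_integral_endpoints_reverse)
  also have "(LBINT z=ereal v..ereal u. f z) = (LBINT z=ereal v..ereal u. 0)"
    by (rule interval_integral_cong) (use False assms in \<open>auto simp: einterval_def min_def max_def\<close>)
  finally show ?thesis using False by simp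
qed

text \<open>Here W and V stand for the scale functions of orders p and p + q, c for \<open>\<Phi>(p)\<close> and \<open>\<kappa>\<close> for
  \<open>1 / \<psi>'(\<Phi>(p))\<close>. In the paper's notation \<open>Wx x\<close> is the function \<open>\<W>\<close> with index \<open>x - a\<close>, \<open>brace\<close> and
  \<open>Nk x\<close> are the two expressions in braces, \<open>hk\<close> is the numerator and \<open>\<Delta>\<close> the denominator.\<close>

locale scale_pair =
  fixes W V :: "real \<Rightarrow> real" and c q a \<kappa> :: real
  assumes W: "loc_bounded W" and V: "loc_bounded V"
    and W0: "\<And>x. x < 0 \<Longrightarrow> W x = 0" and V0: "\<And>x. x < 0 \<Longrightarrow> V x = 0" and Vnn: "\<And>x. 0 \<le> V x"
    and volterra: "\<And>x. V x = W x + q * conv W V x"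
    and q: "q \<ge> 0" and a: "a > 0" and \<kappa>: "\<kappa> > 0"
begin

lemma W_measurable [measurable]: "W \<in> borel_measurable borel" using W by (rule loc_bounded_measurable)
lemma V_measurable [measurable]: "V \<in> borel_measurable borel" using V by (rule loc_bounded_measurable)

lemma W_bounded: obtains B where "B \<ge> 0" "\<And>x. x \<le> T \<Longrightarrow> \<bar>W x\<bar> \<le> B"
proof -
  obtain B where "B \<ge> 0" "\<And>x. 0 \<le> x \<Longrightarrow> x \<le> T \<Longrightarrow> \<bar>W x\<bar> \<le> B" using loc_boundedD[OF W] by metis
  then have "\<bar>W x\<bar> \<le> B" if "x \<le> T" for x using that W0[of x] by (cases "x < 0") auto
  then show ?thesis using that \<open>B \<ge> 0\<close> by blast
qed

lemma V_bounded: obtains B where "B \<ge> 0" "\<And>x. x \<le> T \<Longrightarrow> \<bar>V x\<bar> \<le> B"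
proof -
  obtain B where "B \<ge> 0" "\<And>x. 0 \<le> x \<Longrightarrow> x \<le> T \<Longrightarrow> \<bar>V x\<bar> \<le> B" using loc_boundedD[OF V] by metis
  then have "\<bar>V x\<bar> \<le> B" if "x \<le> T" for x using that V0[of x] by (cases "x < 0") auto
  then show ?thesis using that \<open>B \<ge> 0\<close> by blast
qed

lemma volterra': "V x = W x + q * conv V W x"
  using volterra[of x] by (simp add: conv_commute)

definition e :: "real \<Rightarrow> real" where "e x = exp (c * x)"

lemma e_lb: "loc_bounded e"
  by (rule loc_bounded_continuous) (auto simp: e_def intro!: borel_measurable_continuous_onI continuous_intros)

lemma e_measurable [measurable]: "e \<in> borel_measurable borel" using e_lb by (rule loc_bounded_measurable)

text \<open>The function H of the theorem with the factor exp (c x) moved under the integral, which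
  makes it a convolution.\<close>

definition H :: "real \<Rightarrow> real" where "H x = e x + q * conv e V x"

lemma H_lb: "loc_bounded H"
  unfolding H_def[abs_def] by (rule loc_bounded_add[OF e_lb conv_loc_bounded[OF e_lb V]])

lemma H_measurable [measurable]: "H \<in> borel_measurable borel" using H_lb by (rule loc_bounded_measurable)

lemma H_pos: "0 < H x"
proof -
  have "0 \<le> conv e V x" unfolding conv_def
    by (rule Bochner_Integration.integral_nonneg) (use Vnn in \<open>auto simp: e_def\<close>)
  then show ?thesis using q by (auto simp: H_def e_def intro!: add_pos_nonneg)
qed

text \<open>Associativity gives W * H = e * (W + q W * V), and the Volterra equation collapses the
  bracket to V.\<close>

lemma conv_W_H: "conv W H x = conv e V x"
proof -
  have "conv W H x = conv W e x + q * conv W (conv e V) x"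
    unfolding H_def[abs_def] by (rule conv_add_right[OF W e_lb conv_loc_bounded[OF e_lb V]])
  also have "conv W (conv e V) x = conv (conv W e) V x" by (rule conv_assoc[OF W e_lb V])
  also have "\<dots> = conv (conv e W) V x" by (rule conv_cong; (rule conv_commute | rule refl))
  also have "\<dots> = conv e (conv W V) x" by (rule conv_assoc[OF e_lb W V, symmetric])
  also have "conv W e x = conv e W x" by (rule conv_commute)
  also have "conv e W x + q * conv e (conv W V) x = conv e (\<lambda>z. W z + q * conv W V z) x"
    by (rule conv_add_right[OF e_lb W conv_loc_bounded[OF W V], symmetric])
  also have "\<dots> = conv e V x" by (simp only: volterra[symmetric])
  finally show ?thesis .
qed

lemma H_eq: "H x = e x + q * conv W H x"
  by (simp add: H_def conv_W_H)

lemma shifted_W_lb: "loc_bounded (\<lambda>s. W (s - y))"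
  unfolding loc_bounded_def
proof (intro conjI allI)
  fix T
  obtain B where "B \<ge> 0" "\<And>x. x \<le> T - y \<Longrightarrow> \<bar>W x\<bar> \<le> B" using W_bounded[where T="T - y"] by blast
  then show "\<exists>B. \<forall>x\<in>{0..T}. \<bar>W (x - y)\<bar> \<le> B" by (intro exI[of _ B]) auto
qed measurable

text \<open>The part of the convolution beyond - y becomes, after translation, a convolution with
  the shifted W. For y > 0 the first integral is degenerate and the shifted W vanishes before
  y.\<close>

lemma conv_shifted_W:
  assumes f: "loc_bounded f" and x: "0 \<le> x"
  shows "conv f W (x - y) = icc 0 (- y) (\<lambda>u. f (x - y - u) * W u) + conv f (\<lambda>s. W (s - y)) x"
proof (cases "y \<le> 0")
  case True
  note [measurable] = loc_bounded_measurable[OF f]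
  obtain Bf where Bf: "Bf \<ge> 0" "\<And>z. 0 \<le> z \<Longrightarrow> z \<le> x - y \<Longrightarrow> \<bar>f z\<bar> \<le> Bf" using loc_boundedD[OF f] by metis
  obtain BW where BW: "BW \<ge> 0" "\<And>z. z \<le> x - y \<Longrightarrow> \<bar>W z\<bar> \<le> BW" using W_bounded[where T="x - y"] by blast
  have b: "\<bar>f (x - y - z) * W z\<bar> \<le> Bf * BW" if "0 \<le> z" "z \<le> x - y" for z
    unfolding abs_mult using that by (intro mult_mono Bf BW) auto
  have "conv f W (x - y) = (\<integral>z. indicator {0..- y} z * (f (x - y - z) * W z) + indicator {- y..x - y} z * (f (x - y - z) * W z) \<partial>lborel)"
    unfolding conv_def
    by (rule integral_cong_AE) (use AE_lborel_singleton[of "- y"] True x in \<open>auto elim!: eventually_mono simp: indicator_def\<close>)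
  also have "\<dots> = icc 0 (- y) (\<lambda>u. f (x - y - u) * W u) + icc (- y) (x - y) (\<lambda>u. f (x - y - u) * W u)"
    by (rule Bochner_Integration.integral_add) (rule icc_integrable[where B="Bf * BW"]; use b True x in auto)+
  also have "icc (- y) (x - y) (\<lambda>u. f (x - y - u) * W u) = conv f (\<lambda>s. W (s - y)) x"
    using icc_shift[of 0 "- y" x "\<lambda>u. f (x - y - u) * W u"] by (simp add: conv_def)
  finally show ?thesis .
next
  case False
  have "conv f (\<lambda>s. W (s - y)) x = icc y x (\<lambda>s. f (x - s) * W (s - y))"
    unfolding conv_def using False x W0 by (intro Bochner_Integration.integral_cong) (auto simp: indicator_def)
  also have "\<dots> = conv f W (x - y)"
    using icc_shift[of 0 y "x - y" "\<lambda>s. f (x - s) * W (s - y)"] by (simp add: conv_def algebra_simps)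
  finally show ?thesis using False by simp
qed

text \<open>The two-parameter scale function of index - y, evaluated at x - y.\<close>

definition Mk :: "real \<Rightarrow> real \<Rightarrow> real" where
  "Mk x y = V (x - y) - q * icc 0 (- y) (\<lambda>u. V (x - y - u) * W u)"

lemma Mk_eq: "0 \<le> x \<Longrightarrow> Mk x y = W (x - y) + q * conv V (\<lambda>s. W (s - y)) x"
  using conv_shifted_W[OF V, of x y] volterra'[of "x - y"] by (simp add: Mk_def algebra_simps)

definition brace :: "real \<Rightarrow> real" where
  "brace y = H (a - y) - q * icc 0 (- y) (\<lambda>z. H (a - y - z) * W z)"

lemma brace_eq: "brace y = e (a - y) + q * conv H (\<lambda>s. W (s - y)) a"
proof -
  have "H (a - y) = e (a - y) + q * conv H W (a - y)" using H_eq[of "a - y"] by (simp add: conv_commute)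
  then show ?thesis using conv_shifted_W[OF H_lb, of a y] a by (simp add: brace_def algebra_simps)
qed

text \<open>The value of \<open>Mk x y\<close> for x >= 0, as a function of x with y fixed; in this
  form it can be convolved.\<close>

definition Mg :: "real \<Rightarrow> real \<Rightarrow> real" where
  "Mg y x = W (x - y) + q * conv V (\<lambda>s. W (s - y)) x"

lemma Mg_lb: "loc_bounded (Mg y)"
  unfolding Mg_def[abs_def] by (rule loc_bounded_add[OF shifted_W_lb conv_loc_bounded[OF V shifted_W_lb]])

text \<open>The same collapse as in \<open>conv_W_H\<close>, now with the shifted W in place of the
  exponential.\<close>

lemma conv_W_Mg: "conv W (Mg y) x = conv V (\<lambda>s. W (s - y)) x"
proof -
  let ?g = "\<lambda>s. W (s - y)"
  have "conv W (Mg y) x = conv W ?g x + q * conv W (conv V ?g) x"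
    unfolding Mg_def[abs_def] by (rule conv_add_right[OF W shifted_W_lb conv_loc_bounded[OF V shifted_W_lb]])
  also have "conv W (conv V ?g) x = conv (conv W V) ?g x" by (rule conv_assoc[OF W V shifted_W_lb])
  also have "conv W ?g x + q * conv (conv W V) ?g x = conv (\<lambda>z. W z + q * conv W V z) ?g x"
    by (rule conv_add_left[OF shifted_W_lb W conv_loc_bounded[OF W V], symmetric])
  also have "\<dots> = conv V ?g x" by (simp only: volterra[symmetric])
  finally show ?thesis .
qed

lemma conv_e_Mg: "conv e (Mg y) x = conv H (\<lambda>s. W (s - y)) x"
proof -
  let ?g = "\<lambda>s. W (s - y)"
  have "conv e (Mg y) x = conv e ?g x + q * conv e (conv V ?g) x"
    unfolding Mg_def[abs_def] by (rule conv_add_right[OF e_lb shifted_W_lb conv_loc_bounded[OF V shifted_W_lb]])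
  also have "conv e (conv V ?g) x = conv (conv e V) ?g x" by (rule conv_assoc[OF e_lb V shifted_W_lb])
  also have "conv e ?g x + q * conv (conv e V) ?g x = conv H ?g x"
    unfolding H_def[abs_def] by (rule conv_add_left[OF shifted_W_lb e_lb conv_loc_bounded[OF e_lb V], symmetric])
  finally show ?thesis .
qed

lemma conv_e_icc: "conv e f a = e a * icc 0 a (\<lambda>z. exp (- c * z) * f z)"
proof -
  have "conv e f a = (\<integral>z. e a * (indicator {0..a} z * (exp (- c * z) * f z)) \<partial>lborel)"
    unfolding conv_def
  proof (rule Bochner_Integration.integral_cong[OF refl])
    fix z
    have "e (a - z) = e a * exp (- c * z)" unfolding e_def exp_add[symmetric] by (simp add: algebra_simps)
    then show "indicator {0..a} z * (e (a - z) * f z) = e a * (indicator {0..a} z * (exp (- c * z) * f z))" by simp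
  qed
  then show ?thesis by simp
qed

text \<open>Relates the first brace of the formula to the exponential moment of \<open>Mg y\<close>
  on [0, a], which is what the exponential part of r produces when it acts on
  \<open>Mg y\<close>.\<close>

lemma brace_Mg: "exp (- c * a) * brace y = exp (- c * y) + q * icc 0 a (\<lambda>z. exp (- c * z) * Mg y z)"
proof -
  have "brace y = e (a - y) + q * (e a * icc 0 a (\<lambda>z. exp (- c * z) * Mg y z))"
    unfolding brace_eq using conv_e_Mg[of y a] conv_e_icc[of "Mg y"] by simp
  moreover have "exp (- c * a) * e (a - y) = exp (- c * y)" "exp (- c * a) * e a = 1"
    unfolding e_def exp_add[symmetric] by (simp_all add: algebra_simps)
  moreover have "k * (E1 + q * (E2 * J)) = k * E1 + q * ((k * E2) * J)" for k E1 E2 J :: real by (simp add: algebra_simps)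
  ultimately show ?thesis by (simp only: mult_1)
qed

text \<open>For x < a the first integral stops at x by itself, because W vanishes on negative
  arguments, and the second is degenerate.\<close>

lemma conv_W_split:
  assumes f: "loc_bounded f"
  shows "conv W f x = icc 0 a (\<lambda>z. W (x - z) * f z) + icc a x (\<lambda>z. W (x - z) * f z)"
proof -
  note [measurable] = loc_bounded_measurable[OF f]
  obtain Bf where Bf: "Bf \<ge> 0" "\<And>z. 0 \<le> z \<Longrightarrow> z \<le> max a x \<Longrightarrow> \<bar>f z\<bar> \<le> Bf" using loc_boundedD[OF f] by metis
  obtain BW where BW: "BW \<ge> 0" "\<And>z. z \<le> x \<Longrightarrow> \<bar>W z\<bar> \<le> BW" using W_bounded[where T="x"] by blast
  have b: "\<bar>W (x - z) * f z\<bar> \<le> BW * Bf" if "0 \<le> z" "z \<le> max a x" for z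
    unfolding abs_mult using that by (intro mult_mono Bf BW) auto
  have "conv W f x = (\<integral>z. indicator {0..a} z * (W (x - z) * f z) + indicator {a..x} z * (W (x - z) * f z) \<partial>lborel)"
    unfolding conv_def
  proof (rule integral_cong_AE)
    show "AE z in lborel. indicator {0..x} z * (W (x - z) * f z) = indicator {0..a} z * (W (x - z) * f z) + indicator {a..x} z * (W (x - z) * f z)"
      using AE_lborel_singleton[of a]
    proof eventually_elim
      case (elim z)
      show ?case using elim a W0[of "x - z"] by (cases "x < z") (auto simp: indicator_def)
    qed
  qed measurable
  also have "\<dots> = icc 0 a (\<lambda>z. W (x - z) * f z) + icc a x (\<lambda>z. W (x - z) * f z)"
    by (rule Bochner_Integration.integral_add) (rule icc_integrable[where B="BW * Bf"]; use b a in auto)+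
  finally show ?thesis .
qed

definition hk :: "real \<Rightarrow> real" where "hk x = H x - q * icc a x (\<lambda>z. W (x - z) * H z)"

text \<open>The subtracted integral cancels the part of W * H beyond a, so that only values of H on
  [0, a] remain, as in the resolvent equation.\<close>

lemma hk_eq: "hk x = e x + q * icc 0 a (\<lambda>z. W (x - z) * H z)"
  using H_eq[of x] conv_W_split[OF H_lb, of x] by (simp add: hk_def algebra_simps)

definition Wx :: "real \<Rightarrow> real \<Rightarrow> real" where
  "Wx x v = V v - q * icc 0 (x - a) (\<lambda>z. V (v - z) * W z)"

definition Nk :: "real \<Rightarrow> real \<Rightarrow> real" where
  "Nk x y = Wx x (x - y) - q * icc 0 (- y) (\<lambda>z. Wx x (x - y - z) * W z)"

text \<open>Both sides contain the same double integral over \<open>{0..x - a}\<close> and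
  \<open>{0..- y}\<close>; exchanging its order swaps the roles of the indices x - a and -
  y.\<close>

lemma Nk_Mk: "Nk x y = Mk x y - q * icc 0 (x - a) (\<lambda>z. Mk (x - z) y * W z)"
proof -
  obtain BV where BV: "BV \<ge> 0" "\<And>z. z \<le> x - y \<Longrightarrow> \<bar>V z\<bar> \<le> BV" using V_bounded[where T="x - y"] by blast
  obtain BW where BW: "BW \<ge> 0" "\<And>z. z \<le> max (x - a) (- y) \<Longrightarrow> \<bar>W z\<bar> \<le> BW" using W_bounded[where T="max (x - a) (- y)"] by blast
  let ?T = "{0..x - a}" and ?U = "{0..- y}"
  let ?f = "\<lambda>z u. indicator ?T z * indicator ?U u * (V (x - y - u - z) * W z * W u)"
  have int: "integrable (lborel \<Otimes>\<^sub>M lborel) (case_prod ?f)"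
  proof (rule integrable_bounded_support[where S="?T \<times> ?U" and B="BV * BW * BW"])
    show "emeasure (lborel \<Otimes>\<^sub>M lborel) (?T \<times> ?U) < \<infinity>"
      by (simp add: lborel.emeasure_pair_measure_Times emeasure_lborel_Icc_eq ennreal_mult_less_top)
    fix w :: "real \<times> real"
    have "\<bar>V (x - y - u - z) * W z * W u\<bar> \<le> BV * BW * BW" if "0 \<le> z" "z \<le> x - a" "0 \<le> u" "u \<le> - y" for z u
      unfolding abs_mult using that BV(1) BW(1) by (intro mult_mono BV(2) BW(2) mult_nonneg_nonneg abs_ge_zero) auto
    then show "\<bar>case_prod ?f w\<bar> \<le> BV * BW * BW * indicator (?T \<times> ?U) w"
      by (cases w) (auto simp: indicator_def)
  qed auto
  have iV: "integrable lborel (\<lambda>u. indicator {0..b} u * (V (v - u) * W u))" if "v \<le> x - y" "b \<le> max (x - a) (- y)" for b v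
    by (rule icc_integrable[where B="BV * BW"]) (use that BV BW in \<open>auto simp: abs_mult intro!: mult_mono\<close>)
  have s1: "icc 0 (- y) (\<lambda>u. Wx x (x - y - u) * W u) = icc 0 (- y) (\<lambda>u. V (x - y - u) * W u) - q * (\<integral>u. (\<integral>z. ?f z u \<partial>lborel) \<partial>lborel)"
  proof -
    have "icc 0 (- y) (\<lambda>u. Wx x (x - y - u) * W u) = (\<integral>u. indicator ?U u * (V (x - y - u) * W u) - q * (\<integral>z. ?f z u \<partial>lborel) \<partial>lborel)"
    proof (rule Bochner_Integration.integral_cong[OF refl])
      fix u
      have "(\<integral>z. ?f z u \<partial>lborel) = (\<integral>z. (indicator ?U u * W u) * (indicator ?T z * (V (x - y - u - z) * W z)) \<partial>lborel)"
        by (rule Bochner_Integration.integral_cong) auto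
      also have "\<dots> = (indicator ?U u * W u) * icc 0 (x - a) (\<lambda>z. V (x - y - u - z) * W z)" by simp
      finally show "indicator ?U u * (Wx x (x - y - u) * W u) = indicator ?U u * (V (x - y - u) * W u) - q * (\<integral>z. ?f z u \<partial>lborel)"
        by (simp add: Wx_def algebra_simps)
    qed
    also have "\<dots> = icc 0 (- y) (\<lambda>u. V (x - y - u) * W u) - q * (\<integral>u. (\<integral>z. ?f z u \<partial>lborel) \<partial>lborel)"
      using iV[of "x - y" "- y"] lborel_pair.integrable_snd[OF int] by simp
    finally show ?thesis .
  qed
  have s2: "icc 0 (x - a) (\<lambda>z. Mk (x - z) y * W z) = icc 0 (x - a) (\<lambda>z. V (x - y - z) * W z) - q * (\<integral>z. (\<integral>u. ?f z u \<partial>lborel) \<partial>lborel)"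
  proof -
    have "icc 0 (x - a) (\<lambda>z. Mk (x - z) y * W z) = (\<integral>z. indicator ?T z * (V (x - y - z) * W z) - q * (\<integral>u. ?f z u \<partial>lborel) \<partial>lborel)"
    proof (rule Bochner_Integration.integral_cong[OF refl])
      fix z
      have "(\<integral>u. ?f z u \<partial>lborel) = (\<integral>u. (indicator ?T z * W z) * (indicator ?U u * (V (x - z - y - u) * W u)) \<partial>lborel)"
        by (rule Bochner_Integration.integral_cong) (auto simp: algebra_simps)
      also have "\<dots> = (indicator ?T z * W z) * icc 0 (- y) (\<lambda>u. V (x - z - y - u) * W u)" by simp
      finally show "indicator ?T z * (Mk (x - z) y * W z) = indicator ?T z * (V (x - y - z) * W z) - q * (\<integral>u. ?f z u \<partial>lborel)"
        by (simp add: Mk_def algebra_simps)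
    qed
    also have "\<dots> = icc 0 (x - a) (\<lambda>z. V (x - y - z) * W z) - q * (\<integral>z. (\<integral>u. ?f z u \<partial>lborel) \<partial>lborel)"
      using iV[of "x - y" "x - a"] lborel_pair.integrable_fst[OF int] by simp
    finally show ?thesis .
  qed
  have "(\<integral>u. (\<integral>z. ?f z u \<partial>lborel) \<partial>lborel) = (\<integral>z. (\<integral>u. ?f z u \<partial>lborel) \<partial>lborel)"
    by (rule lborel_pair.Fubini_integral[OF int])
  then show ?thesis unfolding Nk_def s1 s2 by (simp add: Wx_def Mk_def algebra_simps)
qed

text \<open>The analogue of \<open>hk_eq\<close> with \<open>Mg y\<close> in place of H. Negative x
  is separate, since \<open>Mk_eq\<close> identifies \<open>Mk\<close> with \<open>Mg\<close> for x
  >= 0 only.\<close>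

lemma Nk_eq: "Nk x y = W (x - y) + q * icc 0 a (\<lambda>z. W (x - z) * Mg y z)"
proof (cases "x < 0")
  case True
  have N: "Nk x y = Mk x y" using Nk_Mk[of x y] True a by (simp add: icc_degenerate)
  \<comment> \<open>As x < 0, the range up to - y exceeds that up to x - y only by points where V
    vanishes.\<close>
  have "icc 0 (- y) (\<lambda>u. V (x - y - u) * W u) = conv V W (x - y)"
    unfolding conv_def
  proof (rule Bochner_Integration.integral_cong[OF refl])
    fix u
    show "indicator {0..- y} u * (V (x - y - u) * W u) = indicator {0..x - y} u * (V (x - y - u) * W u)"
      using True V0[of "x - y - u"] by (cases "x - y < u") (auto simp: indicator_def)
  qed
  then have M: "Mk x y = W (x - y)" using volterra'[of "x - y"] by (simp add: Mk_def)
  have Z: "icc 0 a (\<lambda>z. W (x - z) * Mg y z) = icc 0 a (\<lambda>z. 0)"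
    by (rule icc_cong) (use True W0 in auto)
  show ?thesis unfolding N M Z by simp
next
  case False
  have "Nk x y = Mk x y - q * icc a x (\<lambda>z. W (x - z) * Mg y z)"
  proof -
    have "icc a x (\<lambda>z. W (x - z) * Mg y z) = icc (x - x) (x - a) (\<lambda>z. W (x - (x - z)) * Mg y (x - z))"
      by (rule icc_reflect)
    also have "\<dots> = icc 0 (x - a) (\<lambda>z. Mk (x - z) y * W z)"
      by simp (rule icc_cong, use a in \<open>simp add: Mk_eq Mg_def\<close>)
    finally show ?thesis using Nk_Mk[of x y] by simp
  qed
  moreover have "Mk x y = W (x - y) + q * conv W (Mg y) x" using Mk_eq[of x y] False conv_W_Mg[of y x] by simp
  ultimately show ?thesis using conv_W_split[OF Mg_lb, of y x] by (simp add: algebra_simps)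
qed

section \<open>The candidate kernel and its resolvent equation\<close>

definition IH :: real where "IH = icc 0 a (\<lambda>z. exp (- c * z) * H z)"
definition \<Delta> :: real where "\<Delta> = 1 / \<kappa> + q * IH"

lemma IH_nonneg: "0 \<le> IH"
  unfolding IH_def by (rule Bochner_Integration.integral_nonneg) (auto intro!: mult_nonneg_nonneg less_imp_le[OF H_pos])

lemma \<Delta>_pos: "0 < \<Delta>"
  using \<kappa> q IH_nonneg by (auto simp: \<Delta>_def intro!: add_pos_nonneg)

text \<open>The solution of the scalar equation to which the resolvent equation reduces:
  \<open>\<alpha> y * \<Delta>\<close> equals exp (- c y) plus q times the exponential moment of
  \<open>Mg y\<close> on [0, a].\<close>

definition \<alpha> :: "real \<Rightarrow> real" where "\<alpha> y = exp (- c * a) * brace y / \<Delta>"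
definition Kk :: "real \<Rightarrow> real \<Rightarrow> real" where "Kk x y = \<alpha> y * hk x - Nk x y"
definition r :: "real \<Rightarrow> real" where "r x = \<kappa> * e x - W x"

lemma on_interval: assumes "0 \<le> x" "x \<le> a" shows "Kk x y = \<alpha> y * H x - Mg y x"
proof -
  have "hk x = H x" using assms by (simp add: hk_def icc_degenerate)
  moreover have "Nk x y = Mg y x" using Nk_Mk[of x y] assms by (simp add: icc_degenerate Mk_eq Mg_def)
  ultimately show ?thesis by (simp add: Kk_def)
qed

text \<open>The exponential \<open>e (x - z)\<close> factorises in x and z, so this part of r acts
  through a single scalar moment of f.\<close>

lemma icc_r_split:
  assumes f: "loc_bounded f"
  shows "icc 0 a (\<lambda>z. r (x - z) * f z) = \<kappa> * e x * icc 0 a (\<lambda>z. exp (- c * z) * f z) - icc 0 a (\<lambda>z. W (x - z) * f z)"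
    and "integrable lborel (\<lambda>z. indicator {0..a} z * (exp (- c * z) * f z))"
    and "integrable lborel (\<lambda>z. indicator {0..a} z * (W (x - z) * f z))"
    and "integrable lborel (\<lambda>z. indicator {0..a} z * (r (x - z) * f z))"
proof -
  note [measurable] = loc_bounded_measurable[OF f]
  obtain Bf where Bf: "Bf \<ge> 0" "\<And>z. 0 \<le> z \<Longrightarrow> z \<le> a \<Longrightarrow> \<bar>f z\<bar> \<le> Bf" using loc_boundedD[OF f] by metis
  obtain BW where BW: "BW \<ge> 0" "\<And>z. z \<le> x \<Longrightarrow> \<bar>W z\<bar> \<le> BW" using W_bounded[where T="x"] by blast
  show i1: "integrable lborel (\<lambda>z. indicator {0..a} z * (exp (- c * z) * f z))"
  proof (rule icc_integrable[where B="exp (\<bar>c\<bar> * a) * Bf"])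
    fix z :: real assume z: "0 \<le> z" "z \<le> a"
    have "- c * z \<le> \<bar>c\<bar> * z" by (rule mult_right_mono) (use z in auto)
    also have "\<dots> \<le> \<bar>c\<bar> * a" by (rule mult_left_mono) (use z in auto)
    finally have "- c * z \<le> \<bar>c\<bar> * a" .
    then show "\<bar>exp (- c * z) * f z\<bar> \<le> exp (\<bar>c\<bar> * a) * Bf" unfolding abs_mult using z by (intro mult_mono Bf) auto
  qed measurable
  show i2: "integrable lborel (\<lambda>z. indicator {0..a} z * (W (x - z) * f z))"
    by (rule icc_integrable[where B="BW * Bf"]) (use Bf BW in \<open>auto simp: abs_mult intro!: mult_mono\<close>)
  have eq: "indicator {0..a} z * (r (x - z) * f z) = \<kappa> * e x * (indicator {0..a} z * (exp (- c * z) * f z)) - indicator {0..a} z * (W (x - z) * f z)" for z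
  proof -
    have "e (x - z) = e x * exp (- c * z)" unfolding e_def exp_add[symmetric] by (simp add: algebra_simps)
    then show ?thesis by (simp add: r_def algebra_simps)
  qed
  show "icc 0 a (\<lambda>z. r (x - z) * f z) = \<kappa> * e x * icc 0 a (\<lambda>z. exp (- c * z) * f z) - icc 0 a (\<lambda>z. W (x - z) * f z)"
    unfolding eq using i1 i2 by simp
  show "integrable lborel (\<lambda>z. indicator {0..a} z * (r (x - z) * f z))"
    unfolding eq using i1 i2 by simp
qed

text \<open>By \<open>hk_eq\<close> and \<open>Nk_eq\<close> the terms with W agree on both sides;
  what is left is a multiple of \<open>e x\<close>, and its vanishing is the scalar equation for
  \<alpha>.\<close>

theorem kernel_equation: "Kk x y = r (x - y) - q * icc 0 a (\<lambda>z. r (x - z) * Kk z y)"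
proof -
  define IM where "IM = icc 0 a (\<lambda>z. exp (- c * z) * Mg y z)"
  have \<alpha>\<Delta>: "\<alpha> y * \<Delta> = exp (- c * y) + q * IM"
    using \<Delta>_pos brace_Mg[of y] by (simp add: \<alpha>_def IM_def)
  have "icc 0 a (\<lambda>z. r (x - z) * Kk z y) = icc 0 a (\<lambda>z. r (x - z) * (\<alpha> y * H z - Mg y z))"
    by (rule icc_cong) (simp add: on_interval)
  also have "\<dots> = (\<integral>z. \<alpha> y * (indicator {0..a} z * (r (x - z) * H z)) - indicator {0..a} z * (r (x - z) * Mg y z) \<partial>lborel)"
    by (rule Bochner_Integration.integral_cong) (auto simp: algebra_simps)
  also have "\<dots> = \<alpha> y * icc 0 a (\<lambda>z. r (x - z) * H z) - icc 0 a (\<lambda>z. r (x - z) * Mg y z)"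
    using icc_r_split(4)[OF H_lb, of x] icc_r_split(4)[OF Mg_lb, of x y] by simp
  also have "\<dots> = \<alpha> y * (\<kappa> * e x * IH - icc 0 a (\<lambda>z. W (x - z) * H z)) - (\<kappa> * e x * IM - icc 0 a (\<lambda>z. W (x - z) * Mg y z))"
    unfolding icc_r_split(1)[OF H_lb] icc_r_split(1)[OF Mg_lb] IH_def IM_def ..
  finally have I: "icc 0 a (\<lambda>z. r (x - z) * Kk z y) = \<alpha> y * (\<kappa> * e x * IH - icc 0 a (\<lambda>z. W (x - z) * H z)) - (\<kappa> * e x * IM - icc 0 a (\<lambda>z. W (x - z) * Mg y z))" .
  have ex: "e (x - y) = e x * exp (- c * y)" unfolding e_def exp_add[symmetric] by (simp add: algebra_simps)
  \<comment> \<open>The term 1 / \<kappa> in \<Delta>, multiplied by \<kappa>, leaves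
    \<open>\<alpha> y * e x\<close>, while the term with IH cancels.\<close>
  have key: "\<kappa> * e x * (exp (- c * y) + q * IM) - q * (\<alpha> y * (\<kappa> * e x * IH)) = \<alpha> y * e x"
    unfolding \<alpha>\<Delta>[symmetric] \<Delta>_def using \<kappa> by (simp add: algebra_simps)
  have L: "Kk x y = \<alpha> y * (e x + q * icc 0 a (\<lambda>z. W (x - z) * H z)) - (W (x - y) + q * icc 0 a (\<lambda>z. W (x - z) * Mg y z))"
    by (simp only: Kk_def hk_eq Nk_eq)
  have alg: "\<kappa> * E * (y' + q * m) - q * (b * (\<kappa> * E * h)) = b * E \<Longrightarrow>
      b * (E + q * u) - (w + q * v) = (\<kappa> * (E * y') - w) - q * (b * (\<kappa> * E * h - u) - (\<kappa> * E * m - v))"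
    for E y' m b h u v w :: real by (simp add: algebra_simps)
  show ?thesis unfolding I unfolding L r_def ex by (rule alg[OF key])
qed

text \<open>Convolving the equation with V and using \<open>V = W + q V * W\<close> shows that d is a multiple of H on
  [0, a].\<close>

theorem unique_zero:
  assumes dm [measurable]: "d \<in> borel_measurable borel" and db: "\<And>x. 0 \<le> x \<Longrightarrow> x \<le> a \<Longrightarrow> \<bar>d x\<bar> \<le> B"
    and eq: "\<And>x. 0 \<le> x \<Longrightarrow> x \<le> a \<Longrightarrow> d x = - q * icc 0 a (\<lambda>z. r (x - z) * d z)"
    and x: "0 \<le> x" "x \<le> a"
  shows "d x = 0"
proof -
  define f where "f z = indicator {0..a} z * d z" for z
  have f: "loc_bounded f" unfolding loc_bounded_def
  proof (intro conjI allI)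
    fix T show "\<exists>B. \<forall>x\<in>{0..T}. \<bar>f x\<bar> \<le> B"
      using db by (intro exI[of _ "max 0 B"]) (force simp: f_def indicator_def)
  qed (simp add: f_def[abs_def])
  \<comment> \<open>The scalar through which the exponential part of r acts on f; it remains to show
    that it is 0.\<close>
  define \<beta> where "\<beta> = - q * \<kappa> * icc 0 a (\<lambda>z. exp (- c * z) * f z)"
  have fx: "f x = \<beta> * e x + q * conv W f x" if x: "0 \<le> x" "x \<le> a" for x
  proof -
    have "f x = - q * icc 0 a (\<lambda>z. r (x - z) * d z)" using eq[OF x] x by (simp add: f_def)
    also have "icc 0 a (\<lambda>z. r (x - z) * d z) = icc 0 a (\<lambda>z. r (x - z) * f z)" by (rule icc_cong) (simp add: f_def)
    also have "\<dots> = \<kappa> * e x * icc 0 a (\<lambda>z. exp (- c * z) * f z) - icc 0 a (\<lambda>z. W (x - z) * f z)" by (rule icc_r_split(1)[OF f])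
    also have "icc 0 a (\<lambda>z. W (x - z) * f z) = conv W f x"
      using conv_W_split[OF f, of x] x by (simp add: icc_degenerate)
    finally show ?thesis by (simp add: \<beta>_def algebra_simps)
  qed
  have fH: "f x = \<beta> * H x" if x: "0 \<le> x" "x \<le> a" for x
  proof -
    have eb: "loc_bounded (\<lambda>z. \<beta> * e z)" by (rule loc_bounded_scale[OF e_lb])
    have "conv V f x = conv V (\<lambda>z. \<beta> * e z + q * conv W f z) x"
      by (rule conv_cong) (use fx x in auto)
    also have "\<dots> = conv V (\<lambda>z. \<beta> * e z) x + q * conv V (conv W f) x"
      by (rule conv_add_right[OF V eb conv_loc_bounded[OF W f]])
    also have "conv V (\<lambda>z. \<beta> * e z) x = \<beta> * conv V e x"
      using conv_add_right[OF V loc_bounded_scale[OF e_lb, of 0] e_lb, of \<beta> x] by (simp add: conv_def)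
    also have "conv V (conv W f) x = conv (conv V W) f x" by (rule conv_assoc[OF V W f])
    finally have 1: "conv V f x = \<beta> * conv V e x + q * conv (conv V W) f x" .
    have "conv V f x = conv (\<lambda>z. W z + q * conv V W z) f x" by (simp only: volterra'[symmetric])
    also have "\<dots> = conv W f x + q * conv (conv V W) f x"
      by (rule conv_add_left[OF f W conv_loc_bounded[OF V W]])
    finally have "conv W f x = \<beta> * conv V e x" using 1 by simp
    then show ?thesis using fx[OF x] by (simp add: H_def conv_commute[of e V] algebra_simps)
  qed
  have "icc 0 a (\<lambda>z. exp (- c * z) * f z) = icc 0 a (\<lambda>z. \<beta> * (exp (- c * z) * H z))"
    by (rule icc_cong) (simp add: fH)
  also have "\<dots> = (\<integral>z. \<beta> * (indicator {0..a} z * (exp (- c * z) * H z)) \<partial>lborel)"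
    by (rule Bochner_Integration.integral_cong) auto
  also have "\<dots> = \<beta> * IH" by (simp add: IH_def)
  finally have "\<beta> = - q * \<kappa> * (\<beta> * IH)" by (simp add: \<beta>_def)
  then have "\<beta> * (1 + q * \<kappa> * IH) = 0" by (simp add: algebra_simps)
  moreover have "1 + q * \<kappa> * IH > 0" using q \<kappa> IH_nonneg by (auto intro!: add_pos_nonneg)
  ultimately have "\<beta> = 0" by simp
  then show ?thesis using fH[OF x] x by (simp add: f_def)
qed

end

section \<open>Measurability and local bounds of the kernel\<close>

context scale_pair
begin

lemma Mk_measurable [measurable (raw)]:
  assumes [measurable]: "f \<in> borel_measurable N" "g \<in> borel_measurable N"
  shows "(\<lambda>x. Mk (f x) (g x)) \<in> borel_measurable N"
proof -
  have "Mk x y = V (x - y) - q * (\<integral>u. (if 0 \<le> u \<and> u \<le> - y then V (x - y - u) * W u else 0) \<partial>lborel)" for x y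
    unfolding Mk_def by (intro arg_cong2[where f="(-)"] arg_cong2[where f="(*)"] refl Bochner_Integration.integral_cong) (auto simp: indicator_def)
  then show ?thesis by simp
qed

lemma brace_measurable [measurable]: "brace \<in> borel_measurable borel"
proof -
  have "brace y = H (a - y) - q * (\<integral>u. (if 0 \<le> u \<and> u \<le> - y then H (a - y - u) * W u else 0) \<partial>lborel)" for y
    unfolding brace_def by (intro arg_cong2[where f="(-)"] arg_cong2[where f="(*)"] refl Bochner_Integration.integral_cong) (auto simp: indicator_def)
  then show ?thesis by (simp cong: measurable_cong)
qed

lemma \<alpha>_measurable [measurable]: "\<alpha> \<in> borel_measurable borel"
  unfolding \<alpha>_def[abs_def] by measurable

lemma r_measurable [measurable]: "r \<in> borel_measurable borel"
  unfolding r_def[abs_def] by measurable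

text \<open>On [0, a] the kernel involves only H and \<open>Mk\<close>, whose measurability in both
  variables is available.\<close>

lemma kernel_measurable [measurable]: "(\<lambda>w. indicator {0..a} (fst w) * Kk (fst w) (snd w)) \<in> borel_measurable (borel \<Otimes>\<^sub>M borel)"
proof -
  have eq: "(\<lambda>w. indicator {0..a} (fst w) * Kk (fst w) (snd w)) =
      (\<lambda>w. indicator {0..a} (fst w) * (\<alpha> (snd w) * H (fst w) - Mk (fst w) (snd w)))"
    by (auto simp: fun_eq_iff indicator_def on_interval Mk_eq Mg_def)
  show ?thesis unfolding eq by measurable
qed

lemma r_bounded: obtains B where "B \<ge> 0" "\<And>x. - T \<le> x \<Longrightarrow> x \<le> T \<Longrightarrow> \<bar>r x\<bar> \<le> B"
proof -
  obtain BW where BW: "BW \<ge> 0" "\<And>x. x \<le> T \<Longrightarrow> \<bar>W x\<bar> \<le> BW" using W_bounded[where T=T] by blast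
  have "\<bar>r x\<bar> \<le> \<kappa> * exp (\<bar>c\<bar> * T) + BW" if "- T \<le> x" "x \<le> T" for x
  proof -
    have "c * x \<le> \<bar>c\<bar> * \<bar>x\<bar>" by (metis abs_ge_self abs_mult)
    also have "\<dots> \<le> \<bar>c\<bar> * T" using that by (intro mult_left_mono) auto
    finally have "\<kappa> * e x \<le> \<kappa> * exp (\<bar>c\<bar> * T)" using \<kappa> by (simp add: e_def)
    moreover have "0 \<le> \<kappa> * e x" using \<kappa> by (simp add: e_def)
    ultimately show ?thesis unfolding r_def using BW(2)[OF that(2)] by linarith
  qed
  then show ?thesis using that[of "\<kappa> * exp (\<bar>c\<bar> * T) + BW"] \<kappa> BW(1) by auto
qed

lemma H_bounded: obtains B where "B \<ge> 0" "\<And>x. - T \<le> x \<Longrightarrow> x \<le> T \<Longrightarrow> \<bar>H x\<bar> \<le> B"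
proof -
  obtain B where B: "B \<ge> 0" "\<And>x. 0 \<le> x \<Longrightarrow> x \<le> T \<Longrightarrow> \<bar>H x\<bar> \<le> B" using loc_boundedD[OF H_lb] by metis
  have "\<bar>H x\<bar> \<le> max B (exp (\<bar>c\<bar> * T))" if "- T \<le> x" "x \<le> T" for x
  proof (cases "x < 0")
    case True
    have "c * x \<le> \<bar>c\<bar> * \<bar>x\<bar>" by (metis abs_ge_self abs_mult)
    also have "\<dots> \<le> \<bar>c\<bar> * T" using that by (intro mult_left_mono) auto
    finally show ?thesis using True by (simp add: H_def conv_eq_0 e_def le_max_iff_disj)
  qed (use B(2)[of x] that in auto)
  then show ?thesis using that[of "max B (exp (\<bar>c\<bar> * T))"] B(1) by auto
qed

lemma kernel_bounded:
  assumes n: "n \<ge> 0"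
  obtains C where "C \<ge> 0" "\<And>z y. 0 \<le> z \<Longrightarrow> z \<le> a \<Longrightarrow> - n \<le> y \<Longrightarrow> y \<le> n \<Longrightarrow> \<bar>Kk z y\<bar> \<le> C"
proof -
  obtain BV where BV: "BV \<ge> 0" "\<And>x. x \<le> a + n \<Longrightarrow> \<bar>V x\<bar> \<le> BV" using V_bounded[where T="a + n"] by blast
  obtain BW where BW: "BW \<ge> 0" "\<And>x. x \<le> n \<Longrightarrow> \<bar>W x\<bar> \<le> BW" using W_bounded[where T=n] by blast
  obtain BH where BH: "BH \<ge> 0" "\<And>x. - (a + n) \<le> x \<Longrightarrow> x \<le> a + n \<Longrightarrow> \<bar>H x\<bar> \<le> BH" using H_bounded[where T="a + n"] by blast
  define CM where "CM = BV + q * (BV * BW * n)"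
  define CB where "CB = BH + q * (BH * BW * n)"
  have nn: "0 \<le> CM" "0 \<le> CB" using BV BW BH q n by (auto simp: CM_def CB_def)
  have M: "\<bar>Mk z y\<bar> \<le> CM" if "0 \<le> z" "z \<le> a" "- n \<le> y" "y \<le> n" for z y
  proof -
    have "\<bar>icc 0 (- y) (\<lambda>u. V (z - y - u) * W u)\<bar> \<le> BV * BW * max 0 (- y - 0)"
    proof (rule icc_bound)
      fix u assume "0 \<le> u" "u \<le> - y"
      then show "\<bar>V (z - y - u) * W u\<bar> \<le> BV * BW" unfolding abs_mult using that BV BW by (intro mult_mono) auto
    qed (use BV BW in auto)
    also have "\<dots> \<le> BV * BW * n" using that BV BW n by (intro mult_left_mono) auto
    finally have "q * \<bar>icc 0 (- y) (\<lambda>u. V (z - y - u) * W u)\<bar> \<le> q * (BV * BW * n)" using q by (rule mult_left_mono)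
    moreover have "\<bar>q * icc 0 (- y) (\<lambda>u. V (z - y - u) * W u)\<bar> = q * \<bar>icc 0 (- y) (\<lambda>u. V (z - y - u) * W u)\<bar>" using q by (simp add: abs_mult)
    moreover have "\<bar>V (z - y)\<bar> \<le> BV" using that BV by auto
    ultimately show ?thesis unfolding Mk_def CM_def by linarith
  qed
  have Br: "\<bar>brace y\<bar> \<le> CB" if "- n \<le> y" "y \<le> n" for y
  proof -
    have "\<bar>icc 0 (- y) (\<lambda>u. H (a - y - u) * W u)\<bar> \<le> BH * BW * max 0 (- y - 0)"
    proof (rule icc_bound)
      fix u assume "0 \<le> u" "u \<le> - y"
      then show "\<bar>H (a - y - u) * W u\<bar> \<le> BH * BW" unfolding abs_mult using that BH BW a by (intro mult_mono) auto
    qed (use BH BW in auto)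
    also have "\<dots> \<le> BH * BW * n" using that BH BW n by (intro mult_left_mono) auto
    finally have "q * \<bar>icc 0 (- y) (\<lambda>u. H (a - y - u) * W u)\<bar> \<le> q * (BH * BW * n)" using q by (rule mult_left_mono)
    moreover have "\<bar>q * icc 0 (- y) (\<lambda>u. H (a - y - u) * W u)\<bar> = q * \<bar>icc 0 (- y) (\<lambda>u. H (a - y - u) * W u)\<bar>" using q by (simp add: abs_mult)
    moreover have "\<bar>H (a - y)\<bar> \<le> BH" using that BH a by auto
    ultimately show ?thesis unfolding brace_def CB_def by linarith
  qed
  define C where "C = exp (- c * a) * CB / \<Delta> * BH + CM"
  have "\<bar>Kk z y\<bar> \<le> C" if "0 \<le> z" "z \<le> a" "- n \<le> y" "y \<le> n" for z y
  proof -
    have "\<bar>\<alpha> y * H z\<bar> \<le> (exp (- c * a) * CB / \<Delta>) * BH"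
    proof -
      have "exp (- c * a) * \<bar>brace y\<bar> / \<Delta> \<le> exp (- c * a) * CB / \<Delta>"
        using Br[OF that(3,4)] \<Delta>_pos by (intro divide_right_mono mult_left_mono) auto
      then have "\<bar>\<alpha> y\<bar> \<le> exp (- c * a) * CB / \<Delta>" using \<Delta>_pos by (simp add: \<alpha>_def abs_mult)
      moreover have "\<bar>H z\<bar> \<le> BH" using BH(2)[of z] that n by auto
      ultimately show ?thesis unfolding abs_mult by (rule mult_mono) (use nn \<Delta>_pos in auto)
    qed
    moreover have "Kk z y = \<alpha> y * H z - Mk z y" using on_interval[OF that(1,2)] Mk_eq[OF that(1)] by (simp add: Mg_def)
    ultimately show ?thesis unfolding C_def using M[OF that] by linarith
  qed
  moreover have "C \<ge> 0" unfolding C_def using nn BH \<Delta>_pos by (auto intro!: add_nonneg_nonneg mult_nonneg_nonneg divide_nonneg_nonneg)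
  ultimately show ?thesis using that by blast
qed

text \<open>\<open>kernel_equation\<close> integrated over A. Boundedness of A makes the double
  integrand bounded with bounded support, so Fubini applies regardless of the sign of the
  kernel.\<close>

lemma kernel_integral_equation:
  assumes A [measurable]: "A \<in> sets borel" and n: "n \<ge> 0" "A \<subseteq> {- n..n}"
  defines "\<phi> \<equiv> \<lambda>x. \<integral>y. indicator A y * Kk x y \<partial>lborel"
  shows "integrable lborel (\<lambda>y. indicator A y * Kk x y)"
    and "\<phi> x = (\<integral>y. indicator A y * r (x - y) \<partial>lborel) - q * icc 0 a (\<lambda>z. r (x - z) * \<phi> z)"
    and "(\<lambda>z. indicator {0..a} z * \<phi> z) \<in> borel_measurable borel"
    and "\<exists>B. \<forall>z. 0 \<le> z \<longrightarrow> z \<le> a \<longrightarrow> \<bar>\<phi> z\<bar> \<le> B"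
proof -
  obtain C where C: "C \<ge> 0" "\<And>z y. 0 \<le> z \<Longrightarrow> z \<le> a \<Longrightarrow> - n \<le> y \<Longrightarrow> y \<le> n \<Longrightarrow> \<bar>Kk z y\<bar> \<le> C"
    using kernel_bounded[OF n(1)] by blast
  define K' where "K' z y = indicator {0..a} z * Kk z y" for z y
  have K'm [measurable]: "(\<lambda>w. K' (fst w) (snd w)) \<in> borel_measurable (borel \<Otimes>\<^sub>M borel)"
    unfolding K'_def by measurable
  have K'm2 [measurable (raw)]: "(\<lambda>x. K' (f x) (g x)) \<in> borel_measurable N" if "f \<in> borel_measurable N" "g \<in> borel_measurable N" for f g N
    using measurable_compose[OF _ K'm, of "\<lambda>x. (f x, g x)" N] that by simp
  show "(\<lambda>z. indicator {0..a} z * \<phi> z) \<in> borel_measurable borel"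
  proof -
    have "indicator {0..a} z * \<phi> z = (\<integral>y. indicator A y * K' z y \<partial>lborel)" for z
      unfolding \<phi>_def K'_def by (subst integral_mult_right_zero[symmetric]) (simp add: mult.left_commute)
    then show ?thesis by simp
  qed
  show "\<exists>B. \<forall>z. 0 \<le> z \<longrightarrow> z \<le> a \<longrightarrow> \<bar>\<phi> z\<bar> \<le> B"
  proof (intro exI allI impI)
    fix z assume z: "0 \<le> z" "z \<le> a"
    have "\<phi> z = icc (- n) n (\<lambda>y. indicator A y * K' z y)"
      unfolding \<phi>_def using z n(2) by (intro Bochner_Integration.integral_cong) (auto simp: indicator_def K'_def)
    moreover have "\<bar>icc (- n) n (\<lambda>y. indicator A y * K' z y)\<bar> \<le> C * max 0 (n - - n)"
    proof (rule icc_bound)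
      show "(\<lambda>y. indicator A y * K' z y) \<in> borel_measurable borel" by measurable
    qed (use C z in \<open>auto simp: K'_def indicator_def\<close>)
    ultimately show "\<bar>\<phi> z\<bar> \<le> C * max 0 (n - - n)" by simp
  qed
  obtain Br where Br: "Br \<ge> 0" "\<And>z. - (\<bar>x\<bar> + a + n) \<le> z \<Longrightarrow> z \<le> \<bar>x\<bar> + a + n \<Longrightarrow> \<bar>r z\<bar> \<le> Br" using r_bounded[where T="\<bar>x\<bar> + a + n"] by blast
  let ?F = "\<lambda>z y. indicator {0..a} z * indicator A y * (r (x - z) * Kk z y)"
  have Fint: "integrable (lborel \<Otimes>\<^sub>M lborel) (case_prod ?F)"
  proof (rule integrable_bounded_support[where S="{0..a} \<times> {- n..n}" and B="Br * C"])
    have eq: "case_prod ?F = (\<lambda>w. indicator A (snd w) * (r (x - fst w) * K' (fst w) (snd w)))" by (auto simp: fun_eq_iff K'_def)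
    show "case_prod ?F \<in> borel_measurable (lborel \<Otimes>\<^sub>M lborel)" unfolding eq by measurable
    show "emeasure (lborel \<Otimes>\<^sub>M lborel) ({0..a} \<times> {- n..n}) < \<infinity>"
      by (simp add: lborel.emeasure_pair_measure_Times emeasure_lborel_Icc_eq ennreal_mult_less_top)
    fix w :: "real \<times> real"
    have "\<bar>r (x - z) * Kk z y\<bar> \<le> Br * C" if "0 \<le> z" "z \<le> a" "- n \<le> y" "y \<le> n" for z y
      unfolding abs_mult using that n(1) Br(1) by (intro mult_mono Br(2) C(2)) auto
    then show "\<bar>case_prod ?F w\<bar> \<le> Br * C * indicator ({0..a} \<times> {- n..n}) w"
      using n(2) Br(1) C(1) by (cases w) (auto simp: indicator_def subset_eq)
  qed auto
  have rint: "integrable lborel (\<lambda>y. indicator A y * r (x - y))"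
  proof (rule integrable_bounded_support[where S="{- n..n}" and B=Br])
    fix y
    show "\<bar>indicator A y * r (x - y)\<bar> \<le> Br * indicator {- n..n} y"
      using n(2) Br(1) Br(2)[of "x - y"] a by (auto simp: indicator_def subset_eq)
  qed (auto simp: emeasure_lborel_Icc_eq)
  have Keq: "indicator A y * Kk x y = indicator A y * r (x - y) - q * (\<integral>z. ?F z y \<partial>lborel)" for y
  proof -
    have "(\<integral>z. ?F z y \<partial>lborel) = indicator A y * icc 0 a (\<lambda>z. r (x - z) * Kk z y)"
      by (subst integral_mult_right_zero[symmetric]) (simp add: mult_ac)
    then show ?thesis using kernel_equation[of x y] by (simp add: right_diff_distrib)
  qed
  show "integrable lborel (\<lambda>y. indicator A y * Kk x y)"
    unfolding Keq using rint lborel_pair.integrable_snd[OF Fint] by simp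
  have "\<phi> x = (\<integral>y. indicator A y * r (x - y) \<partial>lborel) - q * (\<integral>y. (\<integral>z. ?F z y \<partial>lborel) \<partial>lborel)"
    unfolding \<phi>_def Keq using rint lborel_pair.integrable_snd[OF Fint] by simp
  also have "(\<integral>y. (\<integral>z. ?F z y \<partial>lborel) \<partial>lborel) = (\<integral>z. (\<integral>y. ?F z y \<partial>lborel) \<partial>lborel)"
    by (rule lborel_pair.Fubini_integral[OF Fint])
  also have "\<dots> = icc 0 a (\<lambda>z. r (x - z) * \<phi> z)"
  proof (rule Bochner_Integration.integral_cong[OF refl])
    fix z
    show "(\<integral>y. ?F z y \<partial>lborel) = indicator {0..a} z * (r (x - z) * \<phi> z)"
      unfolding \<phi>_def by (subst integral_mult_right_zero[symmetric], subst integral_mult_right_zero[symmetric]) (simp add: mult_ac)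
  qed
  finally show "\<phi> x = (\<integral>y. indicator A y * r (x - y) \<partial>lborel) - q * icc 0 a (\<lambda>z. r (x - z) * \<phi> z)" .
qed

end

section \<open>Identification of the resolvent density\<close>

locale killed_levy = sn_levy M X for M :: "'a measure" and X +
  fixes p q a :: real
  assumes p: "p > 0" and q: "q \<ge> 0" and a: "a > 0"
begin

sublocale sp: scale_pair "scale p" "scale (p + q)" "rate p" q a "A0 p"
proof
  have pq: "p + q > 0" using p q by simp
  show "loc_bounded (scale p)" "loc_bounded (scale (p + q))" using scale_loc_bounded p pq by auto
  show "x < 0 \<Longrightarrow> scale p x = 0" "x < 0 \<Longrightarrow> scale (p + q) x = 0" for x using scale_neg p pq by auto
  show "0 \<le> scale (p + q) x" for x using scale_nonneg pq by auto
  show "scale (p + q) x = scale p x + q * conv (scale p) (scale (p + q)) x" for x by (rule scale_volterra[OF p q])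
  show "0 \<le> q" "0 < a" "0 < A0 p" using q a A0_pos[OF p] by auto
qed

abbreviation res :: "real set \<Rightarrow> real \<Rightarrow> real" where "res A \<equiv> omega_killed.res M X p q a A"

lemma omega: "A \<in> sets borel \<Longrightarrow> omega_killed M X p q A"
  using sn_levy_axioms p q by (simp add: omega_killed_def omega_killed_axioms_def)

lemma res_dens_r: "z \<noteq> x \<Longrightarrow> res_dens p (z - x) = sp.r (x - z)"
  using res_dens_eq[OF p, of "z - x"] by (simp add: sp.r_def sp.e_def algebra_simps)

lemma res_equation:
  assumes A [measurable]: "A \<in> sets borel"
  shows "res A x = (\<integral>y. indicator A y * sp.r (x - y) \<partial>lborel) - q * icc 0 a (\<lambda>z. sp.r (x - z) * res A z)"
proof -
  interpret ok: omega_killed M X p q a A by (rule omega[OF A])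
  have [measurable]: "res_dens p \<in> borel_measurable borel" by (rule res_dens_measurable[OF p])
  have 1: "(\<integral>z. indicator A (x + XX (fst z) (snd z)) \<partial>exp_time p) / p = (\<integral>y. indicator A y * sp.r (x - y) \<partial>lborel)"
  proof -
    have "(\<integral>z. indicator A (x + XX (fst z) (snd z)) \<partial>exp_time p) / p = (\<integral>z. res_dens p (z - x) * indicator A z \<partial>lborel)"
      using XX_integral[OF p, of "indicator A" x] p by simp
    also have "\<dots> = (\<integral>y. indicator A y * sp.r (x - y) \<partial>lborel)"
    proof (rule integral_cong_AE)
      show "AE z in lborel. res_dens p (z - x) * indicator A z = indicator A z * sp.r (x - z)"
        using AE_lborel_singleton[of x] by eventually_elim (simp add: res_dens_r)
    qed measurable
    finally show ?thesis .
  qed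
  have 2: "(\<integral>z. indicator {0<..<a} (x + XX (fst z) (snd z)) * res A (x + XX (fst z) (snd z)) \<partial>exp_time p) / p = icc 0 a (\<lambda>z. sp.r (x - z) * res A z)"
  proof -
    have "(\<integral>z. indicator {0<..<a} (x + XX (fst z) (snd z)) * res A (x + XX (fst z) (snd z)) \<partial>exp_time p) / p = (\<integral>z. res_dens p (z - x) * (indicator {0<..<a} z * res A z) \<partial>lborel)"
      using XX_integral[OF p, of "\<lambda>z. indicator {0<..<a} z * res A z" x] p by simp
    also have "\<dots> = icc 0 a (\<lambda>z. sp.r (x - z) * res A z)"
    proof (rule integral_cong_AE)
      \<comment> \<open>Killing takes place on the open interval and \<open>icc\<close> uses the
        closed one; the end points, and z = x where \<open>res_dens_r\<close> is silent, are
        null.\<close>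
      show "AE z in lborel. res_dens p (z - x) * (indicator {0<..<a} z * res A z) = indicator {0..a} z * (sp.r (x - z) * res A z)"
        using AE_lborel_singleton[of x] AE_lborel_singleton[of 0] AE_lborel_singleton[of a]
        by eventually_elim (auto simp: res_dens_r indicator_def)
    qed measurable
    finally show ?thesis .
  qed
  have qp: "q / p * I = q * (I / p)" for I by simp
  show ?thesis by (subst ok.feynman_kac) (simp only: 1 2 qp)
qed

text \<open>Both sides solve the same equation. Their difference vanishes on [0, a] by
  \<open>unique_zero\<close>, and since the equation reads only values on [0, a], it then vanishes
  at every x.\<close>

theorem res_bounded_set:
  assumes A: "A \<in> sets borel" and n: "n \<ge> 0" "A \<subseteq> {- n..n}"
  shows "(\<integral>y. indicator A y * sp.Kk x y \<partial>lborel) = res A x"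
proof -
  interpret ok: omega_killed M X p q a A by (rule omega[OF A])
  define \<phi> where "\<phi> x = (\<integral>y. indicator A y * sp.Kk x y \<partial>lborel)" for x
  note KI = sp.kernel_integral_equation[OF A n, folded \<phi>_def]
  obtain B where B: "\<And>z. 0 \<le> z \<Longrightarrow> z \<le> a \<Longrightarrow> \<bar>\<phi> z\<bar> \<le> B" using KI(4) by blast
  define d where "d z = indicator {0..a} z * res A z - indicator {0..a} z * \<phi> z" for z
  note [measurable] = KI(3)
  have dm: "d \<in> borel_measurable borel" unfolding d_def by measurable
  have db: "\<bar>d z\<bar> \<le> 1 / p + B" if "0 \<le> z" "z \<le> a" for z
    using that B[OF that] ok.res_bound[of z] by (simp add: d_def)
  have rm: "loc_bounded (\<lambda>z. indicator {0..a} z * res A z)"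
    unfolding loc_bounded_def using ok.res_bound p by (auto simp: indicator_def intro!: exI[of _ "1 / p"])
  have \<phi>m: "loc_bounded (\<lambda>z. indicator {0..a} z * \<phi> z)"
    unfolding loc_bounded_def using B KI(3) order_trans[OF abs_ge_zero B[of 0]] a by (auto simp: indicator_def intro!: exI[of _ B])
  have icc_diff: "icc 0 a (\<lambda>z. sp.r (x - z) * res A z) - icc 0 a (\<lambda>z. sp.r (x - z) * \<phi> z) = icc 0 a (\<lambda>z. sp.r (x - z) * d z)" for x
  proof -
    have "icc 0 a (\<lambda>z. sp.r (x - z) * d z) = (\<integral>z. indicator {0..a} z * (sp.r (x - z) * (indicator {0..a} z * res A z)) - indicator {0..a} z * (sp.r (x - z) * (indicator {0..a} z * \<phi> z)) \<partial>lborel)"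
      by (rule Bochner_Integration.integral_cong) (auto simp: d_def algebra_simps)
    also have "\<dots> = icc 0 a (\<lambda>z. sp.r (x - z) * (indicator {0..a} z * res A z)) - icc 0 a (\<lambda>z. sp.r (x - z) * (indicator {0..a} z * \<phi> z))"
      by (rule Bochner_Integration.integral_diff[OF sp.icc_r_split(4)[OF rm] sp.icc_r_split(4)[OF \<phi>m]])
    also have "icc 0 a (\<lambda>z. sp.r (x - z) * (indicator {0..a} z * res A z)) = icc 0 a (\<lambda>z. sp.r (x - z) * res A z)"
      by (rule icc_cong) simp
    also have "icc 0 a (\<lambda>z. sp.r (x - z) * (indicator {0..a} z * \<phi> z)) = icc 0 a (\<lambda>z. sp.r (x - z) * \<phi> z)"
      by (rule icc_cong) simp
    finally show ?thesis by simp
  qed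
  have diff: "res A x - \<phi> x = - q * icc 0 a (\<lambda>z. sp.r (x - z) * d z)" for x
    using res_equation[OF A, of x] KI(2)[of x] unfolding icc_diff[symmetric] by (simp add: algebra_simps)
  have d0: "d z = 0" if "0 \<le> z" "z \<le> a" for z
  proof (rule sp.unique_zero[OF dm db _ that])
    fix x assume "0 \<le> x" "x \<le> a"
    then show "d x = - q * icc 0 a (\<lambda>z. sp.r (x - z) * d z)" unfolding diff[symmetric] by (simp add: d_def)
  qed
  have "icc 0 a (\<lambda>z. sp.r (x - z) * d z) = icc 0 a (\<lambda>z. 0)" by (rule icc_cong) (simp add: d0)
  then show ?thesis using diff[of x] by (simp add: \<phi>_def)
qed

end

context killed_levy
begin

text \<open>For x outside [0, a] measurability in y is read off the kernel equation, whose integral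
  uses only kernel values at z in [0, a].\<close>

lemma Kk_measurable [measurable]: "sp.Kk x \<in> borel_measurable borel"
proof -
  have m [measurable (raw)]: "(\<lambda>w. indicator {0..a} (f w) * sp.Kk (f w) (g w)) \<in> borel_measurable N"
    if "f \<in> borel_measurable N" "g \<in> borel_measurable N" for f g and N :: "'b measure"
    using measurable_compose[OF _ sp.kernel_measurable, of "\<lambda>w. (f w, g w)" N] that by simp
  have "sp.Kk x y = sp.r (x - y) - q * (\<integral>z. sp.r (x - z) * (indicator {0..a} z * sp.Kk z y) \<partial>lborel)" for y
    using sp.kernel_equation[of x y] by (simp only: mult.left_commute)
  then have "sp.Kk x = (\<lambda>y. sp.r (x - y) - q * (\<integral>z. sp.r (x - z) * (indicator {0..a} z * sp.Kk z y) \<partial>lborel))" by blast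
  also have "\<dots> \<in> borel_measurable borel"
  proof -
    have "(\<lambda>w. indicator {0..a} (snd w) * sp.Kk (snd w) (fst w)) \<in> borel_measurable (borel \<Otimes>\<^sub>M lborel)"
      using measurable_compose[OF _ sp.kernel_measurable, of "\<lambda>w. (snd w, fst w)" "borel \<Otimes>\<^sub>M lborel"] by simp
    then have [measurable]: "(\<lambda>w. sp.r (x - snd w) * (indicator {0..a} (snd w) * sp.Kk (snd w) (fst w))) \<in> borel_measurable (borel \<Otimes>\<^sub>M lborel)"
      by measurable
    have "(\<lambda>y. \<integral>z. sp.r (x - z) * (indicator {0..a} z * sp.Kk z y) \<partial>lborel) \<in> borel_measurable borel"
      by (rule lborel.borel_measurable_lebesgue_integral) (simp add: case_prod_beta')
    then show ?thesis by measurable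
  qed
  finally show ?thesis .
qed

text \<open>The bounded parts of the set where the kernel is negative serve as test sets: there the
  integral of the kernel equals \<open>res\<close>, which is nonnegative.\<close>

lemma Kk_nonneg: "AE y in lborel. 0 \<le> sp.Kk x y"
proof -
  have "AE y in lborel. - real n \<le> y \<and> y \<le> real n \<longrightarrow> 0 \<le> sp.Kk x y" for n
  proof -
    define B where "B = {y. - real n \<le> y \<and> y \<le> real n \<and> sp.Kk x y < 0}"
    have B [measurable]: "B \<in> sets borel" unfolding B_def by measurable
    have n: "real n \<ge> 0" "B \<subseteq> {- real n..real n}" by (auto simp: B_def)
    interpret ok: omega_killed M X p q a B by (rule omega[OF B])
    have "0 \<le> (\<integral>y. indicator B y * sp.Kk x y \<partial>lborel)"
      using res_bounded_set[OF B n, of x] ok.res_bound(1)[of x] by simp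
    moreover have "0 \<le> (\<integral>y. - (indicator B y * sp.Kk x y) \<partial>lborel)"
      by (rule Bochner_Integration.integral_nonneg) (auto simp: B_def indicator_def)
    ultimately have "(\<integral>y. - (indicator B y * sp.Kk x y) \<partial>lborel) = 0" by simp
    then have "AE y in lborel. - (indicator B y * sp.Kk x y) = 0"
      using sp.kernel_integral_equation(1)[OF B n, of x]
      by (subst (asm) integral_nonneg_eq_0_iff_AE) (auto simp: B_def indicator_def)
    then show ?thesis by eventually_elim (force simp: B_def indicator_def split: if_splits)
  qed
  then have "AE y in lborel. \<forall>n::nat. - real n \<le> y \<and> y \<le> real n \<longrightarrow> 0 \<le> sp.Kk x y" unfolding AE_all_countable by blast
  then show ?thesis
  proof eventually_elim
    case (elim y)
    obtain n :: nat where "\<bar>y\<bar> \<le> real n" using real_arch_simple by blast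
    then have "- real n \<le> y \<and> y \<le> real n" by linarith
    then show ?case using elim by blast
  qed
qed

text \<open>Nonnegativity makes the passage from the part of A in [- n, n] to A a monotone limit;
  the bounded limit \<open>res A x\<close> then also yields integrability.\<close>

theorem res_density:
  assumes A [measurable]: "A \<in> sets borel"
  shows "integrable lborel (\<lambda>y. indicator A y * sp.Kk x y)" "(\<integral>y. indicator A y * sp.Kk x y \<partial>lborel) = res A x"
proof -
  define S where "S n = A \<inter> {- real n..real n}" for n
  have S [measurable]: "S n \<in> sets borel" for n unfolding S_def by measurable
  have n: "real n \<ge> 0" "S n \<subseteq> {- real n..real n}" for n by (auto simp: S_def)
  let ?f = "\<lambda>n y. indicator (S n) y * sp.Kk x y"
  have ev: "\<forall>\<^sub>F n in sequentially. indicator A y = (indicator (S n) y :: real)" for y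
  proof -
    obtain N :: nat where "\<bar>y\<bar> \<le> real N" using real_arch_simple by blast
    then show ?thesis
      by (intro eventually_sequentiallyI[of N]) (auto simp: S_def indicator_def)
  qed
  have int: "integrable lborel (?f n)" for n by (rule sp.kernel_integral_equation(1)[OF S n])
  have mono: "AE y in lborel. mono (\<lambda>n. ?f n y)"
    using Kk_nonneg[of x]
  proof eventually_elim
    case (elim y)
    show ?case by (rule monoI, rule mult_right_mono[OF _ elim]) (auto simp: S_def indicator_def)
  qed
  have lim: "AE y in lborel. (\<lambda>n. ?f n y) \<longlonglongrightarrow> indicator A y * sp.Kk x y"
    by (intro AE_I2 tendsto_intros Lim_transform_eventually[OF tendsto_const ev])
  have ilim: "(\<lambda>n. \<integral>y. ?f n y \<partial>lborel) \<longlonglongrightarrow> res A x"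
  proof -
    interpret N: prob_space "exp_time p" by (rule prob_space_exp_time[OF p])
    interpret ok: omega_killed M X p q a A by (rule omega[OF A])
    have eq: "(\<integral>y. ?f n y \<partial>lborel) = (\<integral>z. exp (- q * ok.occ (fst z) x (snd z)) * indicator (S n) (x + XX (fst z) (snd z)) \<partial>exp_time p) / p" for n
      unfolding res_bounded_set[OF S n] by (rule omega_killed.res_def[OF omega[OF S]])
    show ?thesis unfolding eq ok.res_def
    proof (intro tendsto_divide tendsto_const integral_dominated_convergence[where w="\<lambda>_. 1"])
      show "AE z in exp_time p. (\<lambda>n. exp (- q * ok.occ (fst z) x (snd z)) * indicator (S n) (x + XX (fst z) (snd z))) \<longlonglongrightarrow> exp (- q * ok.occ (fst z) x (snd z)) * indicator A (x + XX (fst z) (snd z))"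
        by (intro AE_I2 tendsto_mult tendsto_const Lim_transform_eventually[OF tendsto_const ev])
      show "AE z in exp_time p. norm (exp (- q * ok.occ (fst z) x (snd z)) * indicator (S n) (x + XX (fst z) (snd z))) \<le> 1" for n
        using q ok.occ_nonneg by (intro AE_I2) (auto simp: indicator_def)
    qed (use p in auto)
  qed
  show "integrable lborel (\<lambda>y. indicator A y * sp.Kk x y)"
    by (rule integrable_monotone_convergence[OF int mono lim ilim]) measurable
  show "(\<integral>y. indicator A y * sp.Kk x y \<partial>lborel) = res A x"
    by (rule integral_monotone_convergence[OF int mono lim ilim]) measurable
qed

section \<open>Translation into the terms of the statement\<close>

lemma path_functional_res:
  assumes A [measurable]: "A \<in> sets borel"
  shows "(LINT t:{0..}|lborel. exp (- p * t) *
           (\<integral>\<omega>. exp (- q * (LINT s:{0..t}|lborel. indicator {0<..<a} (x + X s \<omega>)))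
                 * indicator A (x + X t \<omega>) \<partial>M)) = res A x"
proof -
  interpret ok: omega_killed M X p q a A by (rule omega[OF A])
  have "res A x = (\<integral>t. exponential_density p t * (\<integral>\<omega>. exp (- q * ok.occ t x \<omega>) * indicator A (x + XX t \<omega>) \<partial>M) \<partial>lborel) / p"
    unfolding ok.res_def using p by (subst exp_time_integral(3)[OF p, where B=1]) (use ok.weight_bound in auto)
  also have "\<dots> = (\<integral>t. exponential_density p t * (\<integral>\<omega>. exp (- q * ok.occ t x \<omega>) * indicator A (x + XX t \<omega>) \<partial>M) / p \<partial>lborel)" by simp
  also have "\<dots> = (LINT t:{0..}|lborel. exp (- p * t) *
           (\<integral>\<omega>. exp (- q * (LINT s:{0..t}|lborel. indicator {0<..<a} (x + X s \<omega>)))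
                 * indicator A (x + X t \<omega>) \<partial>M))"
    unfolding set_lebesgue_integral_def
  proof (rule Bochner_Integration.integral_cong[OF refl])
    fix t :: real
    show "exponential_density p t * (\<integral>\<omega>. exp (- q * ok.occ t x \<omega>) * indicator A (x + XX t \<omega>) \<partial>M) / p =
      indicator {0..} t *\<^sub>R (exp (- p * t) * (\<integral>\<omega>. exp (- q * (\<integral>s. indicator {0..t} s *\<^sub>R indicator {0<..<a} (x + X s \<omega>) \<partial>lborel))
                 * indicator A (x + X t \<omega>) \<partial>M))"
    proof (cases "0 \<le> t")
      case True
      have "ok.occ t x \<omega> = (\<integral>s. indicator {0..t} s *\<^sub>R indicator {0<..<a} (x + X s \<omega>) \<partial>lborel)" for \<omega>
        unfolding ok.occ_def by (rule Bochner_Integration.integral_cong) (auto simp: indicator_def XX_def)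
      then show ?thesis using True p by (simp add: exponential_density_eq XX_def)
    qed (simp add: exponential_density_eq)
  qed
  finally show ?thesis by simp
qed

lemma scale_H_eq: "scale_H M X p q x = sp.H x"
proof -
  have pq: "p + q > 0" using p q by simp
  have L: "(LBINT z=0..ereal x. exp (- rate p * z) * scale (p + q) z) = icc 0 x (\<lambda>z. exp (- rate p * z) * scale (p + q) z)"
    using icc_LBINT[of x 0 "\<lambda>z. exp (- rate p * z) * scale (p + q) z"] scale_neg[OF pq] by (simp add: zero_ereal_def)
  have "conv sp.e (scale (p + q)) x = (\<integral>z. sp.e x * (indicator {0..x} z * (exp (- rate p * z) * scale (p + q) z)) \<partial>lborel)"
    unfolding conv_def
  proof (rule Bochner_Integration.integral_cong[OF refl])
    fix z
    have "sp.e (x - z) = sp.e x * exp (- rate p * z)" unfolding sp.e_def exp_add[symmetric] by (simp add: algebra_simps)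
    then show "indicator {0..x} z * (sp.e (x - z) * scale (p + q) z) = sp.e x * (indicator {0..x} z * (exp (- rate p * z) * scale (p + q) z))" by simp
  qed
  also have "\<dots> = sp.e x * icc 0 x (\<lambda>z. exp (- rate p * z) * scale (p + q) z)" by (rule integral_mult_right_zero)
  finally have C: "conv sp.e (scale (p + q)) x = sp.e x * icc 0 x (\<lambda>z. exp (- rate p * z) * scale (p + q) z)" .
  show ?thesis
    unfolding scale_H_def sp.H_def Phi_eq_rate[OF p] scale_W_eq[OF pq] L C sp.e_def[of x]
    by (simp only: distrib_left mult_1_right mult.left_commute)
qed

lemma scale_Wpq_eq: "scale_Wpq M X p q (x - a) v = sp.Wx x v"
proof -
  have pq: "p + q > 0" using p q by simp
  show ?thesis
    unfolding scale_Wpq_def sp.Wx_def scale_W_eq[OF p] scale_W_eq[OF pq]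
    using icc_LBINT[of "x - a" 0 "\<lambda>z. scale (p + q) (v - z) * scale p z"] scale_neg[OF p] by (simp add: zero_ereal_def)
qed

lemma Kk_formula:
  "exp (- rate p * a) * ((sp.H x - q * (LBINT z=a..x. scale p (x - z) * sp.H z)) /
      (deriv \<psi> (rate p) + q * (LBINT z=0..a. exp (- rate p * z) * sp.H z))) *
     (sp.H (a - y) - q * (LBINT z=0..-y. sp.H (a - y - z) * scale p z))
   - (sp.Wx x (x - y) - q * (LBINT z=0..-y. sp.Wx x (x - y - z) * scale p z)) = sp.Kk x y"
proof -
  have 1: "(LBINT z=a..x. scale p (x - z) * sp.H z) = icc a x (\<lambda>z. scale p (x - z) * sp.H z)"
    by (rule icc_LBINT) (simp add: scale_neg[OF p])
  have 2: "(LBINT z=0..a. exp (- rate p * z) * sp.H z) = sp.IH"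
    using icc_LBINT[of a 0 "\<lambda>z. exp (- rate p * z) * sp.H z"] a by (simp add: zero_ereal_def sp.IH_def)
  have 3: "(LBINT z=0..-y. f z * scale p z) = icc 0 (- y) (\<lambda>z. f z * scale p z)" for f
    using icc_LBINT[of "- y" 0 "\<lambda>z. f z * scale p z"] scale_neg[OF p] by (simp add: zero_ereal_def)
  show ?thesis
    unfolding 1 2 3 deriv_psi_A0[OF p] sp.Kk_def sp.\<alpha>_def sp.brace_def[symmetric] sp.hk_def[symmetric] sp.Nk_def[symmetric] sp.\<Delta>_def[symmetric]
    by simp
qed

end

text \<open>Equality of measures in y is tested on all Borel sets A. Integrability belongs to the
  claim because a non-integrable function has Bochner integral 0 by convention.\<close>

theorem mainTheorem2:
  fixes M :: "'a measure" and X :: "real \<Rightarrow> 'a \<Rightarrow> real" and a q x p :: real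
  assumes "spectrally_negative_levy M X" and "a > 0" and "q \<ge> 0" and "p > 0"
  shows "\<forall>A \<in> sets borel.
    (let \<Phi> = levy_Phi M X p;
         W = scale_W M X p;
         H = scale_H M X p q;
         \<W> = scale_Wpq M X p q (x - a);
         f = (\<lambda>y. exp (- \<Phi> * a) *
               ((H x - q * (LBINT z=a..x. W (x - z) * H z)) /
                (deriv (levy_psi M X) \<Phi> + q * (LBINT z=0..a. exp (- \<Phi> * z) * H z))) *
               (H (a - y) - q * (LBINT z=0..-y. H (a - y - z) * W z))
             - (\<W> (x - y) - q * (LBINT z=0..-y. \<W> (x - y - z) * W z)))
     in set_integrable lborel A f \<and>
        (LINT t:{0..}|lborel. exp (- p * t) *
           (\<integral>\<omega>. exp (- q * (LINT s:{0..t}|lborel. indicator {0<..<a} (x + X s \<omega>)))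
                 * indicator A (x + X t \<omega>) \<partial>M))
        = (LINT y:A|lborel. f y))"
proof
  fix A :: "real set" assume A: "A \<in> sets borel"
  have "prob_space M" using assms(1) by (simp add: spectrally_negative_levy_def levy_process_def)
  then interpret killed_levy M X p q a
    using assms by (simp add: killed_levy_def killed_levy_axioms_def sn_levy_def sn_levy_axioms_def)
  have H: "scale_H M X p q = sp.H" and W: "scale_Wpq M X p q (x - a) = sp.Wx x"
    using scale_H_eq scale_Wpq_eq by auto
  show "let \<Phi> = levy_Phi M X p;
         W = scale_W M X p;
         H = scale_H M X p q;
         \<W> = scale_Wpq M X p q (x - a);
         f = (\<lambda>y. exp (- \<Phi> * a) *
               ((H x - q * (LBINT z=a..x. W (x - z) * H z)) /
                (deriv (levy_psi M X) \<Phi> + q * (LBINT z=0..a. exp (- \<Phi> * z) * H z))) *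
               (H (a - y) - q * (LBINT z=0..-y. H (a - y - z) * W z))
             - (\<W> (x - y) - q * (LBINT z=0..-y. \<W> (x - y - z) * W z)))
     in set_integrable lborel A f \<and>
        (LINT t:{0..}|lborel. exp (- p * t) *
           (\<integral>\<omega>. exp (- q * (LINT s:{0..t}|lborel. indicator {0<..<a} (x + X s \<omega>)))
                 * indicator A (x + X t \<omega>) \<partial>M))
        = (LINT y:A|lborel. f y)"
    unfolding Let_def H W Phi_eq_rate[OF p] scale_W_eq[OF p] Kk_formula path_functional_res[OF A]
    using res_density[OF A, of x] by (simp add: set_integrable_def set_lebesgue_integral_def)
qed

end
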